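(* Let $k$ be a commutative ring, $A$ an abelian group, and $G$ a finite group. (a) One has $E_G^c+I_G=E_G$ and $$E_G^c\cap I_G=\bigoplus_{\substack{\{K,\kappa\}_G\in\mathcal{M}_G^G/\sim\\ (K,\kappa)\notin\mathcal{R}_G}}f_{\{K,\kappa\}_G}E_G^c.$$ (b) The canonical epimorphism $E_G\to\bar E_G$ maps the subalgebra $\bigoplus_{\{K,\kappa\}_G\in\mathcal{R}_G/\sim}f_{\{K,\kappa\}_G}E_G^c$ of $E_G^c$ isomorphically onto $\bar E_G$. (c) For each $(K,\kappa)\in\mathcal{R}_G$, the map $$k\Gamma_{(G,K,\kappa)}\to\bar f_{(K,\kappa)}\bar E_G\bar f_{(K,\kappa)},\qquad a\mapsto\bar f_{(K,\kappa)}\bar a\bar f_{(K,\kappa)},$$ is a $k$-algebra isomorphism.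
   Context: $A$ is written multiplicatively. For a finite group $K$ put $K^*=\mathrm{Hom}(K,A)$. $\mathcal{M}_G$ is the set of pairs $(K,\kappa)$ with $K\le G$, $\kappa\in K^*$, partially ordered by $(L,\lambda)\le(K,\kappa)$ iff $L\le K$ and $\lambda=\kappa|_L$; $\mathcal{M}_G^G$ is the subset of pairs with $K\trianglelefteq G$ and $\kappa(gxg^{-1})=\kappa(x)$ for $g\in G,x\in K$. For $(U,\phi)\in\mathcal{M}_{G\times H}$ let $p_1(U)\le G$, $p_2(U)\le H$ be the projections, $k_1(U)=\{g: (g,1)\in U\}$, $k_2(U)=\{h:(1,h)\in U\}$, and define $\phi_i\in k_i(U)^*$ by $\phi(g,h)=\phi_1(g)\phi_2(h)^{-1}$ on $k_1(U)\times k_2(U)$. Put $l(U,\phi)=(p_1(U),k_1(U),\phi_1)$, $r(U,\phi)=(p_2(U),k_2(U),\phi_2)$. An $A$-fibered $(G,H)$-biset is a left $A\times G\times H$-set, free as an $A$-set with finitely many $A$-orbits. $\left(\frac{G\times H}{U,\phi}\right)=(A\times G\times H)/U_\phi$ with $U_\phi=\{(\phi(u)^{-1},u): u\in U\}$; these are up to isomorphism the transitive ones, two being isomorphic iff the pairs are $G\times H$-conjugate. For an $A$-fibered $(G,H)$-biset $X$ and an $A$-fibered $(H,I)$-biset $Y$, let $A\times H$ act on $X\times Y$ by $(a,h)\cdot(x,y)=((a^{-1},1,h)x,(a,h,1)y)$; the orbit set is an $A\times G\times I$-set via $(a,g,i)[x,y]=[(a,g,1)x,(1,1,i)y]$, and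 $X\otimes_{AH}Y$ is its subset of elements with trivial stabilizer in $A$. $B_k^A(G,H)=k\otimes B^A(G,H)$, where $B^A(G,H)$ is the Grothendieck group of isomorphism classes of $A$-fibered $(G,H)$-bisets under disjoint union (basis: the classes $\left[\frac{G\times H}{U,\phi}\right]$), with compositions induced by the tensor product. $E_G=B_k^A(G,G)$; $I_G=\sum_{|H|<|G|}B_k^A(G,H)\cdot B_k^A(H,G)$, an ideal of $E_G$; $\bar E_G=E_G/I_G$ and $\bar b$ is the image of $b\in E_G$. $E_G^c\subseteq E_G$ is the subalgebra spanned by the $\left[\frac{G\times G}{U,\phi}\right]$ with $p_1(U)=G=p_2(U)$. For $(K,\kappa)\in\mathcal{M}_G^G$: $e_{(K,\kappa)}=\left[\frac{G\times G}{\Delta_K(G),\phi_\kappa}\right]$, with $\Delta_K(G)=\{(g_1,g_2): g_1K=g_2K\}$, $\phi_\kappa(g_1,g_2)=\kappa(g_1g_2^{-1})$; $f_{(K,\kappa)}=\sum_{(K,\kappa)\le(L,\lambda)\in\mathcal{M}_G^G}\mu^{\triangleleft}_{K,L}e_{(L,\lambda)}$, with $\mu^\triangleleft$ the Möbius function of the poset of normal subgroups of $G$. $\mathcal{R}_G=\{(K,\kappa)\in\mathcal{M}_G^G:e_{(K,\kappa)}\notin I_G\}$. $G$-linkage: $(K,\kappa)\sim(K',\kappa')$ iff there is $(U,\phi)\in\mathcal{M}_{G\times G}$ with $l(U,\phi)=(G,K,\kappa)$ and $r(U,\phi)=(G,K',\kappa')$; this is an equivalence relation on $\mathcal{M}_G^G$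 under which $\mathcal{R}_G$ is a union of classes; $\{K,\kappa\}_G$ is the class of $(K,\kappa)$ and $f_{\{K,\kappa\}_G}=\sum_{(K',\kappa')\in\{K,\kappa\}_G}f_{(K',\kappa')}$. $\Gamma_{(G,K,\kappa)}$ is the group, under the product of $E_G$ with identity $e_{(K,\kappa)}$, of all classes $\left[\frac{G\times G}{U,\phi}\right]$ with $l(U,\phi)=(G,K,\kappa)=r(U,\phi)$.
   Formalization: The formal theorem assumes in addition that the set M_G^G is finite; otherwise some f_(K,κ) is an infinite sum and not an element of E_G (for example G=C_2 and A an infinite elementary abelian 2-group). *)

theory Defs
  imports "HOL-Algebra.Group_Action" "HOL-Algebra.Left_Coset" "HOL-Algebra.QuotRing" "HOL-Algebra.Module"
begin

section \<open>Algebras over a commutative ring\<close>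

text \<open>The library locale \<open>algebra\<close> only covers commutative algebras.\<close>

definition k_algebra :: "'k ring \<Rightarrow> ('k, 'm) module \<Rightarrow> bool" where
  "k_algebra R M \<longleftrightarrow> module R M \<and> ring M \<and>
     (\<forall>c\<in>carrier R. \<forall>x\<in>carrier M. \<forall>y\<in>carrier M.
        (c \<odot>\<^bsub>M\<^esub> x) \<otimes>\<^bsub>M\<^esub> y = c \<odot>\<^bsub>M\<^esub> (x \<otimes>\<^bsub>M\<^esub> y) \<and>
        x \<otimes>\<^bsub>M\<^esub> (c \<odot>\<^bsub>M\<^esub> y) = c \<odot>\<^bsub>M\<^esub> (x \<otimes>\<^bsub>M\<^esub> y))"

definition k_algebra_iso ::
  "'k ring \<Rightarrow> ('k, 'm) module \<Rightarrow> ('k, 'n) module \<Rightarrow> ('m \<Rightarrow> 'n) \<Rightarrow> bool" where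
  "k_algebra_iso R M N h \<longleftrightarrow> k_algebra R M \<and> k_algebra R N \<and> h \<in> ring_iso M N \<and>
     (\<forall>c\<in>carrier R. \<forall>x\<in>carrier M. h (c \<odot>\<^bsub>M\<^esub> x) = c \<odot>\<^bsub>N\<^esub> h x)"

definition k_span :: "'k ring \<Rightarrow> ('k, 'm) module \<Rightarrow> 'm set \<Rightarrow> 'm set" where
  "k_span R M S = \<Inter>{N. submodule N R M \<and> S \<subseteq> N}"

definition sum_of_submodules :: "('k, 'm) module \<Rightarrow> 'j set \<Rightarrow> ('j \<Rightarrow> 'm set) \<Rightarrow> 'm set" where
  "sum_of_submodules M J N = (\<lambda>x. \<Oplus>\<^bsub>M\<^esub>j\<in>J. x j) ` (\<Pi>\<^sub>E j\<in>J. N j)"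

text \<open>The index set has to be finite because \<open>finsum\<close> over an infinite set is zero.\<close>

definition sum_is_direct :: "'k ring \<Rightarrow> ('k, 'm) module \<Rightarrow> 'j set \<Rightarrow> ('j \<Rightarrow> 'm set) \<Rightarrow> bool" where
  "sum_is_direct R M J N \<longleftrightarrow> finite J \<and> (\<forall>j\<in>J. submodule (N j) R M) \<and>
     inj_on (\<lambda>x. \<Oplus>\<^bsub>M\<^esub>j\<in>J. x j) (\<Pi>\<^sub>E j\<in>J. N j)"

text \<open>For a two-sided ideal \<open>I\<close>, the scalar multiplication sends \<open>I +> x\<close> to \<open>I +> c \<odot> x\<close>.\<close>

definition quotient_algebra :: "('k, 'm) module \<Rightarrow> 'm set \<Rightarrow> ('k, 'm set) module" where
  "quotient_algebra M I = ring.extend (M Quot I)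
     \<lparr>smult = (\<lambda>c C. I <+>\<^bsub>M\<^esub> ((\<lambda>x. c \<odot>\<^bsub>M\<^esub> x) ` C))\<rparr>"

definition corner_algebra :: "('k, 'm) module \<Rightarrow> 'm \<Rightarrow> ('k, 'm) module" where
  "corner_algebra M f =
     M\<lparr>carrier := {f \<otimes>\<^bsub>M\<^esub> x \<otimes>\<^bsub>M\<^esub> f | x. x \<in> carrier M}, one := f\<rparr>"

definition group_algebra :: "'k ring \<Rightarrow> 'c monoid \<Rightarrow> ('k, 'c \<Rightarrow> 'k) module" where
  "group_algebra R \<Gamma> =
     \<lparr>carrier = {a. (\<forall>\<gamma>. a \<gamma> \<in> carrier R) \<and> finite {\<gamma>. a \<gamma> \<noteq> \<zero>\<^bsub>R\<^esub>} \<and>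
                    {\<gamma>. a \<gamma> \<noteq> \<zero>\<^bsub>R\<^esub>} \<subseteq> carrier \<Gamma>},
      monoid.mult = (\<lambda>a b \<gamma>. \<Oplus>\<^bsub>R\<^esub>p\<in>{(\<alpha>, \<beta>). a \<alpha> \<noteq> \<zero>\<^bsub>R\<^esub> \<and> b \<beta> \<noteq> \<zero>\<^bsub>R\<^esub> \<and> \<alpha> \<otimes>\<^bsub>\<Gamma>\<^esub> \<beta> = \<gamma>}.
                        a (fst p) \<otimes>\<^bsub>R\<^esub> b (snd p)),
      one = (\<lambda>\<gamma>. if \<gamma> = \<one>\<^bsub>\<Gamma>\<^esub> then \<one>\<^bsub>R\<^esub> else \<zero>\<^bsub>R\<^esub>),
      ring.zero = (\<lambda>\<gamma>. \<zero>\<^bsub>R\<^esub>),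
      ring.add = (\<lambda>a b \<gamma>. a \<gamma> \<oplus>\<^bsub>R\<^esub> b \<gamma>),
      smult = (\<lambda>c a \<gamma>. c \<otimes>\<^bsub>R\<^esub> a \<gamma>)\<rparr>"


section \<open>The posets of pairs\<close>

type_synonym ('g, 'a) cpair = "'g set \<times> ('g \<Rightarrow> 'a)"

text \<open>The elements of \<open>Hom(K, A)\<close> are the homomorphisms that are \<open>undefined\<close> outside \<open>K\<close>,
  so that equality of pairs is the intended one.\<close>

definition pairs :: "'a monoid \<Rightarrow> 'g monoid \<Rightarrow> ('g, 'a) cpair set" where
  "pairs A G = {(K, \<kappa>). subgroup K G \<and> \<kappa> \<in> hom (G\<lparr>carrier := K\<rparr>) A \<inter> extensional K}"

definition pair_le :: "('g, 'a) cpair \<Rightarrow> ('g, 'a) cpair \<Rightarrow> bool" where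
  "pair_le = (\<lambda>(L, l) (K, \<kappa>). L \<subseteq> K \<and> l = restrict \<kappa> L)"

definition stable_pairs :: "'a monoid \<Rightarrow> 'g monoid \<Rightarrow> ('g, 'a) cpair set" where
  "stable_pairs A G = {(K, \<kappa>) \<in> pairs A G. K \<lhd> G \<and>
     (\<forall>g\<in>carrier G. \<forall>x\<in>K. \<kappa> (g \<otimes>\<^bsub>G\<^esub> x \<otimes>\<^bsub>G\<^esub> inv\<^bsub>G\<^esub> g) = \<kappa> x)}"

definition p1 :: "('g \<times> 'h) set \<Rightarrow> 'g set" where "p1 U = fst ` U"
definition p2 :: "('g \<times> 'h) set \<Rightarrow> 'h set" where "p2 U = snd ` U"

definition k1 :: "'h monoid \<Rightarrow> ('g \<times> 'h) set \<Rightarrow> 'g set" where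
  "k1 H U = {g. (g, \<one>\<^bsub>H\<^esub>) \<in> U}"
definition k2 :: "'g monoid \<Rightarrow> ('g \<times> 'h) set \<Rightarrow> 'h set" where
  "k2 G U = {h. (\<one>\<^bsub>G\<^esub>, h) \<in> U}"

text \<open>The inverse in \<open>right_triple\<close> comes from the convention
  \<open>\<phi>(g, h) = \<phi>\<^sub>1(g) \<phi>\<^sub>2(h)\<inverse>\<close> on \<open>k\<^sub>1(U) \<times> k\<^sub>2(U)\<close>.\<close>

definition left_triple ::
  "'g monoid \<Rightarrow> 'h monoid \<Rightarrow> ('g \<times> 'h, 'a) cpair \<Rightarrow> 'g set \<times> ('g, 'a) cpair" where
  "left_triple G H = (\<lambda>(U, \<phi>). (p1 U, k1 H U, \<lambda>g\<in>k1 H U. \<phi> (g, \<one>\<^bsub>H\<^esub>)))"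

definition right_triple ::
  "'a monoid \<Rightarrow> 'g monoid \<Rightarrow> 'h monoid \<Rightarrow> ('g \<times> 'h, 'a) cpair \<Rightarrow> 'h set \<times> ('h, 'a) cpair" where
  "right_triple A G H = (\<lambda>(U, \<phi>). (p2 U, k2 G U, \<lambda>h\<in>k2 G U. inv\<^bsub>A\<^esub> (\<phi> (\<one>\<^bsub>G\<^esub>, h))))"


section \<open>Fibered bisets\<close>

type_synonym ('a, 'g, 'h, 'x) biset = "'x set \<times> ('a \<times> 'g \<times> 'h \<Rightarrow> 'x \<Rightarrow> 'x)"

definition fibered_biset ::
  "'a monoid \<Rightarrow> 'g monoid \<Rightarrow> 'h monoid \<Rightarrow> ('a, 'g, 'h, 'x) biset \<Rightarrow> bool" where
  "fibered_biset A G H = (\<lambda>(X, \<rho>). group_action (A \<times>\<times> G \<times>\<times> H) X \<rho> \<and>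
     (\<forall>x\<in>X. stabilizer A (\<lambda>a. \<rho> (a, \<one>\<^bsub>G\<^esub>, \<one>\<^bsub>H\<^esub>)) x = {\<one>\<^bsub>A\<^esub>}) \<and>
     finite (orbits A X (\<lambda>a. \<rho> (a, \<one>\<^bsub>G\<^esub>, \<one>\<^bsub>H\<^esub>))))"

definition biset_iso ::
  "'a monoid \<Rightarrow> 'g monoid \<Rightarrow> 'h monoid \<Rightarrow>
   ('a, 'g, 'h, 'x) biset \<Rightarrow> ('a, 'g, 'h, 'y) biset \<Rightarrow> bool" where
  "biset_iso A G H = (\<lambda>(X, \<rho>) (Y, \<sigma>). \<exists>f. bij_betw f X Y \<and>
     (\<forall>t\<in>carrier (A \<times>\<times> G \<times>\<times> H). \<forall>x\<in>X. f (\<rho> t x) = \<sigma> t (f x)))"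

definition twisted_subgroup ::
  "'a monoid \<Rightarrow> ('g \<times> 'h, 'a) cpair \<Rightarrow> ('a \<times> 'g \<times> 'h) set" where
  "twisted_subgroup A = (\<lambda>(U, \<phi>). {(inv\<^bsub>A\<^esub> (\<phi> u), u) | u. u \<in> U})"

definition std_biset ::
  "'a monoid \<Rightarrow> 'g monoid \<Rightarrow> 'h monoid \<Rightarrow> ('g \<times> 'h, 'a) cpair \<Rightarrow>
   ('a, 'g, 'h, ('a \<times> 'g \<times> 'h) set) biset" where
  "std_biset A G H p =
     (let T = A \<times>\<times> G \<times>\<times> H; X = lcosets\<^bsub>T\<^esub> (twisted_subgroup A p)
      in (X, \<lambda>t. \<lambda>C\<in>X. t <#\<^bsub>T\<^esub> C))"

text \<open>An element of the orbit set of \<open>X \<times> Y\<close> is acted on as a set of pairs: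
  \<open>t \<cdot> [x, y]\<close> is the image of the orbit \<open>[x, y]\<close>.\<close>

definition tensor ::
  "'a monoid \<Rightarrow> 'g monoid \<Rightarrow> 'h monoid \<Rightarrow> 'i monoid \<Rightarrow>
   ('a, 'g, 'h, 'x) biset \<Rightarrow> ('a, 'h, 'i, 'y) biset \<Rightarrow> ('a, 'g, 'i, ('x \<times> 'y) set) biset" where
  "tensor A G H I = (\<lambda>(X, \<rho>) (Y, \<sigma>).
     (let
        \<tau> = (\<lambda>(a, h). \<lambda>(x, y)\<in>X \<times> Y. (\<rho> (inv\<^bsub>A\<^esub> a, \<one>\<^bsub>G\<^esub>, h) x, \<sigma> (a, h, \<one>\<^bsub>I\<^esub>) y));
        act = (\<lambda>(a, g, i) w. (\<lambda>(x, y). (\<rho> (a, g, \<one>\<^bsub>H\<^esub>) x, \<sigma> (\<one>\<^bsub>A\<^esub>, \<one>\<^bsub>H\<^esub>, i) y)) ` w);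
        Z = {w \<in> orbits (A \<times>\<times> H) (X \<times> Y) \<tau>.
              stabilizer A (\<lambda>a. act (a, \<one>\<^bsub>G\<^esub>, \<one>\<^bsub>I\<^esub>)) w = {\<one>\<^bsub>A\<^esub>}}
      in (Z, \<lambda>t. \<lambda>w\<in>Z. act t w)))"


section \<open>The fibered Burnside modules\<close>

text \<open>Isomorphism classes of fibered bisets are represented by their members whose underlying set
  consists of subsets of \<open>A \<times> G \<times> H\<close>.  These classes are nonempty for all transitive fibered
  bisets, since every one of the latter is isomorphic to some \<open>std_biset A G H p\<close>.\<close>

type_synonym ('a, 'g, 'h) iso_class = "('a, 'g, 'h, ('a \<times> 'g \<times> 'h) set) biset set"

definition transitive_biset ::
  "'a monoid \<Rightarrow> 'g monoid \<Rightarrow> 'h monoid \<Rightarrow> ('a, 'g, 'h, 'x) biset \<Rightarrow> bool" where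
  "transitive_biset A G H = (\<lambda>(X, \<rho>). fibered_biset A G H (X, \<rho>) \<and>
     X \<noteq> {} \<and> transitive_action (A \<times>\<times> G \<times>\<times> H) X \<rho>)"

definition iso_class ::
  "'a monoid \<Rightarrow> 'g monoid \<Rightarrow> 'h monoid \<Rightarrow> ('a, 'g, 'h, 'x) biset \<Rightarrow> ('a, 'g, 'h) iso_class" where
  "iso_class A G H X = {Y. fibered_biset A G H Y \<and> biset_iso A G H X Y}"

definition iso_classes :: "'a monoid \<Rightarrow> 'g monoid \<Rightarrow> 'h monoid \<Rightarrow> ('a, 'g, 'h) iso_class set" where
  "iso_classes A G H =
     {iso_class A G H X | X :: ('a, 'g, 'h, ('a \<times> 'g \<times> 'h) set) biset. transitive_biset A G H X}"

text \<open>The Grothendieck group of fibered bisets under disjoint union is free on the classes of the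
  transitive ones, so its scalar extension is realised as the module of finitely supported
  functions on these classes.  The element \<open>[X]\<close> of an arbitrary fibered biset \<open>X\<close> counts the
  orbits of \<open>X\<close> of each isomorphism type.\<close>

definition burnside ::
  "'k ring \<Rightarrow> 'a monoid \<Rightarrow> 'g monoid \<Rightarrow> 'h monoid \<Rightarrow> (('a, 'g, 'h) iso_class \<Rightarrow> 'k) set" where
  "burnside R A G H = {v. (\<forall>b. v b \<in> carrier R) \<and> finite {b. v b \<noteq> \<zero>\<^bsub>R\<^esub>} \<and>
     {b. v b \<noteq> \<zero>\<^bsub>R\<^esub>} \<subseteq> iso_classes A G H}"

definition biset_class ::
  "'k ring \<Rightarrow> 'a monoid \<Rightarrow> 'g monoid \<Rightarrow> 'h monoid \<Rightarrow> ('a, 'g, 'h, 'x) biset \<Rightarrow>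
   (('a, 'g, 'h) iso_class \<Rightarrow> 'k)" where
  "biset_class R A G H = (\<lambda>(X, \<rho>) b.
     [card {w \<in> orbits (A \<times>\<times> G \<times>\<times> H) X \<rho>.
              iso_class A G H (w, \<lambda>t. restrict (\<rho> t) w) = b}] \<cdot>\<^bsub>R\<^esub> \<one>\<^bsub>R\<^esub>)"

definition std_class ::
  "'k ring \<Rightarrow> 'a monoid \<Rightarrow> 'g monoid \<Rightarrow> 'h monoid \<Rightarrow> ('g \<times> 'h, 'a) cpair \<Rightarrow>
   (('a, 'g, 'h) iso_class \<Rightarrow> 'k)" where
  "std_class R A G H p = biset_class R A G H (std_biset A G H p)"

text \<open>The composition is the bilinear extension of \<open>([X], [Y]) \<mapsto> [X \<otimes> Y]\<close> for transitive
  \<open>X\<close>, \<open>Y\<close>.\<close>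

definition compose_burnside ::
  "'k ring \<Rightarrow> 'a monoid \<Rightarrow> 'g monoid \<Rightarrow> 'h monoid \<Rightarrow> 'i monoid \<Rightarrow>
   (('a, 'g, 'h) iso_class \<Rightarrow> 'k) \<Rightarrow> (('a, 'h, 'i) iso_class \<Rightarrow> 'k) \<Rightarrow>
   (('a, 'g, 'i) iso_class \<Rightarrow> 'k)" where
  "compose_burnside R A G H I v w d =
     (\<Oplus>\<^bsub>R\<^esub>b\<in>{b. v b \<noteq> \<zero>\<^bsub>R\<^esub>}. \<Oplus>\<^bsub>R\<^esub>c\<in>{c. w c \<noteq> \<zero>\<^bsub>R\<^esub>}.
        v b \<otimes>\<^bsub>R\<^esub> w c \<otimes>\<^bsub>R\<^esub>
        biset_class R A G I
          (tensor A G H I (SOME X. X \<in> b) (SOME Y. Y \<in> c)) d)"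

definition diag_pair :: "'g monoid \<Rightarrow> ('g, 'a) cpair \<Rightarrow> ('g \<times> 'g, 'a) cpair" where
  "diag_pair G = (\<lambda>(K, \<kappa>).
     (let D = {(g1, g2). g1 \<in> carrier G \<and> g2 \<in> carrier G \<and> g1 <#\<^bsub>G\<^esub> K = g2 <#\<^bsub>G\<^esub> K}
      in (D, \<lambda>(g1, g2)\<in>D. \<kappa> (g1 \<otimes>\<^bsub>G\<^esub> inv\<^bsub>G\<^esub> g2))))"

definition e_elt ::
  "'k ring \<Rightarrow> 'a monoid \<Rightarrow> 'g monoid \<Rightarrow> ('g, 'a) cpair \<Rightarrow> (('a, 'g, 'g) iso_class \<Rightarrow> 'k)" where
  "e_elt R A G p = std_class R A G G (diag_pair G p)"

definition E_alg ::
  "'k ring \<Rightarrow> 'a monoid \<Rightarrow> 'g monoid \<Rightarrow> ('k, ('a, 'g, 'g) iso_class \<Rightarrow> 'k) module" where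
  "E_alg R A G =
     \<lparr>carrier = burnside R A G G,
      monoid.mult = compose_burnside R A G G G,
      one = e_elt R A G ({\<one>\<^bsub>G\<^esub>}, \<lambda>x\<in>{\<one>\<^bsub>G\<^esub>}. \<one>\<^bsub>A\<^esub>),
      ring.zero = (\<lambda>b. \<zero>\<^bsub>R\<^esub>),
      ring.add = (\<lambda>v w b. v b \<oplus>\<^bsub>R\<^esub> w b),
      smult = (\<lambda>c v b. c \<otimes>\<^bsub>R\<^esub> v b)\<rparr>"

text \<open>Every finite group is isomorphic to one whose carrier is a set of natural numbers, so it
  suffices to let \<open>H\<close> range over the latter.\<close>

definition I_ideal ::
  "'k ring \<Rightarrow> 'a monoid \<Rightarrow> 'g monoid \<Rightarrow> (('a, 'g, 'g) iso_class \<Rightarrow> 'k) set" where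
  "I_ideal R A G = k_span R (E_alg R A G)
     {compose_burnside R A G H G v w | (H :: nat monoid) v w.
        group H \<and> finite (carrier H) \<and> order H < order G \<and>
        v \<in> burnside R A G H \<and> w \<in> burnside R A H G}"

definition E_bar ::
  "'k ring \<Rightarrow> 'a monoid \<Rightarrow> 'g monoid \<Rightarrow> ('k, (('a, 'g, 'g) iso_class \<Rightarrow> 'k) set) module" where
  "E_bar R A G = quotient_algebra (E_alg R A G) (I_ideal R A G)"

definition bar ::
  "'k ring \<Rightarrow> 'a monoid \<Rightarrow> 'g monoid \<Rightarrow> (('a, 'g, 'g) iso_class \<Rightarrow> 'k) \<Rightarrow>
   (('a, 'g, 'g) iso_class \<Rightarrow> 'k) set" where
  "bar R A G v = I_ideal R A G +>\<^bsub>E_alg R A G\<^esub> v"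

definition E_cov ::
  "'k ring \<Rightarrow> 'a monoid \<Rightarrow> 'g monoid \<Rightarrow> (('a, 'g, 'g) iso_class \<Rightarrow> 'k) set" where
  "E_cov R A G = k_span R (E_alg R A G)
     {std_class R A G G (U, \<phi>) | U \<phi>.
        (U, \<phi>) \<in> pairs A (G \<times>\<times> G) \<and> p1 U = carrier G \<and> p2 U = carrier G}"


section \<open>Idempotents and linkage\<close>

text \<open>The Moebius function of a family \<open>P\<close> of finite sets ordered by inclusion.\<close>

function moebius :: "'b set set \<Rightarrow> 'b set \<Rightarrow> 'b set \<Rightarrow> int" where
  "moebius P K L =
     (if finite L \<and> K \<in> P \<and> L \<in> P \<and> K \<subseteq> L
      then if K = L then 1 else - (\<Sum>N\<in>{N \<in> P. K \<subseteq> N \<and> N \<subset> L}. moebius P K N)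
      else 0)"
  by pat_completeness auto
termination
  by (relation "measure (\<lambda>(P, K, L). card L)") (auto intro: psubset_card_mono)

declare moebius.simps [simp del]

text \<open>If \<open>A\<close> has infinitely many elements of some finite order, \<open>stable_pairs A G\<close> may be infinite;
  the sums defining \<open>f_elt\<close> and \<open>f_class\<close> are meaningful only if it is finite.\<close>

definition f_elt ::
  "'k ring \<Rightarrow> 'a monoid \<Rightarrow> 'g monoid \<Rightarrow> ('g, 'a) cpair \<Rightarrow> (('a, 'g, 'g) iso_class \<Rightarrow> 'k)" where
  "f_elt R A G p = (\<Oplus>\<^bsub>E_alg R A G\<^esub>q\<in>{q \<in> stable_pairs A G. pair_le p q}.
     [moebius {N. N \<lhd> G} (fst p) (fst q)] \<cdot>\<^bsub>E_alg R A G\<^esub> e_elt R A G q)"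

definition R_set :: "'k ring \<Rightarrow> 'a monoid \<Rightarrow> 'g monoid \<Rightarrow> ('g, 'a) cpair set" where
  "R_set R A G = {p \<in> stable_pairs A G. e_elt R A G p \<notin> I_ideal R A G}"

definition linkage :: "'a monoid \<Rightarrow> 'g monoid \<Rightarrow> (('g, 'a) cpair \<times> ('g, 'a) cpair) set" where
  "linkage A G = {(p, q). p \<in> stable_pairs A G \<and> q \<in> stable_pairs A G \<and>
     (\<exists>u\<in>pairs A (G \<times>\<times> G). left_triple G G u = (carrier G, p) \<and>
        right_triple A G G u = (carrier G, q))}"

definition f_class ::
  "'k ring \<Rightarrow> 'a monoid \<Rightarrow> 'g monoid \<Rightarrow> ('g, 'a) cpair set \<Rightarrow> (('a, 'g, 'g) iso_class \<Rightarrow> 'k)" where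
  "f_class R A G C = (\<Oplus>\<^bsub>E_alg R A G\<^esub>p\<in>C. f_elt R A G p)"

definition block ::
  "'k ring \<Rightarrow> 'a monoid \<Rightarrow> 'g monoid \<Rightarrow> ('g, 'a) cpair set \<Rightarrow> (('a, 'g, 'g) iso_class \<Rightarrow> 'k) set" where
  "block R A G C = f_class R A G C <#\<^bsub>E_alg R A G\<^esub> E_cov R A G"

text \<open>The algebra on the sum of the blocks indexed by \<open>R_set R A G // linkage A G\<close>.  Its identity
  is the sum of the block idempotents, in general not the one of \<open>E_alg R A G\<close>.\<close>

definition essential_blocks ::
  "'k ring \<Rightarrow> 'a monoid \<Rightarrow> 'g monoid \<Rightarrow> ('k, ('a, 'g, 'g) iso_class \<Rightarrow> 'k) module" where
  "essential_blocks R A G = (E_alg R A G)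
     \<lparr>carrier := sum_of_submodules (E_alg R A G) (R_set R A G // linkage A G) (block R A G),
      one := (\<Oplus>\<^bsub>E_alg R A G\<^esub>C\<in>R_set R A G // linkage A G. f_class R A G C)\<rparr>"

definition Gamma ::
  "'k ring \<Rightarrow> 'a monoid \<Rightarrow> 'g monoid \<Rightarrow> ('g, 'a) cpair \<Rightarrow> (('a, 'g, 'g) iso_class \<Rightarrow> 'k) monoid" where
  "Gamma R A G p =
     \<lparr>carrier = {std_class R A G G u | u. u \<in> pairs A (G \<times>\<times> G) \<and>
        left_triple G G u = (carrier G, p) \<and> right_triple A G G u = (carrier G, p)},
      monoid.mult = monoid.mult (E_alg R A G),
      one = e_elt R A G p\<rparr>"

text \<open>The linear extension to \<open>k\<Gamma>\<close> of the inclusion of \<open>\<Gamma>\<close> into \<open>E_alg R A G\<close>.\<close>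

definition Gamma_incl ::
  "'k ring \<Rightarrow> 'a monoid \<Rightarrow> 'g monoid \<Rightarrow> ((('a, 'g, 'g) iso_class \<Rightarrow> 'k) \<Rightarrow> 'k) \<Rightarrow>
   (('a, 'g, 'g) iso_class \<Rightarrow> 'k)" where
  "Gamma_incl R A G a =
     (\<Oplus>\<^bsub>E_alg R A G\<^esub>\<gamma>\<in>{\<gamma>. a \<gamma> \<noteq> \<zero>\<^bsub>R\<^esub>}. a \<gamma> \<odot>\<^bsub>E_alg R A G\<^esub> \<gamma>)"

end

theory Submission
  imports Defs "HOL-Algebra.Weak_Morphisms" "HOL-Algebra.Generated_Groups"
begin

text \<open>Subgroups \<open>S\<close> of \<open>A \<times> G \<times> H\<close> meeting \<open>A\<close> trivially are the graphs of the pairs \<open>(U, \<phi>)\<close>, and a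
  product of two transitive bisets with stabilizers \<open>S\<close> and \<open>S'\<close> is governed by the relational
  composite of \<open>S\<close> and \<open>S'\<close>.  A class whose projections are not both surjective factors through a
  proper subgroup of \<open>G\<close> and lies in \<open>I\<^sub>G\<close>.  The other classes form an inverse semigroup with zero,
  whose idempotents are the \<open>e\<^bsub>(K,\<kappa>)\<^esub>\<close>.  Moebius inversion along the normal subgroups of \<open>G\<close> turns
  these into orthogonal idempotents \<open>f\<^bsub>(K,\<kappa>)\<^esub>\<close> summing to \<open>1\<close>, and \<open>f\<^sub>p x f\<^sub>q\<close> depends only on the part
  of \<open>x\<close> supported on the classes that link \<open>p\<close> to \<open>q\<close>.  Since \<open>I\<^sub>G\<close> is spanned by classes, a linkage
  block is either contained in \<open>I\<^sub>G\<close> or meets it trivially.\<close>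

section \<open>Ideals and quotients of algebras\<close>

text \<open>The coefficients form an arbitrary commutative ring, so no nonzero integer may be
  cancelled. This shapes two steps. Products are evaluated only when one factor projects onto the
  whole middle group: the orbit set is then a single orbit, and the product is one class with
  coefficient one, or zero when \<open>A\<close> fails to act freely. For a product through a small
  group \<open>H\<close> multiplicities are never computed: each class that occurs arises again,
  with coefficient one, through a subgroup of \<open>H\<close>, and therefore the ideal is spanned
  by classes. Associativity is the other obstacle. Composition is defined on chosen representatives
  of transitive bisets, but their tensor product is in general not transitive, so
  \<open>[X] [Y] = [X \<otimes> Y]\<close> has to be proved for all fibered bisets first. The block
  theory lives in a locale that knows only a few product rules for basis elements; there the Moebius
  function enters through two facts only: \<open>f p\<close> is \<open>e p\<close> plus terms
  strictly above \<open>p\<close>, and the \<open>f q\<close> with \<open>q\<close> above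
  \<open>p\<close> sum to \<open>e p\<close>.\<close>

locale k_alg =
  fixes R :: "'k ring" and M :: "('k, 'm) module" (structure)
  assumes k_algebra: "k_algebra R M"

sublocale k_alg \<subseteq> ring M
  using k_algebra by (simp add: k_algebra_def)

sublocale k_alg \<subseteq> mod: module R M
  using k_algebra by (simp add: k_algebra_def)

context k_alg
begin

lemma smult_mult_left:
  assumes "c \<in> carrier R" "x \<in> carrier M" "y \<in> carrier M"
  shows "(c \<odot> x) \<otimes> y = c \<odot> (x \<otimes> y)"
  using k_algebra assms unfolding k_algebra_def by blast

lemma smult_mult_right:
  assumes "c \<in> carrier R" "x \<in> carrier M" "y \<in> carrier M"
  shows "x \<otimes> (c \<odot> y) = c \<odot> (x \<otimes> y)"
  using k_algebra assms unfolding k_algebra_def by blast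

lemma submodule_k_span:
  assumes "S \<subseteq> carrier M"
  shows "submodule (k_span R M S) R M"
proof (rule mod.submoduleI)
  have whole: "submodule (carrier M) R M"
    by (rule mod.carrier_is_submodule)
  then show "k_span R M S \<subseteq> carrier M"
    using assms by (auto simp: k_span_def)
  show "\<zero> \<in> k_span R M S"
    unfolding k_span_def
    by (auto simp: submodule_def dest: subgroup.one_closed)
qed (auto simp: k_span_def mod.submoduleE)

lemma k_span_superset: "S \<subseteq> k_span R M S"
  by (auto simp: k_span_def)

lemma k_span_least: "submodule N R M \<Longrightarrow> S \<subseteq> N \<Longrightarrow> k_span R M S \<subseteq> N"
  by (auto simp: k_span_def)

text \<open>No finiteness of \<open>S\<close> is asked: over an infinite set \<open>finsum\<close>
  takes its default value zero, which lies in every submodule.\<close>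

lemma finsum_in_submodule:
  assumes "submodule N R M" "\<And>i. i \<in> S \<Longrightarrow> f i \<in> N"
  shows "finsum M f S \<in> N"
proof -
  note N = mod.submoduleE[OF assms(1)]
  have z: "\<zero> \<in> N"
    using assms(1) by (auto simp: submodule_def dest: subgroup.one_closed)
  show ?thesis
  proof (cases "finite S")
    case True
    then show ?thesis using assms(2)
    proof (induction S)
      case (insert i S)
      moreover have "f \<in> S \<rightarrow> carrier M" "f i \<in> carrier M"
        using N(1) insert by auto
      ultimately show ?case using N(5) by simp
    qed (simp add: z)
  qed (simp add: z)
qed

lemma corner_k_algebra:
  assumes f: "f \<in> carrier M" "f \<otimes> f = f"
  shows "k_algebra R (corner_algebra M f)"
proof -
  define C where "C = {f \<otimes> x \<otimes> f | x. x \<in> carrier M}"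
  define N where "N = M\<lparr>carrier := C, one := f\<rparr>"
  \<comment> \<open>Idempotency of \<open>f\<close> turns the corner into the set of elements fixed
    by \<open>f\<close> on both sides; all closure properties are read off this form.\<close>
  have C_iff: "y \<in> C \<longleftrightarrow> y \<in> carrier M \<and> f \<otimes> y = y \<and> y \<otimes> f = y" for y
  proof
    assume "y \<in> C"
    then obtain x where x: "x \<in> carrier M" "y = f \<otimes> x \<otimes> f" by (auto simp: C_def)
    have "f \<otimes> y = (f \<otimes> f) \<otimes> x \<otimes> f" "y \<otimes> f = f \<otimes> x \<otimes> (f \<otimes> f)"
      using x f(1) by (simp_all only: m_assoc m_closed)
    then show "y \<in> carrier M \<and> f \<otimes> y = y \<and> y \<otimes> f = y"
      using x f by simp
  next
    assume "y \<in> carrier M \<and> f \<otimes> y = y \<and> y \<otimes> f = y"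
    then have "y = f \<otimes> y \<otimes> f" "y \<in> carrier M" by simp_all
    then show "y \<in> C" unfolding C_def by blast
  qed
  have N_sel: "carrier N = C" "monoid.mult N = monoid.mult M" "ring.add N = ring.add M"
    "ring.zero N = \<zero>" "monoid.one N = f" "smult N = smult M"
    by (simp_all add: N_def)
  have sub: "submodule C R M"
    using f by (intro mod.submoduleI)
      (auto simp: C_iff r_minus l_minus l_distr r_distr smult_mult_left smult_mult_right)
  have mod': "module R (M\<lparr>carrier := C\<rparr>)"
    using submodule.submodule_is_module[OF sub] mod.module_axioms by blast
  \<comment> \<open>The additive structure does not see the identity element, so the additive group
    of \<open>N\<close> is that of the submodule \<open>C\<close>.\<close>
  have add: "add_monoid N = add_monoid (M\<lparr>carrier := C\<rparr>)"
    by (simp add: N_def)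
  have ab: "abelian_group N"
    using module.axioms(2)[OF mod']
    unfolding abelian_group_def abelian_monoid_def abelian_group_axioms_def add .
  have mult: "x \<otimes> y \<in> C" if "x \<in> C" "y \<in> C" for x y
    using that f(1) unfolding C_iff by (metis m_assoc m_closed)
  have Cm: "y \<in> C \<Longrightarrow> y \<in> carrier M" for y by (simp add: C_iff)
  have fC: "f \<in> C" using f by (simp add: C_iff)
  have id: "y \<in> C \<Longrightarrow> f \<otimes> y = y" "y \<in> C \<Longrightarrow> y \<otimes> f = y" for y by (simp_all add: C_iff)
  have mon: "Group.monoid N"
    by (rule monoidI; unfold N_sel) (simp_all add: mult Cm fC id m_assoc)
  have "ring N"
    by (rule ringI[OF ab mon]; unfold N_sel) (simp_all add: Cm l_distr r_distr)
  moreover have "module R N"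
    by (rule moduleI[OF mod.cring_axioms ab]; unfold N_sel)
      (use Cm sub in \<open>simp_all add: mod.smult_l_distr mod.smult_r_distr mod.smult_assoc1 submodule.smult_closed\<close>)
  ultimately have "k_algebra R N"
    unfolding k_algebra_def N_sel
    using Cm by (simp add: smult_mult_left smult_mult_right)
  then show ?thesis by (simp add: corner_algebra_def N_def C_def)
qed

end

text \<open>Each algebra law holds in \<open>M\<close> because it holds in \<open>N\<close> after
  applying the injective map \<open>h\<close>. In this way the essential blocks, whose identity is
  not that of the surrounding algebra, and the group algebra are recognised as algebras together
  with the isomorphisms out of them.\<close>

lemma k_algebra_iso_transport:
  assumes N: "k_algebra R N"
    and bij: "bij_betw h (carrier M) (carrier N)"
    and closed: "\<And>x y. x \<in> carrier M \<Longrightarrow> y \<in> carrier M \<Longrightarrow> x \<oplus>\<^bsub>M\<^esub> y \<in> carrier M"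
      "\<And>x y. x \<in> carrier M \<Longrightarrow> y \<in> carrier M \<Longrightarrow> x \<otimes>\<^bsub>M\<^esub> y \<in> carrier M"
      "\<And>c x. c \<in> carrier R \<Longrightarrow> x \<in> carrier M \<Longrightarrow> c \<odot>\<^bsub>M\<^esub> x \<in> carrier M"
      "\<zero>\<^bsub>M\<^esub> \<in> carrier M" "\<one>\<^bsub>M\<^esub> \<in> carrier M"
    and hom: "\<And>x y. x \<in> carrier M \<Longrightarrow> y \<in> carrier M \<Longrightarrow> h (x \<oplus>\<^bsub>M\<^esub> y) = h x \<oplus>\<^bsub>N\<^esub> h y"
      "\<And>x y. x \<in> carrier M \<Longrightarrow> y \<in> carrier M \<Longrightarrow> h (x \<otimes>\<^bsub>M\<^esub> y) = h x \<otimes>\<^bsub>N\<^esub> h y"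
      "\<And>c x. c \<in> carrier R \<Longrightarrow> x \<in> carrier M \<Longrightarrow> h (c \<odot>\<^bsub>M\<^esub> x) = c \<odot>\<^bsub>N\<^esub> h x"
      "h \<zero>\<^bsub>M\<^esub> = \<zero>\<^bsub>N\<^esub>" "h \<one>\<^bsub>M\<^esub> = \<one>\<^bsub>N\<^esub>"
  shows "k_algebra_iso R M N h"
proof -
  interpret N: k_alg R N by (unfold_locales) (rule N)
  have hc: "x \<in> carrier M \<Longrightarrow> h x \<in> carrier N" for x
    using bij by (auto simp: bij_betw_def)
  have inj: "x = y" if "h x = h y" "x \<in> carrier M" "y \<in> carrier M" for x y
    using bij that by (auto simp: bij_betw_def inj_on_def)
  have ab: "abelian_group M"
  proof (rule abelian_groupI)
    fix x assume x: "x \<in> carrier M"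
    \<comment> \<open>Negatives are not among the closure assumptions on \<open>M\<close>;
      surjectivity of \<open>h\<close> supplies them.\<close>
    obtain y where y: "y \<in> carrier M" "h y = \<ominus>\<^bsub>N\<^esub> h x"
      using bij N.a_inv_closed[OF hc[OF x]] unfolding bij_betw_def by (metis imageE)
    then have "y \<oplus>\<^bsub>M\<^esub> x = \<zero>\<^bsub>M\<^esub>"
      by (intro inj) (simp_all add: x closed hom hc N.l_neg)
    then show "\<exists>y\<in>carrier M. y \<oplus>\<^bsub>M\<^esub> x = \<zero>\<^bsub>M\<^esub>" using y by blast
  qed (auto intro!: inj simp: closed hom hc N.a_ac)
  have mon: "Group.monoid M"
    by (rule monoidI) (auto intro!: inj simp: closed hom hc N.m_assoc)
  have "ring M"
    by (rule ringI[OF ab mon]) (auto intro!: inj simp: closed hom hc N.l_distr N.r_distr)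
  moreover have "module R M"
    by (rule moduleI[OF N.mod.cring_axioms ab])
      (auto intro!: inj simp: closed hom hc N.mod.smult_l_distr N.mod.smult_r_distr N.mod.smult_assoc1)
  ultimately have "k_algebra R M"
    unfolding k_algebra_def
    by (auto intro!: inj simp: closed hom hc N.smult_mult_left N.smult_mult_right)
  moreover have "h \<in> ring_iso M N"
    using bij by (auto simp: ring_iso_def ring_hom_def hc hom)
  ultimately show ?thesis
    unfolding k_algebra_iso_def using N hom by blast
qed

section \<open>Quotient of an algebra by an ideal stable under scalars\<close>

locale k_alg_ideal = k_alg R M + ideal I M
  for R :: "'k ring" and M :: "('k, 'm) module" (structure) and I +
  assumes smult_in_ideal: "c \<in> carrier R \<Longrightarrow> x \<in> I \<Longrightarrow> c \<odot> x \<in> I"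
begin

abbreviation Quo where "Quo \<equiv> quotient_algebra M I"

lemma quotient_sel:
  "carrier Quo = carrier (M Quot I)"
  "monoid.mult Quo = monoid.mult (M Quot I)"
  "ring.add Quo = ring.add (M Quot I)"
  "ring.zero Quo = ring.zero (M Quot I)"
  "monoid.one Quo = monoid.one (M Quot I)"
  "smult Quo = (\<lambda>c C. I <+> ((\<lambda>x. c \<odot> x) ` C))"
  by (simp_all add: quotient_algebra_def ring.defs)

lemma carrier_quotient: "carrier Quo = (\<lambda>x. I +> x) ` carrier M"
  unfolding quotient_sel FactRing_def A_RCOSETS_def' by auto

lemma coset_mult:
  "x \<in> carrier M \<Longrightarrow> y \<in> carrier M \<Longrightarrow> (I +> x) \<otimes>\<^bsub>Quo\<^esub> (I +> y) = I +> (x \<otimes> y)"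
  unfolding quotient_sel by (simp add: FactRing_def rcoset_mult_add)

lemma coset_add:
  "x \<in> carrier M \<Longrightarrow> y \<in> carrier M \<Longrightarrow> (I +> x) \<oplus>\<^bsub>Quo\<^esub> (I +> y) = I +> (x \<oplus> y)"
  unfolding quotient_sel by (simp add: FactRing_def a_rcos_sum)

lemma coset_zero: "\<zero>\<^bsub>Quo\<^esub> = I +> \<zero>"
  unfolding quotient_sel
  by (metis FactRing_def Icarr a_coset_add_zero a_subset ring.simps(1))

lemma coset_one: "\<one>\<^bsub>Quo\<^esub> = I +> \<one>"
  unfolding quotient_sel by (simp add: FactRing_def)

text \<open>The set of all \<open>c \<odot> y\<close> with \<open>y\<close> in a coset may be
  smaller than a coset, since \<open>c\<close> times the ideal may be smaller than the ideal. Adding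
  \<open>I\<close> once more, as the definition does, fills it up.\<close>

lemma coset_smult:
  assumes "c \<in> carrier R" "x \<in> carrier M"
  shows "c \<odot>\<^bsub>Quo\<^esub> (I +> x) = I +> (c \<odot> x)"
proof -
  have "I <+> ((\<lambda>x. c \<odot> x) ` (I +> x)) = I +> (c \<odot> x)" (is "?L = ?R")
  proof
    show "?L \<subseteq> ?R"
    proof
      fix z assume "z \<in> ?L"
      then obtain i j where ij: "i \<in> I" "j \<in> I" "z = i \<oplus> c \<odot> (j \<oplus> x)"
        by (auto simp: set_add_def' a_r_coset_def')
      then have "z = (i \<oplus> c \<odot> j) \<oplus> c \<odot> x"
        using assms by (simp add: mod.smult_r_distr a_assoc)
      moreover have "i \<oplus> c \<odot> j \<in> I"
        using ij assms smult_in_ideal by (simp add: a_closed)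
      ultimately show "z \<in> ?R" by (auto simp: a_r_coset_def')
    qed
    show "?R \<subseteq> ?L"
    proof
      fix z assume "z \<in> ?R"
      then obtain i where i: "i \<in> I" "z = i \<oplus> c \<odot> x"
        by (auto simp: a_r_coset_def')
      moreover have "x \<in> I +> x"
        using assms a_rcos_self[OF assms(2)] by simp
      ultimately show "z \<in> ?L" unfolding set_add_def' by blast
    qed
  qed
  then show ?thesis by (simp add: quotient_sel)
qed

lemma coset_eq_iff:
  assumes "x \<in> carrier M" "y \<in> carrier M"
  shows "I +> x = I +> y \<longleftrightarrow> x \<ominus> y \<in> I"
  using quotient_eq_iff_same_a_r_cos[OF ideal_axioms assms] by simp

lemma quotient_k_algebra: "k_algebra R Quo"
proof -
  have q: "ring (M Quot I)" by (rule quotient_is_ring)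
  have ab: "abelian_group Quo"
  proof (rule abelian_groupI)
    fix x assume "x \<in> carrier Quo"
    then obtain y where y: "y \<in> carrier M" "x = I +> y" by (auto simp: carrier_quotient)
    have "(I +> \<ominus> y) \<oplus>\<^bsub>Quo\<^esub> x = \<zero>\<^bsub>Quo\<^esub>"
      using y by (simp add: coset_add coset_zero l_neg)
    moreover have "I +> \<ominus> y \<in> carrier Quo" using y by (simp add: carrier_quotient)
    ultimately show "\<exists>y\<in>carrier Quo. y \<oplus>\<^bsub>Quo\<^esub> x = \<zero>\<^bsub>Quo\<^esub>" by blast
  qed (auto simp: carrier_quotient coset_add coset_zero a_ac)
  have mon: "Group.monoid Quo"
    using ring.is_monoid[OF q] unfolding Group.monoid_def quotient_sel .
  have "ring Quo"
    by (rule ringI[OF ab mon])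
      (auto simp: carrier_quotient coset_add coset_mult l_distr r_distr)
  moreover have "module R Quo"
    by (rule moduleI[OF mod.cring_axioms ab])
      (auto simp: carrier_quotient coset_add coset_smult
        mod.smult_l_distr mod.smult_r_distr mod.smult_assoc1)
  ultimately show ?thesis
    unfolding k_algebra_def
    by (auto simp: carrier_quotient coset_mult coset_smult smult_mult_left smult_mult_right)
qed

end

section \<open>Free modules with a partial semigroup of basis elements\<close>

definition fin_supp :: "'k ring \<Rightarrow> 'b set \<Rightarrow> ('b \<Rightarrow> 'k) set" where
  "fin_supp R S = {v. (\<forall>b. v b \<in> carrier R) \<and> finite {b. v b \<noteq> \<zero>\<^bsub>R\<^esub>} \<and> {b. v b \<noteq> \<zero>\<^bsub>R\<^esub>} \<subseteq> S}"

text \<open>The basis vector attached to \<open>b\<close>. It determines \<open>b\<close> only when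
  one and zero of \<open>R\<close> differ, and the zero ring is allowed; arguments that compare
  basis vectors have to deal with that case.\<close>

definition single :: "'k ring \<Rightarrow> 'b \<Rightarrow> ('b \<Rightarrow> 'k)" where
  "single R b = (\<lambda>c. if c = b then \<one>\<^bsub>R\<^esub> else \<zero>\<^bsub>R\<^esub>)"

lemma fin_suppD:
  assumes "v \<in> fin_supp R S"
  shows "v b \<in> carrier R" "finite {b. v b \<noteq> \<zero>\<^bsub>R\<^esub>}" "b \<notin> S \<Longrightarrow> v b = \<zero>\<^bsub>R\<^esub>"
  using assms unfolding fin_supp_def by auto

lemma fin_supp_mono: "S \<subseteq> T \<Longrightarrow> fin_supp R S \<subseteq> fin_supp R T"
  by (auto simp: fin_supp_def)

locale coefficients = cring R for R :: "'k ring" (structure)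
begin

lemma zero_fin_supp: "(\<lambda>b. \<zero>) \<in> fin_supp R S"
  by (simp add: fin_supp_def)

lemma add_fin_supp:
  assumes "v \<in> fin_supp R S" "w \<in> fin_supp R S"
  shows "(\<lambda>b. v b \<oplus> w b) \<in> fin_supp R S"
proof -
  have "{b. v b \<oplus> w b \<noteq> \<zero>} \<subseteq> {b. v b \<noteq> \<zero>} \<union> {b. w b \<noteq> \<zero>}" by auto
  then show ?thesis using assms unfolding fin_supp_def
    by (auto intro: finite_subset)
qed

lemma smult_fin_supp:
  assumes "v \<in> fin_supp R S" "c \<in> carrier R"
  shows "(\<lambda>b. c \<otimes> v b) \<in> fin_supp R S"
proof -
  have "{b. c \<otimes> v b \<noteq> \<zero>} \<subseteq> {b. v b \<noteq> \<zero>}" using assms(2) by auto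
  then show ?thesis using assms unfolding fin_supp_def
    by (auto intro: finite_subset)
qed

lemma single_fin_supp: "b \<in> S \<Longrightarrow> single R b \<in> fin_supp R S"
  by (auto simp: fin_supp_def single_def)

lemma fin_supp_induct [consumes 1, case_names zero add]:
  assumes v: "v \<in> fin_supp R S"
    and zero: "P (\<lambda>b. \<zero>)"
    and add: "\<And>c b v. c \<in> carrier R \<Longrightarrow> b \<in> S \<Longrightarrow> v \<in> fin_supp R S \<Longrightarrow> P v \<Longrightarrow>
      P (\<lambda>x. c \<otimes> single R b x \<oplus> v x)"
  shows "P v"
proof -
  have "finite {b. v b \<noteq> \<zero>}" using v by (simp add: fin_supp_def)
  then show ?thesis using v
  proof (induction "{b. v b \<noteq> \<zero>}" arbitrary: v rule: finite_induct)
    case empty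
    then have "v = (\<lambda>b. \<zero>)" by auto
    then show ?case using zero by simp
  next
    case (insert b F)
    define w where "w = v(b := \<zero>)"
    have F: "F = {x. w x \<noteq> \<zero>}" using insert.hyps by (auto simp: w_def)
    have vb: "v b \<in> carrier R" "b \<in> S" using insert unfolding fin_supp_def by auto
    have w: "w \<in> fin_supp R S"
      using insert.prems insert.hyps(1) F insert.hyps(4) unfolding fin_supp_def w_def by auto
    have "v = (\<lambda>x. v b \<otimes> single R b x \<oplus> w x)"
      using insert.prems by (auto simp: w_def single_def fin_supp_def fun_eq_iff)
    moreover have "P (\<lambda>x. v b \<otimes> single R b x \<oplus> w x)"
      by (rule add) (use vb w insert.hyps(3)[OF F w] in auto)
    ultimately show ?case by simp
  qed
qed

end

locale free_module = R: coefficients R for R :: "'k ring" +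
  fixes B :: "'b set" and M :: "('k, 'b \<Rightarrow> 'k) module" (structure)
  assumes carrier_M: "carrier M = fin_supp R B"
    and add_M: "add M = (\<lambda>v w b. v b \<oplus>\<^bsub>R\<^esub> w b)"
    and zero_M: "\<zero> = (\<lambda>b. \<zero>\<^bsub>R\<^esub>)"
    and smult_M: "smult M = (\<lambda>c v b. c \<otimes>\<^bsub>R\<^esub> v b)"
begin

lemma free_abelian_group: "abelian_group M"
proof (rule abelian_groupI; unfold carrier_M add_M zero_M)
  fix v assume v: "v \<in> fin_supp R B"
  then have "(\<lambda>b. (\<ominus>\<^bsub>R\<^esub> \<one>\<^bsub>R\<^esub>) \<otimes>\<^bsub>R\<^esub> v b) \<in> fin_supp R B" by (simp add: R.smult_fin_supp)
  moreover have "(\<lambda>b. (\<ominus>\<^bsub>R\<^esub> \<one>\<^bsub>R\<^esub>) \<otimes>\<^bsub>R\<^esub> v b \<oplus>\<^bsub>R\<^esub> v b) = (\<lambda>b. \<zero>\<^bsub>R\<^esub>)"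
    using fin_suppD(1)[OF v] by (simp add: R.l_minus R.l_neg)
  ultimately show "\<exists>y\<in>fin_supp R B. (\<lambda>b. y b \<oplus>\<^bsub>R\<^esub> v b) = (\<lambda>b. \<zero>\<^bsub>R\<^esub>)"
    by (intro bexI[of _ "\<lambda>b. (\<ominus>\<^bsub>R\<^esub> \<one>\<^bsub>R\<^esub>) \<otimes>\<^bsub>R\<^esub> v b"])
qed (auto simp: R.add_fin_supp R.zero_fin_supp fin_suppD(1) R.a_ac)

lemma free_is_module: "module R M"
  by (rule moduleI[OF R.cring_axioms free_abelian_group]; unfold carrier_M add_M smult_M)
    (auto simp: R.smult_fin_supp fin_suppD(1) R.l_distr R.r_distr R.m_assoc)

end

sublocale free_module \<subseteq> fm: module R M
  by (rule free_is_module)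

context free_module
begin

abbreviation \<delta> where "\<delta> \<equiv> single R"

lemma carrier_apply: "v \<in> carrier M \<Longrightarrow> v b \<in> carrier R"
  by (simp add: carrier_M fin_suppD(1))

lemma uminus_apply:
  assumes "v \<in> carrier M"
  shows "(\<ominus> v) b = \<ominus>\<^bsub>R\<^esub> v b"
proof -
  have "(v \<oplus> \<ominus> v) b = \<zero>\<^bsub>R\<^esub>"
    using assms fm.M.r_neg by (simp add: zero_M)
  then show ?thesis
    unfolding add_M using carrier_apply[OF assms] carrier_apply[OF fm.M.add.inv_closed[OF assms]]
    by (metis R.minus_equality R.add.m_comm)
qed

lemma finsum_apply:
  assumes "f \<in> S \<rightarrow> carrier M"
  shows "finsum M f S b = (\<Oplus>\<^bsub>R\<^esub>i\<in>S. f i b)"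
proof (cases "finite S")
  case True
  then show ?thesis using assms
  proof (induction S)
    case (insert i S)
    then have f: "f \<in> S \<rightarrow> carrier M" "f i \<in> carrier M" by auto
    then have "(\<lambda>i. f i b) \<in> S \<rightarrow> carrier R" "f i b \<in> carrier R" by (auto intro!: carrier_apply)
    then show ?case using insert f by (simp add: add_M)
  qed (simp add: zero_M)
qed (simp add: zero_M)

lemma submodule_fin_supp:
  assumes "S \<subseteq> B"
  shows "submodule (fin_supp R S) R M"
proof (rule fm.submoduleI)
  show "fin_supp R S \<subseteq> carrier M" unfolding carrier_M using assms by (rule fin_supp_mono)
  then have "\<ominus> v = (\<lambda>b. (\<ominus>\<^bsub>R\<^esub> \<one>\<^bsub>R\<^esub>) \<otimes>\<^bsub>R\<^esub> v b)" if "v \<in> fin_supp R S" for v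
    using that fin_suppD(1)[OF that] uminus_apply[of v] by (auto simp: R.l_minus)
  then show "\<ominus> v \<in> fin_supp R S" if "v \<in> fin_supp R S" for v
    using R.smult_fin_supp[OF that R.add.inv_closed[OF R.one_closed]] that by simp
qed (simp_all add: zero_M add_M smult_M R.zero_fin_supp R.add_fin_supp R.smult_fin_supp)

lemma single_closed: "b \<in> B \<Longrightarrow> \<delta> b \<in> carrier M"
  by (simp add: carrier_M R.single_fin_supp)

lemma free_induct [consumes 2, case_names zero add]:
  assumes v: "v \<in> fin_supp R S" "S \<subseteq> B"
    and zero: "P \<zero>"
    and add: "\<And>c b v. c \<in> carrier R \<Longrightarrow> b \<in> S \<Longrightarrow> v \<in> fin_supp R S \<Longrightarrow> v \<in> carrier M \<Longrightarrow> \<delta> b \<in> carrier M \<Longrightarrow> P v \<Longrightarrow>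
      P (c \<odot> \<delta> b \<oplus> v)"
  shows "P v"
  using v(1)
proof (induction rule: R.fin_supp_induct)
  case zero
  then show ?case using assms(3) by (simp add: zero_M)
next
  case (add c b v)
  then show ?case using assms(4)[OF add(1-3)] fin_supp_mono[OF v(2)] single_closed v(2)
    unfolding carrier_M add_M smult_M by auto
qed

lemma fin_supp_subset_submodule:
  assumes N: "submodule N R M" and S: "S \<subseteq> B" "\<And>b. b \<in> S \<Longrightarrow> \<delta> b \<in> N"
  shows "fin_supp R S \<subseteq> N"
proof
  fix v assume "v \<in> fin_supp R S"
  from this S(1) show "v \<in> N"
  proof (induction rule: free_induct)
    case zero
    then show ?case using N by (auto simp: submodule_def dest: subgroup.one_closed)
  next
    case (add c b v)
    then show ?case using fm.submoduleE[OF N] S(2) by auto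
  qed
qed

lemma k_span_single:
  assumes "S \<subseteq> B"
  shows "k_span R M (\<delta> ` S) = fin_supp R S"
  unfolding k_span_def using fin_supp_subset_submodule[OF _ assms]
    submodule_fin_supp[OF assms] R.single_fin_supp[of _ S]
  by auto

end

text \<open>\<open>Cv\<close> plays the role of the classes of pairs \<open>(U, \<phi>)\<close> with surjective projections, \<open>lt\<close> and \<open>rt\<close>
  of the pairs \<open>(k\<^sub>1(U), \<phi>\<^sub>1)\<close> and \<open>(k\<^sub>2(U), \<phi>\<^sub>2)\<close>, and \<open>bt\<close> of the trivial pair.\<close>

locale fibered_blocks = k_alg R M + free_module R B M
  for R :: "'k ring" and B :: "'b set" and M :: "('k, 'b \<Rightarrow> 'k) module" (structure) +
  fixes Cv :: "'b set" and P :: "'p set" and le :: "'p \<Rightarrow> 'p \<Rightarrow> bool" and e :: "'p \<Rightarrow> 'b"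
    and lt rt :: "'b \<Rightarrow> 'p" and bt :: 'p
    and f :: "'p \<Rightarrow> 'b \<Rightarrow> 'k" and I :: "('b \<Rightarrow> 'k) set"
  assumes smult_I: "a \<in> carrier R \<Longrightarrow> x \<in> I \<Longrightarrow> a \<odot> x \<in> I"
    and Cv_subset: "Cv \<subseteq> B"
    and finite_P: "finite P"
    and le_refl: "p \<in> P \<Longrightarrow> le p p"
    and le_trans: "le p q \<Longrightarrow> le q s \<Longrightarrow> le p s"
    and le_antisym: "p \<in> P \<Longrightarrow> q \<in> P \<Longrightarrow> le p q \<Longrightarrow> le q p \<Longrightarrow> p = q"
    and bt: "bt \<in> P" "p \<in> P \<Longrightarrow> le bt p"
    and e_Cv: "p \<in> P \<Longrightarrow> e p \<in> Cv" "p \<in> P \<Longrightarrow> lt (e p) = p" "p \<in> P \<Longrightarrow> rt (e p) = p"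
    and lt_P: "b \<in> Cv \<Longrightarrow> lt b \<in> P" and rt_P: "b \<in> Cv \<Longrightarrow> rt b \<in> P"
    and one_e: "\<one> = single R (e bt)"
    and Cv_mult: "b \<in> Cv \<Longrightarrow> c \<in> Cv \<Longrightarrow> single R b \<otimes> single R c = \<zero> \<or>
      (\<exists>d\<in>Cv. single R b \<otimes> single R c = single R d \<and> le (lt b) (lt d) \<and> le (rt c) (rt d))"
    and Cv_mult_linked: "b \<in> Cv \<Longrightarrow> c \<in> Cv \<Longrightarrow> rt b = lt c \<Longrightarrow>
      \<exists>d\<in>Cv. single R b \<otimes> single R c = single R d \<and> lt d = lt b \<and> rt d = rt c"
    and e_left: "p \<in> P \<Longrightarrow> b \<in> Cv \<Longrightarrow> le p (lt b) \<Longrightarrow> single R (e p) \<otimes> single R b = single R b"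
    and e_right: "p \<in> P \<Longrightarrow> b \<in> Cv \<Longrightarrow> le p (rt b) \<Longrightarrow> single R b \<otimes> single R (e p) = single R b"
    and e_join: "p \<in> P \<Longrightarrow> q \<in> P \<Longrightarrow>
      (\<exists>j\<in>P. single R (e p) \<otimes> single R (e q) = single R (e j) \<and>
        (\<forall>s\<in>P. le j s \<longleftrightarrow> le p s \<and> le q s)) \<or>
      single R (e p) \<otimes> single R (e q) = \<zero> \<and> \<not> (\<exists>s\<in>P. le p s \<and> le q s)"
    and Cv_inverse: "b \<in> Cv \<Longrightarrow> \<exists>c\<in>Cv. lt c = rt b \<and> rt c = lt b \<and>
      single R b \<otimes> single R c = single R (e (lt b)) \<and> single R c \<otimes> single R b = single R (e (rt b))"
    and f_upper: "p \<in> P \<Longrightarrow> \<exists>h\<in>fin_supp R (e ` {q \<in> P. le p q \<and> q \<noteq> p}). f p = single R (e p) \<oplus> h"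
    and f_sum: "p \<in> P \<Longrightarrow> (\<Oplus>q\<in>{q \<in> P. le p q}. f q) = single R (e p)"
    and ideal_I: "ideal I M"
    and I_basis: "v \<in> I \<Longrightarrow> v b \<noteq> \<zero>\<^bsub>R\<^esub> \<Longrightarrow> single R b \<in> I"
    and I_not_Cv: "b \<in> B \<Longrightarrow> b \<notin> Cv \<Longrightarrow> single R b \<in> I"

sublocale fibered_blocks \<subseteq> k_alg_ideal R M I
  by (intro k_alg_ideal.intro k_alg_axioms ideal_I k_alg_ideal_axioms.intro smult_I)

section \<open>Orthogonal idempotents and the components they cut out\<close>

context fibered_blocks
begin

abbreviation cov where "cov \<equiv> fin_supp R Cv"

definition Lk where "Lk p q = {b \<in> Cv. lt b = p \<and> rt b = q}"

definition Rs where "Rs = {p \<in> P. \<delta> (e p) \<notin> I}"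

definition linked where "linked = {(p, q). p \<in> P \<and> q \<in> P \<and> Lk p q \<noteq> {}}"

text \<open>Kept general in \<open>S\<close>: a linkage class gives its block idempotent,
  \<open>Rs\<close> the identity of the essential part, and \<open>P\<close> the identity of the
  whole algebra.\<close>

definition eps where "eps S = (\<Oplus>p\<in>S. f p)"

lemma Cv_closed [simp]: "b \<in> Cv \<Longrightarrow> \<delta> b \<in> carrier M"
  using single_closed Cv_subset by auto

lemma e_closed [simp]: "p \<in> P \<Longrightarrow> \<delta> (e p) \<in> carrier M"
  by (simp add: e_Cv)

lemma cov_submodule: "submodule cov R M"
  by (rule submodule_fin_supp[OF Cv_subset])

lemma cov_closed: "x \<in> cov \<Longrightarrow> x \<in> carrier M"
  using mod.submoduleE(1)[OF cov_submodule] by blast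

lemma single_cov: "b \<in> Cv \<Longrightarrow> \<delta> b \<in> cov"
  by (rule R.single_fin_supp)

lemma mult_fin_supp:
  assumes "S \<subseteq> B" "T \<subseteq> B" "U \<subseteq> B"
    and "\<And>b c. b \<in> S \<Longrightarrow> c \<in> T \<Longrightarrow> \<delta> b \<otimes> \<delta> c \<in> fin_supp R U"
    and "x \<in> fin_supp R S" "y \<in> fin_supp R T"
  shows "x \<otimes> y \<in> fin_supp R U"
proof -
  note U = submodule_fin_supp[OF assms(3)]
  note UE = mod.submoduleE[OF U]
  have z: "\<zero> \<in> fin_supp R U" by (simp add: zero_M R.zero_fin_supp)
  have y: "y \<in> carrier M" using mod.submoduleE(1)[OF submodule_fin_supp[OF assms(2)]] assms(6) by blast
  have 1: "\<delta> b \<otimes> y \<in> fin_supp R U" if b: "b \<in> S" for b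
    using assms(6,2)
  proof (induction rule: free_induct)
    case zero
    then show ?case using b assms(1) z single_closed by auto
  next
    case (add c d v)
    then show ?case using b assms(1,4) single_closed UE
      by (auto simp: r_distr smult_mult_right subset_iff)
  qed
  show ?thesis
    using assms(5,1)
  proof (induction rule: free_induct)
    case zero
    then show ?case using y z by simp
  next
    case (add c d v)
    then show ?case using y 1 UE by (auto simp: l_distr smult_mult_left)
  qed
qed

lemma single_mult_cov: "b \<in> Cv \<Longrightarrow> c \<in> Cv \<Longrightarrow> \<delta> b \<otimes> \<delta> c \<in> cov"
  using Cv_mult[of b c] single_cov R.zero_fin_supp by (auto simp: zero_M)

lemma cov_mult: "x \<in> cov \<Longrightarrow> y \<in> cov \<Longrightarrow> x \<otimes> y \<in> cov"
  using mult_fin_supp[OF Cv_subset Cv_subset Cv_subset single_mult_cov] .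

lemma f_cov: "p \<in> P \<Longrightarrow> f p \<in> cov"
proof -
  assume p: "p \<in> P"
  then obtain h where h: "h \<in> fin_supp R (e ` {q \<in> P. le p q \<and> q \<noteq> p})" "f p = \<delta> (e p) \<oplus> h"
    using f_upper by blast
  have "h \<in> cov" using h(1) fin_supp_mono[of "e ` {q \<in> P. le p q \<and> q \<noteq> p}" Cv R] e_Cv by auto
  then show ?thesis using h p mod.submoduleE(5)[OF cov_submodule] single_cov e_Cv by auto
qed

lemma f_closed [simp]: "p \<in> P \<Longrightarrow> f p \<in> carrier M"
  using f_cov cov_closed by blast

definition above where "above p = {q \<in> P. le p q \<and> q \<noteq> p}"

lemma above_P: "q \<in> above p \<Longrightarrow> q \<in> P" by (simp add: above_def)

lemma finite_above [simp]: "finite (above p)" by (simp add: above_def finite_P)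

lemma e_split:
  assumes "p \<in> P" shows "\<delta> (e p) = f p \<oplus> eps (above p)"
proof -
  have "{q \<in> P. le p q} = insert p (above p)" using assms le_refl by (auto simp: above_def)
  moreover have "(\<Oplus>q\<in>insert p (above p). f q) = f p \<oplus> eps (above p)"
    unfolding eps_def using assms by (subst finsum_insert) (auto simp: above_P, simp add: above_def)
  ultimately show ?thesis using f_sum[OF assms] by simp
qed

lemma eps_closed [simp]: "S \<subseteq> P \<Longrightarrow> eps S \<in> carrier M"
  unfolding eps_def by (rule finsum_closed) auto

lemma above_closed [simp]: "eps (above p) \<in> carrier M"
  by (rule eps_closed) (auto simp: above_def)

lemma eps_mult_right:
  assumes "S \<subseteq> P" "x \<in> carrier M"
  shows "eps S \<otimes> x = (\<Oplus>p\<in>S. f p \<otimes> x)"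
  unfolding eps_def using assms finite_subset[OF _ finite_P]
  by (intro finsum_ldistr) auto

lemma eps_mult_left:
  assumes "S \<subseteq> P" "x \<in> carrier M"
  shows "x \<otimes> eps S = (\<Oplus>p\<in>S. x \<otimes> f p)"
  unfolding eps_def using assms finite_subset[OF _ finite_P]
  by (intro finsum_rdistr) auto

lemma finsum_select:
  assumes "finite S" "g \<in> S \<rightarrow> carrier M"
  shows "(\<Oplus>s\<in>S. if Pr s then g s else \<zero>) = (\<Oplus>s\<in>{s \<in> S. Pr s}. g s)"
proof (rule sym, rule add.finprod_mono_neutral_cong_left)
qed (use assms in auto)

text \<open>Induction on the number of pairs strictly above \<open>p\<close>. Write
  \<open>f p\<close> as \<open>e p\<close> minus the sum of the \<open>f s\<close> with
  \<open>s\<close> strictly above \<open>p\<close>. By induction multiplication by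
  \<open>e q\<close> keeps the \<open>f s\<close> with \<open>q\<close> below \<open>s\<close> and
  kills the others. If \<open>q\<close> is below \<open>p\<close>, nothing is lost; otherwise what
  is subtracted equals the product of \<open>e p\<close> and \<open>e q\<close>, and zero
  remains.\<close>

lemma f_e:
  assumes "p \<in> P" "q \<in> P"
  shows "f p \<otimes> \<delta> (e q) = (if le q p then f p else \<zero>)"
    and "\<delta> (e q) \<otimes> f p = (if le q p then f p else \<zero>)"
proof -
  have "f p \<otimes> \<delta> (e q) = (if le q p then f p else \<zero>) \<and>
     \<delta> (e q) \<otimes> f p = (if le q p then f p else \<zero>)"
    using assms(1)
  proof (induction "card (above p)" arbitrary: p rule: less_induct)
    case less
    have IH: "f s \<otimes> \<delta> (e q) = (if le q s then f s else \<zero>)"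
      "\<delta> (e q) \<otimes> f s = (if le q s then f s else \<zero>)" if s: "s \<in> above p" for s
    proof -
      have "above s \<subset> above p"
        using s less.prems le_trans le_antisym unfolding above_def by blast
      then have "card (above s) < card (above p)" by (intro psubset_card_mono) auto
      then show "f s \<otimes> \<delta> (e q) = (if le q s then f s else \<zero>)"
        "\<delta> (e q) \<otimes> f s = (if le q s then f s else \<zero>)"
        using less.hyps above_P[OF s] by blast+
    qed
    let ?U = "{s \<in> above p. le q s}"
    have sub: "above p \<subseteq> P" by (auto simp: above_def)
    have A: "eps (above p) \<otimes> \<delta> (e q) = eps ?U" "\<delta> (e q) \<otimes> eps (above p) = eps ?U"
      using finsum_select[of "above p" f "le q"] sub
      unfolding eps_mult_right[OF sub e_closed[OF assms(2)]] eps_mult_left[OF sub e_closed[OF assms(2)]]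
      by (auto simp: eps_def IH above_P subset_iff assms(2) cong: finsum_cong)
    have f: "f p = \<delta> (e p) \<ominus> eps (above p)"
      using e_split[OF less.prems] less.prems by (simp add: a_minus_def a_assoc r_neg)
    have F: "f p \<otimes> \<delta> (e q) = \<delta> (e p) \<otimes> \<delta> (e q) \<ominus> eps ?U"
      "\<delta> (e q) \<otimes> f p = \<delta> (e q) \<otimes> \<delta> (e p) \<ominus> eps ?U"
      using less.prems assms(2) A unfolding f
      by (simp_all add: a_minus_def l_distr r_distr l_minus r_minus)
    show ?case
    proof (cases "le q p")
      case True
      then have "?U = above p" using le_trans by (auto simp: above_def)
      moreover have "\<delta> (e p) \<otimes> \<delta> (e q) = \<delta> (e p)" "\<delta> (e q) \<otimes> \<delta> (e p) = \<delta> (e p)"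
        using True less.prems assms(2) e_left[of q "e p"] e_right[of q "e p"] by (simp_all add: e_Cv)
      ultimately show ?thesis using F f True by simp
    next
      case False
      \<comment> \<open>By \<open>e_join\<close> the product is zero or the \<open>e\<close> of the
        join, hence in both cases the sum of the \<open>f s\<close> over all common upper bounds
        \<open>s\<close> of \<open>p\<close> and \<open>q\<close>. These lie strictly above
        \<open>p\<close> because \<open>q\<close> is not below \<open>p\<close>. Stated for an
        arbitrary \<open>x\<close> so as to serve both orders of multiplication.\<close>
      have *: "x = eps ?U" if
        x: "(\<exists>j\<in>P. x = \<delta> (e j) \<and> (\<forall>s\<in>P. le j s \<longleftrightarrow> le p s \<and> le q s)) \<or>
          x = \<zero> \<and> \<not> (\<exists>s\<in>P. le p s \<and> le q s)" for x
        using x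
      proof
        assume "\<exists>j\<in>P. x = \<delta> (e j) \<and> (\<forall>s\<in>P. le j s \<longleftrightarrow> le p s \<and> le q s)"
        then obtain j where j: "j \<in> P" "x = \<delta> (e j)" "\<forall>s\<in>P. le j s \<longleftrightarrow> le p s \<and> le q s" by blast
        have "?U = {s \<in> P. le j s}" using j(3) False by (auto simp: above_def)
        then show ?thesis using f_sum[OF j(1)] j(2) by (simp add: eps_def)
      next
        assume "x = \<zero> \<and> \<not> (\<exists>s\<in>P. le p s \<and> le q s)"
        moreover from this have U: "?U = {}" by (auto simp: above_def)
        ultimately show ?thesis unfolding U by (simp add: eps_def)
      qed
      have "\<delta> (e p) \<otimes> \<delta> (e q) = eps ?U" "\<delta> (e q) \<otimes> \<delta> (e p) = eps ?U"
        using *[OF e_join[OF less.prems assms(2)]] *[of "\<delta> (e q) \<otimes> \<delta> (e p)"]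
          e_join[OF assms(2) less.prems] by blast+
      moreover have "eps ?U \<in> carrier M" by (rule eps_closed) (use sub in auto)
      ultimately show ?thesis using F False by (simp add: a_minus_def r_neg)
    qed
  qed
  then show "f p \<otimes> \<delta> (e q) = (if le q p then f p else \<zero>)"
    "\<delta> (e q) \<otimes> f p = (if le q p then f p else \<zero>)" by auto
qed

text \<open>For distinct \<open>s\<close> and \<open>t\<close> the product does not change when
  \<open>e t\<close> or \<open>e s\<close> is inserted between the factors. By antisymmetry one of
  the relations between \<open>s\<close> and \<open>t\<close> fails, and then the corresponding
  insertion gives zero by \<open>f_e\<close>. Idempotency follows by expanding the
  \<open>e p\<close> in \<open>f p \<otimes> e p\<close> with \<open>e_split\<close>.\<close>

lemma f_f:
  assumes "p \<in> P" "q \<in> P"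
  shows "f p \<otimes> f q = (if p = q then f p else \<zero>)"
proof -
  have ortho: "f s \<otimes> f t = \<zero>" if "s \<in> P" "t \<in> P" "s \<noteq> t" for s t
  proof -
    have "f s \<otimes> f t = (f s \<otimes> \<delta> (e t)) \<otimes> f t"
      using f_e[of t t] that le_refl by (simp add: m_assoc)
    moreover have "f s \<otimes> f t = f s \<otimes> (\<delta> (e s) \<otimes> f t)"
      using f_e[of s s] that le_refl by (simp flip: m_assoc)
    moreover have "\<not> le t s \<or> \<not> le s t" using le_antisym that by blast
    ultimately show ?thesis
      using f_e(1)[OF that(1,2)] f_e(2)[OF that(2,1)] that by (metis f_closed l_null r_null)
  qed
  moreover have "f p \<otimes> f p = f p"
  proof -
    have "f p = f p \<otimes> \<delta> (e p)" using f_e assms(1) le_refl by simp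
    also have "\<dots> = f p \<otimes> f p \<oplus> f p \<otimes> eps (above p)"
      using e_split assms(1) by (simp add: r_distr)
    also have "f p \<otimes> eps (above p) = \<zero>"
    proof -
      have "f p \<otimes> eps (above p) = (\<Oplus>s\<in>above p. f p \<otimes> f s)"
        using assms(1) by (intro eps_mult_left) (auto simp: above_def)
      also have "\<dots> = \<zero>"
        by (rule add.finprod_one_eqI) (use ortho assms(1) in \<open>auto simp: above_def\<close>)
      finally show ?thesis .
    qed
    finally show ?thesis using assms(1) by (metis f_closed m_closed r_zero)
  qed
  ultimately show ?thesis using assms by auto
qed

text \<open>The class \<open>b\<close> absorbs \<open>e (lt b)\<close> on its left, and
  \<open>f p\<close> kills that idempotent unless \<open>lt b\<close> is below
  \<open>p\<close>.\<close>

lemma f_single_zero: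
  assumes "p \<in> P" "b \<in> Cv" "\<not> le (lt b) p"
  shows "f p \<otimes> \<delta> b = \<zero>"
proof -
  have "f p \<otimes> \<delta> b = (f p \<otimes> \<delta> (e (lt b))) \<otimes> \<delta> b"
    using assms e_left[of "lt b" b] lt_P le_refl by (simp add: m_assoc)
  then show ?thesis using assms f_e lt_P by simp
qed

lemma single_f_zero:
  assumes "p \<in> P" "b \<in> Cv" "\<not> le (rt b) p"
  shows "\<delta> b \<otimes> f p = \<zero>"
proof -
  have "\<delta> b \<otimes> f p = \<delta> b \<otimes> (\<delta> (e (rt b)) \<otimes> f p)"
    using assms e_right[of "rt b" b] rt_P le_refl by (simp flip: m_assoc)
  then show ?thesis using assms f_e rt_P by simp
qed

lemma Lk_subset: "Lk p q \<subseteq> Cv" by (auto simp: Lk_def)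

lemma Lk_subset_B: "Lk p q \<subseteq> B" using Lk_subset Cv_subset by blast

lemma fin_supp_Lk_cov: "z \<in> fin_supp R (Lk p q) \<Longrightarrow> z \<in> cov"
  using fin_supp_mono[OF Lk_subset] by blast

text \<open>Insert \<open>e q\<close> on the right of \<open>b\<close> and split it into
  \<open>f q\<close> and the \<open>f s\<close> with \<open>s\<close> strictly above
  \<open>q\<close>. The latter contribute nothing: \<open>b\<close> times \<open>e s\<close> is zero
  or a class whose left pair is strictly above \<open>p\<close>, and \<open>f p\<close> kills such a
  class.\<close>

lemma f_single_absorb:
  assumes p: "p \<in> P" and b: "b \<in> Lk p q"
  shows "f p \<otimes> \<delta> b \<otimes> f q = f p \<otimes> \<delta> b"
proof -
  have bC: "b \<in> Cv" and l: "lt b = p" and r: "rt b = q" and q: "q \<in> P"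
    using b rt_P by (auto simp: Lk_def)
  have zero: "f p \<otimes> \<delta> b \<otimes> f s = \<zero>" if s: "s \<in> above q" for s
  proof -
    have sP: "s \<in> P" and qs: "le q s" "q \<noteq> s" using s by (auto simp: above_def)
    have "f p \<otimes> (\<delta> b \<otimes> \<delta> (e s)) = \<zero>"
      using Cv_mult[OF bC e_Cv(1)[OF sP]]
    proof
      assume "\<exists>d\<in>Cv. \<delta> b \<otimes> \<delta> (e s) = \<delta> d \<and> le (lt b) (lt d) \<and> le (rt (e s)) (rt d)"
      then obtain d where d: "d \<in> Cv" "\<delta> b \<otimes> \<delta> (e s) = \<delta> d" "le p (lt d)"
        using l by auto
      show ?thesis
      proof (cases "le (lt d) p")
        case True
        \<comment> \<open>The left pair cannot stay equal to \<open>p\<close>: multiplying by the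
          inverse \<open>c\<close> of \<open>b\<close> would turn \<open>d\<close> into
          \<open>e s\<close>, whose left pair is \<open>s\<close>, while a linked product starting
          with \<open>c\<close> has left pair \<open>q\<close>.\<close>
        then have ltd: "lt d = p" using le_antisym[OF lt_P[OF d(1)] p] d(3) by simp
        obtain c where c: "c \<in> Cv" "lt c = q" "rt c = p" "\<delta> c \<otimes> \<delta> b = \<delta> (e q)"
          using Cv_inverse[OF bC] l r by auto
        obtain x where x: "\<delta> c \<otimes> \<delta> d = \<delta> x" "lt x = q"
          using Cv_mult_linked[OF c(1) d(1)] c ltd by auto
        have "\<delta> c \<otimes> \<delta> d = \<delta> (e q) \<otimes> \<delta> (e s)"
          unfolding d(2)[symmetric] c(4)[symmetric] using c(1) bC sP by (simp add: m_assoc)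
        also have "\<dots> = \<delta> (e s)" using e_left[OF q e_Cv(1)[OF sP]] e_Cv(2)[OF sP] qs(1) by simp
        finally have "\<delta> x = \<delta> (e s)" using x(1) by simp
        moreover have "x \<noteq> e s" using x(2) e_Cv(2)[OF sP] qs(2) by auto
        \<comment> \<open>Distinct indices with the same basis vector exist only over the zero ring,
          where everything claimed is trivial.\<close>
        ultimately have "\<one>\<^bsub>R\<^esub> = \<zero>\<^bsub>R\<^esub>" unfolding single_def by metis
        then have "\<delta> d = \<zero>" by (auto simp: single_def zero_M)
        then show ?thesis using d(2) p by simp
      next
        case False
        then show ?thesis using d f_single_zero p by simp
      qed
    qed (use p in simp)
    moreover have "f p \<otimes> \<delta> b \<otimes> f s = f p \<otimes> (\<delta> b \<otimes> \<delta> (e s)) \<otimes> f s"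
      using p bC sP f_e[of s s] le_refl by (simp add: m_assoc)
    ultimately show ?thesis using sP by simp
  qed
  have "f p \<otimes> \<delta> b = f p \<otimes> \<delta> b \<otimes> \<delta> (e q)"
    using e_right[of q b] q bC r p le_refl by (simp add: m_assoc)
  also have "\<dots> = f p \<otimes> \<delta> b \<otimes> f q \<oplus> f p \<otimes> \<delta> b \<otimes> eps (above q)"
    using e_split[OF q] p bC q by (simp add: r_distr)
  also have "f p \<otimes> \<delta> b \<otimes> eps (above q) = \<zero>"
    using p bC zero by (subst eps_mult_left) (auto simp: above_P intro: add.finprod_one_eqI)
  finally show ?thesis using p bC q by (metis Cv_closed f_closed m_closed r_zero)
qed

lemma f_absorb:
  assumes p: "p \<in> P" "q \<in> P" and z: "z \<in> fin_supp R (Lk p q)"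
  shows "f p \<otimes> z \<otimes> f q = f p \<otimes> z"
  using z Lk_subset_B
proof (induction rule: free_induct)
  case (add c b v)
  then show ?case using p f_single_absorb[OF p(1) add(2)]
    by (simp add: r_distr l_distr smult_mult_left smult_mult_right)
qed (use p in simp)

text \<open>Between \<open>f p\<close> and \<open>f q\<close> the class \<open>b\<close> may be
  replaced by \<open>e p\<close> times \<open>b\<close> times \<open>e q\<close>. This is zero or a
  class \<open>d\<close> with \<open>p\<close> below \<open>lt d\<close> and \<open>q\<close> below
  \<open>rt d\<close>; unless both are equalities, one of the outer factors kills
  \<open>d\<close>.\<close>

lemma f_single_f:
  assumes p: "p \<in> P" "q \<in> P" and b: "b \<in> Cv"
  shows "\<exists>z\<in>fin_supp R (Lk p q). f p \<otimes> \<delta> b \<otimes> f q = f p \<otimes> z \<otimes> f q"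
proof -
  have *: "f p \<otimes> \<delta> b \<otimes> f q = f p \<otimes> (\<delta> (e p) \<otimes> \<delta> b \<otimes> \<delta> (e q)) \<otimes> f q"
  proof -
    have "f p \<otimes> \<delta> b \<otimes> f q = (f p \<otimes> \<delta> (e p)) \<otimes> \<delta> b \<otimes> (\<delta> (e q) \<otimes> f q)"
      using p b f_e[of p p] f_e[of q q] le_refl by simp
    also have "\<dots> = f p \<otimes> (\<delta> (e p) \<otimes> \<delta> b \<otimes> \<delta> (e q)) \<otimes> f q"
      using p b by (simp add: m_assoc)
    finally show ?thesis .
  qed
  have z: "\<zero> \<in> fin_supp R (Lk p q)" by (simp add: zero_M R.zero_fin_supp)
  have final: "\<exists>z\<in>fin_supp R (Lk p q). f p \<otimes> \<delta> d \<otimes> f q = f p \<otimes> z \<otimes> f q"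
    if d: "d \<in> Cv" "le p (lt d)" "le q (rt d)" for d
  proof (cases "le (lt d) p \<and> le (rt d) q")
    case True
    then have "d \<in> Lk p q" using d le_antisym p lt_P rt_P by (auto simp: Lk_def)
    then show ?thesis by (intro bexI[of _ "\<delta> d"] R.single_fin_supp refl)
  next
    case False
    then have "f p \<otimes> \<delta> d \<otimes> f q = \<zero>"
      using f_single_zero[OF p(1) d(1)] single_f_zero[OF p(2) d(1)] p d
      by (metis Cv_closed f_closed l_null m_assoc r_null)
    then show ?thesis using z p by (intro bexI[of _ \<zero>]) auto
  qed
  have zero: "\<exists>z\<in>fin_supp R (Lk p q). f p \<otimes> \<zero> \<otimes> f q = f p \<otimes> z \<otimes> f q"
    by (intro bexI[of _ \<zero>] z refl)
  from Cv_mult[OF e_Cv(1)[OF p(1)] b] show ?thesis unfolding *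
  proof
    assume "\<exists>d\<in>Cv. \<delta> (e p) \<otimes> \<delta> b = \<delta> d \<and> le (lt (e p)) (lt d) \<and> le (rt b) (rt d)"
    then obtain c where c: "c \<in> Cv" "\<delta> (e p) \<otimes> \<delta> b = \<delta> c" "le p (lt c)" using p e_Cv by auto
    from Cv_mult[OF c(1) e_Cv(1)[OF p(2)]]
    show "\<exists>z\<in>fin_supp R (Lk p q). f p \<otimes> (\<delta> (e p) \<otimes> \<delta> b \<otimes> \<delta> (e q)) \<otimes> f q = f p \<otimes> z \<otimes> f q"
      unfolding c(2)
    proof
      assume "\<exists>d\<in>Cv. \<delta> c \<otimes> \<delta> (e q) = \<delta> d \<and> le (lt c) (lt d) \<and> le (rt (e q)) (rt d)"
      then obtain d where d: "d \<in> Cv" "\<delta> c \<otimes> \<delta> (e q) = \<delta> d" "le (lt c) (lt d)" "le q (rt d)"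
        using p e_Cv by auto
      show "\<exists>z\<in>fin_supp R (Lk p q). f p \<otimes> (\<delta> c \<otimes> \<delta> (e q)) \<otimes> f q = f p \<otimes> z \<otimes> f q"
        unfolding d(2) using final[OF d(1) le_trans[OF c(3) d(3)] d(4)] .
    qed (simp only: zero)
  qed (use zero p in simp)
qed

lemma f_cov_f:
  assumes p: "p \<in> P" "q \<in> P" and x: "x \<in> cov"
  shows "\<exists>z\<in>fin_supp R (Lk p q). f p \<otimes> x \<otimes> f q = f p \<otimes> z"
proof -
  have "\<exists>z\<in>fin_supp R (Lk p q). f p \<otimes> x \<otimes> f q = f p \<otimes> z \<otimes> f q"
    using x Cv_subset
  proof (induction rule: free_induct)
    case zero
    have "\<zero> \<in> fin_supp R (Lk p q)" by (simp add: zero_M R.zero_fin_supp)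
    then show ?case by (intro bexI[of _ \<zero>] refl)
  next
    case (add c b v)
    then obtain z w where zw: "z \<in> fin_supp R (Lk p q)" "f p \<otimes> v \<otimes> f q = f p \<otimes> z \<otimes> f q"
      "w \<in> fin_supp R (Lk p q)" "f p \<otimes> \<delta> b \<otimes> f q = f p \<otimes> w \<otimes> f q"
      using f_single_f[OF p add(2)] by blast
    note L = mod.submoduleE[OF submodule_fin_supp[OF Lk_subset_B]]
    have "z \<in> carrier M" "w \<in> carrier M" using zw L(1) by auto
    then have "f p \<otimes> (c \<odot> \<delta> b \<oplus> v) \<otimes> f q = f p \<otimes> (c \<odot> w \<oplus> z) \<otimes> f q"
      using add p zw by (simp add: r_distr l_distr smult_mult_left smult_mult_right)
    moreover have "c \<odot> w \<oplus> z \<in> fin_supp R (Lk p q)" using L(5)[OF L(4)[OF add(1) zw(3)] zw(1)] .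
    ultimately show ?case by (intro bexI[of _ "c \<odot> w \<oplus> z"])
  qed
  then show ?thesis using f_absorb[OF p] by auto
qed

text \<open>Besides \<open>e p\<close>, which fixes \<open>z\<close>, the element \<open>f p\<close>
  only involves \<open>e s\<close> with \<open>s\<close> strictly above \<open>p\<close>. These
  produce classes with left pair strictly above \<open>p\<close>, hence outside
  \<open>Lk p q\<close>. So \<open>z\<close> can be recovered from \<open>f p \<otimes> z\<close>,
  and with \<open>f_cov_f\<close> the component cut out by \<open>f p\<close> and \<open>f q\<close>
  is a copy of the free module on \<open>Lk p q\<close>.\<close>

lemma f_mult_coeff:
  assumes p: "p \<in> P" and z: "z \<in> fin_supp R (Lk p q)" and b: "b \<in> Lk p q"
  shows "(f p \<otimes> z) b = z b"
proof -
  obtain h where h: "h \<in> fin_supp R (e ` above p)" "f p = \<delta> (e p) \<oplus> h"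
    using f_upper[OF p] unfolding above_def by blast
  have eB: "e ` above p \<subseteq> B" using e_Cv Cv_subset by (auto simp: above_def)
  have zM: "z \<in> carrier M" using fin_supp_Lk_cov[OF z] cov_closed by blast
  have hM: "h \<in> carrier M" using h(1) fin_supp_mono[OF eB] by (auto simp: carrier_M)
  have ez: "\<delta> (e p) \<otimes> z = z"
    using z Lk_subset_B
  proof (induction rule: free_induct)
    case (add c d v)
    moreover have "\<delta> (e p) \<otimes> \<delta> d = \<delta> d" using add(2) p le_refl by (intro e_left) (auto simp: Lk_def)
    ultimately show ?case using p by (simp add: r_distr smult_mult_right)
  qed (use p in simp)
  have "h \<otimes> z \<in> fin_supp R {d \<in> Cv. lt d \<noteq> p}"
  proof (rule mult_fin_supp[OF eB Lk_subset_B _ _ h(1) z])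
    fix c d assume "c \<in> e ` above p" and d: "d \<in> Lk p q"
    then obtain s where s: "s \<in> P" "le p s" "s \<noteq> p" "c = e s" by (auto simp: above_def)
    have "d \<in> Cv" using d by (simp add: Lk_def)
    from Cv_mult[OF e_Cv(1)[OF s(1)] this]
    show "\<delta> c \<otimes> \<delta> d \<in> fin_supp R {d \<in> Cv. lt d \<noteq> p}"
    proof
      assume "\<exists>x\<in>Cv. \<delta> (e s) \<otimes> \<delta> d = \<delta> x \<and> le (lt (e s)) (lt x) \<and> le (rt d) (rt x)"
      then obtain x where x: "x \<in> Cv" "\<delta> c \<otimes> \<delta> d = \<delta> x" "le s (lt x)" using s e_Cv by auto
      then have "lt x \<noteq> p" using le_antisym[OF p s(1)] s by auto
      then have "x \<in> {d \<in> Cv. lt d \<noteq> p}" using x by simp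
      from R.single_fin_supp[OF this] show ?thesis unfolding x(2) .
    qed (use s in \<open>simp add: zero_M R.zero_fin_supp\<close>)
  qed (use Cv_subset in blast)
  then have "(h \<otimes> z) b = \<zero>\<^bsub>R\<^esub>" using b fin_suppD(3) by (fastforce simp: Lk_def)
  moreover have "f p \<otimes> z = z \<oplus> h \<otimes> z" using h(2) p hM zM ez by (simp add: l_distr)
  ultimately show ?thesis using carrier_apply[OF zM] by (simp add: add_M)
qed

end

section \<open>Linkage classes, block idempotents and the intersection with the ideal\<close>

section \<open>Linkage blocks\<close>

context fibered_blocks
begin

lemma Lk_sym: "Lk p q \<noteq> {} \<Longrightarrow> Lk q p \<noteq> {}"
  using Cv_inverse by (fastforce simp: Lk_def)

lemma equiv_linked: "equiv P linked"
proof (rule equivI)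
  show "linked \<subseteq> P \<times> P" by (auto simp: linked_def)
  show "refl_on P linked"
    unfolding refl_on_def linked_def Lk_def using e_Cv by fastforce
  show "sym linked" using Lk_sym by (auto simp: linked_def sym_def)
  show "trans linked"
  proof (rule transI)
    fix p q s assume "(p, q) \<in> linked" "(q, s) \<in> linked"
    then obtain b c where "p \<in> P" "s \<in> P" "b \<in> Lk p q" "c \<in> Lk q s" by (auto simp: linked_def)
    then show "(p, s) \<in> linked"
      using Cv_mult_linked[of b c] by (auto simp: linked_def Lk_def)
  qed
qed

text \<open>A linking class times its inverse is \<open>e p\<close>, so an ideal that contains the
  one contains the other.\<close>

lemma Lk_in_I:
  assumes "b \<in> Lk p q" "\<delta> b \<in> I"
  shows "\<delta> (e p) \<in> I"
proof -
  obtain c where "c \<in> Cv" "\<delta> b \<otimes> \<delta> c = \<delta> (e p)"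
    using Cv_inverse[of b] assms(1) by (auto simp: Lk_def)
  then show ?thesis using I_r_closed[OF assms(2), of "\<delta> c"] by simp
qed

text \<open>For a class \<open>b\<close> linking \<open>p\<close> to \<open>q\<close>, the equation
  of \<open>b\<close> with \<open>b\<close> times \<open>e q\<close> carries \<open>e q\<close> in
  the ideal over to \<open>b\<close>, and from there to \<open>e p\<close>.\<close>

lemma Rs_linked:
  assumes "p \<in> Rs" "(p, q) \<in> linked"
  shows "q \<in> Rs"
proof (rule ccontr)
  obtain b where b: "b \<in> Lk p q" "q \<in> P" using assms(2) by (auto simp: linked_def)
  then have bC: "b \<in> Cv" by (simp add: Lk_def)
  assume "q \<notin> Rs"
  then have "\<delta> (e q) \<in> I" using b(2) by (simp add: Rs_def)
  then have "\<delta> b \<otimes> \<delta> (e q) \<in> I" using bC by (intro I_l_closed) auto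
  moreover have "\<delta> b \<otimes> \<delta> (e q) = \<delta> b" using b le_refl by (intro e_right) (auto simp: Lk_def)
  ultimately show False using Lk_in_I[OF b(1)] assms(1) by (simp add: Rs_def)
qed

text \<open>The unions of linkage classes. \<open>Rs\<close>, its complement and every single class
  are of this kind, so the block decomposition is proved once for all of them.\<close>

definition saturated where "saturated S \<longleftrightarrow> S \<subseteq> P \<and> (\<forall>p q. p \<in> S \<longrightarrow> (p, q) \<in> linked \<longrightarrow> q \<in> S)"

lemma saturated_Rs: "saturated Rs"
proof -
  have "Rs \<subseteq> P" by (auto simp: Rs_def)
  then show ?thesis unfolding saturated_def using Rs_linked by blast
qed

lemma linked_P: "(p, q) \<in> linked \<Longrightarrow> p \<in> P \<and> q \<in> P"
  by (auto simp: linked_def)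

lemma linked_sym: "(p, q) \<in> linked \<Longrightarrow> (q, p) \<in> linked"
  using equiv_linked by (meson equivE symE)

lemma linked_trans: "(p, q) \<in> linked \<Longrightarrow> (q, s) \<in> linked \<Longrightarrow> (p, s) \<in> linked"
  using equiv_linked by (meson equivE transE)

lemma linked_refl: "p \<in> P \<Longrightarrow> (p, p) \<in> linked"
  using equiv_linked by (meson equivE refl_onD)

lemma saturated_Diff: "saturated S \<Longrightarrow> saturated (P - S)"
  unfolding saturated_def using linked_sym linked_P by blast

lemma saturated_subset: "saturated S \<Longrightarrow> S \<subseteq> P"
  by (simp add: saturated_def)

lemma quotient_saturated:
  assumes "saturated S" "C \<in> S // linked"
  shows "saturated C" "C \<subseteq> S" "C \<noteq> {}"
proof -
  obtain p where p: "p \<in> S" "C = {q. (p, q) \<in> linked}"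
    using assms(2) by (auto simp: quotient_def)
  show "C \<subseteq> S" using p assms(1) unfolding saturated_def by blast
  show "saturated C" unfolding saturated_def p(2) using linked_P linked_trans by blast
  show "C \<noteq> {}" using p assms(1) linked_refl unfolding saturated_def by blast
qed

lemma quotient_disjoint:
  assumes "saturated S" "C \<in> S // linked" "D \<in> S // linked" "C \<noteq> D"
  shows "C \<inter> D = {}"
  using quotient_disj[OF equiv_linked, of C D] assms saturated_subset[OF assms(1)]
  by (auto simp: quotient_def)

lemma Union_saturated:
  assumes "saturated S" shows "\<Union> (S // linked) = S"
proof
  show "\<Union> (S // linked) \<subseteq> S" using quotient_saturated(2)[OF assms] by blast
  show "S \<subseteq> \<Union> (S // linked)"
  proof
    fix p assume p: "p \<in> S"
    then have "(p, p) \<in> linked"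
      using saturated_subset[OF assms] equiv_linked by (auto simp: equiv_def refl_on_def)
    then show "p \<in> \<Union> (S // linked)" using p by (auto simp: quotient_def)
  qed
qed

lemma finite_quotient': "saturated S \<Longrightarrow> finite (S // linked)"
  by (rule finite_subset[of _ "Pow P"])
    (use quotient_saturated(2) saturated_subset finite_P in \<open>blast+\<close>)

lemma eps_empty: "eps {} = \<zero>"
  by (simp add: eps_def)

text \<open>The trivial pair lies below everything and its \<open>e\<close> is the identity, so this
  is \<open>f_sum\<close> at the bottom.\<close>

lemma eps_P: "eps P = \<one>"
  using f_sum[OF bt(1)] bt(2) one_e by (simp add: eps_def cong: conj_cong)

lemma eps_cov: "S \<subseteq> P \<Longrightarrow> eps S \<in> cov"
  unfolding eps_def by (rule finsum_in_submodule[OF cov_submodule]) (use f_cov in auto)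

lemma eps_Un:
  assumes "S \<subseteq> P" "T \<subseteq> P" "S \<inter> T = {}"
  shows "eps (S \<union> T) = eps S \<oplus> eps T"
  unfolding eps_def using assms finite_subset[OF _ finite_P]
  by (intro finsum_Un_disjoint) auto

lemma eps_f:
  assumes "S \<subseteq> P" "p \<in> P"
  shows "eps S \<otimes> f p = (if p \<in> S then f p else \<zero>)"
proof -
  have "eps S \<otimes> f p = (\<Oplus>s\<in>S. if s = p then f s else \<zero>)"
    unfolding eps_mult_right[OF assms(1) f_closed[OF assms(2)]]
    using assms f_f by (intro finsum_cong') auto
  also have "\<dots> = (\<Oplus>s\<in>{s \<in> S. s = p}. f s)"
    using assms finite_subset[OF _ finite_P] by (intro finsum_select) auto
  also have "\<dots> = (if p \<in> S then f p else \<zero>)"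
  proof (cases "p \<in> S")
    case True
    then have E: "{s \<in> S. s = p} = {p}" by auto
    show ?thesis unfolding E using True assms by simp
  next
    case False
    then have E: "{s \<in> S. s = p} = {}" by auto
    show ?thesis unfolding E using False by simp
  qed
  finally show ?thesis .
qed

lemma eps_eps:
  assumes "S \<subseteq> P" "T \<subseteq> P"
  shows "eps S \<otimes> eps T = eps (S \<inter> T)"
proof -
  have "eps S \<otimes> eps T = (\<Oplus>p\<in>T. if p \<in> S then f p else \<zero>)"
    unfolding eps_mult_left[OF assms(2) eps_closed[OF assms(1)]]
    using assms eps_f by (intro finsum_cong') auto
  also have "\<dots> = (\<Oplus>p\<in>{p \<in> T. p \<in> S}. f p)"
    using assms finite_subset[OF _ finite_P] by (intro finsum_select) auto
  also have "{p \<in> T. p \<in> S} = S \<inter> T" by auto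
  finally show ?thesis by (simp add: eps_def)
qed

lemma eps_cov_eps_zero:
  assumes "S \<subseteq> P" "T \<subseteq> P" "x \<in> carrier M"
    and "\<And>p q. p \<in> S \<Longrightarrow> q \<in> T \<Longrightarrow> f p \<otimes> x \<otimes> f q = \<zero>"
  shows "eps S \<otimes> x \<otimes> eps T = \<zero>"
proof -
  have "eps S \<otimes> x \<otimes> eps T = (\<Oplus>q\<in>T. eps S \<otimes> x \<otimes> f q)"
    using assms by (intro eps_mult_left) auto
  also have "\<dots> = \<zero>"
  proof (rule add.finprod_one_eqI)
    fix q assume q: "q \<in> T"
    then have "eps S \<otimes> x \<otimes> f q = eps S \<otimes> (x \<otimes> f q)"
      using assms by (intro m_assoc) auto
    also have "\<dots> = (\<Oplus>p\<in>S. f p \<otimes> (x \<otimes> f q))"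
      using assms q by (intro eps_mult_right) auto
    also have "\<dots> = \<zero>"
    proof (rule add.finprod_one_eqI)
      fix p assume p: "p \<in> S"
      then have "f p \<otimes> (x \<otimes> f q) = f p \<otimes> x \<otimes> f q"
        using assms(1-3) q by (intro m_assoc[symmetric]) auto
      then show "f p \<otimes> (x \<otimes> f q) = \<zero>" using assms(4)[OF p q] by simp
    qed
    finally show "eps S \<otimes> x \<otimes> f q = \<zero>" .
  qed
  finally show ?thesis .
qed

definition blk where "blk C = eps C <# cov"

lemma blk_eq: "blk C = {eps C \<otimes> x | x. x \<in> cov}"
  by (auto simp: blk_def l_coset_def)

lemma eps_cov_iff:
  assumes "C \<subseteq> P"
  shows "y \<in> blk C \<longleftrightarrow> y \<in> cov \<and> eps C \<otimes> y = y"
proof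
  assume "y \<in> blk C"
  then obtain x where "x \<in> cov" "y = eps C \<otimes> x" by (auto simp: blk_eq)
  moreover from this have "eps C \<otimes> y = eps C \<otimes> eps C \<otimes> x"
    using assms cov_closed by (simp add: m_assoc)
  ultimately show "y \<in> cov \<and> eps C \<otimes> y = y"
    using assms eps_eps[of C C] cov_mult[OF eps_cov] by auto
next
  assume "y \<in> cov \<and> eps C \<otimes> y = y"
  then show "y \<in> blk C" unfolding blk_eq by (auto intro: exI[of _ y])
qed

lemma submodule_blk:
  assumes "C \<subseteq> P" shows "submodule (blk C) R M"
proof (rule mod.submoduleI)
  note L = mod.submoduleE[OF cov_submodule]
  have z: "\<zero> \<in> cov" by (simp add: zero_M R.zero_fin_supp)
  show "blk C \<subseteq> carrier M" using assms cov_closed by (auto simp: eps_cov_iff)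
  show "\<zero> \<in> blk C" using assms z by (simp add: eps_cov_iff)
  show "\<ominus> a \<in> blk C" if "a \<in> blk C" for a
    using that L(3) cov_closed assms by (auto simp: eps_cov_iff r_minus)
  show "a \<oplus> b \<in> blk C" if "a \<in> blk C" "b \<in> blk C" for a b
    using that L(5) cov_closed assms by (auto simp: eps_cov_iff r_distr)
  show "a \<odot> x \<in> blk C" if "a \<in> carrier R" "x \<in> blk C" for a x
    using that L(4) cov_closed assms by (auto simp: eps_cov_iff smult_mult_right)
qed

lemma eps_quotient_sum:
  assumes S: "saturated S"
  shows "(\<Oplus>C\<in>S // linked. eps C) = eps S"
proof -
  have "(\<Oplus>p\<in>\<Union> (S // linked). f p) = (\<Oplus>C\<in>S // linked. \<Oplus>p\<in>C. f p)"
    using add.finprod_Union_disjoint[of "S // linked" f] finite_quotient'[OF S]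
      quotient_saturated(2)[OF S] saturated_subset[OF S] quotient_disjoint[OF S]
      finite_subset[OF _ finite_P]
    by (auto simp: pairwise_def disjnt_def Pi_def subset_iff)
  then show ?thesis by (simp add: eps_def Union_saturated[OF S])
qed

text \<open>Distinct classes are disjoint, so their idempotents multiply to zero and
  \<open>eps C\<close> projects a sum of block elements to its component in \<open>C\<close>.
  Directness of the sum is an immediate consequence.\<close>

lemma eps_select:
  assumes S: "saturated S" and C: "C \<in> S // linked"
    and x: "\<And>D. D \<in> S // linked \<Longrightarrow> x D \<in> blk D"
  shows "eps C \<otimes> (\<Oplus>D\<in>S // linked. x D) = x C"
proof -
  have sub: "D \<subseteq> P" if "D \<in> S // linked" for D
    using quotient_saturated(2)[OF S that] saturated_subset[OF S] by blast
  have xM: "x D \<in> carrier M" if "D \<in> S // linked" for D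
    using x[OF that] sub[OF that] cov_closed by (simp add: eps_cov_iff)
  have "eps C \<otimes> (\<Oplus>D\<in>S // linked. x D) = (\<Oplus>D\<in>S // linked. eps C \<otimes> x D)"
    using xM sub[OF C] finite_quotient'[OF S] by (intro finsum_rdistr) auto
  also have "\<dots> = (\<Oplus>D\<in>S // linked. if C = D then x D else \<zero>)"
  proof (rule finsum_cong')
    fix D assume D: "D \<in> S // linked"
    have "eps C \<otimes> x D = eps (C \<inter> D) \<otimes> x D"
      using x[OF D] sub[OF D] sub[OF C] xM[OF D] eps_eps[of C D]
      by (metis eps_closed eps_cov_iff m_assoc)
    then show "eps C \<otimes> x D = (if C = D then x D else \<zero>)"
      using quotient_disjoint[OF S C D] x[OF D] sub[OF D] xM[OF D] eps_empty
      by (cases "C = D") (simp_all add: eps_cov_iff)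
  qed (use xM in auto)
  also have "\<dots> = x C"
    using add.finprod_singleton[OF C finite_quotient'[OF S], of x] xM by simp
  finally show ?thesis .
qed

lemma blk_direct:
  assumes S: "saturated S"
  shows "sum_is_direct R M (S // linked) blk"
  unfolding sum_is_direct_def
proof (intro conjI ballI)
  show "finite (S // linked)" by (rule finite_quotient'[OF S])
  show "submodule (blk C) R M" if "C \<in> S // linked" for C
    using submodule_blk quotient_saturated(2)[OF S that] saturated_subset[OF S] by blast
  show "inj_on (\<lambda>x. \<Oplus>j\<in>S // linked. x j) (\<Pi>\<^sub>E j\<in>S // linked. blk j)"
  proof (rule inj_onI)
    fix x y assume x: "x \<in> (\<Pi>\<^sub>E j\<in>S // linked. blk j)" and y: "y \<in> (\<Pi>\<^sub>E j\<in>S // linked. blk j)"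
      and eq: "(\<Oplus>j\<in>S // linked. x j) = (\<Oplus>j\<in>S // linked. y j)"
    show "x = y"
    proof (rule PiE_ext[OF x y])
      fix C assume C: "C \<in> S // linked"
      show "x C = y C"
        using eps_select[OF S C PiE_mem[OF x]] eps_select[OF S C PiE_mem[OF y]] eq by simp
    qed
  qed
qed

lemma sum_blk:
  assumes S: "saturated S"
  shows "sum_of_submodules M (S // linked) blk = blk S"
proof
  note SP = saturated_subset[OF S]
  have sub: "D \<subseteq> P" "D \<subseteq> S" if "D \<in> S // linked" for D
    using quotient_saturated(2)[OF S that] SP by auto
  have "blk D \<subseteq> blk S" if D: "D \<in> S // linked" for D
  proof
    fix y assume "y \<in> blk D"
    then have y: "y \<in> cov" "eps D \<otimes> y = y" using sub[OF D] by (auto simp: eps_cov_iff)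
    have "eps S \<otimes> y = (eps S \<otimes> eps D) \<otimes> y"
      using y sub[OF D] SP cov_closed by (simp add: m_assoc)
    also have "\<dots> = y" using eps_eps[of S D] sub[OF D] SP y by (simp add: Int_absorb1)
    finally show "y \<in> blk S" using y SP by (simp add: eps_cov_iff)
  qed
  then show "sum_of_submodules M (S // linked) blk \<subseteq> blk S"
    unfolding sum_of_submodules_def
    by (auto intro!: finsum_in_submodule[OF submodule_blk[OF SP]] dest: PiE_mem)
  show "blk S \<subseteq> sum_of_submodules M (S // linked) blk"
  proof
    fix y assume "y \<in> blk S"
    then have y: "y \<in> cov" "eps S \<otimes> y = y" using SP by (auto simp: eps_cov_iff)
    define x where "x = (\<lambda>C\<in>S // linked. eps C \<otimes> y)"
    have "x \<in> (\<Pi>\<^sub>E j\<in>S // linked. blk j)" using y by (auto simp: x_def blk_eq)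
    moreover have "(\<Oplus>C\<in>S // linked. x C) = (\<Oplus>C\<in>S // linked. eps C \<otimes> y)"
      using sub y cov_closed by (intro finsum_cong') (auto simp: x_def)
    moreover have "\<dots> = eps S \<otimes> y"
      unfolding eps_quotient_sum[OF S, symmetric]
      using sub y cov_closed finite_quotient'[OF S] by (intro finsum_ldistr[symmetric]) auto
    ultimately show "y \<in> sum_of_submodules M (S // linked) blk"
      unfolding sum_of_submodules_def using y(2) by (metis image_eqI)
  qed
qed

text \<open>Each \<open>f p\<close> absorbs \<open>e p\<close>, and for \<open>p\<close> outside
  \<open>Rs\<close> the latter lies in the ideal.\<close>

lemma eps_not_Rs: "S \<subseteq> P - Rs \<Longrightarrow> eps S \<in> I"
proof -
  assume S: "S \<subseteq> P - Rs"
  have sub: "submodule I R M"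
    by (rule mod.submoduleI) (auto simp: smult_I a_inv_closed a_closed zero_closed)
  show ?thesis unfolding eps_def
  proof (rule finsum_in_submodule[OF sub])
    fix p assume "p \<in> S"
    then have p: "p \<in> P" "\<delta> (e p) \<in> I" using S by (auto simp: Rs_def)
    then have "f p \<otimes> \<delta> (e p) \<in> I" by (intro I_l_closed) auto
    then show "f p \<in> I" using f_e(1)[OF p(1) p(1)] le_refl[OF p(1)] by simp
  qed
qed

text \<open>The product equals \<open>f p \<otimes> z\<close> with \<open>z\<close> supported on
  \<open>Lk p q\<close>, and it lies in the ideal. A nonzero coefficient of \<open>z\<close> is a
  coefficient of the product by \<open>f_mult_coeff\<close>, so \<open>I_basis\<close> puts a
  linking class into the ideal, and with it \<open>e p\<close>, against the choice of
  \<open>p\<close>.\<close>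

lemma f_ideal_f_zero:
  assumes p: "p \<in> Rs" and q: "q \<in> P" and x: "x \<in> cov" "x \<in> I"
  shows "f p \<otimes> x \<otimes> f q = \<zero>"
proof -
  have pP: "p \<in> P" using p by (simp add: Rs_def)
  obtain z where z: "z \<in> fin_supp R (Lk p q)" "f p \<otimes> x \<otimes> f q = f p \<otimes> z"
    using f_cov_f[OF pP q x(1)] by blast
  have "f p \<otimes> x \<otimes> f q \<in> I"
    using I_r_closed[OF I_l_closed[OF x(2) f_closed[OF pP]] f_closed[OF q]] .
  then have I: "f p \<otimes> z \<in> I" using z(2) by simp
  have "z b = \<zero>\<^bsub>R\<^esub>" for b
  proof (cases "b \<in> Lk p q")
    case True
    show ?thesis
    proof (rule ccontr)
      assume "z b \<noteq> \<zero>\<^bsub>R\<^esub>"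
      then have "\<delta> b \<in> I" using I_basis[OF I] f_mult_coeff[OF pP z(1) True] by simp
      then show False using Lk_in_I[OF True] p by (simp add: Rs_def)
    qed
  qed (rule fin_suppD(3)[OF z(1)])
  then have "z = \<zero>" by (simp add: zero_M fun_eq_iff)
  then show ?thesis using z(2) pP by simp
qed

lemma eps_Rs_ideal_zero:
  assumes x: "x \<in> cov" "x \<in> I"
  shows "eps Rs \<otimes> x = \<zero>"
proof -
  have xM: "x \<in> carrier M" using cov_closed[OF x(1)] .
  have "eps Rs \<otimes> x \<otimes> eps P = \<zero>"
    by (rule eps_cov_eps_zero) (use f_ideal_f_zero x xM in \<open>auto simp: Rs_def\<close>)
  then show ?thesis using xM saturated_subset[OF saturated_Rs] by (simp add: eps_P)
qed

lemma one_split: "\<one> = eps Rs \<oplus> eps (P - Rs)"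
  using eps_Un[of Rs "P - Rs"] saturated_subset[OF saturated_Rs] eps_P by (simp add: Un_absorb1)

text \<open>Split the identity into \<open>eps Rs\<close> and \<open>eps (P - Rs)\<close>: the first
  kills everything in the intersection, the second itself lies in the ideal.\<close>

lemma cov_Int_I: "cov \<inter> I = blk (P - Rs)"
proof
  show "cov \<inter> I \<subseteq> blk (P - Rs)"
  proof
    fix x assume x: "x \<in> cov \<inter> I"
    then have "x = (eps Rs \<oplus> eps (P - Rs)) \<otimes> x" using cov_closed by (simp flip: one_split)
    also have "\<dots> = eps (P - Rs) \<otimes> x"
      using x eps_Rs_ideal_zero cov_closed saturated_subset[OF saturated_Rs] by (simp add: l_distr)
    finally show "x \<in> blk (P - Rs)" using x by (auto simp: blk_eq)
  qed
  show "blk (P - Rs) \<subseteq> cov \<inter> I"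
    using cov_mult[OF eps_cov] I_r_closed[OF eps_not_Rs] cov_closed by (fastforce simp: blk_eq)
qed

text \<open>Every basis vector lies in one of the two summands by \<open>I_not_Cv\<close>; what
  remains is that the sum is a submodule.\<close>

lemma cov_plus_I: "set_add M cov I = carrier M"
proof
  show "set_add M cov I \<subseteq> carrier M" using cov_closed Icarr by (auto simp: set_add_def')
  have mem: "x \<oplus> y \<in> set_add M cov I" if "x \<in> cov" "y \<in> I" for x y
    using that by (auto simp: set_add_def')
  have sub: "submodule (set_add M cov I) R M"
  proof (rule mod.submoduleI)
    note L = mod.submoduleE[OF cov_submodule]
    have z: "\<zero> \<in> cov" by (simp add: zero_M R.zero_fin_supp)
    show "set_add M cov I \<subseteq> carrier M" by fact
    show "\<zero> \<in> set_add M cov I" using mem[OF z zero_closed] by simp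
    fix a assume "a \<in> set_add M cov I"
    then obtain x y where a: "x \<in> cov" "y \<in> I" "a = x \<oplus> y" by (auto simp: set_add_def')
    then have "\<ominus> a = \<ominus> x \<oplus> \<ominus> y" using cov_closed Icarr by (simp add: minus_add a_comm)
    then show "\<ominus> a \<in> set_add M cov I" using mem[OF L(3)[OF a(1)] a_inv_closed[OF a(2)]] by simp
    show "c \<odot> a \<in> set_add M cov I" if c: "c \<in> carrier R" for c
    proof -
      have "c \<odot> a = c \<odot> x \<oplus> c \<odot> y" using a c cov_closed Icarr by (simp add: mod.smult_r_distr)
      then show ?thesis using mem[OF L(4)[OF c a(1)] smult_I[OF c a(2)]] by simp
    qed
    fix b assume "b \<in> set_add M cov I"
    then obtain u v where b: "u \<in> cov" "v \<in> I" "b = u \<oplus> v" by (auto simp: set_add_def')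
    have "a \<oplus> b = (x \<oplus> u) \<oplus> (y \<oplus> v)" using a b cov_closed Icarr by (simp add: a_ac)
    then show "a \<oplus> b \<in> set_add M cov I" using mem[OF L(5)[OF a(1) b(1)] a_closed[OF a(2) b(2)]] by simp
  qed
  have "\<delta> b \<in> set_add M cov I" if b: "b \<in> B" for b
  proof (cases "b \<in> Cv")
    case True
    then show ?thesis using mem[OF single_cov[OF True] zero_closed] by simp
  next
    case False
    have z: "\<zero> \<in> cov" by (simp add: zero_M R.zero_fin_supp)
    show ?thesis using mem[OF z I_not_Cv[OF b False]] single_closed[OF b] by simp
  qed
  then show "carrier M \<subseteq> set_add M cov I"
    unfolding carrier_M by (intro fin_supp_subset_submodule[OF sub]) auto
qed

end

section \<open>Essential blocks\<close>

lemma (in abelian_monoid) finsum_cartesian: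
  assumes "finite S" "finite T" "\<And>i j. i \<in> S \<Longrightarrow> j \<in> T \<Longrightarrow> g (i, j) \<in> carrier G"
  shows "(\<Oplus>p\<in>S \<times> T. g p) = (\<Oplus>i\<in>S. \<Oplus>j\<in>T. g (i, j))"
proof -
  have "S \<times> T = (\<Union>i\<in>S. Pair i ` T)" by auto
  then have "(\<Oplus>p\<in>S \<times> T. g p) = (\<Oplus>i\<in>S. \<Oplus>p\<in>Pair i ` T. g p)"
    using assms by (auto intro!: add.finprod_UN_disjoint simp: pairwise_def disjnt_def)
  also have "\<dots> = (\<Oplus>i\<in>S. \<Oplus>j\<in>T. g (i, j))"
  proof (rule finsum_cong')
    fix i assume "i \<in> S"
    then show "(\<Oplus>p\<in>Pair i ` T. g p) = (\<Oplus>j\<in>T. g (i, j))"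
      using assms by (intro finsum_reindex) (auto simp: inj_on_def)
  qed (use assms in auto)
  finally show ?thesis .
qed

lemma (in abelian_group) add_minus_cancel:
  "a \<in> carrier G \<Longrightarrow> b \<in> carrier G \<Longrightarrow> (a \<oplus> b) \<ominus> b = a"
  by (simp add: a_minus_def a_assoc r_neg)

lemma (in abelian_group) minus_eq_zero_imp_eq:
  assumes "a \<in> carrier G" "b \<in> carrier G" "a \<ominus> b = \<zero>"
  shows "a = b"
proof -
  have "a \<ominus> b \<oplus> b = a" using assms(1,2) by (simp add: a_minus_def a_assoc l_neg)
  then show ?thesis using assms by simp
qed

context fibered_blocks
begin

text \<open>An element of the kernel is fixed by \<open>eps Rs\<close> and also killed by it, hence
  zero; surjectivity holds because \<open>x\<close> and \<open>eps Rs \<otimes> x\<close> agree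
  modulo the ideal. Only left multiplication by \<open>eps Rs\<close> is controlled directly. That
  it is a right identity of the essential part as well comes out of
  \<open>k_algebra_iso_transport\<close>, from injectivity.\<close>

lemma essential_iso:
  "k_algebra_iso R (M\<lparr>carrier := blk Rs, one := eps Rs\<rparr>) Quo (\<lambda>x. I +> x)"
proof -
  note RsP = saturated_subset[OF saturated_Rs]
  define N where "N = M\<lparr>carrier := blk Rs, one := eps Rs\<rparr>"
  have N_sel: "carrier N = blk Rs" "monoid.mult N = monoid.mult M" "ring.add N = ring.add M"
    "ring.zero N = \<zero>" "monoid.one N = eps Rs" "smult N = smult M"
    by (simp_all add: N_def)
  have iff: "y \<in> blk Rs \<longleftrightarrow> y \<in> cov \<and> eps Rs \<otimes> y = y" for y by (rule eps_cov_iff[OF RsP])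
  have M: "y \<in> blk Rs \<Longrightarrow> y \<in> carrier M" for y using iff cov_closed by blast
  note L = mod.submoduleE[OF submodule_blk[OF RsP]]
  \<comment> \<open>The complement of \<open>eps Rs\<close> in the identity is
    \<open>eps (P - Rs)\<close>, an element of the ideal.\<close>
  have inI: "x \<ominus> eps Rs \<otimes> x \<in> I" if "x \<in> carrier M" for x
  proof -
    have "x = (eps Rs \<oplus> eps (P - Rs)) \<otimes> x" using that by (simp flip: one_split)
    also have "\<dots> = eps (P - Rs) \<otimes> x \<oplus> eps Rs \<otimes> x" using that RsP by (simp add: l_distr a_comm)
    finally have eq: "x = eps (P - Rs) \<otimes> x \<oplus> eps Rs \<otimes> x" .
    have "(eps (P - Rs) \<otimes> x \<oplus> eps Rs \<otimes> x) \<ominus> eps Rs \<otimes> x = eps (P - Rs) \<otimes> x"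
      using that RsP by (intro add_minus_cancel) auto
    then have "x \<ominus> eps Rs \<otimes> x = eps (P - Rs) \<otimes> x"
      unfolding eq[symmetric] .
    then show ?thesis using that I_r_closed[OF eps_not_Rs] by simp
  qed
  have "k_algebra_iso R N Quo (\<lambda>x. I +> x)"
  proof (rule k_algebra_iso_transport[OF quotient_k_algebra]; unfold N_sel)
    show "bij_betw (\<lambda>x. I +> x) (blk Rs) (carrier Quo)"
    proof (rule bij_betw_imageI)
      show "inj_on (\<lambda>x. I +> x) (blk Rs)"
      proof (rule inj_onI)
        fix x y assume xy: "x \<in> blk Rs" "y \<in> blk Rs" "I +> x = I +> y"
        have sub: "x \<ominus> y \<in> blk Rs" unfolding a_minus_def using xy L(3,5) by blast
        have "x \<ominus> y \<in> I" using coset_eq_iff xy M by blast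
        then have "x \<ominus> y = \<zero>" using eps_Rs_ideal_zero[of "x \<ominus> y"] sub iff by metis
        then show "x = y" using xy M minus_eq_zero_imp_eq by blast
      qed
      show "(\<lambda>x. I +> x) ` blk Rs = carrier Quo"
      proof
        show "(\<lambda>x. I +> x) ` blk Rs \<subseteq> carrier Quo" using M by (auto simp: carrier_quotient)
        show "carrier Quo \<subseteq> (\<lambda>x. I +> x) ` blk Rs"
        proof
          fix X assume "X \<in> carrier Quo"
          then obtain v where v: "v \<in> carrier M" "X = I +> v" by (auto simp: carrier_quotient)
          then obtain x i where x: "x \<in> cov" "i \<in> I" "v = x \<oplus> i"
            using cov_plus_I by (fastforce simp: set_add_def')
          have xM: "x \<in> carrier M" using cov_closed x by blast
          have "v \<ominus> x = i" using x(3) add_minus_cancel[OF Icarr[OF x(2)] xM] Icarr[OF x(2)] xM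
            by (simp add: a_comm)
          then have "v \<ominus> x \<in> I" using x(2) by simp
          then have "X = I +> x" using coset_eq_iff v xM by blast
          also have "\<dots> = I +> (eps Rs \<otimes> x)" using coset_eq_iff inI[OF xM] xM RsP by simp
          finally show "X \<in> (\<lambda>x. I +> x) ` blk Rs" using x by (auto simp: blk_eq)
        qed
      qed
    qed
    show "x \<otimes> y \<in> blk Rs" if "x \<in> blk Rs" "y \<in> blk Rs" for x y
      using that cov_mult M RsP by (simp add: iff flip: m_assoc)
    show "\<zero> \<in> blk Rs" using submodule_blk[OF RsP] by (auto simp: submodule_def dest: subgroup.one_closed)
    show "eps Rs \<in> blk Rs" using RsP eps_cov eps_eps[OF RsP RsP] by (simp add: iff)
    have "\<one> \<ominus> eps Rs \<in> I" using inI[of \<one>] RsP by simp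
    then have "I +> \<one> = I +> eps Rs" using coset_eq_iff RsP by simp
    then show "I +> eps Rs = \<one>\<^bsub>Quo\<^esub>" by (simp add: coset_one)
  qed (use L(4,5) M in \<open>simp_all add: coset_add coset_mult coset_smult coset_zero\<close>)
  then show ?thesis by (simp add: N_def)
qed

lemma f_mult_in_I:
  assumes p: "p \<in> Rs" and z: "z \<in> fin_supp R (Lk p q)" and I: "f p \<otimes> z \<in> I"
  shows "z = \<zero>"
proof -
  have pP: "p \<in> P" using p by (simp add: Rs_def)
  have "z b = \<zero>\<^bsub>R\<^esub>" for b
  proof (cases "b \<in> Lk p q")
    case True
    show ?thesis
    proof (rule ccontr)
      assume "z b \<noteq> \<zero>\<^bsub>R\<^esub>"
      then have "\<delta> b \<in> I" using I_basis[OF I] f_mult_coeff[OF pP z True] by simp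
      then show False using Lk_in_I[OF True] p by (simp add: Rs_def)
    qed
  qed (rule fin_suppD(3)[OF z])
  then show ?thesis by (simp add: zero_M fun_eq_iff)
qed

text \<open>Over the zero ring every \<open>e p\<close> is the zero vector and so lies in the ideal.
  As soon as \<open>Rs\<close> has an element, distinct classes have distinct basis vectors.\<close>

lemma nontrivial_of_Rs:
  assumes "p \<in> Rs" shows "\<one>\<^bsub>R\<^esub> \<noteq> \<zero>\<^bsub>R\<^esub>"
proof
  assume "\<one>\<^bsub>R\<^esub> = \<zero>\<^bsub>R\<^esub>"
  then have "\<delta> (e p) = \<zero>" by (auto simp: single_def zero_M)
  then show False using assms zero_closed by (simp add: Rs_def)
qed

end

section \<open>The group algebra attached to one essential pair\<close>

locale group_block = fibered_blocks R B M Cv P le e lt rt bt f I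
  for R :: "'k ring" and B :: "'b set" and M :: "('k, 'b \<Rightarrow> 'k) module" (structure)
    and Cv and P :: "'p set" and le e lt rt bt f I +
  fixes \<Gamma> :: "('b \<Rightarrow> 'k) monoid" and p :: 'p
  assumes p_Rs: "p \<in> Rs"
    and carrier_\<Gamma>: "carrier \<Gamma> = single R ` Lk p p"
    and mult_\<Gamma>: "monoid.mult \<Gamma> = monoid.mult M"
    and one_\<Gamma>: "monoid.one \<Gamma> = single R (e p)"
begin

abbreviation L where "L \<equiv> Lk p p"

abbreviation GA where "GA \<equiv> group_algebra R \<Gamma>"

text \<open>The elements of \<open>\<Gamma>\<close> are basis vectors \<open>single R b\<close> and
  not the indices \<open>b\<close>, so an element of the group algebra is a function of functions.
  This map brings it back to a function of the indices in \<open>L\<close>.\<close>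

definition incl where "incl a = (\<Oplus>\<gamma>\<in>{\<gamma>. a \<gamma> \<noteq> \<zero>\<^bsub>R\<^esub>}. a \<gamma> \<odot> \<gamma>)"

lemma p_P: "p \<in> P" using p_Rs by (simp add: Rs_def)

lemma e_L: "e p \<in> L" using p_P e_Cv by (simp add: Lk_def)

lemma L_Cv: "b \<in> L \<Longrightarrow> b \<in> Cv" by (simp add: Lk_def)

lemma single_eq_iff: "\<delta> b = \<delta> c \<longleftrightarrow> b = c"
  using nontrivial_of_Rs[OF p_Rs] by (metis single_def)

lemma L_mult: "b \<in> L \<Longrightarrow> c \<in> L \<Longrightarrow> \<exists>d\<in>L. \<delta> b \<otimes> \<delta> c = \<delta> d"
  using Cv_mult_linked[of b c] by (auto simp: Lk_def)

lemma GA_sel: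
  "carrier GA = fin_supp R (\<delta> ` L)"
  "ring.add GA = (\<lambda>a b \<gamma>. a \<gamma> \<oplus>\<^bsub>R\<^esub> b \<gamma>)"
  "ring.zero GA = (\<lambda>\<gamma>. \<zero>\<^bsub>R\<^esub>)"
  "monoid.one GA = single R (\<delta> (e p))"
  "smult GA = (\<lambda>c a \<gamma>. c \<otimes>\<^bsub>R\<^esub> a \<gamma>)"
  "monoid.mult GA = (\<lambda>a b \<gamma>. \<Oplus>\<^bsub>R\<^esub>p\<in>{(\<alpha>, \<beta>). a \<alpha> \<noteq> \<zero>\<^bsub>R\<^esub> \<and> b \<beta> \<noteq> \<zero>\<^bsub>R\<^esub> \<and> \<alpha> \<otimes> \<beta> = \<gamma>}.
                        a (fst p) \<otimes>\<^bsub>R\<^esub> b (snd p))"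
  by (auto simp: group_algebra_def fin_supp_def carrier_\<Gamma> mult_\<Gamma> one_\<Gamma> single_def fun_eq_iff)

lemma supp_GA:
  assumes "a \<in> carrier GA"
  shows "{\<gamma>. a \<gamma> \<noteq> \<zero>\<^bsub>R\<^esub>} \<subseteq> \<delta> ` L" "finite {\<gamma>. a \<gamma> \<noteq> \<zero>\<^bsub>R\<^esub>}" "a \<gamma> \<in> carrier R"
  using assms by (auto simp: GA_sel fin_supp_def)

lemma supp_closed: "a \<in> carrier GA \<Longrightarrow> a \<gamma> \<noteq> \<zero>\<^bsub>R\<^esub> \<Longrightarrow> \<gamma> \<in> carrier M"
  using supp_GA(1) L_Cv by fastforce

lemma incl_fin_supp:
  assumes a: "a \<in> carrier GA" shows "incl a \<in> fin_supp R L"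
  unfolding incl_def
proof (rule finsum_in_submodule[OF submodule_fin_supp[OF Lk_subset_B]])
  fix \<gamma> assume "\<gamma> \<in> {\<gamma>. a \<gamma> \<noteq> \<zero>\<^bsub>R\<^esub>}"
  then have "\<gamma> \<in> \<delta> ` L" using supp_GA(1)[OF a] by blast
  then have "\<gamma> \<in> fin_supp R L" by (auto intro: R.single_fin_supp)
  then show "a \<gamma> \<odot> \<gamma> \<in> fin_supp R L"
    by (rule mod.submoduleE(4)[OF submodule_fin_supp[OF Lk_subset_B] supp_GA(3)[OF a]])
qed

lemma incl_closed: "a \<in> carrier GA \<Longrightarrow> incl a \<in> carrier M"
  using incl_fin_supp fin_supp_Lk_cov cov_closed by blast

lemma incl_apply:
  assumes a: "a \<in> carrier GA" and b: "b \<in> L"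
  shows "incl a b = a (\<delta> b)"
proof -
  let ?S = "{\<gamma>. a \<gamma> \<noteq> \<zero>\<^bsub>R\<^esub>}"
  have "incl a b = (\<Oplus>\<^bsub>R\<^esub>\<gamma>\<in>?S. (a \<gamma> \<odot> \<gamma>) b)"
    unfolding incl_def using supp_closed[OF a] supp_GA(3)[OF a] by (intro finsum_apply) auto
  also have "\<dots> = (\<Oplus>\<^bsub>R\<^esub>\<gamma>\<in>?S. if \<gamma> = \<delta> b then a (\<delta> b) else \<zero>\<^bsub>R\<^esub>)"
  proof (rule mod.R.finsum_cong')
    fix \<gamma> assume "\<gamma> \<in> ?S"
    then obtain c where c: "\<gamma> = \<delta> c" using supp_GA(1)[OF a] by blast
    show "(a \<gamma> \<odot> \<gamma>) b = (if \<gamma> = \<delta> b then a (\<delta> b) else \<zero>\<^bsub>R\<^esub>)"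
      using supp_GA(3)[OF a] unfolding c single_eq_iff by (auto simp: smult_M single_def)
  qed (use supp_GA(3)[OF a] in auto)
  also have "\<dots> = a (\<delta> b)"
  proof (cases "\<delta> b \<in> ?S")
    case True
    then show ?thesis
      using mod.R.finsum_singleton[OF True supp_GA(2)[OF a], of "\<lambda>_. a (\<delta> b)"] supp_GA(3)[OF a]
      by (simp add: eq_commute)
  next
    case False
    then show ?thesis by (auto intro!: mod.R.add.finprod_one_eqI)
  qed
  finally show ?thesis .
qed

lemma incl_eq: "a \<in> carrier GA \<Longrightarrow> incl a = (\<lambda>b. if b \<in> L then a (\<delta> b) else \<zero>\<^bsub>R\<^esub>)"
  using incl_apply fin_suppD(3)[OF incl_fin_supp] by fastforce

lemma incl_inj:
  assumes "a \<in> carrier GA" "a' \<in> carrier GA" "incl a = incl a'"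
  shows "a = a'"
proof
  fix \<gamma>
  show "a \<gamma> = a' \<gamma>"
  proof (cases "\<gamma> \<in> \<delta> ` L")
    case True
    then obtain b where b: "\<gamma> = \<delta> b" "b \<in> L" by blast
    show ?thesis using incl_apply[OF assms(1) b(2)] incl_apply[OF assms(2) b(2)] assms(3) b(1) by simp
  next
    case False
    then show ?thesis
      using fin_suppD(3)[of a R "\<delta> ` L"] fin_suppD(3)[of a' R "\<delta> ` L"] assms(1,2)
      by (simp add: GA_sel)
  qed
qed

lemma incl_surj:
  assumes z: "z \<in> fin_supp R L"
  shows "\<exists>a\<in>carrier GA. incl a = z"
proof -
  define a where "a = (\<lambda>\<gamma>. if \<gamma> \<in> \<delta> ` L then z (the_inv_into L \<delta> \<gamma>) else \<zero>\<^bsub>R\<^esub>)"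
  have inj: "inj_on \<delta> L" by (simp add: inj_on_def single_eq_iff)
  have ad: "a (\<delta> b) = z b" if "b \<in> L" for b
    using that the_inv_into_f_f[OF inj] by (simp add: a_def)
  have "{\<gamma>. a \<gamma> \<noteq> \<zero>\<^bsub>R\<^esub>} \<subseteq> \<delta> ` {b. z b \<noteq> \<zero>\<^bsub>R\<^esub>}"
    using ad by (auto simp: a_def split: if_splits)
  then have "finite {\<gamma>. a \<gamma> \<noteq> \<zero>\<^bsub>R\<^esub>}" using fin_suppD(2)[OF z] finite_subset by blast
  moreover have "a \<gamma> \<in> carrier R" for \<gamma>
    using fin_suppD(1)[OF z] by (simp add: a_def)
  moreover have "{\<gamma>. a \<gamma> \<noteq> \<zero>\<^bsub>R\<^esub>} \<subseteq> \<delta> ` L" by (auto simp: a_def)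
  ultimately have a: "a \<in> carrier GA" unfolding GA_sel fin_supp_def by blast
  moreover have "incl a = z"
    unfolding incl_eq[OF a] using ad fin_suppD(3)[OF z] by fastforce
  ultimately show ?thesis by blast
qed

lemma GA_mult:
  assumes a: "a \<in> carrier GA" and b: "b \<in> carrier GA"
  shows "a \<otimes>\<^bsub>GA\<^esub> b \<in> carrier GA" "incl (a \<otimes>\<^bsub>GA\<^esub> b) = incl a \<otimes> incl b"
proof -
  let ?S = "{\<gamma>. a \<gamma> \<noteq> \<zero>\<^bsub>R\<^esub>}" and ?T = "{\<gamma>. b \<gamma> \<noteq> \<zero>\<^bsub>R\<^esub>}"
  let ?W = "\<lambda>\<gamma>. {(\<alpha>, \<beta>). a \<alpha> \<noteq> \<zero>\<^bsub>R\<^esub> \<and> b \<beta> \<noteq> \<zero>\<^bsub>R\<^esub> \<and> \<alpha> \<otimes> \<beta> = \<gamma>}"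
  note fin = supp_GA(2)[OF a] supp_GA(2)[OF b]
  have ab: "(a \<otimes>\<^bsub>GA\<^esub> b) \<gamma> = (\<Oplus>\<^bsub>R\<^esub>p\<in>?W \<gamma>. a (fst p) \<otimes>\<^bsub>R\<^esub> b (snd p))" for \<gamma>
    by (simp add: GA_sel)
  have supp: "{\<gamma>. (a \<otimes>\<^bsub>GA\<^esub> b) \<gamma> \<noteq> \<zero>\<^bsub>R\<^esub>} \<subseteq> (\<lambda>(\<alpha>, \<beta>). \<alpha> \<otimes> \<beta>) ` (?S \<times> ?T)"
  proof
    fix \<gamma> assume "\<gamma> \<in> {\<gamma>. (a \<otimes>\<^bsub>GA\<^esub> b) \<gamma> \<noteq> \<zero>\<^bsub>R\<^esub>}"
    then have "?W \<gamma> \<noteq> {}" unfolding ab by fastforce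
    then show "\<gamma> \<in> (\<lambda>(\<alpha>, \<beta>). \<alpha> \<otimes> \<beta>) ` (?S \<times> ?T)" by auto
  qed
  moreover have "(\<lambda>(\<alpha>, \<beta>). \<alpha> \<otimes> \<beta>) ` (?S \<times> ?T) \<subseteq> \<delta> ` L"
    using supp_GA(1)[OF a] supp_GA(1)[OF b] L_mult by fastforce
  moreover have "finite ((\<lambda>(\<alpha>, \<beta>). \<alpha> \<otimes> \<beta>) ` (?S \<times> ?T))" using fin by simp
  moreover have "(a \<otimes>\<^bsub>GA\<^esub> b) \<gamma> \<in> carrier R" for \<gamma>
    unfolding ab using supp_GA(3)[OF a] supp_GA(3)[OF b] by (intro mod.R.finsum_closed) auto
  ultimately show closed: "a \<otimes>\<^bsub>GA\<^esub> b \<in> carrier GA"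
    unfolding GA_sel(1) fin_supp_def using finite_subset by blast
  have aM: "a \<gamma> \<odot> \<gamma> \<in> carrier M" if "\<gamma> \<in> ?S" for \<gamma> using that supp_closed[OF a] supp_GA(3)[OF a] by simp
  have bM: "b \<gamma> \<odot> \<gamma> \<in> carrier M" if "\<gamma> \<in> ?T" for \<gamma> using that supp_closed[OF b] supp_GA(3)[OF b] by simp
  have prod: "incl a \<otimes> incl b = (\<Oplus>q\<in>?S \<times> ?T. (a (fst q) \<odot> fst q) \<otimes> (b (snd q) \<odot> snd q))"
  proof -
    have "incl a \<otimes> incl b = (\<Oplus>\<alpha>\<in>?S. (a \<alpha> \<odot> \<alpha>) \<otimes> incl b)"
      unfolding incl_def[of a] using aM incl_closed[OF b] fin by (intro finsum_ldistr) auto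
    also have "\<dots> = (\<Oplus>\<alpha>\<in>?S. \<Oplus>\<beta>\<in>?T. (a \<alpha> \<odot> \<alpha>) \<otimes> (b \<beta> \<odot> \<beta>))"
    proof (rule finsum_cong')
      fix \<alpha> assume \<alpha>: "\<alpha> \<in> ?S"
      show "(a \<alpha> \<odot> \<alpha>) \<otimes> incl b = (\<Oplus>\<beta>\<in>?T. (a \<alpha> \<odot> \<alpha>) \<otimes> (b \<beta> \<odot> \<beta>))"
        unfolding incl_def using aM[OF \<alpha>] bM fin by (intro finsum_rdistr) auto
    qed (use aM bM in auto)
    also have "\<dots> = (\<Oplus>q\<in>?S \<times> ?T. (a (fst q) \<odot> fst q) \<otimes> (b (snd q) \<odot> snd q))"
      using finsum_cartesian[OF fin, of "\<lambda>q. (a (fst q) \<odot> fst q) \<otimes> (b (snd q) \<odot> snd q)"] aM bM by simp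
    finally show ?thesis .
  qed
  show "incl (a \<otimes>\<^bsub>GA\<^esub> b) = incl a \<otimes> incl b"
  proof
    fix c
    show "incl (a \<otimes>\<^bsub>GA\<^esub> b) c = (incl a \<otimes> incl b) c"
    proof (cases "c \<in> L")
      case True
      have "(incl a \<otimes> incl b) c = (\<Oplus>\<^bsub>R\<^esub>q\<in>?S \<times> ?T. ((a (fst q) \<odot> fst q) \<otimes> (b (snd q) \<odot> snd q)) c)"
        unfolding prod using aM bM by (intro finsum_apply) auto
      also have "\<dots> = (\<Oplus>\<^bsub>R\<^esub>q\<in>?W (\<delta> c). a (fst q) \<otimes>\<^bsub>R\<^esub> b (snd q))"
      proof (rule mod.R.add.finprod_mono_neutral_cong_right)
        show "finite (?S \<times> ?T)" using fin by simp
        show "?W (\<delta> c) \<subseteq> ?S \<times> ?T" by auto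
        \<comment> \<open>The product of two elements of \<open>\<Gamma>\<close> is again a single
          basis vector, so a pair of factors contributes to the coordinate \<open>c\<close> only if
          that vector is the one of \<open>c\<close>.\<close>
        have *: "((a \<alpha> \<odot> \<alpha>) \<otimes> (b \<beta> \<odot> \<beta>)) c = (if \<alpha> \<otimes> \<beta> = \<delta> c then a \<alpha> \<otimes>\<^bsub>R\<^esub> b \<beta> else \<zero>\<^bsub>R\<^esub>)"
          if \<alpha>: "\<alpha> \<in> ?S" and \<beta>: "\<beta> \<in> ?T" for \<alpha> \<beta>
        proof -
          have "\<alpha> \<in> \<delta> ` L" "\<beta> \<in> \<delta> ` L"
            using supp_GA(1)[OF a] supp_GA(1)[OF b] \<alpha> \<beta> by blast+
          then obtain d where d: "\<alpha> \<otimes> \<beta> = \<delta> d" using L_mult by blast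
          have cl: "\<alpha> \<in> carrier M" "\<beta> \<in> carrier M" using supp_closed a b \<alpha> \<beta> by auto
          have "(a \<alpha> \<odot> \<alpha>) \<otimes> (b \<beta> \<odot> \<beta>) = (a \<alpha> \<otimes>\<^bsub>R\<^esub> b \<beta>) \<odot> (\<alpha> \<otimes> \<beta>)"
            using cl supp_GA(3)[OF a] supp_GA(3)[OF b]
              smult_mult_left[of "a \<alpha>" \<alpha> "b \<beta> \<odot> \<beta>"]
            by (simp add: smult_mult_right mod.smult_assoc1)
          then show ?thesis using supp_GA(3)[OF a] supp_GA(3)[OF b]
            unfolding d single_eq_iff by (auto simp: smult_M single_def)
        qed
        show "((a (fst q) \<odot> fst q) \<otimes> (b (snd q) \<odot> snd q)) c = a (fst q) \<otimes>\<^bsub>R\<^esub> b (snd q)"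
          if "q \<in> ?W (\<delta> c)" for q
          using that *[of "fst q" "snd q"] by auto
        show "((a (fst q) \<odot> fst q) \<otimes> (b (snd q) \<odot> snd q)) c = \<zero>\<^bsub>R\<^esub>"
          if "q \<in> ?S \<times> ?T - ?W (\<delta> c)" for q
          using that *[of "fst q" "snd q"] by (auto split: if_splits)
        show "(\<lambda>q. ((a (fst q) \<odot> fst q) \<otimes> (b (snd q) \<odot> snd q)) c) \<in> ?S \<times> ?T \<rightarrow> carrier R"
          using aM bM by (auto intro!: carrier_apply)
      qed
      also have "\<dots> = incl (a \<otimes>\<^bsub>GA\<^esub> b) c" unfolding incl_apply[OF closed True] ab ..
      finally show ?thesis ..
    next
      case False
      have "incl a \<otimes> incl b \<in> fin_supp R L"
      proof (rule mult_fin_supp[OF Lk_subset_B Lk_subset_B Lk_subset_B _ incl_fin_supp[OF a] incl_fin_supp[OF b]])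
        fix b c assume "b \<in> L" "c \<in> L"
        then obtain d where "d \<in> L" "\<delta> b \<otimes> \<delta> c = \<delta> d" using L_mult by blast
        then show "\<delta> b \<otimes> \<delta> c \<in> fin_supp R L" using R.single_fin_supp[of d L] by simp
      qed
      then show ?thesis using False incl_fin_supp[OF closed] fin_suppD(3) by metis
    qed
  qed
qed

text \<open>By \<open>f_absorb\<close> the map sends \<open>a\<close> to the coset of
  \<open>f p \<otimes> incl a\<close>, and the same lemma removes the inner \<open>f p\<close> from
  a product of two such elements, which gives multiplicativity. Injectivity is
  \<open>f_mult_in_I\<close>. For surjectivity a general element is reduced modulo the ideal to one
  supported on \<open>Cv\<close>, and \<open>f_cov_f\<close> moves its compression to
  \<open>L\<close>.\<close>

lemma group_block_iso:
  "k_algebra_iso R GA (corner_algebra Quo (I +> f p))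
     (\<lambda>a. (I +> f p) \<otimes>\<^bsub>Quo\<^esub> (I +> incl a) \<otimes>\<^bsub>Quo\<^esub> (I +> f p))"
proof -
  interpret Q: k_alg R Quo by unfold_locales (rule quotient_k_algebra)
  have fM: "f p \<in> carrier M" using p_P by simp
  have ff: "f p \<otimes> f p = f p" using f_f[OF p_P p_P] by simp
  have Qf: "I +> f p \<in> carrier Quo" "(I +> f p) \<otimes>\<^bsub>Quo\<^esub> (I +> f p) = I +> f p"
    using fM ff by (auto simp: carrier_quotient coset_mult)
  have sand: "(I +> f p) \<otimes>\<^bsub>Quo\<^esub> (I +> x) \<otimes>\<^bsub>Quo\<^esub> (I +> f p) = I +> (f p \<otimes> x \<otimes> f p)"
    if "x \<in> carrier M" for x
    using that fM by (simp add: coset_mult)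
  have h: "(I +> f p) \<otimes>\<^bsub>Quo\<^esub> (I +> incl a) \<otimes>\<^bsub>Quo\<^esub> (I +> f p) = I +> (f p \<otimes> incl a)"
    if "a \<in> carrier GA" for a
    using that sand[OF incl_closed] f_absorb[OF p_P p_P incl_fin_supp] by simp
  define C where "C = corner_algebra Quo (I +> f p)"
  have C_sel: "carrier C = {(I +> f p) \<otimes>\<^bsub>Quo\<^esub> X \<otimes>\<^bsub>Quo\<^esub> (I +> f p) | X. X \<in> carrier Quo}"
    "monoid.mult C = monoid.mult Quo" "ring.add C = ring.add Quo"
    "ring.zero C = \<zero>\<^bsub>Quo\<^esub>" "monoid.one C = I +> f p" "smult C = smult Quo"
    by (simp_all add: C_def corner_algebra_def)
  have carrier_C: "carrier C = {I +> (f p \<otimes> x \<otimes> f p) | x. x \<in> carrier M}"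
    unfolding C_sel carrier_quotient using sand by auto
  have incl_add: "incl (a \<oplus>\<^bsub>GA\<^esub> b) = incl a \<oplus> incl b" "a \<oplus>\<^bsub>GA\<^esub> b \<in> carrier GA"
    if "a \<in> carrier GA" "b \<in> carrier GA" for a b
  proof -
    show cl: "a \<oplus>\<^bsub>GA\<^esub> b \<in> carrier GA" using that by (simp add: GA_sel R.add_fin_supp)
    show "incl (a \<oplus>\<^bsub>GA\<^esub> b) = incl a \<oplus> incl b"
      unfolding incl_eq[OF cl] incl_eq[OF that(1)] incl_eq[OF that(2)] by (auto simp: GA_sel add_M)
  qed
  have incl_smult: "incl (c \<odot>\<^bsub>GA\<^esub> a) = c \<odot> incl a" "c \<odot>\<^bsub>GA\<^esub> a \<in> carrier GA"
    if "c \<in> carrier R" "a \<in> carrier GA" for c a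
  proof -
    show cl: "c \<odot>\<^bsub>GA\<^esub> a \<in> carrier GA" using that by (simp add: GA_sel R.smult_fin_supp)
    show "incl (c \<odot>\<^bsub>GA\<^esub> a) = c \<odot> incl a"
      unfolding incl_eq[OF cl] incl_eq[OF that(2)] using that by (auto simp: GA_sel smult_M)
  qed
  have GA0: "\<zero>\<^bsub>GA\<^esub> \<in> carrier GA" by (simp add: GA_sel R.zero_fin_supp)
  have incl0: "incl \<zero>\<^bsub>GA\<^esub> = \<zero>" unfolding incl_eq[OF GA0] by (auto simp: GA_sel zero_M)
  have GA1: "\<one>\<^bsub>GA\<^esub> \<in> carrier GA" using e_L by (simp add: GA_sel R.single_fin_supp)
  have incl1: "incl \<one>\<^bsub>GA\<^esub> = \<delta> (e p)"
  proof
    fix b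
    have "\<one>\<^bsub>GA\<^esub> (\<delta> b) = (if b = e p then \<one>\<^bsub>R\<^esub> else \<zero>\<^bsub>R\<^esub>)"
      unfolding GA_sel single_def[of R "\<delta> (e p)"] single_eq_iff ..
    then show "incl \<one>\<^bsub>GA\<^esub> b = \<delta> (e p) b"
      unfolding incl_eq[OF GA1] using e_L by (auto simp: single_def)
  qed
  have "k_algebra_iso R GA C (\<lambda>a. (I +> f p) \<otimes>\<^bsub>Quo\<^esub> (I +> incl a) \<otimes>\<^bsub>Quo\<^esub> (I +> f p))"
  proof (rule k_algebra_iso_transport)
    show "k_algebra R C" unfolding C_def by (rule Q.corner_k_algebra[OF Qf])
    show "bij_betw (\<lambda>a. (I +> f p) \<otimes>\<^bsub>Quo\<^esub> (I +> incl a) \<otimes>\<^bsub>Quo\<^esub> (I +> f p)) (carrier GA) (carrier C)"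
    proof (rule bij_betw_imageI)
      show "inj_on (\<lambda>a. (I +> f p) \<otimes>\<^bsub>Quo\<^esub> (I +> incl a) \<otimes>\<^bsub>Quo\<^esub> (I +> f p)) (carrier GA)"
      proof (rule inj_onI)
        fix a b assume a: "a \<in> carrier GA" and b: "b \<in> carrier GA" and
          "(I +> f p) \<otimes>\<^bsub>Quo\<^esub> (I +> incl a) \<otimes>\<^bsub>Quo\<^esub> (I +> f p) =
           (I +> f p) \<otimes>\<^bsub>Quo\<^esub> (I +> incl b) \<otimes>\<^bsub>Quo\<^esub> (I +> f p)"
        then have "I +> (f p \<otimes> incl a) = I +> (f p \<otimes> incl b)" using h by simp
        then have "f p \<otimes> incl a \<ominus> f p \<otimes> incl b \<in> I" using coset_eq_iff incl_closed a b fM by simp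
        moreover have "f p \<otimes> incl a \<ominus> f p \<otimes> incl b = f p \<otimes> (incl a \<ominus> incl b)"
          using incl_closed a b fM by (simp add: a_minus_def r_distr r_minus)
        moreover have "incl a \<ominus> incl b \<in> fin_supp R L"
          using mod.submoduleE(3,5)[OF submodule_fin_supp[OF Lk_subset_B]] incl_fin_supp a b
          unfolding a_minus_def by blast
        ultimately have "incl a \<ominus> incl b = \<zero>" using f_mult_in_I[OF p_Rs] by simp
        then show "a = b" using incl_inj[OF a b] incl_closed a b minus_eq_zero_imp_eq by blast
      qed
      show "(\<lambda>a. (I +> f p) \<otimes>\<^bsub>Quo\<^esub> (I +> incl a) \<otimes>\<^bsub>Quo\<^esub> (I +> f p)) ` carrier GA = carrier C"
      proof
        show "(\<lambda>a. (I +> f p) \<otimes>\<^bsub>Quo\<^esub> (I +> incl a) \<otimes>\<^bsub>Quo\<^esub> (I +> f p)) ` carrier GA \<subseteq> carrier C"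
          unfolding carrier_C using sand incl_closed by blast
        show "carrier C \<subseteq> (\<lambda>a. (I +> f p) \<otimes>\<^bsub>Quo\<^esub> (I +> incl a) \<otimes>\<^bsub>Quo\<^esub> (I +> f p)) ` carrier GA"
        proof
          fix X assume "X \<in> carrier C"
          then obtain v where v: "v \<in> carrier M" "X = I +> (f p \<otimes> v \<otimes> f p)" by (auto simp: carrier_C)
          then obtain x i where x: "x \<in> cov" "i \<in> I" "v = x \<oplus> i"
            using cov_plus_I by (fastforce simp: set_add_def')
          have xM: "x \<in> carrier M" "i \<in> carrier M" using cov_closed x Icarr by auto
          obtain z where z: "z \<in> fin_supp R L" "f p \<otimes> x \<otimes> f p = f p \<otimes> z"
            using f_cov_f[OF p_P p_P x(1)] by blast
          obtain a where a: "a \<in> carrier GA" "incl a = z" using incl_surj[OF z(1)] by blast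
          have "f p \<otimes> v \<otimes> f p = f p \<otimes> i \<otimes> f p \<oplus> f p \<otimes> z"
            unfolding x(3) z(2)[symmetric] using xM fM by (simp add: r_distr l_distr a_comm)
          moreover have "f p \<otimes> i \<otimes> f p \<in> I" using x(2) fM I_l_closed I_r_closed by blast
          ultimately have "f p \<otimes> v \<otimes> f p \<ominus> f p \<otimes> z \<in> I"
            using add_minus_cancel[of "f p \<otimes> i \<otimes> f p" "f p \<otimes> z"] xM fM incl_closed[OF a(1)] a(2)
            by simp
          then have "I +> (f p \<otimes> v \<otimes> f p) = I +> (f p \<otimes> z)"
            using coset_eq_iff v(1) fM incl_closed[OF a(1)] a(2) by simp
          then show "X \<in> (\<lambda>a. (I +> f p) \<otimes>\<^bsub>Quo\<^esub> (I +> incl a) \<otimes>\<^bsub>Quo\<^esub> (I +> f p)) ` carrier GA"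
            using h[OF a(1)] a v(2) by force
        qed
      qed
    qed
  next
    fix a b assume a: "a \<in> carrier GA" and b: "b \<in> carrier GA"
    show "a \<otimes>\<^bsub>GA\<^esub> b \<in> carrier GA" by (rule GA_mult(1)[OF a b])
    show "a \<oplus>\<^bsub>GA\<^esub> b \<in> carrier GA" by (rule incl_add(2)[OF a b])
    show "(I +> f p) \<otimes>\<^bsub>Quo\<^esub> (I +> incl (a \<oplus>\<^bsub>GA\<^esub> b)) \<otimes>\<^bsub>Quo\<^esub> (I +> f p) =
      (I +> f p) \<otimes>\<^bsub>Quo\<^esub> (I +> incl a) \<otimes>\<^bsub>Quo\<^esub> (I +> f p) \<oplus>\<^bsub>C\<^esub>
      (I +> f p) \<otimes>\<^bsub>Quo\<^esub> (I +> incl b) \<otimes>\<^bsub>Quo\<^esub> (I +> f p)"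
      unfolding h[OF a] h[OF b] h[OF incl_add(2)[OF a b]] C_sel
      using incl_closed a b fM by (simp add: coset_add incl_add r_distr)
    have "f p \<otimes> incl a \<otimes> (f p \<otimes> incl b) = (f p \<otimes> incl a \<otimes> f p) \<otimes> incl b"
      using incl_closed a b fM by (simp add: m_assoc)
    also have "\<dots> = f p \<otimes> incl (a \<otimes>\<^bsub>GA\<^esub> b)"
      using f_absorb[OF p_P p_P incl_fin_supp[OF a]] incl_closed a b fM by (simp add: GA_mult m_assoc)
    finally show "(I +> f p) \<otimes>\<^bsub>Quo\<^esub> (I +> incl (a \<otimes>\<^bsub>GA\<^esub> b)) \<otimes>\<^bsub>Quo\<^esub> (I +> f p) =
      (I +> f p) \<otimes>\<^bsub>Quo\<^esub> (I +> incl a) \<otimes>\<^bsub>Quo\<^esub> (I +> f p) \<otimes>\<^bsub>C\<^esub>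
      ((I +> f p) \<otimes>\<^bsub>Quo\<^esub> (I +> incl b) \<otimes>\<^bsub>Quo\<^esub> (I +> f p))"
      unfolding h[OF a] h[OF b] h[OF GA_mult(1)[OF a b]] C_sel
      using incl_closed a b fM by (simp add: coset_mult)
  next
    fix c a assume c: "c \<in> carrier R" and a: "a \<in> carrier GA"
    show "c \<odot>\<^bsub>GA\<^esub> a \<in> carrier GA" by (rule incl_smult(2)[OF c a])
    show "(I +> f p) \<otimes>\<^bsub>Quo\<^esub> (I +> incl (c \<odot>\<^bsub>GA\<^esub> a)) \<otimes>\<^bsub>Quo\<^esub> (I +> f p) =
      c \<odot>\<^bsub>C\<^esub> ((I +> f p) \<otimes>\<^bsub>Quo\<^esub> (I +> incl a) \<otimes>\<^bsub>Quo\<^esub> (I +> f p))"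
      unfolding h[OF a] h[OF incl_smult(2)[OF c a]] C_sel
      using incl_closed a c fM by (simp add: coset_smult incl_smult smult_mult_right)
  next
    show "\<zero>\<^bsub>GA\<^esub> \<in> carrier GA" "\<one>\<^bsub>GA\<^esub> \<in> carrier GA" by fact+
    show "(I +> f p) \<otimes>\<^bsub>Quo\<^esub> (I +> incl \<zero>\<^bsub>GA\<^esub>) \<otimes>\<^bsub>Quo\<^esub> (I +> f p) = \<zero>\<^bsub>C\<^esub>"
      using h[OF GA0] fM by (simp add: C_sel coset_zero incl0)
    show "(I +> f p) \<otimes>\<^bsub>Quo\<^esub> (I +> incl \<one>\<^bsub>GA\<^esub>) \<otimes>\<^bsub>Quo\<^esub> (I +> f p) = \<one>\<^bsub>C\<^esub>"
      using h[OF GA1] f_e(1)[OF p_P p_P] le_refl[OF p_P] by (simp add: C_sel incl1)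
  qed
  then show ?thesis by (simp add: C_def)
qed

end

section \<open>Stabilizers in fibered bisets\<close>

text \<open>An action is a homomorphism into \<open>BijGroup X\<close>, whose members are
  extensional bijections. Extensionality is therefore a separate condition, whereas bijectivity
  follows from acting by the inverse.\<close>

lemma group_actionI:
  assumes "group T"
    and ext: "\<And>t. t \<in> carrier T \<Longrightarrow> \<rho> t \<in> extensional X"
    and closed: "\<And>t x. t \<in> carrier T \<Longrightarrow> x \<in> X \<Longrightarrow> \<rho> t x \<in> X"
    and one: "\<And>x. x \<in> X \<Longrightarrow> \<rho> \<one>\<^bsub>T\<^esub> x = x"
    and comp: "\<And>s t x. s \<in> carrier T \<Longrightarrow> t \<in> carrier T \<Longrightarrow> x \<in> X \<Longrightarrow> \<rho> (s \<otimes>\<^bsub>T\<^esub> t) x = \<rho> s (\<rho> t x)"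
  shows "group_action T X \<rho>"
proof -
  interpret T: group T by fact
  have inv: "\<rho> (inv\<^bsub>T\<^esub> t) (\<rho> t x) = x" "\<rho> t (\<rho> (inv\<^bsub>T\<^esub> t) x) = x"
    if "t \<in> carrier T" "x \<in> X" for t x
    using that comp[of "inv\<^bsub>T\<^esub> t" t x] comp[of t "inv\<^bsub>T\<^esub> t" x] one by auto
  have Bij: "\<rho> t \<in> Bij X" if t: "t \<in> carrier T" for t
  proof -
    have "bij_betw (\<rho> t) X X"
      by (rule bij_betw_byWitness[where f' = "\<rho> (inv\<^bsub>T\<^esub> t)"]) (use t inv closed in auto)
    then show ?thesis using ext[OF t] by (simp add: Bij_def)
  qed
  have "\<rho> (s \<otimes>\<^bsub>T\<^esub> t) = \<rho> s \<otimes>\<^bsub>BijGroup X\<^esub> \<rho> t" if st: "s \<in> carrier T" "t \<in> carrier T" for s t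
  proof
    fix x show "\<rho> (s \<otimes>\<^bsub>T\<^esub> t) x = (\<rho> s \<otimes>\<^bsub>BijGroup X\<^esub> \<rho> t) x"
      using st Bij ext[of "s \<otimes>\<^bsub>T\<^esub> t"] comp[of s t x]
      by (cases "x \<in> X") (auto simp: BijGroup_def compose_def extensional_def)
  qed
  then have "\<rho> \<in> hom T (BijGroup X)"
    using Bij by (auto simp: hom_def BijGroup_def)
  then show ?thesis
    by (intro group_action.intro group_hom.intro group_hom_axioms.intro group_BijGroup T.group_axioms)
qed

lemma group_triple:
  assumes "comm_group A" "group G" "group H"
  shows "group (A \<times>\<times> G \<times>\<times> H)"
  using assms by (intro DirProd_group) (auto simp: comm_group_def)

locale tri_group = A: comm_group A + G: group G + H: group H
  for A :: "'a monoid" and G :: "'g monoid" and H :: "'h monoid"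
begin

abbreviation T where "T \<equiv> A \<times>\<times> G \<times>\<times> H"

sublocale T: group T
  by (rule group_triple) unfold_locales

lemma inv_T: "a \<in> carrier A \<Longrightarrow> g \<in> carrier G \<Longrightarrow> h \<in> carrier H \<Longrightarrow>
  inv\<^bsub>T\<^esub> (a, g, h) = (inv\<^bsub>A\<^esub> a, inv\<^bsub>G\<^esub> g, inv\<^bsub>H\<^esub> h)"
  using inv_DirProd[OF A.group_axioms DirProd_group[OF G.group_axioms H.group_axioms]]
    inv_DirProd[OF G.group_axioms H.group_axioms] by simp

end

definition fib :: "'a monoid \<Rightarrow> 'g monoid \<Rightarrow> 'h monoid \<Rightarrow> ('a \<times> 'g \<times> 'h) set \<Rightarrow> bool" where
  "fib A G H S \<longleftrightarrow> subgroup S (A \<times>\<times> G \<times>\<times> H) \<and> (\<forall>a. (a, \<one>\<^bsub>G\<^esub>, \<one>\<^bsub>H\<^esub>) \<in> S \<longrightarrow> a = \<one>\<^bsub>A\<^esub>)"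

locale tri_action = tri_group A G H + group_action T X \<rho>
  for A :: "'a monoid" and G :: "'g monoid" and H :: "'h monoid"
    and X :: "'x set" and \<rho> :: "'a \<times> 'g \<times> 'h \<Rightarrow> 'x \<Rightarrow> 'x"
begin

lemma act_closed: "t \<in> carrier T \<Longrightarrow> x \<in> X \<Longrightarrow> \<rho> t x \<in> X"
  using element_image by blast

lemma act_closed': "a \<in> carrier A \<Longrightarrow> g \<in> carrier G \<Longrightarrow> h \<in> carrier H \<Longrightarrow> x \<in> X \<Longrightarrow> \<rho> (a, g, h) x \<in> X"
  using act_closed by simp

lemma act_one: "x \<in> X \<Longrightarrow> \<rho> (\<one>\<^bsub>A\<^esub>, \<one>\<^bsub>G\<^esub>, \<one>\<^bsub>H\<^esub>) x = x"
  using id_eq_one by (metis one_DirProd restrict_apply)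

lemma act_act:
  "a \<in> carrier A \<Longrightarrow> g \<in> carrier G \<Longrightarrow> h \<in> carrier H \<Longrightarrow>
   a' \<in> carrier A \<Longrightarrow> g' \<in> carrier G \<Longrightarrow> h' \<in> carrier H \<Longrightarrow> x \<in> X \<Longrightarrow>
   \<rho> (a, g, h) (\<rho> (a', g', h') x) = \<rho> (a \<otimes>\<^bsub>A\<^esub> a', g \<otimes>\<^bsub>G\<^esub> g', h \<otimes>\<^bsub>H\<^esub> h') x"
  using composition_rule[of x "(a, g, h)" "(a', g', h')"] by simp

abbreviation stb where "stb \<equiv> stabilizer T \<rho>"

lemma mem_stb: "(a, g, h) \<in> stb x \<longleftrightarrow>
  a \<in> carrier A \<and> g \<in> carrier G \<and> h \<in> carrier H \<and> \<rho> (a, g, h) x = x"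
  by (auto simp: stabilizer_def)

lemma subgroup_stb: "x \<in> X \<Longrightarrow> subgroup (stb x) T"
  by (rule stabilizer_subgroup)

lemma orbit_subset: "x \<in> X \<Longrightarrow> orbit T \<rho> x \<subseteq> X"
  using act_closed by (auto simp: orbit_def)

lemma orbit_closed: "t \<in> carrier T \<Longrightarrow> x \<in> X \<Longrightarrow> y \<in> orbit T \<rho> x \<Longrightarrow> \<rho> t y \<in> orbit T \<rho> x"
proof -
  assume *: "t \<in> carrier T" "x \<in> X" "y \<in> orbit T \<rho> x"
  then obtain s where "s \<in> carrier T" "y = \<rho> s x" by (auto simp: orbit_def)
  then have "\<rho> t y = \<rho> (t \<otimes>\<^bsub>T\<^esub> s) x" "t \<otimes>\<^bsub>T\<^esub> s \<in> carrier T"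
    using * composition_rule by (auto simp del: carrier_DirProd)
  then show ?thesis unfolding orbit_def by blast
qed

lemma orbit_eq: "x \<in> X \<Longrightarrow> y \<in> orbit T \<rho> x \<Longrightarrow> orbit T \<rho> y = orbit T \<rho> x"
proof -
  assume x: "x \<in> X" and y: "y \<in> orbit T \<rho> x"
  then have yX: "y \<in> X" using orbit_subset by blast
  have "orbit T \<rho> y \<in> orbits T X \<rho>" "orbit T \<rho> x \<in> orbits T X \<rho>"
    using x yX by (auto simp: orbits_def)
  from disjoint_union[OF this] show ?thesis using orbit_refl[OF yX] y by blast
qed

lemma orbit_action:
  assumes "x \<in> X"
  shows "group_action T (orbit T \<rho> x) (\<lambda>t. restrict (\<rho> t) (orbit T \<rho> x))"
proof (rule group_actionI)
  fix s t y assume "s \<in> carrier T" "t \<in> carrier T" "y \<in> orbit T \<rho> x"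
  then show "restrict (\<rho> (s \<otimes>\<^bsub>T\<^esub> t)) (orbit T \<rho> x) y =
    restrict (\<rho> s) (orbit T \<rho> x) (restrict (\<rho> t) (orbit T \<rho> x) y)"
    using assms orbit_closed[of t x y] composition_rule[of y s t] orbit_subset by auto
next
  fix y assume "y \<in> orbit T \<rho> x"
  then show "restrict (\<rho> \<one>\<^bsub>T\<^esub>) (orbit T \<rho> x) y = y"
    using assms orbit_subset act_one by auto
qed (use assms orbit_closed in \<open>auto simp: T.group_axioms\<close>)

lemma stb_conj:
  assumes x: "x \<in> X" and t: "t \<in> carrier T"
  shows "stb (\<rho> t x) = {t \<otimes>\<^bsub>T\<^esub> s \<otimes>\<^bsub>T\<^esub> inv\<^bsub>T\<^esub> t | s. s \<in> stb x}"
proof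
  have cl: "s \<in> stb x \<Longrightarrow> s \<in> carrier T" for s by (auto simp: stabilizer_def)
  have ret: "\<rho> (inv\<^bsub>T\<^esub> t) (\<rho> t x) = x"
    using orbit_sym_aux[OF t x refl] .
  show "{t \<otimes>\<^bsub>T\<^esub> s \<otimes>\<^bsub>T\<^esub> inv\<^bsub>T\<^esub> t | s. s \<in> stb x} \<subseteq> stb (\<rho> t x)"
  proof
    fix u assume "u \<in> {t \<otimes>\<^bsub>T\<^esub> s \<otimes>\<^bsub>T\<^esub> inv\<^bsub>T\<^esub> t | s. s \<in> stb x}"
    then obtain s where s: "s \<in> stb x" and u: "u = t \<otimes>\<^bsub>T\<^esub> s \<otimes>\<^bsub>T\<^esub> inv\<^bsub>T\<^esub> t" by blast
    have "\<rho> (t \<otimes>\<^bsub>T\<^esub> s \<otimes>\<^bsub>T\<^esub> inv\<^bsub>T\<^esub> t) (\<rho> t x) = \<rho> (t \<otimes>\<^bsub>T\<^esub> s) (\<rho> (inv\<^bsub>T\<^esub> t) (\<rho> t x))"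
      using t cl[OF s] act_closed[OF t x] by (intro composition_rule) (auto simp del: carrier_DirProd)
    also have "\<dots> = \<rho> t (\<rho> s x)" unfolding ret using t cl[OF s] x by (intro composition_rule) (auto simp del: carrier_DirProd)
    also have "\<dots> = \<rho> t x" using s by (simp add: stabilizer_def)
    finally show "u \<in> stb (\<rho> t x)"
      unfolding u using t cl[OF s] by (simp add: stabilizer_def del: carrier_DirProd)
  qed
  show "stb (\<rho> t x) \<subseteq> {t \<otimes>\<^bsub>T\<^esub> s \<otimes>\<^bsub>T\<^esub> inv\<^bsub>T\<^esub> t | s. s \<in> stb x}"
  proof
    fix u assume "u \<in> stb (\<rho> t x)"
    then have u: "u \<in> carrier T" "\<rho> u (\<rho> t x) = \<rho> t x" by (simp_all add: stabilizer_def)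
    define s where "s = inv\<^bsub>T\<^esub> t \<otimes>\<^bsub>T\<^esub> (u \<otimes>\<^bsub>T\<^esub> t)"
    have sT: "s \<in> carrier T" using t u by (simp add: s_def del: carrier_DirProd)
    have "\<rho> s x = \<rho> (inv\<^bsub>T\<^esub> t) (\<rho> (u \<otimes>\<^bsub>T\<^esub> t) x)"
      unfolding s_def using t u x by (intro composition_rule) (auto simp del: carrier_DirProd)
    also have "\<rho> (u \<otimes>\<^bsub>T\<^esub> t) x = \<rho> t x"
      using composition_rule[OF x u(1) t] u(2) by simp
    finally have "s \<in> stb x" using ret sT by (simp add: stabilizer_def)
    moreover have "u = t \<otimes>\<^bsub>T\<^esub> s \<otimes>\<^bsub>T\<^esub> inv\<^bsub>T\<^esub> t"
      unfolding s_def using t u by (metis T.inv_closed T.m_assoc T.m_closed T.r_inv T.r_one T.l_inv T.l_one)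
    ultimately show "u \<in> {t \<otimes>\<^bsub>T\<^esub> s \<otimes>\<^bsub>T\<^esub> inv\<^bsub>T\<^esub> t | s. s \<in> stb x}" by blast
  qed
qed

end

lemma equivariant_stabilizer:
  assumes "\<And>t. t \<in> carrier T \<Longrightarrow> f (\<rho> t x) = \<sigma> t (f x)" "inj_on f X" "x \<in> X"
    "\<And>t. t \<in> carrier T \<Longrightarrow> \<rho> t x \<in> X"
  shows "stabilizer T \<sigma> (f x) = stabilizer T \<rho> x"
  unfolding stabilizer_def using assms by (force simp: inj_on_def)

lemma equivariant_orbit:
  assumes "\<And>t. t \<in> carrier T \<Longrightarrow> f (\<rho> t x) = \<sigma> t (f x)"
  shows "orbit T \<sigma> (f x) = f ` orbit T \<rho> x"
  unfolding orbit_def using assms by force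

lemma same_stabilizer_iso:
  assumes X: "group_action T X \<rho>" "x \<in> X" "X = orbit T \<rho> x"
    and Y: "group_action T Y \<sigma>" "y \<in> Y" "Y = orbit T \<sigma> y"
    and st: "stabilizer T \<rho> x = stabilizer T \<sigma> y"
  shows "\<exists>f. bij_betw f X Y \<and> f x = y \<and> (\<forall>t\<in>carrier T. \<forall>x\<in>X. f (\<rho> t x) = \<sigma> t (f x))"
proof -
  interpret X: group_action T X \<rho> by fact
  interpret Y: group_action T Y \<sigma> by fact
  interpret T: group T using X.group_hom by (simp add: group_hom_def)
  \<comment> \<open>Both equalities say that the inverse of \<open>t\<close> times \<open>s\<close>
    lies in the common stabilizer. Hence sending \<open>\<rho> t x\<close> to
    \<open>\<sigma> t y\<close> is well defined and injective.\<close>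
  have key: "\<rho> s x = \<rho> t x \<longleftrightarrow> \<sigma> s y = \<sigma> t y" if st': "s \<in> carrier T" "t \<in> carrier T" for s t
  proof -
    have *: "\<phi> s z = \<phi> t z \<longleftrightarrow> inv\<^bsub>T\<^esub> t \<otimes>\<^bsub>T\<^esub> s \<in> stabilizer T \<phi> z"
      if "group_action T Z \<phi>" "z \<in> Z" for \<phi> :: "_ \<Rightarrow> 'z \<Rightarrow> 'z" and Z z
    proof -
      interpret Z: group_action T Z \<phi> by fact
      have 1: "\<phi> (inv\<^bsub>T\<^esub> t \<otimes>\<^bsub>T\<^esub> s) z = \<phi> (inv\<^bsub>T\<^esub> t) (\<phi> s z)"
        using st' that by (intro Z.composition_rule) auto
      have 2: "\<phi> t (\<phi> (inv\<^bsub>T\<^esub> t) (\<phi> s z)) = \<phi> s z"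
        using st' that Z.element_image[of s z] Z.orbit_sym_aux[of "inv\<^bsub>T\<^esub> t" "\<phi> s z"] by simp
      have 3: "\<phi> (inv\<^bsub>T\<^esub> t) (\<phi> t z) = z" using Z.orbit_sym_aux[of t z] st' that by simp
      show ?thesis using 1 2 3 st' by (auto simp: stabilizer_def)
    qed
    show ?thesis using *[OF X(1,2)] *[OF Y(1,2)] st by simp
  qed
  define f where "f = (\<lambda>z. \<sigma> (SOME t. t \<in> carrier T \<and> \<rho> t x = z) y)"
  have f: "f (\<rho> t x) = \<sigma> t y" if "t \<in> carrier T" for t
  proof -
    have "(SOME s. s \<in> carrier T \<and> \<rho> s x = \<rho> t x) \<in> carrier T \<and>
      \<rho> (SOME s. s \<in> carrier T \<and> \<rho> s x = \<rho> t x) x = \<rho> t x"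
      by (rule someI[of _ t]) (use that in simp)
    then show ?thesis unfolding f_def using key that by blast
  qed
  have Xeq: "X = (\<lambda>t. \<rho> t x) ` carrier T" and Yeq: "Y = (\<lambda>t. \<sigma> t y) ` carrier T"
    using X(3) Y(3) by (auto simp: orbit_def)
  have "bij_betw f X Y"
  proof (rule bij_betw_imageI)
    show "inj_on f X" unfolding Xeq by (rule inj_onI) (use f key in auto)
    show "f ` X = Y" unfolding Xeq Yeq by (force simp: f)
  qed
  moreover have "f (\<rho> t z) = \<sigma> t (f z)" if tz: "t \<in> carrier T" "z \<in> X" for t z
  proof -
    obtain s where s: "s \<in> carrier T" "z = \<rho> s x" using tz Xeq by auto
    have "\<rho> t z = \<rho> (t \<otimes>\<^bsub>T\<^esub> s) x" "\<sigma> t (\<sigma> s y) = \<sigma> (t \<otimes>\<^bsub>T\<^esub> s) y"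
      using X.composition_rule[OF X(2) tz(1) s(1)] Y.composition_rule[OF Y(2) tz(1) s(1)] s by simp_all
    then show ?thesis using f tz s by simp
  qed
  moreover have "f x = y"
    using f[of "\<one>\<^bsub>T\<^esub>"] X.id_eq_one Y.id_eq_one X(2) Y(2) by (metis T.one_closed restrict_apply')
  ultimately show ?thesis by blast
qed

text \<open>The isomorphism class of the transitive bisets with stabilizer \<open>S\<close>; it is empty unless \<open>S\<close> meets
  \<open>A\<close> trivially.\<close>

definition cl :: "'a monoid \<Rightarrow> 'g monoid \<Rightarrow> 'h monoid \<Rightarrow> ('a \<times> 'g \<times> 'h) set \<Rightarrow> ('a, 'g, 'h) iso_class" where
  "cl A G H S = {(Y, \<sigma>). fibered_biset A G H (Y, \<sigma>) \<and>
     (\<exists>y\<in>Y. Y = orbit (A \<times>\<times> G \<times>\<times> H) \<sigma> y \<and> stabilizer (A \<times>\<times> G \<times>\<times> H) \<sigma> y = S)}"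

lemma fibered_bisetD:
  assumes "fibered_biset A G H (X, \<rho>)"
  shows "group_action (A \<times>\<times> G \<times>\<times> H) X \<rho>"
    and "x \<in> X \<Longrightarrow> a \<in> carrier A \<Longrightarrow> \<rho> (a, \<one>\<^bsub>G\<^esub>, \<one>\<^bsub>H\<^esub>) x = x \<Longrightarrow> a = \<one>\<^bsub>A\<^esub>"
    and "finite (orbits A X (\<lambda>a. \<rho> (a, \<one>\<^bsub>G\<^esub>, \<one>\<^bsub>H\<^esub>)))"
  using assms by (auto simp: fibered_biset_def stabilizer_def)

context tri_group
begin

lemma tri_actionI: "group_action T X \<rho> \<Longrightarrow> tri_action A G H X \<rho>"
  by (intro tri_action.intro tri_group_axioms)

lemma fibered_bisetI:
  assumes "group_action T X \<rho>"
    and "\<And>x a. x \<in> X \<Longrightarrow> a \<in> carrier A \<Longrightarrow> \<rho> (a, \<one>\<^bsub>G\<^esub>, \<one>\<^bsub>H\<^esub>) x = x \<Longrightarrow> a = \<one>\<^bsub>A\<^esub>"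
    and "finite (orbits A X (\<lambda>a. \<rho> (a, \<one>\<^bsub>G\<^esub>, \<one>\<^bsub>H\<^esub>)))"
  shows "fibered_biset A G H (X, \<rho>)"
proof -
  interpret tri_action A G H X \<rho> by (rule tri_actionI) fact
  show ?thesis using assms act_one unfolding fibered_biset_def stabilizer_def by auto
qed

lemma fibered_stb:
  assumes "fibered_biset A G H (X, \<rho>)" "x \<in> X"
  shows "fib A G H (stabilizer T \<rho> x)"
proof -
  interpret tri_action A G H X \<rho> by (rule tri_actionI) (rule fibered_bisetD(1)[OF assms(1)])
  show ?thesis unfolding fib_def using subgroup_stb[OF assms(2)] fibered_bisetD(2)[OF assms]
    by (auto simp: mem_stb)
qed

text \<open>A transitive biset is determined up to isomorphism by the stabilizer of one point. The
  type of the elements of \<open>X\<close> is arbitrary here, so bisets of different origin, tensor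
  products among them, are compared through their stabilizers.\<close>

lemma iso_class_cl:
  fixes X :: "'x set"
  assumes X: "group_action T X \<rho>" and x: "x \<in> X" "X = orbit T \<rho> x"
  shows "iso_class A G H (X, \<rho>) = cl A G H (stabilizer T \<rho> x)"
proof -
  interpret X: tri_action A G H X \<rho> by (rule tri_actionI) (rule X)
  have "(Y, \<sigma>) \<in> cl A G H (stabilizer T \<rho> x)" if "(Y, \<sigma>) \<in> iso_class A G H (X, \<rho>)"
    for Y :: "('a \<times> 'g \<times> 'h) set set" and \<sigma>
  proof -
    note that
    then obtain f where Y: "fibered_biset A G H (Y, \<sigma>)" and f: "bij_betw f X Y"
      "\<forall>t\<in>carrier T. \<forall>x\<in>X. f (\<rho> t x) = \<sigma> t (f x)"
      by (auto simp: iso_class_def biset_iso_def)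
    have "orbit T \<sigma> (f x) = f ` X"
      unfolding arg_cong[OF x(2), of "image f"]
      by (rule equivariant_orbit) (use f(2) x(1) in blast)
    moreover have "stabilizer T \<sigma> (f x) = stabilizer T \<rho> x"
      by (rule equivariant_stabilizer) (use f x X.act_closed in \<open>auto simp: bij_betw_def\<close>)
    moreover have "f ` X = Y" "f x \<in> Y" using f(1) x(1) by (auto simp: bij_betw_def)
    ultimately show "(Y, \<sigma>) \<in> cl A G H (stabilizer T \<rho> x)"
      using Y unfolding cl_def by (auto intro!: bexI[of _ "f x"])
  qed
  moreover have "(Y, \<sigma>) \<in> iso_class A G H (X, \<rho>)" if "(Y, \<sigma>) \<in> cl A G H (stabilizer T \<rho> x)"
    for Y :: "('a \<times> 'g \<times> 'h) set set" and \<sigma>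
  proof -
    note that
    then obtain y where Y: "fibered_biset A G H (Y, \<sigma>)" "y \<in> Y" "Y = orbit T \<sigma> y"
      "stabilizer T \<sigma> y = stabilizer T \<rho> x"
      by (auto simp: cl_def)
    obtain f where "bij_betw f X Y" "\<forall>t\<in>carrier T. \<forall>x\<in>X. f (\<rho> t x) = \<sigma> t (f x)"
      using same_stabilizer_iso[OF X x fibered_bisetD(1)[OF Y(1)] Y(2,3) Y(4)[symmetric]] by blast
    then show "(Y, \<sigma>) \<in> iso_class A G H (X, \<rho>)"
      using Y(1) unfolding iso_class_def biset_iso_def by auto
  qed
  ultimately show ?thesis by auto
qed

lemma orbit_class:
  assumes X: "group_action T X \<rho>" and x: "x \<in> X"
  shows "iso_class A G H (orbit T \<rho> x, \<lambda>t. restrict (\<rho> t) (orbit T \<rho> x)) = cl A G H (stabilizer T \<rho> x)"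
proof -
  interpret X: tri_action A G H X \<rho> by (rule tri_actionI) (rule X)
  have mem: "x \<in> orbit T \<rho> x" using X.orbit_refl x by blast
  have "orbit T (\<lambda>t. restrict (\<rho> t) (orbit T \<rho> x)) x = orbit T \<rho> x"
    using mem by (auto simp: orbit_def)
  moreover have "stabilizer T (\<lambda>t. restrict (\<rho> t) (orbit T \<rho> x)) x = stabilizer T \<rho> x"
    using mem by (auto simp: stabilizer_def)
  ultimately show ?thesis
    using iso_class_cl[OF X.orbit_action[OF x] mem] by simp
qed

end

section \<open>Counting orbits by isomorphism type\<close>

abbreviation orb_class where
  "orb_class A G H \<rho> w \<equiv> iso_class A G H (w, \<lambda>t. restrict (\<rho> t) w)"

context tri_group
begin

text \<open>An equivariant injection maps orbits to orbits with the same stabilizers. It is stated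
  for an embedding, not only for a bijection, because it is applied to the part of a tensor product
  that lies over a given pair of orbits.\<close>

lemma card_orbits_equivariant:
  assumes X: "group_action T X \<rho>" and Y: "group_action T Y \<sigma>"
    and f: "f \<in> X \<rightarrow> Y" "inj_on f X" "\<And>t x. t \<in> carrier T \<Longrightarrow> x \<in> X \<Longrightarrow> f (\<rho> t x) = \<sigma> t (f x)"
  shows "card {w \<in> orbits T X \<rho>. orb_class A G H \<rho> w = d} =
    card {w \<in> orbits T Y \<sigma>. w \<subseteq> f ` X \<and> orb_class A G H \<sigma> w = d}"
proof -
  interpret X: tri_action A G H X \<rho> by (rule tri_actionI) (rule X)
  interpret Y: tri_action A G H Y \<sigma> by (rule tri_actionI) (rule Y)
  have orb: "orbit T \<sigma> (f x) = f ` orbit T \<rho> x" if "x \<in> X" for x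
    by (rule equivariant_orbit) (use f(3) that in blast)
  have stab: "stabilizer T \<sigma> (f x) = stabilizer T \<rho> x" if "x \<in> X" for x
    by (rule equivariant_stabilizer) (use f that X.act_closed in blast)+
  have cls: "orb_class A G H \<sigma> (orbit T \<sigma> (f x)) = orb_class A G H \<rho> (orbit T \<rho> x)" if "x \<in> X" for x
    using orbit_class[OF X that] orbit_class[OF Y, of "f x"] stab[OF that] f(1) that by auto
  have "bij_betw ((`) f) {w \<in> orbits T X \<rho>. orb_class A G H \<rho> w = d}
    {w \<in> orbits T Y \<sigma>. w \<subseteq> f ` X \<and> orb_class A G H \<sigma> w = d}"
  proof (rule bij_betw_imageI)
    show "inj_on ((`) f) {w \<in> orbits T X \<rho>. orb_class A G H \<rho> w = d}"
    proof (rule inj_onI)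
      fix v w assume "v \<in> {w \<in> orbits T X \<rho>. orb_class A G H \<rho> w = d}"
        "w \<in> {w \<in> orbits T X \<rho>. orb_class A G H \<rho> w = d}" and eq: "f ` v = f ` w"
      then have "v \<subseteq> X" "w \<subseteq> X" using X.orbit_subset by (auto simp: orbits_def)
      then show "v = w" using eq f(2) by (simp add: inj_on_image_eq_iff)
    qed
    show "(`) f ` {w \<in> orbits T X \<rho>. orb_class A G H \<rho> w = d} =
      {w \<in> orbits T Y \<sigma>. w \<subseteq> f ` X \<and> orb_class A G H \<sigma> w = d}" (is "?L = ?R")
    proof
      show "?L \<subseteq> ?R"
      proof
        fix v assume "v \<in> ?L"
        then obtain x where x: "x \<in> X" "v = f ` orbit T \<rho> x" "orb_class A G H \<rho> (orbit T \<rho> x) = d"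
          by (auto simp: orbits_def)
        have "v = orbit T \<sigma> (f x)" using x orb by simp
        moreover have "v \<subseteq> f ` X" using x X.orbit_subset by blast
        moreover have "f x \<in> Y" using f(1) x(1) by blast
        ultimately show "v \<in> ?R" using cls[OF x(1)] x(3) by (auto simp: orbits_def)
      qed
      show "?R \<subseteq> ?L"
      proof
        fix v assume v: "v \<in> ?R"
        then obtain y where y: "y \<in> Y" "v = orbit T \<sigma> y" by (auto simp: orbits_def)
        then obtain x where x: "x \<in> X" "y = f x" using v Y.orbit_refl by blast
        have "v = f ` orbit T \<rho> x" using x y orb by simp
        moreover have "orb_class A G H \<rho> (orbit T \<rho> x) = d" using cls[OF x(1)] v x y by simp
        ultimately show "v \<in> ?L" using x(1) by (auto simp: orbits_def)
      qed
    qed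
  qed
  then show ?thesis by (rule bij_betw_same_card)
qed

lemma biset_class_iso:
  assumes X: "group_action T X \<rho>" and Y: "group_action T Y \<sigma>"
    and f: "bij_betw f X Y" "\<And>t x. t \<in> carrier T \<Longrightarrow> x \<in> X \<Longrightarrow> f (\<rho> t x) = \<sigma> t (f x)"
  shows "biset_class R A G H (X, \<rho>) = biset_class R A G H (Y, \<sigma>)"
proof
  fix d
  interpret Y: tri_action A G H Y \<sigma> by (rule tri_actionI) (rule Y)
  have "card {w \<in> orbits T X \<rho>. orb_class A G H \<rho> w = d} =
    card {w \<in> orbits T Y \<sigma>. w \<subseteq> f ` X \<and> orb_class A G H \<sigma> w = d}"
    by (rule card_orbits_equivariant[OF X Y]) (use f in \<open>auto simp: bij_betw_def\<close>)
  also have "{w \<in> orbits T Y \<sigma>. w \<subseteq> f ` X \<and> orb_class A G H \<sigma> w = d} =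
    {w \<in> orbits T Y \<sigma>. orb_class A G H \<sigma> w = d}"
    using f(1) Y.orbit_subset by (auto simp: bij_betw_def orbits_def)
  finally show "biset_class R A G H (X, \<rho>) d = biset_class R A G H (Y, \<sigma>) d"
    unfolding biset_class_def prod.case by (rule arg_cong)
qed

text \<open>Every orbit of the triple product contains an orbit of \<open>A\<close>, and by
  assumption there are finitely many of those.\<close>

lemma finite_orbits:
  assumes X: "fibered_biset A G H (X, \<rho>)"
  shows "finite (orbits T X \<rho>)"
proof -
  interpret X: tri_action A G H X \<rho> by (rule tri_actionI) (rule fibered_bisetD(1)[OF X])
  have "orbits T X \<rho> \<subseteq> (\<lambda>w. orbit T \<rho> (SOME x. x \<in> w)) ` orbits A X (\<lambda>a. \<rho> (a, \<one>\<^bsub>G\<^esub>, \<one>\<^bsub>H\<^esub>))"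
  proof
    fix w assume "w \<in> orbits T X \<rho>"
    then obtain x where x: "x \<in> X" "w = orbit T \<rho> x" by (auto simp: orbits_def)
    let ?v = "orbit A (\<lambda>a. \<rho> (a, \<one>\<^bsub>G\<^esub>, \<one>\<^bsub>H\<^esub>)) x"
    have sub: "?v \<subseteq> w" unfolding x(2) by (auto simp: orbit_def)
    have "x \<in> ?v" unfolding orbit_def using X.act_one[OF x(1)] by force
    then have "(SOME x. x \<in> ?v) \<in> ?v" by (rule someI)
    then have "orbit T \<rho> (SOME x. x \<in> ?v) = w" using sub X.orbit_eq[OF x(1)] x(2) by blast
    moreover have "?v \<in> orbits A X (\<lambda>a. \<rho> (a, \<one>\<^bsub>G\<^esub>, \<one>\<^bsub>H\<^esub>))" using x(1) by (auto simp: orbits_def)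
    ultimately show "w \<in> (\<lambda>w. orbit T \<rho> (SOME x. x \<in> w)) ` orbits A X (\<lambda>a. \<rho> (a, \<one>\<^bsub>G\<^esub>, \<one>\<^bsub>H\<^esub>))"
      by force
  qed
  then show ?thesis using fibered_bisetD(3)[OF X] finite_surj by blast
qed

end

section \<open>Coset bisets and the basis of the Burnside module\<close>

locale fin_tri_group = tri_group A G H
  for A :: "'a monoid" and G :: "'g monoid" and H :: "'h monoid" +
  assumes finite_G: "finite (carrier G)" and finite_H: "finite (carrier H)"
begin

text \<open>\<open>std_biset\<close> with the stabilizer in place of the pair that it comes
  from.\<close>

definition sb where "sb S = (lcosets\<^bsub>T\<^esub> S, \<lambda>t. \<lambda>C\<in>lcosets\<^bsub>T\<^esub> S. t <#\<^bsub>T\<^esub> C)"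

lemma sb_props:
  assumes S: "fib A G H S"
  defines "X \<equiv> lcosets\<^bsub>T\<^esub> S" and "\<rho> \<equiv> (\<lambda>t. \<lambda>C\<in>lcosets\<^bsub>T\<^esub> S. t <#\<^bsub>T\<^esub> C)"
  shows "fibered_biset A G H (X, \<rho>)" "S \<in> X" "X = orbit T \<rho> S" "stabilizer T \<rho> S = S"
proof -
  have sub: "subgroup S T" and free: "\<And>a. (a, \<one>\<^bsub>G\<^esub>, \<one>\<^bsub>H\<^esub>) \<in> S \<Longrightarrow> a = \<one>\<^bsub>A\<^esub>"
    using S by (auto simp: fib_def)
  interpret S: subgroup S T by (rule sub)
  have ST: "S \<subseteq> carrier T" by (rule S.subset)
  have Xmem: "C \<in> X \<longleftrightarrow> (\<exists>t\<in>carrier T. C = t <#\<^bsub>T\<^esub> S)" for C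
    by (auto simp: X_def LCOSETS_def)
  have assoc: "s <#\<^bsub>T\<^esub> (t <#\<^bsub>T\<^esub> S) = (s \<otimes>\<^bsub>T\<^esub> t) <#\<^bsub>T\<^esub> S" if "s \<in> carrier T" "t \<in> carrier T" for s t
    using T.lcos_m_assoc[OF ST that] .
  have rho: "\<rho> s (t <#\<^bsub>T\<^esub> S) = (s \<otimes>\<^bsub>T\<^esub> t) <#\<^bsub>T\<^esub> S" if "s \<in> carrier T" "t \<in> carrier T" for s t
    using that assoc Xmem[of "t <#\<^bsub>T\<^esub> S"] by (auto simp: \<rho>_def X_def simp del: carrier_DirProd)
  have act: "group_action T X \<rho>"
  proof (rule group_actionI[OF T.group_axioms])
    fix t assume "t \<in> carrier T" then show "\<rho> t \<in> extensional X" by (simp add: \<rho>_def X_def)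
  next
    fix t C assume "t \<in> carrier T" "C \<in> X"
    then show "\<rho> t C \<in> X" using rho Xmem by (metis T.m_closed)
  next
    fix C assume "C \<in> X"
    then show "\<rho> \<one>\<^bsub>T\<^esub> C = C" using rho Xmem by (metis T.l_one T.one_closed)
  next
    fix s t C assume st: "s \<in> carrier T" "t \<in> carrier T" "C \<in> X"
    then obtain u where u: "u \<in> carrier T" "C = u <#\<^bsub>T\<^esub> S" using Xmem by blast
    show "\<rho> (s \<otimes>\<^bsub>T\<^esub> t) C = \<rho> s (\<rho> t C)"
      unfolding u(2) using rho[OF T.m_closed[OF st(1,2)] u(1)] rho[OF st(2) u(1)]
        rho[OF st(1) T.m_closed[OF st(2) u(1)]] T.m_assoc[OF st(1,2) u(1)] by metis
  qed
  interpret X: tri_action A G H X \<rho> by (rule tri_actionI) (rule act)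
  have one: "\<one>\<^bsub>T\<^esub> <#\<^bsub>T\<^esub> S = S" by (rule T.lcos_mult_one[OF ST])
  show SX: "S \<in> X" using Xmem one by (metis T.one_closed)
  have rhoS: "\<rho> t S = t <#\<^bsub>T\<^esub> S" if "t \<in> carrier T" for t
    using rho[OF that T.one_closed] that one by (simp del: carrier_DirProd one_DirProd)
  show orb: "X = orbit T \<rho> S"
  proof -
    have "X = (\<lambda>t. t <#\<^bsub>T\<^esub> S) ` carrier T" unfolding X_def LCOSETS_def by blast
    also have "\<dots> = (\<lambda>t. \<rho> t S) ` carrier T" using rhoS by (intro image_cong) simp_all
    finally show ?thesis unfolding orbit_def by blast
  qed
  show stb: "stabilizer T \<rho> S = S"
  proof -
    have "t <#\<^bsub>T\<^esub> S = S \<longleftrightarrow> t \<in> S" if "t \<in> carrier T" for t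
      using that T.lcos_self[OF that sub] T.coset_join3[OF that sub] by auto
    then have "{g \<in> carrier T. \<rho> g S = S} = {g \<in> carrier T. g \<in> S}"
      using rhoS by (intro Collect_cong conj_cong refl) simp
    also have "\<dots> = S" using ST by blast
    finally show ?thesis unfolding stabilizer_def .
  qed
  show "fibered_biset A G H (X, \<rho>)"
  proof (rule fibered_bisetI[OF act])
    fix C a assume C: "C \<in> X" and a: "a \<in> carrier A" "\<rho> (a, \<one>\<^bsub>G\<^esub>, \<one>\<^bsub>H\<^esub>) C = C"
    then obtain t where t: "t \<in> carrier T" "C = \<rho> t S" using orb by (auto simp: orbit_def)
    obtain b g h where bgh: "t = (b, g, h)" "b \<in> carrier A" "g \<in> carrier G" "h \<in> carrier H"
      using t(1) by auto
    have "(a, \<one>\<^bsub>G\<^esub>, \<one>\<^bsub>H\<^esub>) \<in> stabilizer T \<rho> (\<rho> t S)"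
      using a t(2) by (simp add: stabilizer_def)
    then obtain s where s: "s \<in> S" "(a, \<one>\<^bsub>G\<^esub>, \<one>\<^bsub>H\<^esub>) = t \<otimes>\<^bsub>T\<^esub> s \<otimes>\<^bsub>T\<^esub> inv\<^bsub>T\<^esub> t"
      unfolding X.stb_conj[OF SX t(1)] stb by blast
    \<comment> \<open>Elements of the fibre are central, so conjugating \<open>(a, 1, 1)\<close>
      back by \<open>t\<close> does not change it; it lies in \<open>S\<close> itself, which meets
      \<open>A\<close> trivially.\<close>
    have "s = inv\<^bsub>T\<^esub> t \<otimes>\<^bsub>T\<^esub> (a, \<one>\<^bsub>G\<^esub>, \<one>\<^bsub>H\<^esub>) \<otimes>\<^bsub>T\<^esub> t"
      unfolding s(2) using t(1) S.mem_carrier[OF s(1)]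
      by (metis T.inv_closed T.m_assoc T.m_closed T.l_inv T.r_one T.l_one)
    also have "\<dots> = (a, \<one>\<^bsub>G\<^esub>, \<one>\<^bsub>H\<^esub>)"
      using bgh a(1) by (simp add: inv_T A.m_ac)
    finally show "a = \<one>\<^bsub>A\<^esub>" using free s(1) by simp
  next
    let ?o = "orbit A (\<lambda>a. \<rho> (a, \<one>\<^bsub>G\<^esub>, \<one>\<^bsub>H\<^esub>))"
    \<comment> \<open>The fibre component of a coset representative can be absorbed into the acting
      element of \<open>A\<close>, so the orbits of \<open>A\<close> are indexed by a quotient of
      the finite set of pairs \<open>(g, h)\<close>.\<close>
    have "orbits A X (\<lambda>a. \<rho> (a, \<one>\<^bsub>G\<^esub>, \<one>\<^bsub>H\<^esub>)) \<subseteq>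
      (\<lambda>(g, h). ?o (\<rho> (\<one>\<^bsub>A\<^esub>, g, h) S)) ` (carrier G \<times> carrier H)"
    proof
      fix w assume "w \<in> orbits A X (\<lambda>a. \<rho> (a, \<one>\<^bsub>G\<^esub>, \<one>\<^bsub>H\<^esub>))"
      then obtain t where t: "t \<in> carrier T" "w = ?o (\<rho> t S)"
        using orb by (auto simp: orbits_def orbit_def[of T \<rho> S])
      obtain b g h where bgh: "t = (b, g, h)" "b \<in> carrier A" "g \<in> carrier G" "h \<in> carrier H"
        using t(1) by auto
      have "?o (\<rho> (b, g, h) S) = ?o (\<rho> (\<one>\<^bsub>A\<^esub>, g, h) S)" (is "?L = ?R")
      proof
        show "?L \<subseteq> ?R"
        proof
          fix C assume "C \<in> ?L"
          then obtain a where a: "a \<in> carrier A" "C = \<rho> (a, \<one>\<^bsub>G\<^esub>, \<one>\<^bsub>H\<^esub>) (\<rho> (b, g, h) S)" by (auto simp: orbit_def)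
          then have "C = \<rho> (a \<otimes>\<^bsub>A\<^esub> b, \<one>\<^bsub>G\<^esub>, \<one>\<^bsub>H\<^esub>) (\<rho> (\<one>\<^bsub>A\<^esub>, g, h) S)"
            using bgh SX by (simp add: X.act_act)
          then show "C \<in> ?R" using a(1) bgh(2) unfolding orbit_def by blast
        qed
        show "?R \<subseteq> ?L"
        proof
          fix C assume "C \<in> ?R"
          then obtain a where a: "a \<in> carrier A" "C = \<rho> (a, \<one>\<^bsub>G\<^esub>, \<one>\<^bsub>H\<^esub>) (\<rho> (\<one>\<^bsub>A\<^esub>, g, h) S)" by (auto simp: orbit_def)
          then have "C = \<rho> (a \<otimes>\<^bsub>A\<^esub> inv\<^bsub>A\<^esub> b, \<one>\<^bsub>G\<^esub>, \<one>\<^bsub>H\<^esub>) (\<rho> (b, g, h) S)"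
            using bgh SX by (simp add: X.act_act A.m_assoc)
          then show "C \<in> ?L" using a(1) bgh(2) unfolding orbit_def by blast
        qed
      qed
      then show "w \<in> (\<lambda>(g, h). ?o (\<rho> (\<one>\<^bsub>A\<^esub>, g, h) S)) ` (carrier G \<times> carrier H)"
        using t bgh by force
    qed
    then show "finite (orbits A X (\<lambda>a. \<rho> (a, \<one>\<^bsub>G\<^esub>, \<one>\<^bsub>H\<^esub>)))"
      by (rule finite_subset) (use finite_G finite_H in simp)
  qed
qed

lemma sb_cl: "fib A G H S \<Longrightarrow> sb S \<in> cl A G H S"
  unfolding cl_def sb_def using sb_props[of S] by (auto intro!: bexI[of _ S])

lemma clD:
  assumes "(Y, \<sigma>) \<in> cl A G H S"
  obtains y where "fibered_biset A G H (Y, \<sigma>)" "tri_action A G H Y \<sigma>" "y \<in> Y" "Y = orbit T \<sigma> y" "stabilizer T \<sigma> y = S"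
  using assms fibered_bisetD(1) tri_actionI unfolding cl_def by blast

text \<open>If the classes agree, one transitive biset has points with stabilizers \<open>S\<close>
  and \<open>S'\<close>, and the element that moves the first point to the second conjugates the
  stabilizers.\<close>

lemma cl_eqD:
  assumes "cl A G H S = cl A G H S'" "fib A G H S"
  obtains t where "t \<in> carrier T" "S' = {t \<otimes>\<^bsub>T\<^esub> s \<otimes>\<^bsub>T\<^esub> inv\<^bsub>T\<^esub> t | s. s \<in> S}"
proof -
  obtain Y \<sigma> where Y: "sb S = (Y, \<sigma>)" by fastforce
  then have mem: "(Y, \<sigma>) \<in> cl A G H S" using sb_cl[OF assms(2)] by simp
  then obtain y where y: "tri_action A G H Y \<sigma>" "y \<in> Y" "Y = orbit T \<sigma> y" "stabilizer T \<sigma> y = S"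
    by (rule clD)
  have "(Y, \<sigma>) \<in> cl A G H S'" using mem assms(1) by simp
  then obtain z where z: "z \<in> Y" "stabilizer T \<sigma> z = S'" by (rule clD)
  then obtain t where t: "t \<in> carrier T" "z = \<sigma> t y" using y(3) by (auto simp: orbit_def)
  show thesis
    using that[OF t(1)] tri_action.stb_conj[OF y(1,2) t(1)] y(4) z(2) t(2) by simp
qed

lemma iso_classes_eq: "iso_classes A G H = cl A G H ` {S. fib A G H S}"
proof
  show "iso_classes A G H \<subseteq> cl A G H ` {S. fib A G H S}"
  proof
    fix b assume "b \<in> iso_classes A G H"
    then obtain Y :: "('a \<times> 'g \<times> 'h) set set" and \<sigma>
      where Y: "b = iso_class A G H (Y, \<sigma>)" "transitive_biset A G H (Y, \<sigma>)"
      unfolding iso_classes_def by auto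
    then have f: "fibered_biset A G H (Y, \<sigma>)" "Y \<noteq> {}" and tr: "transitive_action T Y \<sigma>"
      by (auto simp: transitive_biset_def)
    obtain y where y: "y \<in> Y" using f(2) by blast
    interpret Y: tri_action A G H Y \<sigma> by (rule tri_actionI) (rule fibered_bisetD(1)[OF f(1)])
    have "Y \<subseteq> orbit T \<sigma> y"
      unfolding orbit_def using transitive_action.unique_orbit[OF tr y] by force
    then have "Y = orbit T \<sigma> y" using Y.orbit_subset[OF y] by blast
    then have "b = cl A G H (stabilizer T \<sigma> y)"
      using iso_class_cl[OF fibered_bisetD(1)[OF f(1)] y] Y(1) by simp
    then show "b \<in> cl A G H ` {S. fib A G H S}" using fibered_stb[OF f(1) y] by blast
  qed
  show "cl A G H ` {S. fib A G H S} \<subseteq> iso_classes A G H"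
  proof
    fix b assume "b \<in> cl A G H ` {S. fib A G H S}"
    then obtain S where S: "fib A G H S" "b = cl A G H S" by blast
    obtain Y \<sigma> where Y: "sb S = (Y, \<sigma>)" by fastforce
    then have "(Y, \<sigma>) \<in> cl A G H S" using sb_cl[OF S(1)] by simp
    then obtain y where y: "fibered_biset A G H (Y, \<sigma>)" "tri_action A G H Y \<sigma>" "y \<in> Y" "Y = orbit T \<sigma> y" "stabilizer T \<sigma> y = S"
      by (rule clD)
    interpret Y: tri_action A G H Y \<sigma> by (rule y(2))
    have "transitive_action T Y \<sigma>"
    proof (intro transitive_action.intro transitive_action_axioms.intro Y.group_action_axioms)
      fix u v assume uv: "u \<in> Y" "v \<in> Y"
      then have "v \<in> orbit T \<sigma> u" using y(4) Y.orbit_eq[OF y(3)] by blast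
      then show "\<exists>g\<in>carrier T. \<sigma> g u = v" by (auto simp: orbit_def)
    qed
    then have "transitive_biset A G H (Y, \<sigma>)" using y by (auto simp: transitive_biset_def)
    moreover have "b = iso_class A G H (Y, \<sigma>)"
      using iso_class_cl[OF fibered_bisetD(1)[OF y(1)] y(3,4)] S(2) y(5) by simp
    ultimately show "b \<in> iso_classes A G H" unfolding iso_classes_def by blast
  qed
qed

end

context fin_tri_group
begin

lemma biset_class_orbit:
  assumes R: "cring R" and X: "group_action T X \<rho>" and x: "x \<in> X" "X = orbit T \<rho> x"
  shows "biset_class R A G H (X, \<rho>) = single R (cl A G H (stabilizer T \<rho> x))"
proof
  fix d
  interpret R: cring R by (rule R)
  interpret X: tri_action A G H X \<rho> by (rule tri_actionI) (rule X)
  have "orbit T \<rho> y = X" if "y \<in> X" for y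
    using X.orbit_eq[OF x(1)] that x(2) by blast
  then have "orbits T X \<rho> = {X}"
    using x(1) unfolding orbits_def by blast
  then have "{w \<in> orbits T X \<rho>. orb_class A G H \<rho> w = d} =
    (if d = cl A G H (stabilizer T \<rho> x) then {X} else {})"
    using orbit_class[OF X x(1), folded x(2)] by auto
  then show "biset_class R A G H (X, \<rho>) d = single R (cl A G H (stabilizer T \<rho> x)) d"
    by (simp add: biset_class_def single_def)
qed

lemma biset_class_empty:
  assumes R: "cring R" shows "biset_class R A G H ({}, \<rho>) = (\<lambda>d. \<zero>\<^bsub>R\<^esub>)"
proof -
  interpret R: cring R by (rule R)
  show ?thesis by (auto simp: biset_class_def orbits_def)
qed

lemma burnside_eq: "burnside R A G H = fin_supp R (iso_classes A G H)"
  by (simp add: burnside_def fin_supp_def)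

lemma cl_iso_classes: "fib A G H S \<Longrightarrow> cl A G H S \<in> iso_classes A G H"
  unfolding iso_classes_eq by blast

lemma biset_class_burnside:
  assumes R: "cring R" and X: "fibered_biset A G H (X, \<rho>)"
  shows "biset_class R A G H (X, \<rho>) \<in> fin_supp R (iso_classes A G H)"
proof -
  interpret R: cring R by (rule R)
  let ?c = "orb_class A G H \<rho> ` orbits T X \<rho>"
  have "b \<in> ?c" if "biset_class R A G H (X, \<rho>) b \<noteq> \<zero>\<^bsub>R\<^esub>" for b
  proof (rule ccontr)
    assume "b \<notin> ?c"
    then have E: "{w \<in> orbits T X \<rho>. orb_class A G H \<rho> w = b} = {}" by blast
    show False using that unfolding biset_class_def prod.case E by simp
  qed
  then have "{b. biset_class R A G H (X, \<rho>) b \<noteq> \<zero>\<^bsub>R\<^esub>} \<subseteq> ?c" by blast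
  moreover have "finite ?c" using finite_orbits[OF X] by blast
  moreover have "?c \<subseteq> iso_classes A G H"
    using orbit_class[OF fibered_bisetD(1)[OF X]] fibered_stb[OF X] cl_iso_classes
    by (auto simp: orbits_def)
  moreover have "biset_class R A G H (X, \<rho>) b \<in> carrier R" for b by (simp add: biset_class_def)
  ultimately show ?thesis unfolding fin_supp_def using finite_subset by blast
qed

end

section \<open>Tensor products of transitive bisets\<close>

text \<open>On graphs of \<open>(U, \<phi>)\<close> and \<open>(V, \<psi>)\<close> this is the
  composite of the relations \<open>U\<close> and \<open>V\<close> with the product of
  \<open>\<phi>\<close> and \<open>\<psi>\<close> as label. The label of a composite element may
  depend on the middle element; exactly then the result is no longer a graph over its
  projection.\<close>

definition tcomp :: "'a monoid \<Rightarrow> ('a \<times> 'g \<times> 'h) set \<Rightarrow> ('a \<times> 'h \<times> 'i) set \<Rightarrow> ('a \<times> 'g \<times> 'i) set" where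
  "tcomp A S S' = {(c \<otimes>\<^bsub>A\<^esub> d, g, i) | c d g h i. (c, g, h) \<in> S \<and> (d, h, i) \<in> S'}"

text \<open>Split off from \<open>fib\<close> because a composite of two subgroups that meet
  \<open>A\<close> trivially may meet \<open>A\<close> in more than the identity. The corresponding
  points of the orbit set are those that the tensor product discards.\<close>

definition afree :: "'a monoid \<Rightarrow> 'g monoid \<Rightarrow> 'h monoid \<Rightarrow> ('a \<times> 'g \<times> 'h) set \<Rightarrow> bool" where
  "afree A G H S \<longleftrightarrow> (\<forall>a. (a, \<one>\<^bsub>G\<^esub>, \<one>\<^bsub>H\<^esub>) \<in> S \<longrightarrow> a = \<one>\<^bsub>A\<^esub>)"

lemma fib_alt: "fib A G H S \<longleftrightarrow> subgroup S (A \<times>\<times> G \<times>\<times> H) \<and> afree A G H S"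
  by (simp add: fib_def afree_def)

section \<open>Points, action and stabilizers of a tensor product\<close>

locale tensor_pair = X: tri_action A G H X \<rho> + Y: tri_action A H I Y \<sigma>
  for A :: "'a monoid" and G :: "'g monoid" and H :: "'h monoid" and I :: "'i monoid"
    and X :: "'x set" and \<rho> and Y :: "'y set" and \<sigma>
begin

sublocale GI: tri_group A G I
  by (intro tri_group.intro X.A.comm_group_axioms X.G.group_axioms Y.H.group_axioms)

text \<open>The point \<open>[x, y]\<close> of the orbit set, in the form used for
  calculation.\<close>

definition tn where
  "tn x y = {(\<rho> (inv\<^bsub>A\<^esub> a, \<one>\<^bsub>G\<^esub>, h) x, \<sigma> (a, h, \<one>\<^bsub>I\<^esub>) y) | a h. a \<in> carrier A \<and> h \<in> carrier H}"

definition ac where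
  "ac = (\<lambda>(a, g, i) w. (\<lambda>(x, y). (\<rho> (a, g, \<one>\<^bsub>H\<^esub>) x, \<sigma> (\<one>\<^bsub>A\<^esub>, \<one>\<^bsub>H\<^esub>, i) y)) ` w)"

lemma tn_image:
  "tn x y = (\<lambda>(a, h). (\<rho> (inv\<^bsub>A\<^esub> a, \<one>\<^bsub>G\<^esub>, h) x, \<sigma> (a, h, \<one>\<^bsub>I\<^esub>) y)) ` (carrier A \<times> carrier H)"
  by (auto simp: tn_def)

lemma tn_refl: "x \<in> X \<Longrightarrow> y \<in> Y \<Longrightarrow> (x, y) \<in> tn x y"
  unfolding tn_image by (rule image_eqI[of _ _ "(\<one>\<^bsub>A\<^esub>, \<one>\<^bsub>H\<^esub>)"]) (simp_all add: X.act_one Y.act_one)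

lemma tn_subset: "x \<in> X \<Longrightarrow> y \<in> Y \<Longrightarrow> tn x y \<subseteq> X \<times> Y"
  unfolding tn_def using X.act_closed' Y.act_closed' by auto

lemma tn_shift_subset:
  assumes "x \<in> X" "y \<in> Y" "a \<in> carrier A" "h \<in> carrier H"
  shows "tn (\<rho> (inv\<^bsub>A\<^esub> a, \<one>\<^bsub>G\<^esub>, h) x) (\<sigma> (a, h, \<one>\<^bsub>I\<^esub>) y) \<subseteq> tn x y"
proof
  fix p assume "p \<in> tn (\<rho> (inv\<^bsub>A\<^esub> a, \<one>\<^bsub>G\<^esub>, h) x) (\<sigma> (a, h, \<one>\<^bsub>I\<^esub>) y)"
  then obtain b k where b: "b \<in> carrier A" "k \<in> carrier H"
    "p = (\<rho> (inv\<^bsub>A\<^esub> b, \<one>\<^bsub>G\<^esub>, k) (\<rho> (inv\<^bsub>A\<^esub> a, \<one>\<^bsub>G\<^esub>, h) x), \<sigma> (b, k, \<one>\<^bsub>I\<^esub>) (\<sigma> (a, h, \<one>\<^bsub>I\<^esub>) y))"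
    unfolding tn_def by blast
  have "p = (\<rho> (inv\<^bsub>A\<^esub> (b \<otimes>\<^bsub>A\<^esub> a), \<one>\<^bsub>G\<^esub>, k \<otimes>\<^bsub>H\<^esub> h) x, \<sigma> (b \<otimes>\<^bsub>A\<^esub> a, k \<otimes>\<^bsub>H\<^esub> h, \<one>\<^bsub>I\<^esub>) y)"
    using b assms by (simp add: X.act_act Y.act_act X.A.inv_mult)
  moreover have "b \<otimes>\<^bsub>A\<^esub> a \<in> carrier A" "k \<otimes>\<^bsub>H\<^esub> h \<in> carrier H" using b assms by auto
  ultimately show "p \<in> tn x y" unfolding tn_def by blast
qed

lemma tn_shift:
  assumes "x \<in> X" "y \<in> Y" "a \<in> carrier A" "h \<in> carrier H"
  shows "tn (\<rho> (inv\<^bsub>A\<^esub> a, \<one>\<^bsub>G\<^esub>, h) x) (\<sigma> (a, h, \<one>\<^bsub>I\<^esub>) y) = tn x y"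
proof
  let ?x = "\<rho> (inv\<^bsub>A\<^esub> a, \<one>\<^bsub>G\<^esub>, h) x" and ?y = "\<sigma> (a, h, \<one>\<^bsub>I\<^esub>) y"
  show "tn ?x ?y \<subseteq> tn x y" by (rule tn_shift_subset[OF assms])
  have "?x \<in> X" "?y \<in> Y" using assms X.act_closed' Y.act_closed' by auto
  from tn_shift_subset[OF this, of "inv\<^bsub>A\<^esub> a" "inv\<^bsub>H\<^esub> h"]
  have "tn (\<rho> (inv\<^bsub>A\<^esub> (inv\<^bsub>A\<^esub> a), \<one>\<^bsub>G\<^esub>, inv\<^bsub>H\<^esub> h) ?x) (\<sigma> (inv\<^bsub>A\<^esub> a, inv\<^bsub>H\<^esub> h, \<one>\<^bsub>I\<^esub>) ?y) \<subseteq> tn ?x ?y"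
    using assms by simp
  moreover have "\<rho> (inv\<^bsub>A\<^esub> (inv\<^bsub>A\<^esub> a), \<one>\<^bsub>G\<^esub>, inv\<^bsub>H\<^esub> h) ?x = x" "\<sigma> (inv\<^bsub>A\<^esub> a, inv\<^bsub>H\<^esub> h, \<one>\<^bsub>I\<^esub>) ?y = y"
    using assms by (simp_all add: X.act_act Y.act_act X.act_one Y.act_one)
  ultimately show "tn x y \<subseteq> tn ?x ?y" by simp
qed

lemma tn_eq_iff:
  assumes "x \<in> X" "y \<in> Y" "x' \<in> X" "y' \<in> Y"
  shows "tn x y = tn x' y' \<longleftrightarrow>
    (\<exists>a\<in>carrier A. \<exists>h\<in>carrier H. x' = \<rho> (inv\<^bsub>A\<^esub> a, \<one>\<^bsub>G\<^esub>, h) x \<and> y' = \<sigma> (a, h, \<one>\<^bsub>I\<^esub>) y)"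
proof
  assume "tn x y = tn x' y'"
  then have "(x', y') \<in> tn x y" using tn_refl[OF assms(3,4)] by simp
  then show "\<exists>a\<in>carrier A. \<exists>h\<in>carrier H. x' = \<rho> (inv\<^bsub>A\<^esub> a, \<one>\<^bsub>G\<^esub>, h) x \<and> y' = \<sigma> (a, h, \<one>\<^bsub>I\<^esub>) y"
    unfolding tn_def by blast
qed (use tn_shift[OF assms(1,2)] in auto)

lemma ac_tn:
  assumes "x \<in> X" "y \<in> Y" "a \<in> carrier A" "g \<in> carrier G" "i \<in> carrier I"
  shows "ac (a, g, i) (tn x y) = tn (\<rho> (a, g, \<one>\<^bsub>H\<^esub>) x) (\<sigma> (\<one>\<^bsub>A\<^esub>, \<one>\<^bsub>H\<^esub>, i) y)"
proof -
  have *: "\<rho> (a, g, \<one>\<^bsub>H\<^esub>) (\<rho> (inv\<^bsub>A\<^esub> b, \<one>\<^bsub>G\<^esub>, h) x) = \<rho> (inv\<^bsub>A\<^esub> b, \<one>\<^bsub>G\<^esub>, h) (\<rho> (a, g, \<one>\<^bsub>H\<^esub>) x)"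
    "\<sigma> (\<one>\<^bsub>A\<^esub>, \<one>\<^bsub>H\<^esub>, i) (\<sigma> (b, h, \<one>\<^bsub>I\<^esub>) y) = \<sigma> (b, h, \<one>\<^bsub>I\<^esub>) (\<sigma> (\<one>\<^bsub>A\<^esub>, \<one>\<^bsub>H\<^esub>, i) y)"
    if "b \<in> carrier A" "h \<in> carrier H" for b h
    using that assms by (simp_all add: X.act_act Y.act_act X.A.m_comm)
  have "ac (a, g, i) (tn x y) = (\<lambda>(b, h). (\<rho> (a, g, \<one>\<^bsub>H\<^esub>) (\<rho> (inv\<^bsub>A\<^esub> b, \<one>\<^bsub>G\<^esub>, h) x),
      \<sigma> (\<one>\<^bsub>A\<^esub>, \<one>\<^bsub>H\<^esub>, i) (\<sigma> (b, h, \<one>\<^bsub>I\<^esub>) y))) ` (carrier A \<times> carrier H)"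
    unfolding ac_def tn_image prod.case image_image by (intro image_cong) auto
  also have "\<dots> = tn (\<rho> (a, g, \<one>\<^bsub>H\<^esub>) x) (\<sigma> (\<one>\<^bsub>A\<^esub>, \<one>\<^bsub>H\<^esub>, i) y)"
    unfolding tn_image using * by (intro image_cong) auto
  finally show ?thesis .
qed

text \<open>The point is fixed iff some \<open>(b, h)\<close> brings the moved representatives back
  to \<open>x\<close> and \<open>y\<close>. This says that \<open>(inv b \<otimes> a, g, h)\<close>
  fixes \<open>x\<close> and \<open>(b, h, i)\<close> fixes \<open>y\<close>, and the fibre entries
  of these two multiply to \<open>a\<close>. It is the reason why stabilizers in tensor products are
  relational composites.\<close>

lemma ac_tn_stab:
  assumes "x \<in> X" "y \<in> Y" "a \<in> carrier A" "g \<in> carrier G" "i \<in> carrier I"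
  shows "ac (a, g, i) (tn x y) = tn x y \<longleftrightarrow> (a, g, i) \<in> tcomp A (X.stb x) (Y.stb y)"
proof -
  have cl: "\<rho> (a, g, \<one>\<^bsub>H\<^esub>) x \<in> X" "\<sigma> (\<one>\<^bsub>A\<^esub>, \<one>\<^bsub>H\<^esub>, i) y \<in> Y"
    using assms X.act_closed' Y.act_closed' by auto
  have eq: "ac (a, g, i) (tn x y) = tn x y \<longleftrightarrow> (\<exists>b\<in>carrier A. \<exists>h\<in>carrier H.
      x = \<rho> (inv\<^bsub>A\<^esub> b, \<one>\<^bsub>G\<^esub>, h) (\<rho> (a, g, \<one>\<^bsub>H\<^esub>) x) \<and>
      y = \<sigma> (b, h, \<one>\<^bsub>I\<^esub>) (\<sigma> (\<one>\<^bsub>A\<^esub>, \<one>\<^bsub>H\<^esub>, i) y))"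
    unfolding ac_tn[OF assms] using tn_eq_iff[OF cl assms(1,2)] .
  also have "\<dots> \<longleftrightarrow> (\<exists>b\<in>carrier A. \<exists>h\<in>carrier H. (inv\<^bsub>A\<^esub> b \<otimes>\<^bsub>A\<^esub> a, g, h) \<in> X.stb x \<and> (b, h, i) \<in> Y.stb y)"
    using assms by (intro bex_cong refl) (auto simp: X.act_act Y.act_act X.mem_stb Y.mem_stb)
  also have "\<dots> \<longleftrightarrow> (a, g, i) \<in> tcomp A (X.stb x) (Y.stb y)"
  proof
    assume "\<exists>b\<in>carrier A. \<exists>h\<in>carrier H. (inv\<^bsub>A\<^esub> b \<otimes>\<^bsub>A\<^esub> a, g, h) \<in> X.stb x \<and> (b, h, i) \<in> Y.stb y"
    then obtain b h where b: "b \<in> carrier A" "(inv\<^bsub>A\<^esub> b \<otimes>\<^bsub>A\<^esub> a, g, h) \<in> X.stb x" "(b, h, i) \<in> Y.stb y" by blast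
    have "a = (inv\<^bsub>A\<^esub> b \<otimes>\<^bsub>A\<^esub> a) \<otimes>\<^bsub>A\<^esub> b" using b(1) assms(3)
      by (simp add: X.A.m_ac)
    then show "(a, g, i) \<in> tcomp A (X.stb x) (Y.stb y)" unfolding tcomp_def using b by blast
  next
    assume "(a, g, i) \<in> tcomp A (X.stb x) (Y.stb y)"
    then obtain c d h where c: "a = c \<otimes>\<^bsub>A\<^esub> d" "(c, g, h) \<in> X.stb x" "(d, h, i) \<in> Y.stb y"
      unfolding tcomp_def by blast
    have m: "c \<in> carrier A" "d \<in> carrier A" "h \<in> carrier H" using c by (auto simp: X.mem_stb Y.mem_stb)
    then have e: "inv\<^bsub>A\<^esub> d \<otimes>\<^bsub>A\<^esub> a = c" unfolding c(1) by (simp add: X.A.m_ac)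
    then show "\<exists>b\<in>carrier A. \<exists>h\<in>carrier H. (inv\<^bsub>A\<^esub> b \<otimes>\<^bsub>A\<^esub> a, g, h) \<in> X.stb x \<and> (b, h, i) \<in> Y.stb y"
      using c(2,3) m e by (intro bexI[of _ d] bexI[of _ h]) simp_all
  qed
  finally show ?thesis .
qed

definition W where "W = {tn x y | x y. x \<in> X \<and> y \<in> Y}"

definition Z where "Z = {tn x y | x y. x \<in> X \<and> y \<in> Y \<and> afree A G I (tcomp A (X.stb x) (Y.stb y))}"

lemma tcomp_carrier: "tcomp A (X.stb x) (Y.stb y) \<subseteq> carrier GI.T"
  by (auto simp: tcomp_def X.mem_stb Y.mem_stb)

text \<open>Membership in \<open>Z\<close> speaks of some representatives of the point. By
  \<open>ac_tn_stab\<close> the freeness condition is a property of the action of \<open>A\<close>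
  on the point alone, so any representatives may be used.\<close>

lemma tn_Z_iff:
  assumes "x \<in> X" "y \<in> Y"
  shows "tn x y \<in> Z \<longleftrightarrow> afree A G I (tcomp A (X.stb x) (Y.stb y))"
proof -
  have *: "afree A G I (tcomp A (X.stb u) (Y.stb v)) \<longleftrightarrow>
    (\<forall>a\<in>carrier A. ac (a, \<one>\<^bsub>G\<^esub>, \<one>\<^bsub>I\<^esub>) (tn u v) = tn u v \<longrightarrow> a = \<one>\<^bsub>A\<^esub>)" if "u \<in> X" "v \<in> Y" for u v
    using ac_tn_stab[OF that, of _ "\<one>\<^bsub>G\<^esub>" "\<one>\<^bsub>I\<^esub>"] tcomp_carrier[of u v] unfolding afree_def by auto
  show ?thesis
  proof
    assume "tn x y \<in> Z"
    then obtain u v where uv: "u \<in> X" "v \<in> Y" "tn x y = tn u v" "afree A G I (tcomp A (X.stb u) (Y.stb v))"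
      by (auto simp: Z_def)
    show "afree A G I (tcomp A (X.stb x) (Y.stb y))"
      using uv(4) unfolding *[OF assms] *[OF uv(1,2)] uv(3) .
  qed (use assms in \<open>auto simp: Z_def\<close>)
qed

lemma tensor_eq: "tensor A G H I (X, \<rho>) (Y, \<sigma>) = (Z, \<lambda>t. \<lambda>w\<in>Z. ac t w)"
proof -
  let ?\<tau> = "\<lambda>(a, h). \<lambda>(x, y)\<in>X \<times> Y. (\<rho> (inv\<^bsub>A\<^esub> a, \<one>\<^bsub>G\<^esub>, h) x, \<sigma> (a, h, \<one>\<^bsub>I\<^esub>) y)"
  have orb: "orbit (A \<times>\<times> H) ?\<tau> (x, y) = tn x y" if "x \<in> X" "y \<in> Y" for x y
    using that unfolding orbit_def tn_def by force
  have W: "orbits (A \<times>\<times> H) (X \<times> Y) ?\<tau> = W"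
  proof -
    have "orbits (A \<times>\<times> H) (X \<times> Y) ?\<tau> = orbit (A \<times>\<times> H) ?\<tau> ` (X \<times> Y)"
      unfolding orbits_def by blast
    also have "\<dots> = (\<lambda>(x, y). tn x y) ` (X \<times> Y)"
      by (rule image_cong[OF refl]) (use orb in \<open>clarsimp simp del: split_paired_All\<close>)
    also have "\<dots> = W" unfolding W_def by auto
    finally show ?thesis .
  qed
  have one: "ac (\<one>\<^bsub>A\<^esub>, \<one>\<^bsub>G\<^esub>, \<one>\<^bsub>I\<^esub>) (tn x y) = tn x y" if "x \<in> X" "y \<in> Y" for x y
    using that by (subst ac_tn) (auto simp: X.act_one Y.act_one)
  have st: "stabilizer A (\<lambda>a. ac (a, \<one>\<^bsub>G\<^esub>, \<one>\<^bsub>I\<^esub>)) (tn x y) = {\<one>\<^bsub>A\<^esub>} \<longleftrightarrow> tn x y \<in> Z"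
    if "x \<in> X" "y \<in> Y" for x y
  proof -
    have mem: "a \<in> stabilizer A (\<lambda>a. ac (a, \<one>\<^bsub>G\<^esub>, \<one>\<^bsub>I\<^esub>)) (tn x y) \<longleftrightarrow>
        (a, \<one>\<^bsub>G\<^esub>, \<one>\<^bsub>I\<^esub>) \<in> tcomp A (X.stb x) (Y.stb y)" for a
      using ac_tn_stab[OF that, of a "\<one>\<^bsub>G\<^esub>" "\<one>\<^bsub>I\<^esub>"] tcomp_carrier[of x y]
      unfolding stabilizer_def[of A] by auto
    have "\<one>\<^bsub>A\<^esub> \<in> stabilizer A (\<lambda>a. ac (a, \<one>\<^bsub>G\<^esub>, \<one>\<^bsub>I\<^esub>)) (tn x y)"
      using one[OF that] by (simp add: stabilizer_def)
    then show ?thesis unfolding tn_Z_iff[OF that] afree_def mem[symmetric] by blast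
  qed
  have "{w \<in> W. stabilizer A (\<lambda>a. ac (a, \<one>\<^bsub>G\<^esub>, \<one>\<^bsub>I\<^esub>)) w = {\<one>\<^bsub>A\<^esub>}} = Z"
    using st unfolding W_def by (auto simp: Z_def)
  then show ?thesis
    unfolding tensor_def Let_def prod.case W by (simp add: ac_def)
qed

lemma ac_ac:
  assumes s: "s \<in> carrier GI.T" and t: "t \<in> carrier GI.T" and w: "w \<in> W"
  shows "ac (s \<otimes>\<^bsub>GI.T\<^esub> t) w = ac s (ac t w)"
proof -
  obtain a g i b h j where st: "s = (a, g, i)" "t = (b, h, j)" by (metis surj_pair)
  obtain x y where xy: "x \<in> X" "y \<in> Y" "w = tn x y" using w by (auto simp: W_def)
  show ?thesis
    using s t xy(1,2) unfolding st xy(3)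
    by (simp add: ac_tn X.act_act Y.act_act X.act_closed' Y.act_closed')
qed

lemma ac_one: "w \<in> W \<Longrightarrow> ac \<one>\<^bsub>GI.T\<^esub> w = w"
  by (auto simp: W_def ac_tn X.act_one Y.act_one)

lemma Z_W: "w \<in> Z \<Longrightarrow> w \<in> W"
  by (auto simp: Z_def W_def)

text \<open>The fibre is central, so an element of \<open>A\<close> that fixes the translate of
  \<open>w\<close> by \<open>t\<close> also fixes \<open>w\<close>.\<close>

lemma ac_Z:
  assumes t: "t \<in> carrier GI.T" and w: "w \<in> Z" shows "ac t w \<in> Z"
proof -
  obtain a g i where agi: "t = (a, g, i)" "a \<in> carrier A" "g \<in> carrier G" "i \<in> carrier I" using t by auto
  obtain x y where xy: "x \<in> X" "y \<in> Y" "w = tn x y" using w by (auto simp: Z_def)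
  have cl: "\<rho> (a, g, \<one>\<^bsub>H\<^esub>) x \<in> X" "\<sigma> (\<one>\<^bsub>A\<^esub>, \<one>\<^bsub>H\<^esub>, i) y \<in> Y"
    using agi xy X.act_closed' Y.act_closed' by auto
  have eq: "ac t w = tn (\<rho> (a, g, \<one>\<^bsub>H\<^esub>) x) (\<sigma> (\<one>\<^bsub>A\<^esub>, \<one>\<^bsub>H\<^esub>, i) y)"
    using ac_tn xy agi by simp
  show ?thesis unfolding eq tn_Z_iff[OF cl] afree_def
  proof (intro allI impI)
    fix b assume b: "(b, \<one>\<^bsub>G\<^esub>, \<one>\<^bsub>I\<^esub>) \<in> tcomp A (X.stb (\<rho> (a, g, \<one>\<^bsub>H\<^esub>) x)) (Y.stb (\<sigma> (\<one>\<^bsub>A\<^esub>, \<one>\<^bsub>H\<^esub>, i) y))"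
    then have bA: "b \<in> carrier A" using tcomp_carrier by auto
    let ?b = "(b, \<one>\<^bsub>G\<^esub>, \<one>\<^bsub>I\<^esub>)"
    have "ac ?b (ac t w) = ac t w" using ac_tn_stab[OF cl bA] b eq by simp
    then have "ac (inv\<^bsub>GI.T\<^esub> t) (ac ?b (ac t w)) = ac (inv\<^bsub>GI.T\<^esub> t) (ac t w)" by simp
    moreover have "ac (inv\<^bsub>GI.T\<^esub> t) (ac t w) = w"
      using ac_ac[of "inv\<^bsub>GI.T\<^esub> t" t w] t Z_W[OF w] ac_one by (simp del: carrier_DirProd one_DirProd)
    moreover have "ac (inv\<^bsub>GI.T\<^esub> t) (ac ?b (ac t w)) = ac ?b w"
    proof -
      have "ac (inv\<^bsub>GI.T\<^esub> t) (ac ?b (ac t w)) = ac (inv\<^bsub>GI.T\<^esub> t \<otimes>\<^bsub>GI.T\<^esub> (?b \<otimes>\<^bsub>GI.T\<^esub> t)) w"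
        using ac_ac[of "inv\<^bsub>GI.T\<^esub> t" "?b \<otimes>\<^bsub>GI.T\<^esub> t" w] ac_ac[of ?b t w] t Z_W[OF w] bA
          GI.T.inv_closed[OF t] GI.T.m_closed[of ?b t]
        by simp
      also have "inv\<^bsub>GI.T\<^esub> t \<otimes>\<^bsub>GI.T\<^esub> (?b \<otimes>\<^bsub>GI.T\<^esub> t) = ?b"
      proof -
        have "inv\<^bsub>A\<^esub> a \<otimes>\<^bsub>A\<^esub> (b \<otimes>\<^bsub>A\<^esub> a) = b"
          using agi(2) bA by (simp add: X.A.m_comm[of b a] flip: X.A.m_assoc)
        then show ?thesis using agi bA by (simp add: GI.inv_T)
      qed
      finally show ?thesis .
    qed
    ultimately have "ac ?b (tn x y) = tn x y" using xy by simp
    then show "b = \<one>\<^bsub>A\<^esub>"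
      using ac_tn_stab[OF xy(1,2) bA] w tn_Z_iff[OF xy(1,2)] xy(3) unfolding afree_def by simp
  qed
qed

lemma Z_action: "group_action GI.T Z (\<lambda>t. \<lambda>w\<in>Z. ac t w)"
proof (rule group_actionI[OF GI.T.group_axioms])
  fix s t w assume "s \<in> carrier GI.T" "t \<in> carrier GI.T" "w \<in> Z"
  then show "restrict (ac (s \<otimes>\<^bsub>GI.T\<^esub> t)) Z w = restrict (ac s) Z (restrict (ac t) Z w)"
    using ac_ac ac_Z Z_W by (simp del: carrier_DirProd)
next
  fix w assume "w \<in> Z"
  then show "restrict (ac \<one>\<^bsub>GI.T\<^esub>) Z w = w" using ac_one Z_W by (simp del: one_DirProd)
qed (use ac_Z in \<open>simp_all del: carrier_DirProd\<close>)

lemma Z_stab: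
  assumes "x \<in> X" "y \<in> Y" "tn x y \<in> Z"
  shows "stabilizer GI.T (\<lambda>t. \<lambda>w\<in>Z. ac t w) (tn x y) = tcomp A (X.stb x) (Y.stb y)"
  unfolding stabilizer_def[of GI.T] using assms ac_tn_stab[OF assms(1,2)] tcomp_carrier[of x y] by auto

text \<open>A factor from \<open>A\<close> acting on \<open>y\<close> can be shifted to
  \<open>x\<close>, so the orbit of a point under \<open>A\<close> consists of all
  \<open>tn x y\<close> with \<open>x\<close> and \<open>y\<close> in given orbits of
  \<open>A\<close>. Finitely many pairs of such orbits then suffice.\<close>

lemma Z_fibered:
  assumes X: "fibered_biset A G H (X, \<rho>)" and Y: "fibered_biset A H I (Y, \<sigma>)"
  shows "fibered_biset A G I (Z, \<lambda>t. \<lambda>w\<in>Z. ac t w)"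
proof (rule GI.fibered_bisetI[OF Z_action])
  fix w a assume w: "w \<in> Z" "a \<in> carrier A" "restrict (ac (a, \<one>\<^bsub>G\<^esub>, \<one>\<^bsub>I\<^esub>)) Z w = w"
  then obtain x y where xy: "x \<in> X" "y \<in> Y" "w = tn x y" "afree A G I (tcomp A (X.stb x) (Y.stb y))"
    by (auto simp: Z_def)
  then show "a = \<one>\<^bsub>A\<^esub>" using w ac_tn_stab[OF xy(1,2) w(2), of "\<one>\<^bsub>G\<^esub>" "\<one>\<^bsub>I\<^esub>"] unfolding afree_def by simp
next
  let ?oX = "orbit A (\<lambda>a. \<rho> (a, \<one>\<^bsub>G\<^esub>, \<one>\<^bsub>H\<^esub>))" and ?oY = "orbit A (\<lambda>a. \<sigma> (a, \<one>\<^bsub>H\<^esub>, \<one>\<^bsub>I\<^esub>))"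
  let ?oZ = "orbit A (\<lambda>a. restrict (ac (a, \<one>\<^bsub>G\<^esub>, \<one>\<^bsub>I\<^esub>)) Z)"
  let ?F = "\<lambda>(u, v). {tn x y | x y. x \<in> u \<and> y \<in> v}"
  have orb: "?oZ (tn x y) = ?F (?oX x, ?oY y)" if xy: "x \<in> X" "y \<in> Y" "tn x y \<in> Z" for x y
  proof
    have r: "restrict (ac (a, \<one>\<^bsub>G\<^esub>, \<one>\<^bsub>I\<^esub>)) Z (tn x y) = tn (\<rho> (a, \<one>\<^bsub>G\<^esub>, \<one>\<^bsub>H\<^esub>) x) y" if "a \<in> carrier A" for a
      using that xy ac_tn[OF xy(1,2) that, of "\<one>\<^bsub>G\<^esub>" "\<one>\<^bsub>I\<^esub>"] Y.act_one by simp
    have yo: "y \<in> ?oY y" unfolding orbit_def using Y.act_one[OF xy(2)] by force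
    show "?oZ (tn x y) \<subseteq> ?F (?oX x, ?oY y)"
    proof
      fix w assume "w \<in> ?oZ (tn x y)"
      then obtain a where a: "a \<in> carrier A" "w = restrict (ac (a, \<one>\<^bsub>G\<^esub>, \<one>\<^bsub>I\<^esub>)) Z (tn x y)"
        unfolding orbit_def by blast
      moreover have "\<rho> (a, \<one>\<^bsub>G\<^esub>, \<one>\<^bsub>H\<^esub>) x \<in> ?oX x" using a(1) unfolding orbit_def by blast
      ultimately show "w \<in> ?F (?oX x, ?oY y)" using r[OF a(1)] yo by auto
    qed
    show "?F (?oX x, ?oY y) \<subseteq> ?oZ (tn x y)"
    proof
      fix w assume "w \<in> ?F (?oX x, ?oY y)"
      then obtain a b where ab: "a \<in> carrier A" "b \<in> carrier A"
        "w = tn (\<rho> (a, \<one>\<^bsub>G\<^esub>, \<one>\<^bsub>H\<^esub>) x) (\<sigma> (b, \<one>\<^bsub>H\<^esub>, \<one>\<^bsub>I\<^esub>) y)"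
        unfolding orbit_def by blast
      have "\<rho> (a, \<one>\<^bsub>G\<^esub>, \<one>\<^bsub>H\<^esub>) x = \<rho> (inv\<^bsub>A\<^esub> b, \<one>\<^bsub>G\<^esub>, \<one>\<^bsub>H\<^esub>) (\<rho> (a \<otimes>\<^bsub>A\<^esub> b, \<one>\<^bsub>G\<^esub>, \<one>\<^bsub>H\<^esub>) x)"
        using ab(1,2) xy by (simp add: X.act_act X.A.m_ac)
      then have "w = tn (\<rho> (a \<otimes>\<^bsub>A\<^esub> b, \<one>\<^bsub>G\<^esub>, \<one>\<^bsub>H\<^esub>) x) y"
        using tn_shift[of "\<rho> (a \<otimes>\<^bsub>A\<^esub> b, \<one>\<^bsub>G\<^esub>, \<one>\<^bsub>H\<^esub>) x" y b "\<one>\<^bsub>H\<^esub>"] ab xy X.act_closed' by simp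
      then show "w \<in> ?oZ (tn x y)" using r[of "a \<otimes>\<^bsub>A\<^esub> b"] ab unfolding orbit_def[of A _ "tn x y"] by force
    qed
  qed
  have "orbits A Z (\<lambda>a. restrict (ac (a, \<one>\<^bsub>G\<^esub>, \<one>\<^bsub>I\<^esub>)) Z) \<subseteq>
    ?F ` (orbits A X (\<lambda>a. \<rho> (a, \<one>\<^bsub>G\<^esub>, \<one>\<^bsub>H\<^esub>)) \<times> orbits A Y (\<lambda>a. \<sigma> (a, \<one>\<^bsub>H\<^esub>, \<one>\<^bsub>I\<^esub>)))"
  proof
    fix w assume "w \<in> orbits A Z (\<lambda>a. restrict (ac (a, \<one>\<^bsub>G\<^esub>, \<one>\<^bsub>I\<^esub>)) Z)"
    then obtain z where z: "z \<in> Z" "w = ?oZ z" unfolding orbits_def by blast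
    then obtain x y where xy: "x \<in> X" "y \<in> Y" "z = tn x y" unfolding Z_def by blast
    have "w = ?F (?oX x, ?oY y)" using orb[OF xy(1,2)] z xy(3) by simp
    moreover have "?oX x \<in> orbits A X (\<lambda>a. \<rho> (a, \<one>\<^bsub>G\<^esub>, \<one>\<^bsub>H\<^esub>))"
      "?oY y \<in> orbits A Y (\<lambda>a. \<sigma> (a, \<one>\<^bsub>H\<^esub>, \<one>\<^bsub>I\<^esub>))"
      using xy unfolding orbits_def by blast+
    ultimately show "w \<in> ?F ` (orbits A X (\<lambda>a. \<rho> (a, \<one>\<^bsub>G\<^esub>, \<one>\<^bsub>H\<^esub>)) \<times> orbits A Y (\<lambda>a. \<sigma> (a, \<one>\<^bsub>H\<^esub>, \<one>\<^bsub>I\<^esub>)))"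
      by (intro image_eqI[of _ _ "(?oX x, ?oY y)"]) auto
  qed
  then show "finite (orbits A Z (\<lambda>a. restrict (ac (a, \<one>\<^bsub>G\<^esub>, \<one>\<^bsub>I\<^esub>)) Z))"
    by (rule finite_subset) (use fibered_bisetD(3)[OF X] fibered_bisetD(3)[OF Y] in simp)
qed

end

text \<open>Freeness of a threefold composite passes to the partial composites, since the third
  stabilizer contains the identity. Therefore no triple that survives in one bracketing of a
  threefold tensor product is discarded at the inner product of the other.\<close>

lemma tcomp_afree_left:
  assumes "afree A G J (tcomp A (tcomp A S S') S'')" "(\<one>\<^bsub>A\<^esub>, \<one>\<^bsub>I\<^esub>, \<one>\<^bsub>J\<^esub>) \<in> S''"
    "Group.monoid A" "\<And>s. s \<in> tcomp A S S' \<Longrightarrow> fst s \<in> carrier A"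
  shows "afree A G I (tcomp A S S')"
  unfolding afree_def
proof (intro allI impI)
  fix a assume a: "(a, \<one>\<^bsub>G\<^esub>, \<one>\<^bsub>I\<^esub>) \<in> tcomp A S S'"
  then have "(a \<otimes>\<^bsub>A\<^esub> \<one>\<^bsub>A\<^esub>, \<one>\<^bsub>G\<^esub>, \<one>\<^bsub>J\<^esub>) \<in> tcomp A (tcomp A S S') S''"
    using assms(2) unfolding tcomp_def[of A "tcomp A S S'"] by blast
  then show "a = \<one>\<^bsub>A\<^esub>" using assms(1,3) assms(4)[OF a] by (simp add: afree_def monoid.r_one)
qed

lemma tcomp_afree_right:
  assumes "afree A G J (tcomp A S (tcomp A S' S''))" "(\<one>\<^bsub>A\<^esub>, \<one>\<^bsub>G\<^esub>, \<one>\<^bsub>H\<^esub>) \<in> S"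
    "Group.monoid A" "\<And>s. s \<in> tcomp A S' S'' \<Longrightarrow> fst s \<in> carrier A"
  shows "afree A H J (tcomp A S' S'')"
  unfolding afree_def
proof (intro allI impI)
  fix a assume a: "(a, \<one>\<^bsub>H\<^esub>, \<one>\<^bsub>J\<^esub>) \<in> tcomp A S' S''"
  then have "(\<one>\<^bsub>A\<^esub> \<otimes>\<^bsub>A\<^esub> a, \<one>\<^bsub>G\<^esub>, \<one>\<^bsub>J\<^esub>) \<in> tcomp A S (tcomp A S' S'')"
    using assms(2) unfolding tcomp_def[of A S "tcomp A S' S''"] by blast
  then show "a = \<one>\<^bsub>A\<^esub>" using assms(1,3) assms(4)[OF a] by (simp add: afree_def monoid.l_one)
qed

lemma tcomp_assoc:
  assumes "Group.monoid A" "\<And>s. s \<in> S \<Longrightarrow> fst s \<in> carrier A" "\<And>s. s \<in> S' \<Longrightarrow> fst s \<in> carrier A"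
    "\<And>s. s \<in> S'' \<Longrightarrow> fst s \<in> carrier A"
  shows "tcomp A (tcomp A S S') S'' = tcomp A S (tcomp A S' S'')"
proof -
  have *: "(c \<otimes>\<^bsub>A\<^esub> d) \<otimes>\<^bsub>A\<^esub> e = c \<otimes>\<^bsub>A\<^esub> (d \<otimes>\<^bsub>A\<^esub> e)"
    if "(c, u) \<in> S" "(d, v) \<in> S'" "(e, w) \<in> S''" for c d e u v w
    using assms(2)[OF that(1)] assms(3)[OF that(2)] assms(4)[OF that(3)]
      monoid.m_assoc[OF assms(1)] by simp
  show ?thesis
  proof
    show "tcomp A (tcomp A S S') S'' \<subseteq> tcomp A S (tcomp A S' S'')"
    proof
      fix s assume "s \<in> tcomp A (tcomp A S S') S''"
      then obtain c d e g h i j where s: "s = ((c \<otimes>\<^bsub>A\<^esub> d) \<otimes>\<^bsub>A\<^esub> e, g, j)" "(c, g, h) \<in> S" "(d, h, i) \<in> S'" "(e, i, j) \<in> S''"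
        unfolding tcomp_def by blast
      then show "s \<in> tcomp A S (tcomp A S' S'')" unfolding *[OF s(2-4)] tcomp_def by blast
    qed
    show "tcomp A S (tcomp A S' S'') \<subseteq> tcomp A (tcomp A S S') S''"
    proof
      fix s assume "s \<in> tcomp A S (tcomp A S' S'')"
      then obtain c d e g h i j where s: "s = (c \<otimes>\<^bsub>A\<^esub> (d \<otimes>\<^bsub>A\<^esub> e), g, j)" "(c, g, h) \<in> S" "(d, h, i) \<in> S'" "(e, i, j) \<in> S''"
        unfolding tcomp_def by blast
      then show "s \<in> tcomp A (tcomp A S S') S''" unfolding *[OF s(2-4), symmetric] tcomp_def by blast
    qed
  qed
qed

lemma tensor_pairI: "tri_action A G H X \<rho> \<Longrightarrow> tri_action A H I Y \<sigma> \<Longrightarrow> tensor_pair A G H I X \<rho> Y \<sigma>"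
  by (rule tensor_pair.intro)

lemma single_valued_bij:
  assumes "\<And>u. u \<in> U \<Longrightarrow> \<exists>v\<in>V. (u, v) \<in> r" "\<And>v. v \<in> V \<Longrightarrow> \<exists>u\<in>U. (u, v) \<in> r"
    "\<And>u v u' v'. (u, v) \<in> r \<Longrightarrow> (u', v') \<in> r \<Longrightarrow> u = u' \<longleftrightarrow> v = v'"
  shows "\<exists>f. bij_betw f U V \<and> (\<forall>u\<in>U. (u, f u) \<in> r)"
proof -
  obtain f where f: "\<And>u. u \<in> U \<Longrightarrow> f u \<in> V \<and> (u, f u) \<in> r" using assms(1) by metis
  have "bij_betw f U V"
  proof (rule bij_betw_imageI)
    show "inj_on f U" by (rule inj_onI) (use f assms(3) in metis)
    show "f ` U = V" using f assms(2,3) by (metis image_subset_iff image_eqI subsetI subset_antisym)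
  qed
  then show ?thesis using f by blast
qed

text \<open>Points of both bracketings are described by triples \<open>(x, y, v)\<close>. The same
  triples are admissible on both sides (\<open>goodP\<close>, \<open>goodQ\<close>), and two triples
  give the same point on one side iff they do on the other (\<open>eqP\<close>, \<open>eqQ\<close>).
  The relation \<open>r\<close> of having a common triple is thus a bijection, and it is equivariant
  because \<open>g\<close> acts only on \<open>x\<close> and \<open>j\<close> only on
  \<open>v\<close>.\<close>

lemma tensor_assoc:
  fixes X :: "'x set" and Y :: "'y set" and V :: "'v set"
  assumes X: "tri_action A G H X \<rho>" and Y: "tri_action A H I Y \<sigma>" and V: "tri_action A I J V \<tau>"
  shows "\<exists>f. bij_betw f
      (fst (tensor A G I J (tensor A G H I (X, \<rho>) (Y, \<sigma>)) (V, \<tau>)))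
      (fst (tensor A G H J (X, \<rho>) (tensor A H I J (Y, \<sigma>) (V, \<tau>)))) \<and>
    (\<forall>t\<in>carrier (A \<times>\<times> G \<times>\<times> J). \<forall>x\<in>fst (tensor A G I J (tensor A G H I (X, \<rho>) (Y, \<sigma>)) (V, \<tau>)).
      f (snd (tensor A G I J (tensor A G H I (X, \<rho>) (Y, \<sigma>)) (V, \<tau>)) t x) =
      snd (tensor A G H J (X, \<rho>) (tensor A H I J (Y, \<sigma>) (V, \<tau>))) t (f x))"
proof -
  interpret P: tensor_pair A G H I X \<rho> Y \<sigma> by (rule tensor_pairI[OF X Y])
  interpret Q: tensor_pair A H I J Y \<sigma> V \<tau> by (rule tensor_pairI[OF Y V])
  define \<pi> where "\<pi> = (\<lambda>t. restrict (P.ac t) P.Z)"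
  define \<kappa> where "\<kappa> = (\<lambda>t. restrict (Q.ac t) Q.Z)"
  have PZ: "tri_action A G I P.Z \<pi>" unfolding \<pi>_def by (rule P.GI.tri_actionI[OF P.Z_action])
  have QZ: "tri_action A H J Q.Z \<kappa>" unfolding \<kappa>_def by (rule Q.GI.tri_actionI[OF Q.Z_action])
  interpret P2: tensor_pair A G I J P.Z \<pi> V \<tau> by (rule tensor_pairI[OF PZ V])
  interpret Q2: tensor_pair A G H J X \<rho> Q.Z \<kappa> by (rule tensor_pairI[OF X QZ])
  have monA: "Group.monoid A" by (rule P.X.A.monoid_axioms)
  have stP: "P2.X.stb (P.tn x y) = tcomp A (P.X.stb x) (P.Y.stb y)" if "x \<in> X" "y \<in> Y" "P.tn x y \<in> P.Z" for x y
    unfolding \<pi>_def by (rule P.Z_stab[OF that])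
  have stQ: "Q2.Y.stb (Q.tn y v) = tcomp A (P.Y.stb y) (Q.Y.stb v)" if "y \<in> Y" "v \<in> V" "Q.tn y v \<in> Q.Z" for y v
    unfolding \<kappa>_def by (rule Q.Z_stab[OF that])
  define good where "good = (\<lambda>x y v. x \<in> X \<and> y \<in> Y \<and> v \<in> V \<and>
    afree A G J (tcomp A (tcomp A (P.X.stb x) (P.Y.stb y)) (Q.Y.stb v)))"
  have assoc: "tcomp A (tcomp A (P.X.stb x) (P.Y.stb y)) (Q.Y.stb v) =
    tcomp A (P.X.stb x) (tcomp A (P.Y.stb y) (Q.Y.stb v))" for x y v
    by (rule tcomp_assoc[OF monA]) (auto simp: P.X.mem_stb P.Y.mem_stb Q.Y.mem_stb)
  have goodP: "good x y v \<longleftrightarrow> P.tn x y \<in> P.Z \<and> P2.tn (P.tn x y) v \<in> P2.Z"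
    if "x \<in> X" "y \<in> Y" "v \<in> V" for x y v
  proof
    assume g: "good x y v"
    have "afree A G I (tcomp A (P.X.stb x) (P.Y.stb y))"
    proof (rule tcomp_afree_left)
      show "afree A G J (tcomp A (tcomp A (P.X.stb x) (P.Y.stb y)) (Q.Y.stb v))" using g by (simp add: good_def)
      show "(\<one>\<^bsub>A\<^esub>, \<one>\<^bsub>I\<^esub>, \<one>\<^bsub>J\<^esub>) \<in> Q.Y.stb v" using Q.Y.act_one that by (simp add: Q.Y.mem_stb)
      fix s assume "s \<in> tcomp A (P.X.stb x) (P.Y.stb y)"
      then show "fst s \<in> carrier A" using P.tcomp_carrier[of x y] by auto
    qed (rule monA)
    then have Z: "P.tn x y \<in> P.Z" using P.tn_Z_iff that by blast
    then show "P.tn x y \<in> P.Z \<and> P2.tn (P.tn x y) v \<in> P2.Z"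
      using g P2.tn_Z_iff[OF Z that(3)] stP[OF that(1,2) Z] by (simp add: good_def)
  next
    assume g: "P.tn x y \<in> P.Z \<and> P2.tn (P.tn x y) v \<in> P2.Z"
    then show "good x y v"
      using P2.tn_Z_iff[of "P.tn x y" v] stP[of x y] that by (simp add: good_def)
  qed
  have goodQ: "good x y v \<longleftrightarrow> Q.tn y v \<in> Q.Z \<and> Q2.tn x (Q.tn y v) \<in> Q2.Z"
    if "x \<in> X" "y \<in> Y" "v \<in> V" for x y v
  proof
    assume g: "good x y v"
    have "afree A H J (tcomp A (P.Y.stb y) (Q.Y.stb v))"
    proof (rule tcomp_afree_right)
      show "afree A G J (tcomp A (P.X.stb x) (tcomp A (P.Y.stb y) (Q.Y.stb v)))"
        using g assoc by (simp add: good_def)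
      show "(\<one>\<^bsub>A\<^esub>, \<one>\<^bsub>G\<^esub>, \<one>\<^bsub>H\<^esub>) \<in> P.X.stb x" using P.X.act_one that by (simp add: P.X.mem_stb)
      fix s assume "s \<in> tcomp A (P.Y.stb y) (Q.Y.stb v)"
      then show "fst s \<in> carrier A" using Q.tcomp_carrier[of y v] by auto
    qed (rule monA)
    then have Z: "Q.tn y v \<in> Q.Z" using Q.tn_Z_iff that by blast
    then show "Q.tn y v \<in> Q.Z \<and> Q2.tn x (Q.tn y v) \<in> Q2.Z"
      using g Q2.tn_Z_iff[OF that(1) Z] stQ[OF that(2,3) Z] assoc by (simp add: good_def)
  next
    assume g: "Q.tn y v \<in> Q.Z \<and> Q2.tn x (Q.tn y v) \<in> Q2.Z"
    then show "good x y v"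
      using Q2.tn_Z_iff[of x "Q.tn y v"] stQ[of y v] that assoc by (simp add: good_def)
  qed
  \<comment> \<open>Both identifications are brought to one symmetric form: one parameter pair for
    each of the two tensor signs.\<close>
  have eqP: "P2.tn (P.tn x y) v = P2.tn (P.tn x' y') v' \<longleftrightarrow>
      (\<exists>a\<in>carrier A. \<exists>b\<in>carrier A. \<exists>h\<in>carrier H. \<exists>i\<in>carrier I.
        x' = \<rho> (inv\<^bsub>A\<^esub> (a \<otimes>\<^bsub>A\<^esub> b), \<one>\<^bsub>G\<^esub>, h) x \<and> y' = \<sigma> (a, h, i) y \<and> v' = \<tau> (b, i, \<one>\<^bsub>J\<^esub>) v)"
    if g: "good x y v" "good x' y' v'" for x y v x' y' v'
  proof -
    have m: "x \<in> X" "y \<in> Y" "v \<in> V" "x' \<in> X" "y' \<in> Y" "v' \<in> V" using g by (auto simp: good_def)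
    have Z: "P.tn x y \<in> P.Z" "P.tn x' y' \<in> P.Z" using g goodP m by blast+
    have step: "P.tn x' y' = \<pi> (inv\<^bsub>A\<^esub> b, \<one>\<^bsub>G\<^esub>, i) (P.tn x y) \<longleftrightarrow>
      (\<exists>a\<in>carrier A. \<exists>h\<in>carrier H. x' = \<rho> (inv\<^bsub>A\<^esub> (a \<otimes>\<^bsub>A\<^esub> b), \<one>\<^bsub>G\<^esub>, h) x \<and> y' = \<sigma> (a, h, i) y)"
      if b: "b \<in> carrier A" "i \<in> carrier I" for b i
    proof -
      have c: "\<rho> (inv\<^bsub>A\<^esub> b, \<one>\<^bsub>G\<^esub>, \<one>\<^bsub>H\<^esub>) x \<in> X" "\<sigma> (\<one>\<^bsub>A\<^esub>, \<one>\<^bsub>H\<^esub>, i) y \<in> Y"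
        using b m P.X.act_closed' P.Y.act_closed' by auto
      have "\<pi> (inv\<^bsub>A\<^esub> b, \<one>\<^bsub>G\<^esub>, i) (P.tn x y) = P.tn (\<rho> (inv\<^bsub>A\<^esub> b, \<one>\<^bsub>G\<^esub>, \<one>\<^bsub>H\<^esub>) x) (\<sigma> (\<one>\<^bsub>A\<^esub>, \<one>\<^bsub>H\<^esub>, i) y)"
        unfolding \<pi>_def using Z(1) P.ac_tn[of x y "inv\<^bsub>A\<^esub> b" "\<one>\<^bsub>G\<^esub>" i] b m by simp
      then have "P.tn x' y' = \<pi> (inv\<^bsub>A\<^esub> b, \<one>\<^bsub>G\<^esub>, i) (P.tn x y) \<longleftrightarrow>
        P.tn (\<rho> (inv\<^bsub>A\<^esub> b, \<one>\<^bsub>G\<^esub>, \<one>\<^bsub>H\<^esub>) x) (\<sigma> (\<one>\<^bsub>A\<^esub>, \<one>\<^bsub>H\<^esub>, i) y) = P.tn x' y'" by auto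
      also have "\<dots> \<longleftrightarrow> (\<exists>a\<in>carrier A. \<exists>h\<in>carrier H.
          x' = \<rho> (inv\<^bsub>A\<^esub> a, \<one>\<^bsub>G\<^esub>, h) (\<rho> (inv\<^bsub>A\<^esub> b, \<one>\<^bsub>G\<^esub>, \<one>\<^bsub>H\<^esub>) x) \<and>
          y' = \<sigma> (a, h, \<one>\<^bsub>I\<^esub>) (\<sigma> (\<one>\<^bsub>A\<^esub>, \<one>\<^bsub>H\<^esub>, i) y))"
        by (rule P.tn_eq_iff[OF c m(4,5)])
      also have "\<dots> \<longleftrightarrow> (\<exists>a\<in>carrier A. \<exists>h\<in>carrier H. x' = \<rho> (inv\<^bsub>A\<^esub> (a \<otimes>\<^bsub>A\<^esub> b), \<one>\<^bsub>G\<^esub>, h) x \<and> y' = \<sigma> (a, h, i) y)"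
        using b m by (intro bex_cong refl) (simp add: P.X.act_act P.Y.act_act P.X.A.inv_mult)
      finally show ?thesis .
    qed
    have "P2.tn (P.tn x y) v = P2.tn (P.tn x' y') v' \<longleftrightarrow> (\<exists>b\<in>carrier A. \<exists>i\<in>carrier I.
        P.tn x' y' = \<pi> (inv\<^bsub>A\<^esub> b, \<one>\<^bsub>G\<^esub>, i) (P.tn x y) \<and> v' = \<tau> (b, i, \<one>\<^bsub>J\<^esub>) v)"
      by (rule P2.tn_eq_iff[OF Z(1) m(3) Z(2) m(6)])
    also have "\<dots> \<longleftrightarrow> (\<exists>b\<in>carrier A. \<exists>i\<in>carrier I.
        (\<exists>a\<in>carrier A. \<exists>h\<in>carrier H. x' = \<rho> (inv\<^bsub>A\<^esub> (a \<otimes>\<^bsub>A\<^esub> b), \<one>\<^bsub>G\<^esub>, h) x \<and> y' = \<sigma> (a, h, i) y) \<and>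
        v' = \<tau> (b, i, \<one>\<^bsub>J\<^esub>) v)"
      using step by (intro bex_cong refl conj_cong) auto
    finally show ?thesis by blast
  qed
  have eqQ: "Q2.tn x (Q.tn y v) = Q2.tn x' (Q.tn y' v') \<longleftrightarrow>
      (\<exists>a\<in>carrier A. \<exists>b\<in>carrier A. \<exists>h\<in>carrier H. \<exists>i\<in>carrier I.
        x' = \<rho> (inv\<^bsub>A\<^esub> (a \<otimes>\<^bsub>A\<^esub> b), \<one>\<^bsub>G\<^esub>, h) x \<and> y' = \<sigma> (a, h, i) y \<and> v' = \<tau> (b, i, \<one>\<^bsub>J\<^esub>) v)"
    if g: "good x y v" "good x' y' v'" for x y v x' y' v'
  proof -
    have m: "x \<in> X" "y \<in> Y" "v \<in> V" "x' \<in> X" "y' \<in> Y" "v' \<in> V" using g by (auto simp: good_def)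
    have Z: "Q.tn y v \<in> Q.Z" "Q.tn y' v' \<in> Q.Z" using g goodQ m by blast+
    have step: "Q.tn y' v' = \<kappa> (a, h, \<one>\<^bsub>J\<^esub>) (Q.tn y v) \<longleftrightarrow>
      (\<exists>b\<in>carrier A. \<exists>i\<in>carrier I. y' = \<sigma> (inv\<^bsub>A\<^esub> b \<otimes>\<^bsub>A\<^esub> a, h, i) y \<and> v' = \<tau> (b, i, \<one>\<^bsub>J\<^esub>) v)"
      if b: "a \<in> carrier A" "h \<in> carrier H" for a h
    proof -
      have c: "\<sigma> (a, h, \<one>\<^bsub>I\<^esub>) y \<in> Y" using b m P.Y.act_closed' by auto
      have "\<kappa> (a, h, \<one>\<^bsub>J\<^esub>) (Q.tn y v) = Q.tn (\<sigma> (a, h, \<one>\<^bsub>I\<^esub>) y) v"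
        unfolding \<kappa>_def using Z(1) Q.ac_tn[of y v a h "\<one>\<^bsub>J\<^esub>"] b m Q.Y.act_one by simp
      then have "Q.tn y' v' = \<kappa> (a, h, \<one>\<^bsub>J\<^esub>) (Q.tn y v) \<longleftrightarrow> Q.tn (\<sigma> (a, h, \<one>\<^bsub>I\<^esub>) y) v = Q.tn y' v'" by auto
      also have "\<dots> \<longleftrightarrow> (\<exists>b\<in>carrier A. \<exists>i\<in>carrier I.
          y' = \<sigma> (inv\<^bsub>A\<^esub> b, \<one>\<^bsub>H\<^esub>, i) (\<sigma> (a, h, \<one>\<^bsub>I\<^esub>) y) \<and> v' = \<tau> (b, i, \<one>\<^bsub>J\<^esub>) v)"
        by (rule Q.tn_eq_iff[OF c m(3,5,6)])
      also have "\<dots> \<longleftrightarrow> (\<exists>b\<in>carrier A. \<exists>i\<in>carrier I. y' = \<sigma> (inv\<^bsub>A\<^esub> b \<otimes>\<^bsub>A\<^esub> a, h, i) y \<and> v' = \<tau> (b, i, \<one>\<^bsub>J\<^esub>) v)"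
        using b m by (intro bex_cong refl) (simp add: P.Y.act_act)
      finally show ?thesis .
    qed
    have "Q2.tn x (Q.tn y v) = Q2.tn x' (Q.tn y' v') \<longleftrightarrow> (\<exists>a\<in>carrier A. \<exists>h\<in>carrier H.
        x' = \<rho> (inv\<^bsub>A\<^esub> a, \<one>\<^bsub>G\<^esub>, h) x \<and> Q.tn y' v' = \<kappa> (a, h, \<one>\<^bsub>J\<^esub>) (Q.tn y v))"
      by (rule Q2.tn_eq_iff[OF m(1) Z(1) m(4) Z(2)])
    also have "\<dots> \<longleftrightarrow> (\<exists>a\<in>carrier A. \<exists>h\<in>carrier H. x' = \<rho> (inv\<^bsub>A\<^esub> a, \<one>\<^bsub>G\<^esub>, h) x \<and>
        (\<exists>b\<in>carrier A. \<exists>i\<in>carrier I. y' = \<sigma> (inv\<^bsub>A\<^esub> b \<otimes>\<^bsub>A\<^esub> a, h, i) y \<and> v' = \<tau> (b, i, \<one>\<^bsub>J\<^esub>) v))"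
      using step by (intro bex_cong refl conj_cong) auto
    \<comment> \<open>In this bracketing the outer parameter acts on \<open>y\<close> and
      \<open>v\<close> together, so it corresponds to the product of the two fibre parameters of the
      symmetric form.\<close>
    also have "\<dots> \<longleftrightarrow> (\<exists>a\<in>carrier A. \<exists>b\<in>carrier A. \<exists>h\<in>carrier H. \<exists>i\<in>carrier I.
        x' = \<rho> (inv\<^bsub>A\<^esub> (a \<otimes>\<^bsub>A\<^esub> b), \<one>\<^bsub>G\<^esub>, h) x \<and> y' = \<sigma> (a, h, i) y \<and> v' = \<tau> (b, i, \<one>\<^bsub>J\<^esub>) v)"
      (is "?L \<longleftrightarrow> ?R")
    proof
      assume ?L
      then obtain a h b i where *: "a \<in> carrier A" "h \<in> carrier H" "b \<in> carrier A" "i \<in> carrier I"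
        "x' = \<rho> (inv\<^bsub>A\<^esub> a, \<one>\<^bsub>G\<^esub>, h) x" "y' = \<sigma> (inv\<^bsub>A\<^esub> b \<otimes>\<^bsub>A\<^esub> a, h, i) y" "v' = \<tau> (b, i, \<one>\<^bsub>J\<^esub>) v" by blast
      have "(inv\<^bsub>A\<^esub> b \<otimes>\<^bsub>A\<^esub> a) \<otimes>\<^bsub>A\<^esub> b = a" using * by (simp add: P.X.A.m_ac)
      then show ?R using * by (intro bexI[of _ "inv\<^bsub>A\<^esub> b \<otimes>\<^bsub>A\<^esub> a"] bexI[of _ b] bexI[of _ h] bexI[of _ i]) simp_all
    next
      assume ?R
      then obtain a h b i where *: "a \<in> carrier A" "h \<in> carrier H" "b \<in> carrier A" "i \<in> carrier I"
        "x' = \<rho> (inv\<^bsub>A\<^esub> (a \<otimes>\<^bsub>A\<^esub> b), \<one>\<^bsub>G\<^esub>, h) x" "y' = \<sigma> (a, h, i) y" "v' = \<tau> (b, i, \<one>\<^bsub>J\<^esub>) v" by blast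
      have "inv\<^bsub>A\<^esub> b \<otimes>\<^bsub>A\<^esub> (a \<otimes>\<^bsub>A\<^esub> b) = a" using * by (simp add: P.X.A.m_ac)
      then show ?L using * by (intro bexI[of _ "a \<otimes>\<^bsub>A\<^esub> b"] conjI bexI[of _ h] bexI[of _ b] bexI[of _ i]) simp_all
    qed
    finally show ?thesis .
  qed
  define r where "r = {(P2.tn (P.tn x y) v, Q2.tn x (Q.tn y v)) | x y v. good x y v}"
  have PU: "\<exists>x y v. good x y v \<and> u = P2.tn (P.tn x y) v" if u: "u \<in> P2.Z" for u
  proof -
    obtain w v where w: "w \<in> P.Z" "v \<in> V" "u = P2.tn w v" using u unfolding P2.Z_def by blast
    then obtain x y where xy: "x \<in> X" "y \<in> Y" "w = P.tn x y" unfolding P.Z_def by blast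
    then have "good x y v" using goodP[OF xy(1,2) w(2)] w u by simp
    then show ?thesis using w xy by blast
  qed
  have QU: "\<exists>x y v. good x y v \<and> u = Q2.tn x (Q.tn y v)" if u: "u \<in> Q2.Z" for u
  proof -
    obtain w x where w: "w \<in> Q.Z" "x \<in> X" "u = Q2.tn x w" using u unfolding Q2.Z_def by blast
    then obtain y v where yv: "y \<in> Y" "v \<in> V" "w = Q.tn y v" unfolding Q.Z_def by blast
    then have "good x y v" using goodQ[OF w(2) yv(1,2)] w u by simp
    then show ?thesis using w yv by blast
  qed
  have rZ: "u \<in> P2.Z \<and> w \<in> Q2.Z" if uw: "(u, w) \<in> r" for u w
  proof -
    obtain x y v where g: "good x y v" "u = P2.tn (P.tn x y) v" "w = Q2.tn x (Q.tn y v)"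
      using uw unfolding r_def by blast
    then have "x \<in> X" "y \<in> Y" "v \<in> V" by (auto simp: good_def)
    then show ?thesis using goodP goodQ g by blast
  qed
  have "\<exists>f. bij_betw f P2.Z Q2.Z \<and> (\<forall>u\<in>P2.Z. (u, f u) \<in> r)"
  proof (rule single_valued_bij)
    fix u assume "u \<in> P2.Z"
    then obtain x y v where "good x y v" "u = P2.tn (P.tn x y) v" using PU by blast
    then have "(u, Q2.tn x (Q.tn y v)) \<in> r" unfolding r_def by blast
    then show "\<exists>w\<in>Q2.Z. (u, w) \<in> r" using rZ by blast
  next
    fix w assume "w \<in> Q2.Z"
    then obtain x y v where "good x y v" "w = Q2.tn x (Q.tn y v)" using QU by blast
    then have "(P2.tn (P.tn x y) v, w) \<in> r" unfolding r_def by blast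
    then show "\<exists>u\<in>P2.Z. (u, w) \<in> r" using rZ by blast
  next
    fix u w u' w' assume "(u, w) \<in> r" "(u', w') \<in> r"
    then obtain x y v x' y' v' where g: "good x y v" "u = P2.tn (P.tn x y) v" "w = Q2.tn x (Q.tn y v)"
      "good x' y' v'" "u' = P2.tn (P.tn x' y') v'" "w' = Q2.tn x' (Q.tn y' v')"
      unfolding r_def by blast
    show "u = u' \<longleftrightarrow> w = w'" unfolding g(2,3,5,6) eqP[OF g(1,4)] eqQ[OF g(1,4)] ..
  qed
  then obtain f where f: "bij_betw f P2.Z Q2.Z" "\<And>u. u \<in> P2.Z \<Longrightarrow> (u, f u) \<in> r" by blast
  have rfun: "w = f u" if uw: "(u, w) \<in> r" for u w
  proof -
    have "(u, f u) \<in> r" using f(2) rZ uw by blast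
    then obtain x y v x' y' v' where g: "good x y v" "u = P2.tn (P.tn x y) v" "w = Q2.tn x (Q.tn y v)"
      "good x' y' v'" "u = P2.tn (P.tn x' y') v'" "f u = Q2.tn x' (Q.tn y' v')"
      using uw unfolding r_def by blast
    show ?thesis unfolding g(3,6) using eqP[OF g(1,4)] eqQ[OF g(1,4)] g(2,5) by simp
  qed
  have equiv: "f (P2.ac t u) = Q2.ac t (f u)" if t: "t \<in> carrier (A \<times>\<times> G \<times>\<times> J)" and u: "u \<in> P2.Z" for t u
  proof -
    obtain a g j where agj: "t = (a, g, j)" "a \<in> carrier A" "g \<in> carrier G" "j \<in> carrier J" using t by auto
    obtain x y v where gd: "good x y v" "u = P2.tn (P.tn x y) v" using PU[OF u] by blast
    have fu: "f u = Q2.tn x (Q.tn y v)" using rfun[of u "Q2.tn x (Q.tn y v)"] gd unfolding r_def by blast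
    have m: "x \<in> X" "y \<in> Y" "v \<in> V" using gd by (auto simp: good_def)
    have Z: "P.tn x y \<in> P.Z" "Q.tn y v \<in> Q.Z" "P2.tn (P.tn x y) v \<in> P2.Z" using gd goodP[OF m] goodQ[OF m] by blast+
    let ?x = "\<rho> (a, g, \<one>\<^bsub>H\<^esub>) x" and ?v = "\<tau> (\<one>\<^bsub>A\<^esub>, \<one>\<^bsub>I\<^esub>, j) v"
    have m': "?x \<in> X" "?v \<in> V" using m agj P.X.act_closed' Q.Y.act_closed' by auto
    have y1: "\<sigma> (\<one>\<^bsub>A\<^esub>, \<one>\<^bsub>H\<^esub>, \<one>\<^bsub>I\<^esub>) y = y" using P.Y.act_one m by simp
    have "P2.ac t u = P2.tn (\<pi> (a, g, \<one>\<^bsub>I\<^esub>) (P.tn x y)) ?v"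
      unfolding agj(1) gd(2) by (rule P2.ac_tn[OF Z(1) m(3) agj(2-4)])
    also have "\<pi> (a, g, \<one>\<^bsub>I\<^esub>) (P.tn x y) = P.tn ?x y"
      unfolding \<pi>_def using Z(1) P.ac_tn[OF m(1,2) agj(2,3), of "\<one>\<^bsub>I\<^esub>"] y1 by simp
    finally have 1: "P2.ac t u = P2.tn (P.tn ?x y) ?v" .
    have "Q2.ac t (f u) = Q2.tn ?x (\<kappa> (\<one>\<^bsub>A\<^esub>, \<one>\<^bsub>H\<^esub>, j) (Q.tn y v))"
      unfolding agj(1) fu by (rule Q2.ac_tn[OF m(1) Z(2) agj(2-4)])
    also have "\<kappa> (\<one>\<^bsub>A\<^esub>, \<one>\<^bsub>H\<^esub>, j) (Q.tn y v) = Q.tn y ?v"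
      unfolding \<kappa>_def using Z(2) Q.ac_tn[OF m(2,3), of "\<one>\<^bsub>A\<^esub>" "\<one>\<^bsub>H\<^esub>" j] y1 agj by simp
    finally have 2: "Q2.ac t (f u) = Q2.tn ?x (Q.tn y ?v)" .
    have Zu: "P2.tn (P.tn ?x y) ?v \<in> P2.Z" using P2.ac_Z[OF t u] 1 by simp
    have PZ: "P.tn ?x y \<in> P.Z" using P.ac_Z[OF _ Z(1), of "(a, g, \<one>\<^bsub>I\<^esub>)"] P.ac_tn[OF m(1,2) agj(2,3), of "\<one>\<^bsub>I\<^esub>"] y1 agj by simp
    have "good ?x y ?v" using goodP[OF m'(1) m(2) m'(2)] Zu PZ by blast
    then have "(P2.ac t u, Q2.ac t (f u)) \<in> r" unfolding 1 2 r_def by blast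
    then show ?thesis using rfun by simp
  qed
  have T: "tensor A G I J (tensor A G H I (X, \<rho>) (Y, \<sigma>)) (V, \<tau>) = (P2.Z, \<lambda>t. restrict (P2.ac t) P2.Z)"
    "tensor A G H J (X, \<rho>) (tensor A H I J (Y, \<sigma>) (V, \<tau>)) = (Q2.Z, \<lambda>t. restrict (Q2.ac t) Q2.Z)"
    unfolding P.tensor_eq Q.tensor_eq \<pi>_def[symmetric] \<kappa>_def[symmetric] P2.tensor_eq Q2.tensor_eq by rule+
  have fZ: "u \<in> P2.Z \<Longrightarrow> f u \<in> Q2.Z" for u using f(1) by (auto simp: bij_betw_def)
  show ?thesis
    unfolding T fst_conv snd_conv using f(1) equiv fZ P2.ac_Z by (intro exI[of _ f] conjI ballI) auto
qed

section \<open>Composition in the Burnside modules\<close>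

text \<open>The tensor product of two sub-bisets sits in the full tensor product as the set of
  points contained in the product of the images. It will be applied to chosen representatives of the
  types of single orbits.\<close>

lemma tensor_embed:
  assumes X': "tri_action A G H X' \<rho>'" and X: "tri_action A G H X \<rho>"
    and Y': "tri_action A H I Y' \<sigma>'" and Y: "tri_action A H I Y \<sigma>"
    and f: "f \<in> X' \<rightarrow> X" "inj_on f X'" "\<And>t x. t \<in> carrier (A \<times>\<times> G \<times>\<times> H) \<Longrightarrow> x \<in> X' \<Longrightarrow> f (\<rho>' t x) = \<rho> t (f x)"
    and g: "g \<in> Y' \<rightarrow> Y" "inj_on g Y'" "\<And>t x. t \<in> carrier (A \<times>\<times> H \<times>\<times> I) \<Longrightarrow> x \<in> Y' \<Longrightarrow> g (\<sigma>' t x) = \<sigma> t (g x)"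
  defines "Z' \<equiv> fst (tensor A G H I (X', \<rho>') (Y', \<sigma>'))" and "Z \<equiv> fst (tensor A G H I (X, \<rho>) (Y, \<sigma>))"
    and "a' \<equiv> snd (tensor A G H I (X', \<rho>') (Y', \<sigma>'))" and "a \<equiv> snd (tensor A G H I (X, \<rho>) (Y, \<sigma>))"
    and "F \<equiv> (`) (map_prod f g)"
  shows "F \<in> Z' \<rightarrow> Z" "inj_on F Z'"
    "\<And>t z. t \<in> carrier (A \<times>\<times> G \<times>\<times> I) \<Longrightarrow> z \<in> Z' \<Longrightarrow> F (a' t z) = a t (F z)"
    "F ` Z' = {z \<in> Z. z \<subseteq> f ` X' \<times> g ` Y'}"
proof -
  interpret P': tensor_pair A G H I X' \<rho>' Y' \<sigma>' by (rule tensor_pairI[OF X' Y'])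
  interpret P: tensor_pair A G H I X \<rho> Y \<sigma> by (rule tensor_pairI[OF X Y])
  have Zs: "Z' = P'.Z" "Z = P.Z" "a' = (\<lambda>t. restrict (P'.ac t) P'.Z)" "a = (\<lambda>t. restrict (P.ac t) P.Z)"
    unfolding Z'_def Z_def a'_def a_def P'.tensor_eq P.tensor_eq by simp_all
  have fX: "x \<in> X' \<Longrightarrow> f x \<in> X" and gY: "y \<in> Y' \<Longrightarrow> g y \<in> Y" for x y using f(1) g(1) by auto
  have st: "P.X.stb (f x) = P'.X.stb x" if "x \<in> X'" for x
    by (rule equivariant_stabilizer[OF _ f(2)]) (use f(3) that P'.X.act_closed in auto)
  have st': "P.Y.stb (g y) = P'.Y.stb y" if "y \<in> Y'" for y
    by (rule equivariant_stabilizer[OF _ g(2)]) (use g(3) that P'.Y.act_closed in auto)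
  have Ftn: "F (P'.tn x y) = P.tn (f x) (g y)" if "x \<in> X'" "y \<in> Y'" for x y
    unfolding F_def P'.tn_image P.tn_image image_image
    by (intro image_cong refl) (use that f(3) g(3) in auto)
  have FZ: "P.tn (f x) (g y) \<in> P.Z \<longleftrightarrow> P'.tn x y \<in> P'.Z" if "x \<in> X'" "y \<in> Y'" for x y
    using P.tn_Z_iff[OF fX[OF that(1)] gY[OF that(2)]] P'.tn_Z_iff[OF that] st[OF that(1)] st'[OF that(2)] by simp
  have Z'E: "\<exists>x\<in>X'. \<exists>y\<in>Y'. z = P'.tn x y" if "z \<in> P'.Z" for z using that unfolding P'.Z_def by blast
  show FZZ: "F \<in> Z' \<rightarrow> Z"
  proof
    fix z assume "z \<in> Z'"
    then have z: "z \<in> P'.Z" using Zs by simp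
    then obtain x y where "x \<in> X'" "y \<in> Y'" "z = P'.tn x y" using Z'E by blast
    then show "F z \<in> Z" using Ftn FZ z Zs by simp
  qed
  show "inj_on F Z'"
  proof (rule inj_onI)
    fix u v assume uv: "u \<in> Z'" "v \<in> Z'" "F u = F v"
    have "u \<subseteq> X' \<times> Y'" "v \<subseteq> X' \<times> Y'"
      using uv(1,2) Z'E P'.tn_subset unfolding Zs by (metis, metis)
    moreover have "inj_on (map_prod f g) (X' \<times> Y')" using f(2) g(2) by (rule map_prod_inj_on)
    ultimately show "u = v" using uv(3) unfolding F_def by (simp add: inj_on_image_eq_iff)
  qed
  show "F (a' t z) = a t (F z)" if t: "t \<in> carrier (A \<times>\<times> G \<times>\<times> I)" and z: "z \<in> Z'" for t z
  proof -
    have zP: "z \<in> P'.Z" using z Zs by simp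
    obtain x y where xy: "x \<in> X'" "y \<in> Y'" "z = P'.tn x y" using Z'E[OF zP] by blast
    obtain b h i where bhi: "t = (b, h, i)" "b \<in> carrier A" "h \<in> carrier G" "i \<in> carrier I" using t by auto
    have m: "\<rho>' (b, h, \<one>\<^bsub>H\<^esub>) x \<in> X'" "\<sigma>' (\<one>\<^bsub>A\<^esub>, \<one>\<^bsub>H\<^esub>, i) y \<in> Y'"
      using bhi xy P'.X.act_closed' P'.Y.act_closed' by auto
    have "F (a' t z) = F (P'.ac t z)" using zP Zs by simp
    also have "\<dots> = P.tn (f (\<rho>' (b, h, \<one>\<^bsub>H\<^esub>) x)) (g (\<sigma>' (\<one>\<^bsub>A\<^esub>, \<one>\<^bsub>H\<^esub>, i) y))"
      using P'.ac_tn[OF xy(1,2) bhi(2-4)] Ftn[OF m] xy(3) bhi(1) by simp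
    also have "\<dots> = P.tn (\<rho> (b, h, \<one>\<^bsub>H\<^esub>) (f x)) (\<sigma> (\<one>\<^bsub>A\<^esub>, \<one>\<^bsub>H\<^esub>, i) (g y))"
      using f(3)[OF _ xy(1)] g(3)[OF _ xy(2)] bhi by simp
    also have "\<dots> = P.ac t (F z)"
      using P.ac_tn[OF fX[OF xy(1)] gY[OF xy(2)] bhi(2-4)] Ftn[OF xy(1,2)] xy(3) bhi(1) by simp
    also have "\<dots> = a t (F z)" using FZZ z Zs by auto
    finally show ?thesis .
  qed
  show "F ` Z' = {z \<in> Z. z \<subseteq> f ` X' \<times> g ` Y'}"
  proof
    show "F ` Z' \<subseteq> {z \<in> Z. z \<subseteq> f ` X' \<times> g ` Y'}"
    proof
      fix w assume "w \<in> F ` Z'"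
      then obtain z where z: "z \<in> Z'" "w = F z" by blast
      then obtain x y where xy: "x \<in> X'" "y \<in> Y'" "z = P'.tn x y" using Z'E Zs by blast
      have "F z \<subseteq> f ` X' \<times> g ` Y'" unfolding F_def using P'.tn_subset[OF xy(1,2)] xy(3) by fastforce
      then show "w \<in> {z \<in> Z. z \<subseteq> f ` X' \<times> g ` Y'}" using z FZZ by auto
    qed
    show "{z \<in> Z. z \<subseteq> f ` X' \<times> g ` Y'} \<subseteq> F ` Z'"
    proof
      fix w assume w: "w \<in> {z \<in> Z. z \<subseteq> f ` X' \<times> g ` Y'}"
      then obtain u v where uv: "u \<in> X" "v \<in> Y" "w = P.tn u v" unfolding Zs P.Z_def by blast
      then have "(u, v) \<in> f ` X' \<times> g ` Y'" using w P.tn_refl by blast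
      then obtain x y where xy: "x \<in> X'" "y \<in> Y'" "u = f x" "v = g y" by blast
      then have "w = F (P'.tn x y)" "P'.tn x y \<in> Z'" using Ftn FZ w uv Zs by auto
      then show "w \<in> F ` Z'" by blast
    qed
  qed
qed

lemma (in coefficients) add_pow_sum:
  assumes "finite S"
  shows "[(\<Sum>i\<in>S. (n i :: nat))] \<cdot> \<one> = (\<Oplus>i\<in>S. [n i] \<cdot> \<one>)"
  using assms
proof (induction S)
  case (insert i S)
  then show ?case by (simp add: add.nat_pow_mult[symmetric])
qed simp

text \<open>Passes from a class written with multiplicities of orbit types to a sum over the orbits
  themselves.\<close>

lemma (in coefficients) finsum_fibres:
  assumes "finite S" "\<And>b. b \<in> h ` S \<Longrightarrow> g b \<in> carrier R"
  shows "(\<Oplus>b\<in>h ` S. [card {w \<in> S. h w = b}] \<cdot> \<one> \<otimes> g b) = (\<Oplus>w\<in>S. g (h w))"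
proof -
  have "(\<Oplus>w\<in>S. g (h w)) = (\<Oplus>w\<in>(\<Union>b\<in>h ` S. {w \<in> S. h w = b}). g (h w))"
    by (rule arg_cong[where f = "finsum R (\<lambda>w. g (h w))"]) auto
  also have "\<dots> = (\<Oplus>b\<in>h ` S. \<Oplus>w\<in>{w \<in> S. h w = b}. g (h w))"
    using assms by (intro add.finprod_UN_disjoint) (auto simp: pairwise_def disjnt_def)
  also have "\<dots> = (\<Oplus>b\<in>h ` S. [card {w \<in> S. h w = b}] \<cdot> \<one> \<otimes> g b)"
  proof (rule finsum_cong')
    fix b assume b: "b \<in> h ` S"
    have "(\<Oplus>w\<in>{w \<in> S. h w = b}. g (h w)) = (\<Oplus>w\<in>{w \<in> S. h w = b}. g b)"
      using assms b by (intro finsum_cong') auto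
    also have "\<dots> = [card {w \<in> S. h w = b}] \<cdot> g b"
      using add.finprod_const[OF assms(2)[OF b]] .
    also have "\<dots> = [card {w \<in> S. h w = b}] \<cdot> \<one> \<otimes> g b"
      using assms(2)[OF b] by (simp add: add_pow_ldistr)
    finally show "(\<Oplus>w\<in>{w \<in> S. h w = b}. g (h w)) = [card {w \<in> S. h w = b}] \<cdot> \<one> \<otimes> g b" .
  qed (use assms in auto)
  finally show ?thesis ..
qed

context fin_tri_group
begin

text \<open>\<open>compose_burnside\<close> works with the biset that \<open>SOME\<close> picks from
  a class; this makes the pick usable.\<close>

lemma rep:
  assumes "b \<in> iso_classes A G H"
  obtains X \<rho> x where "(SOME X. X \<in> b) = (X, \<rho>)" "(X, \<rho>) \<in> b" "fibered_biset A G H (X, \<rho>)" "tri_action A G H X \<rho>"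
    "x \<in> X" "X = orbit T \<rho> x" "b = cl A G H (stabilizer T \<rho> x)"
proof -
  obtain S where S: "fib A G H S" "b = cl A G H S" using assms unfolding iso_classes_eq by blast
  obtain X \<rho> where X: "(SOME X. X \<in> b) = (X, \<rho>)" by fastforce
  have mem: "(SOME X. X \<in> b) \<in> b" by (rule someI[of _ "sb S"]) (use S sb_cl in simp)
  then have "(X, \<rho>) \<in> cl A G H S" using X S by simp
  then obtain x where x: "fibered_biset A G H (X, \<rho>)" "tri_action A G H X \<rho>" "x \<in> X"
    "X = orbit T \<rho> x" "stabilizer T \<rho> x = S"
    by (rule clD)
  have "(X, \<rho>) \<in> b" using mem X by simp
  then show thesis by (rule that[OF X _ x(1-4)]) (simp add: S(2) x(5))
qed

lemma orb_class_iso_classes: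
  assumes X: "fibered_biset A G H (X, \<rho>)" and w: "w \<in> orbits T X \<rho>"
  shows "orb_class A G H \<rho> w \<in> iso_classes A G H"
proof -
  obtain x where x: "x \<in> X" "w = orbit T \<rho> x" using w unfolding orbits_def by blast
  show ?thesis unfolding x(2) orbit_class[OF fibered_bisetD(1)[OF X] x(1)]
    by (rule cl_iso_classes[OF fibered_stb[OF X x(1)]])
qed

lemma orb_rep:
  assumes X: "fibered_biset A G H (X, \<rho>)" and w: "w \<in> orbits T X \<rho>"
  obtains X' \<rho>' f where "(SOME X. X \<in> orb_class A G H \<rho> w) = (X', \<rho>')" "fibered_biset A G H (X', \<rho>')"
    "tri_action A G H X' \<rho>'" "f \<in> X' \<rightarrow> X" "inj_on f X'" "f ` X' = w"
    "\<And>t x. t \<in> carrier T \<Longrightarrow> x \<in> X' \<Longrightarrow> f (\<rho>' t x) = \<rho> t (f x)"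
proof -
  interpret X: tri_action A G H X \<rho> by (rule tri_actionI) (rule fibered_bisetD(1)[OF X])
  obtain x where x: "x \<in> X" "w = orbit T \<rho> x" using w unfolding orbits_def by blast
  have wX: "w \<subseteq> X" using X.orbit_subset[OF x(1)] x(2) by simp
  obtain X' \<rho>' x' where X': "(SOME X. X \<in> orb_class A G H \<rho> w) = (X', \<rho>')"
    "(X', \<rho>') \<in> orb_class A G H \<rho> w" "fibered_biset A G H (X', \<rho>')" "tri_action A G H X' \<rho>'"
    by (rule rep[OF orb_class_iso_classes[OF X w]])
  obtain f where f: "bij_betw f w X'" "\<forall>t\<in>carrier T. \<forall>x\<in>w. f (restrict (\<rho> t) w x) = \<rho>' t (f x)"
    using X'(2) unfolding iso_class_def biset_iso_def by blast
  let ?g = "the_inv_into w f"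
  have bij: "bij_betw ?g X' w" by (rule bij_betw_the_inv_into[OF f(1)])
  have eqv: "?g (\<rho>' t y) = \<rho> t (?g y)" if t: "t \<in> carrier T" and y: "y \<in> X'" for t y
  proof -
    have gy: "?g y \<in> w" using bij y by (auto simp: bij_betw_def)
    have rw: "\<rho> t (?g y) \<in> w" using X.orbit_closed[OF t x(1)] gy unfolding x(2) by blast
    have "f (\<rho> t (?g y)) = \<rho>' t (f (?g y))" using bspec[OF bspec[OF f(2) t] gy] gy by simp
    also have "f (?g y) = y" using f(1) y by (simp add: f_the_inv_into_f_bij_betw)
    finally show ?thesis using the_inv_into_f_f[OF bij_betw_imp_inj_on[OF f(1)] rw] by simp
  qed
  have g: "?g \<in> X' \<rightarrow> X" "inj_on ?g X'" "?g ` X' = w" using bij wX by (auto simp: bij_betw_def)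
  show thesis by (rule that[OF X'(1,3,4) g eqv])
qed

end

section \<open>Bilinearity of the composition and its value on arbitrary bisets\<close>

locale compose_ctx = coefficients R + GH: fin_tri_group A G H + HI: fin_tri_group A H I
  for R :: "'k ring" (structure) and A :: "'a monoid" and G :: "'g monoid" and H :: "'h monoid" and I :: "'i monoid"
begin

sublocale GI: fin_tri_group A G I
  by (intro fin_tri_group.intro tri_group.intro fin_tri_group_axioms.intro GH.A.comm_group_axioms
      GH.G.group_axioms HI.H.group_axioms GH.finite_G HI.finite_H)

definition mm where "mm b c =
  biset_class R A G I (tensor A G H I (SOME X. X \<in> b) (SOME Y. Y \<in> c))"

abbreviation cmp where "cmp \<equiv> compose_burnside R A G H I"

abbreviation BGH where "BGH \<equiv> fin_supp R (iso_classes A G H)"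
abbreviation BHI where "BHI \<equiv> fin_supp R (iso_classes A H I)"
abbreviation BGI where "BGI \<equiv> fin_supp R (iso_classes A G I)"

lemma pairI: "fibered_biset A G H (X, \<rho>) \<Longrightarrow> fibered_biset A H I (Y, \<sigma>) \<Longrightarrow> tensor_pair A G H I X \<rho> Y \<sigma>"
  by (intro tensor_pairI GH.tri_actionI HI.tri_actionI fibered_bisetD(1))

lemma tensor_fibered:
  assumes "fibered_biset A G H (X, \<rho>)" "fibered_biset A H I (Y, \<sigma>)"
  shows "fibered_biset A G I (tensor A G H I (X, \<rho>) (Y, \<sigma>))"
  unfolding tensor_pair.tensor_eq[OF pairI[OF assms]] by (rule tensor_pair.Z_fibered[OF pairI[OF assms] assms])

lemma mm_closed:
  assumes "b \<in> iso_classes A G H" "c \<in> iso_classes A H I"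
  shows "mm b c \<in> BGI"
proof -
  obtain X \<rho> where X: "(SOME X. X \<in> b) = (X, \<rho>)" "fibered_biset A G H (X, \<rho>)" by (rule GH.rep[OF assms(1)])
  obtain Y \<sigma> where Y: "(SOME Y. Y \<in> c) = (Y, \<sigma>)" "fibered_biset A H I (Y, \<sigma>)" by (rule HI.rep[OF assms(2)])
  obtain Z \<tau> where Z: "tensor A G H I (X, \<rho>) (Y, \<sigma>) = (Z, \<tau>)" by fastforce
  show ?thesis unfolding mm_def X(1) Y(1) Z
    by (rule GI.biset_class_burnside[OF cring_axioms]) (use tensor_fibered[OF X(2) Y(2)] Z in simp)
qed

lemma mm_carrier: "b \<in> iso_classes A G H \<Longrightarrow> c \<in> iso_classes A H I \<Longrightarrow> mm b c d \<in> carrier R"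
  using fin_suppD(1)[OF mm_closed] .

text \<open>The supports in the definition vary with the arguments. Replacing them by larger finite
  sets, which adds only zeros, lets several compositions be summed over common index sets; all
  bilinearity rules rest on this.\<close>

lemma cmp_expand:
  assumes v: "v \<in> BGH" and w: "w \<in> BHI"
    and B: "finite B" "{b. v b \<noteq> \<zero>} \<subseteq> B" "B \<subseteq> iso_classes A G H"
    and C: "finite C" "{c. w c \<noteq> \<zero>} \<subseteq> C" "C \<subseteq> iso_classes A H I"
  shows "cmp v w d = (\<Oplus>b\<in>B. \<Oplus>c\<in>C. v b \<otimes> w c \<otimes> mm b c d)"
proof -
  note vc = fin_suppD(1)[OF v] and wc = fin_suppD(1)[OF w]
  have m: "mm b c d \<in> carrier R" if "b \<in> B" "c \<in> C" for b c using mm_carrier that B C by blast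
  have "cmp v w d = (\<Oplus>b\<in>{b. v b \<noteq> \<zero>}. \<Oplus>c\<in>{c. w c \<noteq> \<zero>}. v b \<otimes> w c \<otimes> mm b c d)"
    by (simp add: compose_burnside_def mm_def)
  also have "\<dots> = (\<Oplus>b\<in>{b. v b \<noteq> \<zero>}. \<Oplus>c\<in>C. v b \<otimes> w c \<otimes> mm b c d)"
  proof (rule finsum_cong')
    fix b assume "b \<in> {b. v b \<noteq> \<zero>}"
    then have b: "b \<in> B" using B by blast
    show "(\<Oplus>c\<in>{c. w c \<noteq> \<zero>}. v b \<otimes> w c \<otimes> mm b c d) = (\<Oplus>c\<in>C. v b \<otimes> w c \<otimes> mm b c d)"
      using C b by (intro add.finprod_mono_neutral_cong_left) (auto simp: vc wc m)
  qed (use B C in \<open>auto intro!: finsum_closed m_closed vc wc m\<close>)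
  also have "\<dots> = (\<Oplus>b\<in>B. \<Oplus>c\<in>C. v b \<otimes> w c \<otimes> mm b c d)"
  proof (rule add.finprod_mono_neutral_cong_left)
    fix b assume "b \<in> B - {b. v b \<noteq> \<zero>}"
    then show "(\<Oplus>c\<in>C. v b \<otimes> w c \<otimes> mm b c d) = \<zero>"
      by (intro add.finprod_one_eqI) (simp add: wc m)
  qed (use B C in \<open>auto intro!: finsum_closed m_closed vc wc m\<close>)
  finally show ?thesis .
qed

lemma cmp_single:
  assumes "b \<in> iso_classes A G H" "c \<in> iso_classes A H I"
  shows "cmp (single R b) (single R c) = mm b c"
proof
  fix d
  have "cmp (single R b) (single R c) d = (\<Oplus>b\<in>{b}. \<Oplus>c\<in>{c}. single R b b \<otimes> single R c c \<otimes> mm b c d)"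
  proof -
    have "cmp (single R b) (single R c) d =
      (\<Oplus>x\<in>{b}. \<Oplus>y\<in>{c}. single R b x \<otimes> single R c y \<otimes> mm x y d)"
      by (rule cmp_expand) (use assms single_fin_supp in \<open>auto simp: single_def\<close>)
    then show ?thesis using mm_carrier[OF assms] by (simp add: single_def)
  qed
  then show "cmp (single R b) (single R c) d = mm b c d"
    using mm_carrier[OF assms] by (simp add: single_def)
qed

lemma cmp_add_left:
  assumes "v \<in> BGH" "v' \<in> BGH" "w \<in> BHI"
  shows "cmp (\<lambda>b. v b \<oplus> v' b) w = (\<lambda>d. cmp v w d \<oplus> cmp v' w d)"
proof
  fix d
  let ?B = "{b. v b \<noteq> \<zero>} \<union> {b. v' b \<noteq> \<zero>}" and ?C = "{c. w c \<noteq> \<zero>}"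
  note c = fin_suppD(1)[OF assms(1)] fin_suppD(1)[OF assms(2)] fin_suppD(1)[OF assms(3)]
  have B: "finite ?B" "?B \<subseteq> iso_classes A G H" "finite ?C" "?C \<subseteq> iso_classes A H I"
    using assms by (auto simp: fin_supp_def)
  have m: "mm b c d \<in> carrier R" if "b \<in> ?B" "c \<in> ?C" for b c using mm_carrier that B by blast
  have s: "(\<lambda>b. v b \<oplus> v' b) \<in> BGH" by (rule add_fin_supp[OF assms(1,2)])
  have E: "cmp (\<lambda>b. v b \<oplus> v' b) w d = (\<Oplus>b\<in>?B. \<Oplus>c\<in>?C. (v b \<oplus> v' b) \<otimes> w c \<otimes> mm b c d)"
    by (rule cmp_expand[OF s assms(3)]) (use B in auto)
  have E1: "cmp v w d = (\<Oplus>b\<in>?B. \<Oplus>c\<in>?C. v b \<otimes> w c \<otimes> mm b c d)"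
    by (rule cmp_expand[OF assms(1,3)]) (use B in auto)
  have E2: "cmp v' w d = (\<Oplus>b\<in>?B. \<Oplus>c\<in>?C. v' b \<otimes> w c \<otimes> mm b c d)"
    by (rule cmp_expand[OF assms(2,3)]) (use B in auto)
  have "(\<Oplus>b\<in>?B. \<Oplus>c\<in>?C. (v b \<oplus> v' b) \<otimes> w c \<otimes> mm b c d) =
    (\<Oplus>b\<in>?B. (\<Oplus>c\<in>?C. v b \<otimes> w c \<otimes> mm b c d) \<oplus> (\<Oplus>c\<in>?C. v' b \<otimes> w c \<otimes> mm b c d))"
  proof (rule finsum_cong')
    fix b assume b: "b \<in> ?B"
    have "(\<Oplus>c\<in>?C. (v b \<oplus> v' b) \<otimes> w c \<otimes> mm b c d) =
      (\<Oplus>c\<in>?C. v b \<otimes> w c \<otimes> mm b c d \<oplus> v' b \<otimes> w c \<otimes> mm b c d)"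
      by (rule finsum_cong') (use b m c in \<open>auto simp: l_distr\<close>)
    also have "\<dots> = (\<Oplus>c\<in>?C. v b \<otimes> w c \<otimes> mm b c d) \<oplus> (\<Oplus>c\<in>?C. v' b \<otimes> w c \<otimes> mm b c d)"
      by (rule finsum_addf) (use b m c in auto)
    finally show "(\<Oplus>c\<in>?C. (v b \<oplus> v' b) \<otimes> w c \<otimes> mm b c d) =
      (\<Oplus>c\<in>?C. v b \<otimes> w c \<otimes> mm b c d) \<oplus> (\<Oplus>c\<in>?C. v' b \<otimes> w c \<otimes> mm b c d)" .
  qed (auto intro!: add.m_closed finsum_closed m_closed c m)
  also have "\<dots> = cmp v w d \<oplus> cmp v' w d" unfolding E1 E2
    by (rule finsum_addf) (auto intro!: finsum_closed m_closed c m)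
  finally show "cmp (\<lambda>b. v b \<oplus> v' b) w d = cmp v w d \<oplus> cmp v' w d" using E by simp
qed

lemma cmp_add_right:
  assumes "v \<in> BGH" "w \<in> BHI" "w' \<in> BHI"
  shows "cmp v (\<lambda>b. w b \<oplus> w' b) = (\<lambda>d. cmp v w d \<oplus> cmp v w' d)"
proof
  fix d
  let ?C = "{b. w b \<noteq> \<zero>} \<union> {b. w' b \<noteq> \<zero>}" and ?B = "{c. v c \<noteq> \<zero>}"
  note c = fin_suppD(1)[OF assms(1)] fin_suppD(1)[OF assms(2)] fin_suppD(1)[OF assms(3)]
  have B: "finite ?B" "?B \<subseteq> iso_classes A G H" "finite ?C" "?C \<subseteq> iso_classes A H I"
    using assms by (auto simp: fin_supp_def)
  have m: "mm b c d \<in> carrier R" if "b \<in> ?B" "c \<in> ?C" for b c using mm_carrier that B by blast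
  have s: "(\<lambda>b. w b \<oplus> w' b) \<in> BHI" by (rule add_fin_supp[OF assms(2,3)])
  have E: "cmp v (\<lambda>b. w b \<oplus> w' b) d = (\<Oplus>b\<in>?B. \<Oplus>c\<in>?C. v b \<otimes> (w c \<oplus> w' c) \<otimes> mm b c d)"
    by (rule cmp_expand[OF assms(1) s]) (use B in auto)
  have E1: "cmp v w d = (\<Oplus>b\<in>?B. \<Oplus>c\<in>?C. v b \<otimes> w c \<otimes> mm b c d)"
    by (rule cmp_expand[OF assms(1,2)]) (use B in auto)
  have E2: "cmp v w' d = (\<Oplus>b\<in>?B. \<Oplus>c\<in>?C. v b \<otimes> w' c \<otimes> mm b c d)"
    by (rule cmp_expand[OF assms(1,3)]) (use B in auto)
  have "(\<Oplus>b\<in>?B. \<Oplus>c\<in>?C. v b \<otimes> (w c \<oplus> w' c) \<otimes> mm b c d) =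
    (\<Oplus>b\<in>?B. (\<Oplus>c\<in>?C. v b \<otimes> w c \<otimes> mm b c d) \<oplus> (\<Oplus>c\<in>?C. v b \<otimes> w' c \<otimes> mm b c d))"
  proof (rule finsum_cong')
    fix b assume b: "b \<in> ?B"
    have "(\<Oplus>c\<in>?C. v b \<otimes> (w c \<oplus> w' c) \<otimes> mm b c d) =
      (\<Oplus>c\<in>?C. v b \<otimes> w c \<otimes> mm b c d \<oplus> v b \<otimes> w' c \<otimes> mm b c d)"
      by (rule finsum_cong') (use b m c in \<open>auto simp: l_distr r_distr\<close>)
    also have "\<dots> = (\<Oplus>c\<in>?C. v b \<otimes> w c \<otimes> mm b c d) \<oplus> (\<Oplus>c\<in>?C. v b \<otimes> w' c \<otimes> mm b c d)"
      by (rule finsum_addf) (use b m c in auto)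
    finally show "(\<Oplus>c\<in>?C. v b \<otimes> (w c \<oplus> w' c) \<otimes> mm b c d) =
      (\<Oplus>c\<in>?C. v b \<otimes> w c \<otimes> mm b c d) \<oplus> (\<Oplus>c\<in>?C. v b \<otimes> w' c \<otimes> mm b c d)" .
  qed (auto intro!: add.m_closed finsum_closed m_closed c m)
  also have "\<dots> = cmp v w d \<oplus> cmp v w' d" unfolding E1 E2
    by (rule finsum_addf) (auto intro!: finsum_closed m_closed c m)
  finally show "cmp v (\<lambda>b. w b \<oplus> w' b) d = cmp v w d \<oplus> cmp v w' d" using E by simp
qed

lemma cmp_smult:
  assumes "a \<in> carrier R" "v \<in> BGH" "w \<in> BHI"
  shows "cmp (\<lambda>b. a \<otimes> v b) w = (\<lambda>d. a \<otimes> cmp v w d)"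
    and "cmp v (\<lambda>b. a \<otimes> w b) = (\<lambda>d. a \<otimes> cmp v w d)"
proof -
  let ?B = "{b. v b \<noteq> \<zero>}" and ?C = "{c. w c \<noteq> \<zero>}"
  note c = assms(1) fin_suppD(1)[OF assms(2)] fin_suppD(1)[OF assms(3)]
  have B: "finite ?B" "?B \<subseteq> iso_classes A G H" "finite ?C" "?C \<subseteq> iso_classes A H I"
    using assms by (auto simp: fin_supp_def)
  have m: "mm b c d \<in> carrier R" if "b \<in> ?B" "c \<in> ?C" for b c d using mm_carrier that B by blast
  have E0: "cmp v w d = (\<Oplus>b\<in>?B. \<Oplus>c\<in>?C. v b \<otimes> w c \<otimes> mm b c d)" for d
    by (rule cmp_expand[OF assms(2,3)]) (use B in auto)
  have pull: "(\<Oplus>b\<in>?B. \<Oplus>c\<in>?C. a \<otimes> (v b \<otimes> w c \<otimes> mm b c d)) = a \<otimes> cmp v w d" for d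
  proof -
    have "(\<Oplus>b\<in>?B. \<Oplus>c\<in>?C. a \<otimes> (v b \<otimes> w c \<otimes> mm b c d)) = (\<Oplus>b\<in>?B. a \<otimes> (\<Oplus>c\<in>?C. v b \<otimes> w c \<otimes> mm b c d))"
    proof (rule finsum_cong')
      fix b assume b: "b \<in> ?B"
      show "(\<Oplus>c\<in>?C. a \<otimes> (v b \<otimes> w c \<otimes> mm b c d)) = a \<otimes> (\<Oplus>c\<in>?C. v b \<otimes> w c \<otimes> mm b c d)"
        by (rule finsum_rdistr[symmetric]) (use b B m c in auto)
    qed (auto intro!: finsum_closed m_closed c m)
    also have "\<dots> = a \<otimes> cmp v w d" unfolding E0
      by (rule finsum_rdistr[symmetric]) (use B in \<open>auto intro!: finsum_closed m_closed c m\<close>)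
    finally show ?thesis .
  qed
  show "cmp (\<lambda>b. a \<otimes> v b) w = (\<lambda>d. a \<otimes> cmp v w d)"
  proof
    fix d
    have "cmp (\<lambda>b. a \<otimes> v b) w d = (\<Oplus>b\<in>?B. \<Oplus>c\<in>?C. a \<otimes> v b \<otimes> w c \<otimes> mm b c d)"
      by (rule cmp_expand[OF smult_fin_supp[OF assms(2,1)] assms(3)]) (use B c in auto)
    also have "\<dots> = (\<Oplus>b\<in>?B. \<Oplus>c\<in>?C. a \<otimes> (v b \<otimes> w c \<otimes> mm b c d))"
      by (intro finsum_cong') (auto intro!: finsum_closed m_closed c m simp: m_assoc c m)
    finally show "cmp (\<lambda>b. a \<otimes> v b) w d = a \<otimes> cmp v w d" using pull by simp
  qed
  show "cmp v (\<lambda>b. a \<otimes> w b) = (\<lambda>d. a \<otimes> cmp v w d)"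
  proof
    fix d
    have "cmp v (\<lambda>b. a \<otimes> w b) d = (\<Oplus>b\<in>?B. \<Oplus>c\<in>?C. v b \<otimes> (a \<otimes> w c) \<otimes> mm b c d)"
      by (rule cmp_expand[OF assms(2) smult_fin_supp[OF assms(3,1)]]) (use B c in auto)
    also have "\<dots> = (\<Oplus>b\<in>?B. \<Oplus>c\<in>?C. a \<otimes> (v b \<otimes> w c \<otimes> mm b c d))"
      by (intro finsum_cong') (auto intro!: finsum_closed m_closed c m simp: m_ac c m)
    finally show "cmp v (\<lambda>b. a \<otimes> w b) d = a \<otimes> cmp v w d" using pull by simp
  qed
qed

lemma cmp_zero:
  shows "cmp (\<lambda>b. \<zero>) w = (\<lambda>d. \<zero>)" "cmp v (\<lambda>b. \<zero>) = (\<lambda>d. \<zero>)"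
  by (auto simp: compose_burnside_def fun_eq_iff)

lemma cmp_fin_supp:
  assumes mm: "\<And>b c. b \<in> iso_classes A G H \<Longrightarrow> c \<in> iso_classes A H I \<Longrightarrow> mm b c \<in> fin_supp R U"
    and v: "v \<in> BGH" and w: "w \<in> BHI"
  shows "cmp v w \<in> fin_supp R U"
proof -
  have 1: "cmp (single R b) w \<in> fin_supp R U" if b: "b \<in> iso_classes A G H" for b
    using w
  proof (induction rule: fin_supp_induct)
    case zero
    then show ?case by (simp add: cmp_zero zero_fin_supp)
  next
    case (add c d v)
    have s: "single R b \<in> BGH" "single R d \<in> BHI" by (rule single_fin_supp[OF b], rule single_fin_supp[OF add(2)])
    show ?case
      unfolding cmp_add_right[OF s(1) smult_fin_supp[OF s(2) add(1)] add(3)] cmp_smult(2)[OF add(1) s] cmp_single[OF b add(2)]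
      by (intro add_fin_supp smult_fin_supp mm[OF b add(2)] add(1,4))
  qed
  show ?thesis using v
  proof (induction rule: fin_supp_induct)
    case zero
    then show ?case by (simp add: cmp_zero zero_fin_supp)
  next
    case (add c d v)
    have s: "single R d \<in> BGH" by (rule single_fin_supp[OF add(2)])
    show ?case
      unfolding cmp_add_left[OF smult_fin_supp[OF s add(1)] add(3) w] cmp_smult(1)[OF add(1) s w]
      by (intro add_fin_supp smult_fin_supp 1[OF add(2)] add(1,4))
  qed
qed

lemma cmp_closed:
  assumes "v \<in> BGH" "w \<in> BHI"
  shows "cmp v w \<in> BGI"
  by (rule cmp_fin_supp[OF _ assms]) (rule mm_closed)

text \<open>Every orbit of the tensor product lies over exactly one pair of orbits of the factors,
  so the count splits as a double sum.\<close>

lemma card_tensor_orbits: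
  assumes X: "fibered_biset A G H (X, \<rho>)" and Y: "fibered_biset A H I (Y, \<sigma>)"
  defines "Z \<equiv> fst (tensor A G H I (X, \<rho>) (Y, \<sigma>))" and "a \<equiv> snd (tensor A G H I (X, \<rho>) (Y, \<sigma>))"
  shows "card {w \<in> orbits GI.T Z a. orb_class A G I a w = d} =
    (\<Sum>u\<in>orbits GH.T X \<rho>. \<Sum>v\<in>orbits HI.T Y \<sigma>.
      card {w \<in> orbits GI.T Z a. w \<subseteq> {z \<in> Z. z \<subseteq> u \<times> v} \<and> orb_class A G I a w = d})"
proof -
  interpret P: tensor_pair A G H I X \<rho> Y \<sigma> by (rule pairI[OF X Y])
  have Zs: "Z = P.Z" "a = (\<lambda>t. restrict (P.ac t) P.Z)" unfolding Z_def a_def P.tensor_eq by simp_all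
  let ?OX = "orbits GH.T X \<rho>" and ?OY = "orbits HI.T Y \<sigma>"
  let ?D = "\<lambda>(u, v). {w \<in> orbits GI.T Z a. w \<subseteq> {z \<in> Z. z \<subseteq> u \<times> v} \<and> orb_class A G I a w = d}"
  have fZ: "fibered_biset A G I (Z, a)" using tensor_fibered[OF X Y] unfolding Z_def a_def by simp
  interpret ZA: tri_action A G I Z a by (rule GI.tri_actionI) (rule fibered_bisetD(1)[OF fZ])
  have fin: "finite (orbits GI.T Z a)" "finite ?OX" "finite ?OY"
    using GI.finite_orbits[OF fZ] GH.finite_orbits[OF X] HI.finite_orbits[OF Y] by auto
  have cover: "\<exists>u\<in>?OX. \<exists>v\<in>?OY. w \<subseteq> {z \<in> Z. z \<subseteq> u \<times> v}" if w: "w \<in> orbits GI.T Z a" for w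
  proof -
    obtain z where z: "z \<in> Z" "w = orbit GI.T a z" using w unfolding orbits_def by blast
    obtain x y where xy: "x \<in> X" "y \<in> Y" "z = P.tn x y" using z(1) unfolding Zs P.Z_def by blast
    have "w \<subseteq> {z \<in> Z. z \<subseteq> orbit GH.T \<rho> x \<times> orbit HI.T \<sigma> y}"
    proof
      fix z' assume z': "z' \<in> w"
      then obtain t where t: "t \<in> carrier GI.T" "z' = a t z" unfolding z(2) orbit_def by blast
      obtain b g i where bgi: "t = (b, g, i)" "b \<in> carrier A" "g \<in> carrier G" "i \<in> carrier I" using t(1) by auto
      have "z' = P.tn (\<rho> (b, g, \<one>\<^bsub>H\<^esub>) x) (\<sigma> (\<one>\<^bsub>A\<^esub>, \<one>\<^bsub>H\<^esub>, i) y)"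
        using t(2) z(1) P.ac_tn[OF xy(1,2) bgi(2-4)] unfolding Zs xy(3) bgi(1) by simp
      also have "\<dots> \<subseteq> orbit GH.T \<rho> x \<times> orbit HI.T \<sigma> y"
      proof -
        have "\<rho> (b, g, \<one>\<^bsub>H\<^esub>) x \<in> orbit GH.T \<rho> x" "\<sigma> (\<one>\<^bsub>A\<^esub>, \<one>\<^bsub>H\<^esub>, i) y \<in> orbit HI.T \<sigma> y"
          using bgi unfolding orbit_def by auto
        then show ?thesis unfolding P.tn_image
          using P.X.orbit_closed[OF _ xy(1)] P.Y.orbit_closed[OF _ xy(2)] by auto
      qed
      finally have "z' \<subseteq> orbit GH.T \<rho> x \<times> orbit HI.T \<sigma> y" .
      moreover have "z' \<in> Z" using t z(1) ZA.act_closed by blast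
      ultimately show "z' \<in> {z \<in> Z. z \<subseteq> orbit GH.T \<rho> x \<times> orbit HI.T \<sigma> y}" by blast
    qed
    moreover have "orbit GH.T \<rho> x \<in> ?OX" "orbit HI.T \<sigma> y \<in> ?OY" using xy unfolding orbits_def by blast+
    ultimately show ?thesis by blast
  qed
  have unique: "p = q" if p: "p \<in> ?OX \<times> ?OY" and q: "q \<in> ?OX \<times> ?OY" and w: "w \<in> ?D p" "w \<in> ?D q" for p q w
  proof -
    obtain u v u' v' where pq: "p = (u, v)" "q = (u', v')" by (metis surj_pair)
    have w1: "w \<in> orbits GI.T Z a" "w \<subseteq> {z \<in> Z. z \<subseteq> u \<times> v}" "w \<subseteq> {z \<in> Z. z \<subseteq> u' \<times> v'}"
      using w unfolding pq prod.case by simp_all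
    obtain z where z: "z \<in> Z" "w = orbit GI.T a z" using w1(1) unfolding orbits_def by blast
    have zw: "z \<in> w" using ZA.orbit_refl[OF z(1)] z(2) by simp
    obtain x y where xy: "x \<in> X" "y \<in> Y" "z = P.tn x y" using z(1) unfolding Zs P.Z_def by blast
    have "(x, y) \<in> u \<times> v" "(x, y) \<in> u' \<times> v'"
      using w1(2,3) zw P.tn_refl[OF xy(1,2)] unfolding xy(3) by blast+
    then have "u \<inter> u' \<noteq> {}" "v \<inter> v' \<noteq> {}" by blast+
    moreover have "u \<in> ?OX" "u' \<in> ?OX" "v \<in> ?OY" "v' \<in> ?OY" using p q unfolding pq by simp_all
    ultimately show ?thesis using P.X.disjoint_union[of u u'] P.Y.disjoint_union[of v v'] unfolding pq by simp
  qed
  have "{w \<in> orbits GI.T Z a. orb_class A G I a w = d} = (\<Union>p\<in>?OX \<times> ?OY. ?D p)"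
  proof
    show "{w \<in> orbits GI.T Z a. orb_class A G I a w = d} \<subseteq> (\<Union>p\<in>?OX \<times> ?OY. ?D p)"
    proof
      fix w assume w: "w \<in> {w \<in> orbits GI.T Z a. orb_class A G I a w = d}"
      then obtain u v where "u \<in> ?OX" "v \<in> ?OY" "w \<subseteq> {z \<in> Z. z \<subseteq> u \<times> v}" using cover by blast
      then show "w \<in> (\<Union>p\<in>?OX \<times> ?OY. ?D p)" using w by (intro UN_I[of "(u, v)"]) simp_all
    qed
  qed auto
  also have "card \<dots> = (\<Sum>p\<in>?OX \<times> ?OY. card (?D p))"
  proof (rule card_UN_disjoint)
    show "finite (?OX \<times> ?OY)" using fin by simp
    show "\<forall>p\<in>?OX \<times> ?OY. finite (?D p)" using fin(1) by auto
    show "\<forall>p\<in>?OX \<times> ?OY. \<forall>q\<in>?OX \<times> ?OY. p \<noteq> q \<longrightarrow> ?D p \<inter> ?D q = {}" using unique by blast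
  qed
  also have "\<dots> = (\<Sum>u\<in>?OX. \<Sum>v\<in>?OY. card (?D (u, v)))"
    by (simp add: sum.cartesian_product case_prod_beta')
  finally show ?thesis by simp
qed

text \<open>Frees the composition from transitive factors and from chosen representatives. This is
  indispensable for associativity, where one factor is itself a tensor product, usually with several
  orbits.\<close>

lemma cmp_biset_class:
  assumes X: "fibered_biset A G H (X, \<rho>)" and Y: "fibered_biset A H I (Y, \<sigma>)"
  shows "cmp (biset_class R A G H (X, \<rho>)) (biset_class R A H I (Y, \<sigma>)) =
    biset_class R A G I (tensor A G H I (X, \<rho>) (Y, \<sigma>))"
proof
  fix d
  let ?OX = "orbits GH.T X \<rho>" and ?OY = "orbits HI.T Y \<sigma>"
  let ?h = "orb_class A G H \<rho>" and ?k = "orb_class A H I \<sigma>"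
  define Z a where "Z = fst (tensor A G H I (X, \<rho>) (Y, \<sigma>))" and "a = snd (tensor A G H I (X, \<rho>) (Y, \<sigma>))"
  let ?N = "\<lambda>u v. card {w \<in> orbits GI.T Z a. w \<subseteq> {z \<in> Z. z \<subseteq> u \<times> v} \<and> orb_class A G I a w = d}"
  have fin: "finite ?OX" "finite ?OY" using GH.finite_orbits[OF X] HI.finite_orbits[OF Y] by auto
  have XA: "tri_action A G H X \<rho>" and YA: "tri_action A H I Y \<sigma>"
    using fibered_bisetD(1)[OF X] fibered_bisetD(1)[OF Y] GH.tri_actionI HI.tri_actionI by auto
  have hB: "?h u \<in> iso_classes A G H" if "u \<in> ?OX" for u by (rule GH.orb_class_iso_classes[OF X that])
  have kC: "?k v \<in> iso_classes A H I" if "v \<in> ?OY" for v by (rule HI.orb_class_iso_classes[OF Y that])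
  have Zf: "fibered_biset A G I (Z, a)" using tensor_fibered[OF X Y] unfolding Z_def a_def by simp
  \<comment> \<open>The picked representatives embed onto the orbits \<open>u\<close> and
    \<open>v\<close>. Tensoring these embeddings identifies the tensor product of the
    representatives with the part of \<open>Z\<close> lying over \<open>u\<close> and
    \<open>v\<close>.\<close>
  have mm: "mm (?h u) (?k v) d = [?N u v] \<cdot> \<one>" if u: "u \<in> ?OX" and v: "v \<in> ?OY" for u v
  proof -
    obtain X' \<rho>' f where f: "(SOME X. X \<in> ?h u) = (X', \<rho>')" "fibered_biset A G H (X', \<rho>')"
      "tri_action A G H X' \<rho>'" "f \<in> X' \<rightarrow> X" "inj_on f X'" "f ` X' = u"
      "\<And>t x. t \<in> carrier GH.T \<Longrightarrow> x \<in> X' \<Longrightarrow> f (\<rho>' t x) = \<rho> t (f x)"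
      by (rule GH.orb_rep[OF X u]) blast
    obtain Y' \<sigma>' g where g: "(SOME Y. Y \<in> ?k v) = (Y', \<sigma>')" "fibered_biset A H I (Y', \<sigma>')"
      "tri_action A H I Y' \<sigma>'" "g \<in> Y' \<rightarrow> Y" "inj_on g Y'" "g ` Y' = v"
      "\<And>t x. t \<in> carrier HI.T \<Longrightarrow> x \<in> Y' \<Longrightarrow> g (\<sigma>' t x) = \<sigma> t (g x)"
      by (rule HI.orb_rep[OF Y v]) blast
    obtain Z' a' where Z': "tensor A G H I (X', \<rho>') (Y', \<sigma>') = (Z', a')" by fastforce
    have Z'f: "fibered_biset A G I (Z', a')" using tensor_fibered[OF f(2) g(2)] Z' by simp
    have ZZ: "Z' = fst (tensor A G H I (X', \<rho>') (Y', \<sigma>'))" "a' = snd (tensor A G H I (X', \<rho>') (Y', \<sigma>'))"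
      by (simp_all add: Z')
    have emb: "(`) (map_prod f g) \<in> Z' \<rightarrow> Z" "inj_on ((`) (map_prod f g)) Z'"
      "(`) (map_prod f g) ` Z' = {z \<in> Z. z \<subseteq> f ` X' \<times> g ` Y'}"
      unfolding ZZ Z_def by (rule tensor_embed(1,2,4)[OF f(3) XA g(3) YA f(4,5) _ g(4,5)]; rule f(7) g(7); assumption)+
    have emb': "(`) (map_prod f g) (a' t z) = a t ((`) (map_prod f g) z)"
      if "t \<in> carrier GI.T" "z \<in> Z'" for t z
      using that unfolding ZZ a_def
      by (rule tensor_embed(3)[OF f(3) XA g(3) YA f(4,5) _ g(4,5), rotated -2])
        (rule f(7), assumption+, rule g(7), assumption+)
    have "card {w \<in> orbits GI.T Z' a'. orb_class A G I a' w = d} =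
      card {w \<in> orbits GI.T Z a. w \<subseteq> (`) (map_prod f g) ` Z' \<and> orb_class A G I a w = d}"
      by (rule GI.card_orbits_equivariant[OF fibered_bisetD(1)[OF Z'f] fibered_bisetD(1)[OF Zf] emb(1,2)]) (rule emb')
    then show ?thesis
      unfolding mm_def f(1) g(1) Z' biset_class_def prod.case emb(3) f(6) g(6) by (rule arg_cong)
  qed
  have supp: "{b. biset_class R A G H (X, \<rho>) b \<noteq> \<zero>} \<subseteq> ?h ` ?OX" "{c. biset_class R A H I (Y, \<sigma>) c \<noteq> \<zero>} \<subseteq> ?k ` ?OY"
  proof -
    have "{w \<in> ?OX. ?h w = b} \<noteq> {}" if "biset_class R A G H (X, \<rho>) b \<noteq> \<zero>" for b
      using that unfolding biset_class_def prod.case by (metis card.empty add.nat_pow_0)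
    then show "{b. biset_class R A G H (X, \<rho>) b \<noteq> \<zero>} \<subseteq> ?h ` ?OX" by blast
    have "{w \<in> ?OY. ?k w = b} \<noteq> {}" if "biset_class R A H I (Y, \<sigma>) b \<noteq> \<zero>" for b
      using that unfolding biset_class_def prod.case by (metis card.empty add.nat_pow_0)
    then show "{c. biset_class R A H I (Y, \<sigma>) c \<noteq> \<zero>} \<subseteq> ?k ` ?OY" by blast
  qed
  have bX: "biset_class R A G H (X, \<rho>) \<in> BGH" and bY: "biset_class R A H I (Y, \<sigma>) \<in> BHI"
    by (rule GH.biset_class_burnside[OF cring_axioms X], rule HI.biset_class_burnside[OF cring_axioms Y])
  note cX = fin_suppD(1)[OF bX] and cY = fin_suppD(1)[OF bY]
  have m: "mm b c d \<in> carrier R" if "b \<in> ?h ` ?OX" "c \<in> ?k ` ?OY" for b c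
    using mm_carrier hB kC that by blast
  have "cmp (biset_class R A G H (X, \<rho>)) (biset_class R A H I (Y, \<sigma>)) d =
    (\<Oplus>b\<in>?h ` ?OX. \<Oplus>c\<in>?k ` ?OY. biset_class R A G H (X, \<rho>) b \<otimes> biset_class R A H I (Y, \<sigma>) c \<otimes> mm b c d)"
    by (rule cmp_expand[OF bX bY _ supp(1) _ _ supp(2)]) (use fin hB kC in auto)
  also have "\<dots> = (\<Oplus>b\<in>?h ` ?OX. biset_class R A G H (X, \<rho>) b \<otimes> (\<Oplus>v\<in>?OY. mm b (?k v) d))"
  proof (rule finsum_cong')
    fix b assume b: "b \<in> ?h ` ?OX"
    have "(\<Oplus>c\<in>?k ` ?OY. biset_class R A G H (X, \<rho>) b \<otimes> biset_class R A H I (Y, \<sigma>) c \<otimes> mm b c d) =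
      (\<Oplus>c\<in>?k ` ?OY. biset_class R A G H (X, \<rho>) b \<otimes> (biset_class R A H I (Y, \<sigma>) c \<otimes> mm b c d))"
      by (rule finsum_cong') (use b in \<open>auto intro!: m_assoc m_closed cX cY m\<close>)
    also have "\<dots> = biset_class R A G H (X, \<rho>) b \<otimes> (\<Oplus>c\<in>?k ` ?OY. biset_class R A H I (Y, \<sigma>) c \<otimes> mm b c d)"
      by (rule finsum_rdistr[symmetric]) (use b fin in \<open>auto intro!: m_closed cX cY m\<close>)
    also have "(\<Oplus>c\<in>?k ` ?OY. biset_class R A H I (Y, \<sigma>) c \<otimes> mm b c d) = (\<Oplus>v\<in>?OY. mm b (?k v) d)"
      unfolding biset_class_def prod.case by (rule finsum_fibres[OF fin(2)]) (use b m in auto)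
    finally show "(\<Oplus>c\<in>?k ` ?OY. biset_class R A G H (X, \<rho>) b \<otimes> biset_class R A H I (Y, \<sigma>) c \<otimes> mm b c d) =
      biset_class R A G H (X, \<rho>) b \<otimes> (\<Oplus>v\<in>?OY. mm b (?k v) d)" .
  qed (auto intro!: m_closed finsum_closed cX m)
  also have "\<dots> = (\<Oplus>u\<in>?OX. \<Oplus>v\<in>?OY. mm (?h u) (?k v) d)"
    unfolding biset_class_def prod.case
    by (rule finsum_fibres[OF fin(1)]) (auto intro!: finsum_closed m)
  also have "\<dots> = (\<Oplus>u\<in>?OX. \<Oplus>v\<in>?OY. [?N u v] \<cdot> \<one>)"
    using mm by (intro finsum_cong') auto
  also have "\<dots> = (\<Oplus>u\<in>?OX. [(\<Sum>v\<in>?OY. ?N u v)] \<cdot> \<one>)"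
    using add_pow_sum[OF fin(2)] by (intro finsum_cong') auto
  also have "\<dots> = [(\<Sum>u\<in>?OX. \<Sum>v\<in>?OY. ?N u v)] \<cdot> \<one>"
    by (rule add_pow_sum[OF fin(1), symmetric])
  also have "\<dots> = [card {w \<in> orbits GI.T Z a. orb_class A G I a w = d}] \<cdot> \<one>"
    using card_tensor_orbits[OF X Y, of d] unfolding Z_def[symmetric] a_def[symmetric] by simp
  also have "\<dots> = biset_class R A G I (Z, a) d" by (simp add: biset_class_def)
  also have "(Z, a) = tensor A G H I (X, \<rho>) (Y, \<sigma>)" by (simp add: Z_def a_def)
  finally show "cmp (biset_class R A G H (X, \<rho>)) (biset_class R A H I (Y, \<sigma>)) d =
    biset_class R A G I (tensor A G H I (X, \<rho>) (Y, \<sigma>)) d" .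
qed

end

section \<open>Associativity of the composition\<close>

locale assoc_ctx = GHI: compose_ctx R A G H I + IJ: fin_tri_group A I J
  for R :: "'k ring" (structure) and A :: "'a monoid" and G :: "'g monoid" and H :: "'h monoid"
    and I :: "'i monoid" and J :: "'j monoid"
begin

sublocale HIJ: compose_ctx R A H I J
  by (intro compose_ctx.intro GHI.coefficients_axioms GHI.HI.fin_tri_group_axioms IJ.fin_tri_group_axioms)

sublocale GIJ: compose_ctx R A G I J
  by (intro compose_ctx.intro GHI.coefficients_axioms GHI.GI.fin_tri_group_axioms IJ.fin_tri_group_axioms)

sublocale GHJ: compose_ctx R A G H J
  by (intro compose_ctx.intro GHI.coefficients_axioms GHI.GH.fin_tri_group_axioms HIJ.GI.fin_tri_group_axioms)

lemma single_assoc: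
  assumes b: "b \<in> iso_classes A G H" and c: "c \<in> iso_classes A H I" and d: "d \<in> iso_classes A I J"
  shows "GIJ.cmp (GHI.cmp (single R b) (single R c)) (single R d) =
    GHJ.cmp (single R b) (HIJ.cmp (single R c) (single R d))"
proof -
  obtain X \<rho> x where X: "fibered_biset A G H (X, \<rho>)" "tri_action A G H X \<rho>" "x \<in> X" "X = orbit GHI.GH.T \<rho> x"
    "b = cl A G H (stabilizer GHI.GH.T \<rho> x)" "(X, \<rho>) \<in> b" by (rule GHI.GH.rep[OF b])
  obtain Y \<sigma> y where Y: "fibered_biset A H I (Y, \<sigma>)" "tri_action A H I Y \<sigma>" "y \<in> Y" "Y = orbit GHI.HI.T \<sigma> y"
    "c = cl A H I (stabilizer GHI.HI.T \<sigma> y)" "(Y, \<sigma>) \<in> c" by (rule GHI.HI.rep[OF c])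
  obtain V \<tau> v where V: "fibered_biset A I J (V, \<tau>)" "tri_action A I J V \<tau>" "v \<in> V" "V = orbit IJ.T \<tau> v"
    "d = cl A I J (stabilizer IJ.T \<tau> v)" "(V, \<tau>) \<in> d" by (rule IJ.rep[OF d])
  have R: "cring R" by (rule GHI.cring_axioms)
  have bX: "single R b = biset_class R A G H (X, \<rho>)"
    using GHI.GH.biset_class_orbit[OF R fibered_bisetD(1)[OF X(1)] X(3,4)] X(5) by simp
  have cY: "single R c = biset_class R A H I (Y, \<sigma>)"
    using GHI.HI.biset_class_orbit[OF R fibered_bisetD(1)[OF Y(1)] Y(3,4)] Y(5) by simp
  have dV: "single R d = biset_class R A I J (V, \<tau>)"
    using IJ.biset_class_orbit[OF R fibered_bisetD(1)[OF V(1)] V(3,4)] V(5) by simp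
  obtain U \<pi> where U: "tensor A G H I (X, \<rho>) (Y, \<sigma>) = (U, \<pi>)" by fastforce
  obtain W \<kappa> where W: "tensor A H I J (Y, \<sigma>) (V, \<tau>) = (W, \<kappa>)" by fastforce
  have fU: "fibered_biset A G I (U, \<pi>)" using GHI.tensor_fibered[OF X(1) Y(1)] U by simp
  have fW: "fibered_biset A H J (W, \<kappa>)" using HIJ.tensor_fibered[OF Y(1) V(1)] W by simp
  obtain L \<alpha> where L: "tensor A G I J (U, \<pi>) (V, \<tau>) = (L, \<alpha>)" by fastforce
  obtain K \<beta> where K: "tensor A G H J (X, \<rho>) (W, \<kappa>) = (K, \<beta>)" by fastforce
  have fL: "fibered_biset A G J (L, \<alpha>)" using GIJ.tensor_fibered[OF fU V(1)] L by simp
  have fK: "fibered_biset A G J (K, \<beta>)" using GHJ.tensor_fibered[OF X(1) fW] K by simp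
  have "\<exists>f. bij_betw f L K \<and> (\<forall>t\<in>carrier GIJ.GI.T. \<forall>x\<in>L. f (\<alpha> t x) = \<beta> t (f x))"
    using tensor_assoc[OF X(2) Y(2) V(2)] unfolding U W L K fst_conv snd_conv .
  then obtain f where f: "bij_betw f L K" "\<forall>t\<in>carrier GIJ.GI.T. \<forall>x\<in>L. f (\<alpha> t x) = \<beta> t (f x)" by blast
  have "biset_class R A G J (L, \<alpha>) = biset_class R A G J (K, \<beta>)"
    by (rule GIJ.GI.biset_class_iso[OF fibered_bisetD(1)[OF fL] fibered_bisetD(1)[OF fK] f(1)]) (use f(2) in blast)
  then show ?thesis
    unfolding bX cY dV GHI.cmp_biset_class[OF X(1) Y(1)] HIJ.cmp_biset_class[OF Y(1) V(1)] U W
      GIJ.cmp_biset_class[OF fU V(1)] GHJ.cmp_biset_class[OF X(1) fW] L K .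
qed

lemma cmp_assoc:
  assumes u: "u \<in> fin_supp R (iso_classes A G H)" and v: "v \<in> fin_supp R (iso_classes A H I)"
    and w: "w \<in> fin_supp R (iso_classes A I J)"
  shows "GIJ.cmp (GHI.cmp u v) w = GHJ.cmp u (HIJ.cmp v w)"
proof -
  note S = GHI.single_fin_supp and sm = GHI.smult_fin_supp and ad = GHI.add_fin_supp
  note zero = GHI.cmp_zero HIJ.cmp_zero GIJ.cmp_zero GHJ.cmp_zero
  have 1: "GIJ.cmp (GHI.cmp (single R b) (single R c)) w = GHJ.cmp (single R b) (HIJ.cmp (single R c) w)"
    if b: "b \<in> iso_classes A G H" and c: "c \<in> iso_classes A H I" for b c
    using w
  proof (induction rule: GHI.fin_supp_induct)
    case (add a d x)
    have bc: "GHI.cmp (single R b) (single R c) \<in> GHI.BGI" by (rule GHI.cmp_closed[OF S[OF b] S[OF c]])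
    have cx: "HIJ.cmp (single R c) (single R d) \<in> HIJ.BGI" "HIJ.cmp (single R c) x \<in> HIJ.BGI"
      by (rule HIJ.cmp_closed[OF S[OF c] S[OF add(2)]], rule HIJ.cmp_closed[OF S[OF c] add(3)])
    show ?case
      unfolding GIJ.cmp_add_right[OF bc sm[OF S[OF add(2)] add(1)] add(3)] GIJ.cmp_smult(2)[OF add(1) bc S[OF add(2)]]
        HIJ.cmp_add_right[OF S[OF c] sm[OF S[OF add(2)] add(1)] add(3)] HIJ.cmp_smult(2)[OF add(1) S[OF c] S[OF add(2)]]
        GHJ.cmp_add_right[OF S[OF b] sm[OF cx(1) add(1)] cx(2)] GHJ.cmp_smult(2)[OF add(1) S[OF b] cx(1)]
        add(4) single_assoc[OF b c add(2)] ..
  qed (simp add: zero)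
  have 2: "GIJ.cmp (GHI.cmp (single R b) v) w = GHJ.cmp (single R b) (HIJ.cmp v w)"
    if b: "b \<in> iso_classes A G H" for b
    using v
  proof (induction rule: GHI.fin_supp_induct)
    case (add a d x)
    have bc: "GHI.cmp (single R b) (single R d) \<in> GHI.BGI" "GHI.cmp (single R b) x \<in> GHI.BGI"
      by (rule GHI.cmp_closed[OF S[OF b] S[OF add(2)]], rule GHI.cmp_closed[OF S[OF b] add(3)])
    have cx: "HIJ.cmp (single R d) w \<in> HIJ.BGI" "HIJ.cmp x w \<in> HIJ.BGI"
      by (rule HIJ.cmp_closed[OF S[OF add(2)] w], rule HIJ.cmp_closed[OF add(3) w])
    show ?case
      unfolding GHI.cmp_add_right[OF S[OF b] sm[OF S[OF add(2)] add(1)] add(3)] GHI.cmp_smult(2)[OF add(1) S[OF b] S[OF add(2)]]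
        GIJ.cmp_add_left[OF sm[OF bc(1) add(1)] bc(2) w] GIJ.cmp_smult(1)[OF add(1) bc(1) w]
        HIJ.cmp_add_left[OF sm[OF S[OF add(2)] add(1)] add(3) w] HIJ.cmp_smult(1)[OF add(1) S[OF add(2)] w]
        GHJ.cmp_add_right[OF S[OF b] sm[OF cx(1) add(1)] cx(2)] GHJ.cmp_smult(2)[OF add(1) S[OF b] cx(1)]
        add(4) 1[OF b add(2)] ..
  qed (simp add: zero)
  show ?thesis using u
  proof (induction rule: GHI.fin_supp_induct)
    case (add a d x)
    have bc: "GHI.cmp (single R d) v \<in> GHI.BGI" "GHI.cmp x v \<in> GHI.BGI"
      by (rule GHI.cmp_closed[OF S[OF add(2)] v], rule GHI.cmp_closed[OF add(3) v])
    have cx: "HIJ.cmp v w \<in> HIJ.BGI" by (rule HIJ.cmp_closed[OF v w])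
    show ?case
      unfolding GHI.cmp_add_left[OF sm[OF S[OF add(2)] add(1)] add(3) v] GHI.cmp_smult(1)[OF add(1) S[OF add(2)] v]
        GIJ.cmp_add_left[OF sm[OF bc(1) add(1)] bc(2) w] GIJ.cmp_smult(1)[OF add(1) bc(1) w]
        GHJ.cmp_add_left[OF sm[OF S[OF add(2)] add(1)] add(3) cx] GHJ.cmp_smult(1)[OF add(1) S[OF add(2)] cx]
        add(4) 2[OF add(2)] ..
  qed (simp add: zero)
qed

end

section \<open>Products consisting of at most one orbit\<close>

context compose_ctx
begin

text \<open>In general the orbits of a tensor product of transitive bisets correspond to double
  cosets in the middle group. If one of the stabilizers projects onto all of \<open>H\<close>, there
  is a single double coset: the orbit set is one orbit, with \<open>tcomp A S S'\<close> as the
  candidate for the stabilizer. Either the whole orbit is free over \<open>A\<close> or all of it is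
  discarded.\<close>

lemma tensor_orbit:
  assumes X: "fibered_biset A G H (X, \<rho>)" "x \<in> X" "X = orbit GH.T \<rho> x" "stabilizer GH.T \<rho> x = S"
    and Y: "fibered_biset A H I (Y, \<sigma>)" "y \<in> Y" "Y = orbit HI.T \<sigma> y" "stabilizer HI.T \<sigma> y = S'"
    and cover: "(\<forall>h\<in>carrier H. \<exists>a g. (a, g, h) \<in> S) \<or> (\<forall>h\<in>carrier H. \<exists>a i. (a, h, i) \<in> S')"
  shows "biset_class R A G I (tensor A G H I (X, \<rho>) (Y, \<sigma>)) =
      (if afree A G I (tcomp A S S') then single R (cl A G I (tcomp A S S')) else (\<lambda>d. \<zero>))"
    and "afree A G I (tcomp A S S') \<Longrightarrow> fib A G I (tcomp A S S')"
proof -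
  interpret P: tensor_pair A G H I X \<rho> Y \<sigma> by (rule pairI[OF X(1) Y(1)])
  have st: "P.X.stb x = S" "P.Y.stb y = S'" using X(4) Y(4) by simp_all
  \<comment> \<open>An element \<open>m\<close> of the middle group acting on \<open>y\<close> is
    carried across the tensor sign and absorbed by a stabilizing element of \<open>x\<close>, or
    absorbed directly by one of \<open>y\<close>, at the price of elements of \<open>A\<close>,
    \<open>G\<close> and \<open>I\<close>.\<close>
  have move: "\<exists>t\<in>carrier GI.T. P.tn x (\<sigma> (\<one>\<^bsub>A\<^esub>, m, \<one>\<^bsub>I\<^esub>) y) = P.ac t (P.tn x y)" if m: "m \<in> carrier H" for m
    using cover
  proof
    assume "\<forall>h\<in>carrier H. \<exists>a g. (a, g, h) \<in> S"
    then obtain c g where c: "(c, g, inv\<^bsub>H\<^esub> m) \<in> P.X.stb x" using m st by blast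
    then have cg: "c \<in> carrier A" "g \<in> carrier G" "\<rho> (c, g, inv\<^bsub>H\<^esub> m) x = x" by (auto simp: P.X.mem_stb)
    have "\<rho> (inv\<^bsub>A\<^esub> c, inv\<^bsub>G\<^esub> g, \<one>\<^bsub>H\<^esub>) x = \<rho> (inv\<^bsub>A\<^esub> c, inv\<^bsub>G\<^esub> g, \<one>\<^bsub>H\<^esub>) (\<rho> (c, g, inv\<^bsub>H\<^esub> m) x)"
      using cg by simp
    also have "\<dots> = \<rho> (\<one>\<^bsub>A\<^esub>, \<one>\<^bsub>G\<^esub>, inv\<^bsub>H\<^esub> m) x" using cg(1,2) m X(2) by (simp add: P.X.act_act)
    finally have eq: "\<rho> (\<one>\<^bsub>A\<^esub>, \<one>\<^bsub>G\<^esub>, inv\<^bsub>H\<^esub> m) x = \<rho> (inv\<^bsub>A\<^esub> c, inv\<^bsub>G\<^esub> g, \<one>\<^bsub>H\<^esub>) x" ..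
    have my: "\<sigma> (\<one>\<^bsub>A\<^esub>, m, \<one>\<^bsub>I\<^esub>) y \<in> Y" using m Y(2) P.Y.act_closed' by simp
    have "P.tn x (\<sigma> (\<one>\<^bsub>A\<^esub>, m, \<one>\<^bsub>I\<^esub>) y) = P.tn (\<rho> (\<one>\<^bsub>A\<^esub>, \<one>\<^bsub>G\<^esub>, inv\<^bsub>H\<^esub> m) x) y"
      using P.tn_shift[OF X(2) my, of "\<one>\<^bsub>A\<^esub>" "inv\<^bsub>H\<^esub> m"] m Y(2) by (simp add: P.Y.act_act P.Y.act_one)
    also have "\<dots> = P.ac (inv\<^bsub>A\<^esub> c, inv\<^bsub>G\<^esub> g, \<one>\<^bsub>I\<^esub>) (P.tn x y)"
      unfolding eq using P.ac_tn[OF X(2) Y(2), of "inv\<^bsub>A\<^esub> c" "inv\<^bsub>G\<^esub> g" "\<one>\<^bsub>I\<^esub>"] cg Y(2) by (simp add: P.Y.act_one)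
    finally show ?thesis using cg by (intro bexI[of _ "(inv\<^bsub>A\<^esub> c, inv\<^bsub>G\<^esub> g, \<one>\<^bsub>I\<^esub>)"]) simp_all
  next
    assume "\<forall>h\<in>carrier H. \<exists>a i. (a, h, i) \<in> S'"
    then obtain d i where d: "(d, m, i) \<in> P.Y.stb y" using m st by blast
    then have di: "d \<in> carrier A" "i \<in> carrier I" "\<sigma> (d, m, i) y = y" by (auto simp: P.Y.mem_stb)
    have "\<sigma> (inv\<^bsub>A\<^esub> d, \<one>\<^bsub>H\<^esub>, inv\<^bsub>I\<^esub> i) y = \<sigma> (inv\<^bsub>A\<^esub> d, \<one>\<^bsub>H\<^esub>, inv\<^bsub>I\<^esub> i) (\<sigma> (d, m, i) y)"
      using di by simp
    also have "\<dots> = \<sigma> (\<one>\<^bsub>A\<^esub>, m, \<one>\<^bsub>I\<^esub>) y" using di(1,2) m Y(2) by (simp add: P.Y.act_act)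
    finally have eq: "\<sigma> (\<one>\<^bsub>A\<^esub>, m, \<one>\<^bsub>I\<^esub>) y = \<sigma> (inv\<^bsub>A\<^esub> d, \<one>\<^bsub>H\<^esub>, inv\<^bsub>I\<^esub> i) y" ..
    have iy: "\<sigma> (\<one>\<^bsub>A\<^esub>, \<one>\<^bsub>H\<^esub>, inv\<^bsub>I\<^esub> i) y \<in> Y" "\<rho> (inv\<^bsub>A\<^esub> d, \<one>\<^bsub>G\<^esub>, \<one>\<^bsub>H\<^esub>) x \<in> X"
      using di Y(2) X(2) P.Y.act_closed' P.X.act_closed' by simp_all
    have "P.ac (inv\<^bsub>A\<^esub> d, \<one>\<^bsub>G\<^esub>, inv\<^bsub>I\<^esub> i) (P.tn x y) = P.tn (\<rho> (inv\<^bsub>A\<^esub> d, \<one>\<^bsub>G\<^esub>, \<one>\<^bsub>H\<^esub>) x) (\<sigma> (\<one>\<^bsub>A\<^esub>, \<one>\<^bsub>H\<^esub>, inv\<^bsub>I\<^esub> i) y)"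
      using P.ac_tn[OF X(2) Y(2), of "inv\<^bsub>A\<^esub> d" "\<one>\<^bsub>G\<^esub>" "inv\<^bsub>I\<^esub> i"] di by simp
    also have "\<dots> = P.tn x (\<sigma> (inv\<^bsub>A\<^esub> d, \<one>\<^bsub>H\<^esub>, inv\<^bsub>I\<^esub> i) y)"
      using P.tn_shift[OF iy(2,1), of "inv\<^bsub>A\<^esub> d" "\<one>\<^bsub>H\<^esub>"] di X(2) Y(2)
      by (simp add: P.X.act_act P.Y.act_act P.X.act_one)
    finally have "P.tn x (\<sigma> (\<one>\<^bsub>A\<^esub>, m, \<one>\<^bsub>I\<^esub>) y) = P.ac (inv\<^bsub>A\<^esub> d, \<one>\<^bsub>G\<^esub>, inv\<^bsub>I\<^esub> i) (P.tn x y)"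
      unfolding eq ..
    then show ?thesis using di by (intro bexI[of _ "(inv\<^bsub>A\<^esub> d, \<one>\<^bsub>G\<^esub>, inv\<^bsub>I\<^esub> i)"]) simp_all
  qed
  have xyW: "P.tn x y \<in> P.W" using X(2) Y(2) unfolding P.W_def by blast
  have single_orbit: "\<exists>t\<in>carrier GI.T. w = P.ac t (P.tn x y)" if w: "w \<in> P.W" for w
  proof -
    obtain x' y' where xy': "x' \<in> X" "y' \<in> Y" "w = P.tn x' y'" using w unfolding P.W_def by blast
    obtain s where "s \<in> carrier GH.T" "x' = \<rho> s x" using xy'(1) X(3) unfolding orbit_def by blast
    then obtain a g h where s: "a \<in> carrier A" "g \<in> carrier G" "h \<in> carrier H" "x' = \<rho> (a, g, h) x" by auto
    obtain t where "t \<in> carrier HI.T" "y' = \<sigma> t y" using xy'(2) Y(3) unfolding orbit_def by blast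
    then obtain b k i where t: "b \<in> carrier A" "k \<in> carrier H" "i \<in> carrier I" "y' = \<sigma> (b, k, i) y" by auto
    \<comment> \<open>What keeps \<open>[x', y']\<close> from being an obvious translate of
      \<open>[x, y]\<close>: the mismatch of the two middle components.\<close>
    define m where "m = inv\<^bsub>H\<^esub> h \<otimes>\<^bsub>H\<^esub> k"
    have mH: "m \<in> carrier H" using s t by (simp add: m_def)
    let ?y = "\<sigma> (\<one>\<^bsub>A\<^esub>, m, \<one>\<^bsub>I\<^esub>) y"
    have yY: "?y \<in> Y" using mH Y(2) P.Y.act_closed' by simp
    let ?x1 = "\<rho> (a \<otimes>\<^bsub>A\<^esub> b, g, \<one>\<^bsub>H\<^esub>) x" and ?y1 = "\<sigma> (\<one>\<^bsub>A\<^esub>, \<one>\<^bsub>H\<^esub>, i) ?y"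
    have m1: "?x1 \<in> X" "?y1 \<in> Y" using s t X(2) yY P.X.act_closed' P.Y.act_closed' by simp_all
    have hk: "h \<otimes>\<^bsub>H\<^esub> m = k" using s t unfolding m_def by (simp flip: GH.H.m_assoc)
    have "P.ac (a \<otimes>\<^bsub>A\<^esub> b, g, i) (P.tn x ?y) = P.tn ?x1 ?y1"
      using P.ac_tn[OF X(2) yY, of "a \<otimes>\<^bsub>A\<^esub> b" g i] s t by simp
    also have "\<dots> = P.tn (\<rho> (inv\<^bsub>A\<^esub> b, \<one>\<^bsub>G\<^esub>, h) ?x1) (\<sigma> (b, h, \<one>\<^bsub>I\<^esub>) ?y1)"
      using P.tn_shift[OF m1 t(1) s(3)] ..
    also have "\<rho> (inv\<^bsub>A\<^esub> b, \<one>\<^bsub>G\<^esub>, h) ?x1 = x'"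
      unfolding s(4) using s(1-3) t X(2) by (simp add: P.X.act_act GH.A.m_ac)
    also have "\<sigma> (b, h, \<one>\<^bsub>I\<^esub>) ?y1 = y'"
      unfolding t(4) using s t(1-3) Y(2) mH hk by (simp add: P.Y.act_act)
    finally have 1: "w = P.ac (a \<otimes>\<^bsub>A\<^esub> b, g, i) (P.tn x ?y)" using xy'(3) by simp
    obtain t' where t': "t' \<in> carrier GI.T" "P.tn x ?y = P.ac t' (P.tn x y)" using move[OF mH] by blast
    have tT: "(a \<otimes>\<^bsub>A\<^esub> b, g, i) \<in> carrier GI.T" using s t by simp
    have "w = P.ac ((a \<otimes>\<^bsub>A\<^esub> b, g, i) \<otimes>\<^bsub>GI.T\<^esub> t') (P.tn x y)"
      unfolding 1 t'(2) using P.ac_ac[OF tT t'(1) xyW] by simp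
    then show ?thesis using GI.T.m_closed[OF tT t'(1)] by blast
  qed
  have Zst: "P.tn x y \<in> P.Z \<longleftrightarrow> afree A G I (tcomp A S S')" using P.tn_Z_iff[OF X(2) Y(2)] st by simp
  show "fib A G I (tcomp A S S')" if "afree A G I (tcomp A S S')"
  proof -
    have "P.tn x y \<in> P.Z" using Zst that by simp
    then show ?thesis
      using GI.fibered_stb[OF P.Z_fibered[OF X(1) Y(1)], of "P.tn x y"] P.Z_stab[OF X(2) Y(2)] st by simp
  qed
  show "biset_class R A G I (tensor A G H I (X, \<rho>) (Y, \<sigma>)) =
      (if afree A G I (tcomp A S S') then single R (cl A G I (tcomp A S S')) else (\<lambda>d. \<zero>))"
  proof (cases "afree A G I (tcomp A S S')")
    case True
    then have z: "P.tn x y \<in> P.Z" using Zst by simp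
    have "P.Z = orbit GI.T (\<lambda>t. restrict (P.ac t) P.Z) (P.tn x y)"
    proof
      show "P.Z \<subseteq> orbit GI.T (\<lambda>t. restrict (P.ac t) P.Z) (P.tn x y)"
      proof
        fix w assume "w \<in> P.Z"
        then obtain t where "t \<in> carrier GI.T" "w = P.ac t (P.tn x y)" using single_orbit P.Z_W by blast
        then show "w \<in> orbit GI.T (\<lambda>t. restrict (P.ac t) P.Z) (P.tn x y)"
          unfolding orbit_def using z by force
      qed
      show "orbit GI.T (\<lambda>t. restrict (P.ac t) P.Z) (P.tn x y) \<subseteq> P.Z"
        unfolding orbit_def using z P.ac_Z by auto
    qed
    from GI.biset_class_orbit[OF cring_axioms P.Z_action z this]
    show ?thesis using True P.Z_stab[OF X(2) Y(2) z] st unfolding P.tensor_eq by simp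
  next
    case False
    have "w \<notin> P.Z" for w
    proof
      assume w: "w \<in> P.Z"
      then obtain t where t: "t \<in> carrier GI.T" "w = P.ac t (P.tn x y)" using single_orbit P.Z_W by blast
      have "P.ac (inv\<^bsub>GI.T\<^esub> t) w = P.tn x y"
        unfolding t(2) P.ac_ac[OF GI.T.inv_closed[OF t(1)] t(1) xyW, symmetric]
        unfolding GI.T.l_inv[OF t(1)] by (rule P.ac_one[OF xyW])
      then have "P.tn x y \<in> P.Z" using P.ac_Z[OF GI.T.inv_closed[OF t(1)] w] by simp
      then show False using False Zst by simp
    qed
    then have "P.Z = {}" by blast
    then show ?thesis using False GI.biset_class_empty[OF cring_axioms] unfolding P.tensor_eq by simp
  qed
qed

lemma cmp_single_cover:
  assumes S: "fib A G H S" and S': "fib A H I S'"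
    and cover: "(\<forall>h\<in>carrier H. \<exists>a g. (a, g, h) \<in> S) \<or> (\<forall>h\<in>carrier H. \<exists>a i. (a, h, i) \<in> S')"
  shows "cmp (single R (cl A G H S)) (single R (cl A H I S')) =
      (if afree A G I (tcomp A S S') then single R (cl A G I (tcomp A S S')) else (\<lambda>d. \<zero>))"
    and "afree A G I (tcomp A S S') \<Longrightarrow> fib A G I (tcomp A S S')"
proof -
  obtain X \<rho> where X: "(SOME X. X \<in> cl A G H S) = (X, \<rho>)" "(X, \<rho>) \<in> cl A G H S"
    by (rule GH.rep[OF GH.cl_iso_classes[OF S]])
  obtain x where x: "fibered_biset A G H (X, \<rho>)" "x \<in> X" "X = orbit GH.T \<rho> x" "stabilizer GH.T \<rho> x = S"
    using X(2) by (rule GH.clD)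
  obtain Y \<sigma> where Y: "(SOME X. X \<in> cl A H I S') = (Y, \<sigma>)" "(Y, \<sigma>) \<in> cl A H I S'"
    by (rule HI.rep[OF HI.cl_iso_classes[OF S']])
  obtain y where y: "fibered_biset A H I (Y, \<sigma>)" "y \<in> Y" "Y = orbit HI.T \<sigma> y" "stabilizer HI.T \<sigma> y = S'"
    using Y(2) by (rule HI.clD)
  show "cmp (single R (cl A G H S)) (single R (cl A H I S')) =
      (if afree A G I (tcomp A S S') then single R (cl A G I (tcomp A S S')) else (\<lambda>d. \<zero>))"
    unfolding cmp_single[OF GH.cl_iso_classes[OF S] HI.cl_iso_classes[OF S']] mm_def X(1) Y(1)
    by (rule tensor_orbit(1)[OF x y cover])
  show "afree A G I (tcomp A S S') \<Longrightarrow> fib A G I (tcomp A S S')"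
    by (rule tensor_orbit(2)[OF x y cover])
qed

text \<open>Without a covering hypothesis there may be many orbits. Only the shape of the occurring
  classes is recorded, and the multiplicities are left open.\<close>

lemma mm_support:
  assumes b: "b \<in> iso_classes A G H" and c: "c \<in> iso_classes A H I" and d: "mm b c d \<noteq> \<zero>"
  shows "\<exists>S S'. fib A G H S \<and> fib A H I S' \<and> afree A G I (tcomp A S S') \<and> d = cl A G I (tcomp A S S')"
proof -
  obtain X \<rho> where X: "(SOME X. X \<in> b) = (X, \<rho>)" "fibered_biset A G H (X, \<rho>)" by (rule GH.rep[OF b])
  obtain Y \<sigma> where Y: "(SOME Y. Y \<in> c) = (Y, \<sigma>)" "fibered_biset A H I (Y, \<sigma>)" by (rule HI.rep[OF c])
  interpret P: tensor_pair A G H I X \<rho> Y \<sigma> by (rule pairI[OF X(2) Y(2)])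
  let ?a = "\<lambda>t. restrict (P.ac t) P.Z"
  have "biset_class R A G I (P.Z, ?a) d \<noteq> \<zero>"
    using d unfolding mm_def X(1) Y(1) P.tensor_eq .
  then have "{w \<in> orbits GI.T P.Z ?a. orb_class A G I ?a w = d} \<noteq> {}"
    unfolding biset_class_def prod.case by (metis card.empty add.nat_pow_0)
  then obtain z where z: "z \<in> P.Z" "orb_class A G I ?a (orbit GI.T ?a z) = d"
    unfolding orbits_def by blast
  obtain x y where xy: "x \<in> X" "y \<in> Y" "z = P.tn x y" "afree A G I (tcomp A (P.X.stb x) (P.Y.stb y))"
    using z(1) unfolding P.Z_def by blast
  have "d = cl A G I (tcomp A (P.X.stb x) (P.Y.stb y))"
    using GI.orbit_class[OF P.Z_action z(1)] z P.Z_stab[OF xy(1,2)] xy(3) by simp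
  then show ?thesis using xy(4) GH.fibered_stb[OF X(2) xy(1)] HI.fibered_stb[OF Y(2) xy(2)] by blast
qed

end

section \<open>Pairs as graphs\<close>

text \<open>\<open>twisted_subgroup\<close> over an arbitrary group. It is used for pairs on
  \<open>G\<close> as well as for pairs on the product of \<open>G\<close> with itself; the inverse
  is that of the convention for \<open>twisted_subgroup\<close>.\<close>

definition gr :: "'a monoid \<Rightarrow> ('g, 'a) cpair \<Rightarrow> ('a \<times> 'g) set" where
  "gr A = (\<lambda>(U, \<phi>). {(inv\<^bsub>A\<^esub> (\<phi> u), u) | u. u \<in> U})"

definition graph_sub :: "'a monoid \<Rightarrow> 'g monoid \<Rightarrow> ('a \<times> 'g) set \<Rightarrow> bool" where
  "graph_sub A K S \<longleftrightarrow> subgroup S (A \<times>\<times> K) \<and> (\<forall>a. (a, \<one>\<^bsub>K\<^esub>) \<in> S \<longrightarrow> a = \<one>\<^bsub>A\<^esub>)"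

text \<open>Recovers the pair from its graph. The description is unique as soon as \<open>S\<close>
  is a subgroup meeting \<open>A\<close> trivially.\<close>

definition pr :: "'a monoid \<Rightarrow> ('a \<times> 'g) set \<Rightarrow> ('g, 'a) cpair" where
  "pr A S = (snd ` S, \<lambda>u\<in>snd ` S. inv\<^bsub>A\<^esub> (THE a. (a, u) \<in> S))"

lemma twisted_eq_gr: "twisted_subgroup A p = gr A p"
  by (simp add: twisted_subgroup_def gr_def)

lemma fib_eq_graph_sub: "fib A G H S \<longleftrightarrow> graph_sub A (G \<times>\<times> H) S"
  by (simp add: fib_def graph_sub_def)

locale pair_group = A: comm_group A + K: group K for A :: "'a monoid" and K :: "'g monoid"
begin

lemma AK_group: "group (A \<times>\<times> K)"
  by (rule DirProd_group[OF A.group_axioms K.group_axioms])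

lemma inv_AK: "a \<in> carrier A \<Longrightarrow> g \<in> carrier K \<Longrightarrow> inv\<^bsub>A \<times>\<times> K\<^esub> (a, g) = (inv\<^bsub>A\<^esub> a, inv\<^bsub>K\<^esub> g)"
  by (rule inv_DirProd[OF A.group_axioms K.group_axioms])

lemma pairsD:
  assumes "(U, \<phi>) \<in> pairs A K"
  shows "subgroup U K" "u \<in> U \<Longrightarrow> \<phi> u \<in> carrier A" "\<phi> \<in> extensional U"
    "u \<in> U \<Longrightarrow> v \<in> U \<Longrightarrow> \<phi> (u \<otimes>\<^bsub>K\<^esub> v) = \<phi> u \<otimes>\<^bsub>A\<^esub> \<phi> v"
    "\<phi> \<one>\<^bsub>K\<^esub> = \<one>\<^bsub>A\<^esub>" "u \<in> U \<Longrightarrow> \<phi> (inv\<^bsub>K\<^esub> u) = inv\<^bsub>A\<^esub> (\<phi> u)"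
proof -
  show U: "subgroup U K" and ext: "\<phi> \<in> extensional U" using assms by (auto simp: pairs_def)
  have h: "\<phi> \<in> hom (K\<lparr>carrier := U\<rparr>) A" using assms by (auto simp: pairs_def)
  show c: "\<And>u. u \<in> U \<Longrightarrow> \<phi> u \<in> carrier A" using h by (auto simp: hom_def)
  show m: "\<And>u v. u \<in> U \<Longrightarrow> v \<in> U \<Longrightarrow> \<phi> (u \<otimes>\<^bsub>K\<^esub> v) = \<phi> u \<otimes>\<^bsub>A\<^esub> \<phi> v" using h by (auto simp: hom_def)
  have 1: "\<one>\<^bsub>K\<^esub> \<in> U" using U by (rule subgroup.one_closed)
  have "\<phi> \<one>\<^bsub>K\<^esub> \<otimes>\<^bsub>A\<^esub> \<phi> \<one>\<^bsub>K\<^esub> = \<phi> \<one>\<^bsub>K\<^esub>" using m[OF 1 1] by simp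
  then show one: "\<phi> \<one>\<^bsub>K\<^esub> = \<one>\<^bsub>A\<^esub>" using c[OF 1] by (simp add: A.l_cancel_one)
  show "\<phi> (inv\<^bsub>K\<^esub> u) = inv\<^bsub>A\<^esub> (\<phi> u)" if u: "u \<in> U" for u
  proof -
    have iu: "inv\<^bsub>K\<^esub> u \<in> U" using subgroup.m_inv_closed[OF U u] .
    have uK: "u \<in> carrier K" using subgroup.subset[OF U] u by blast
    have "\<phi> (inv\<^bsub>K\<^esub> u) \<otimes>\<^bsub>A\<^esub> \<phi> u = \<one>\<^bsub>A\<^esub>" using m[OF iu u] one uK by simp
    then show ?thesis using A.inv_equality c[OF u] c[OF iu] by simp
  qed
qed

lemma mem_gr: "(a, u) \<in> gr A (U, \<phi>) \<longleftrightarrow> u \<in> U \<and> a = inv\<^bsub>A\<^esub> (\<phi> u)"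
  by (auto simp: gr_def)

lemma gr_graph_sub:
  assumes p: "p \<in> pairs A K" shows "graph_sub A K (gr A p)"
proof -
  obtain U \<phi> where p': "p = (U, \<phi>)" by fastforce
  note P = pairsD[OF p[unfolded p']]
  have UK: "u \<in> U \<Longrightarrow> u \<in> carrier K" for u using subgroup.subset[OF P(1)] by blast
  have "subgroup (gr A (U, \<phi>)) (A \<times>\<times> K)"
  proof (rule group.subgroupI[OF AK_group])
    show "gr A (U, \<phi>) \<subseteq> carrier (A \<times>\<times> K)" using UK P(2) by (auto simp: gr_def)
    show "gr A (U, \<phi>) \<noteq> {}" using subgroup.one_closed[OF P(1)] by (auto simp: gr_def)
    fix s assume "s \<in> gr A (U, \<phi>)"
    then obtain u where u: "u \<in> U" "s = (inv\<^bsub>A\<^esub> (\<phi> u), u)" by (auto simp: gr_def)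
    then show "inv\<^bsub>A \<times>\<times> K\<^esub> s \<in> gr A (U, \<phi>)"
      using inv_AK[of "inv\<^bsub>A\<^esub> (\<phi> u)" u] UK P(2,6) subgroup.m_inv_closed[OF P(1)] by (simp add: mem_gr)
    fix t assume "t \<in> gr A (U, \<phi>)"
    then obtain v where v: "v \<in> U" "t = (inv\<^bsub>A\<^esub> (\<phi> v), v)" by (auto simp: gr_def)
    show "s \<otimes>\<^bsub>A \<times>\<times> K\<^esub> t \<in> gr A (U, \<phi>)"
      using u v P(2,4) subgroup.m_closed[OF P(1)] by (simp add: mem_gr A.inv_mult)
  qed
  moreover have "a = \<one>\<^bsub>A\<^esub>" if "(a, \<one>\<^bsub>K\<^esub>) \<in> gr A (U, \<phi>)" for a
    using that P(5) by (simp add: mem_gr)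
  ultimately show ?thesis unfolding p' graph_sub_def by blast
qed

lemma graph_sub_unique:
  assumes S: "graph_sub A K S" and "(a, u) \<in> S" "(b, u) \<in> S"
  shows "a = b"
proof -
  have sub: "subgroup S (A \<times>\<times> K)" using S by (simp add: graph_sub_def)
  have c: "a \<in> carrier A" "b \<in> carrier A" "u \<in> carrier K" using subgroup.subset[OF sub] assms(2,3) by auto
  have "(a, u) \<otimes>\<^bsub>A \<times>\<times> K\<^esub> inv\<^bsub>A \<times>\<times> K\<^esub> (b, u) \<in> S"
    using subgroup.m_closed[OF sub assms(2) subgroup.m_inv_closed[OF sub assms(3)]] .
  then have "(a \<otimes>\<^bsub>A\<^esub> inv\<^bsub>A\<^esub> b, \<one>\<^bsub>K\<^esub>) \<in> S" using c by (simp add: inv_AK)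
  then have "a \<otimes>\<^bsub>A\<^esub> inv\<^bsub>A\<^esub> b = \<one>\<^bsub>A\<^esub>" using S by (simp add: graph_sub_def)
  then have "a = inv\<^bsub>A\<^esub> (inv\<^bsub>A\<^esub> b)" using A.inv_equality[of a "inv\<^bsub>A\<^esub> b"] c by simp
  then show ?thesis using c by simp
qed

lemma pr_apply:
  assumes S: "graph_sub A K S" and au: "(a, u) \<in> S"
  shows "snd (pr A S) u = inv\<^bsub>A\<^esub> a"
proof -
  have "(THE a. (a, u) \<in> S) = a" using au graph_sub_unique[OF S] by blast
  then show ?thesis using au by (force simp: pr_def)
qed

lemma gr_pr:
  assumes S: "graph_sub A K S"
  shows "gr A (pr A S) = S"
proof -
  have sub: "subgroup S (A \<times>\<times> K)" using S by (simp add: graph_sub_def)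
  have c: "a \<in> carrier A" if "(a, u) \<in> S" for a u using subgroup.subset[OF sub] that by auto
  obtain U \<phi> where p: "pr A S = (U, \<phi>)" by fastforce
  have U: "U = snd ` S" using p by (simp add: pr_def)
  have \<phi>: "inv\<^bsub>A\<^esub> (\<phi> u) = a" if "(a, u) \<in> S" for a u using pr_apply[OF S that] p c[OF that] by simp
  have "(a, u) \<in> gr A (U, \<phi>) \<longleftrightarrow> (a, u) \<in> S" for a u
  proof
    assume "(a, u) \<in> gr A (U, \<phi>)"
    then have "u \<in> snd ` S" "a = inv\<^bsub>A\<^esub> (\<phi> u)" using U by (simp_all add: mem_gr)
    then show "(a, u) \<in> S" using \<phi> by force
  next
    assume s: "(a, u) \<in> S"
    then have "u \<in> U" unfolding U by force
    then show "(a, u) \<in> gr A (U, \<phi>)" using \<phi>[OF s] by (simp add: mem_gr)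
  qed
  then show ?thesis unfolding p by auto
qed

lemma pr_pairs:
  assumes S: "graph_sub A K S"
  shows "pr A S \<in> pairs A K"
proof -
  have sub: "subgroup S (A \<times>\<times> K)" using S by (simp add: graph_sub_def)
  note sc = subgroup.m_closed[OF sub] and si = subgroup.m_inv_closed[OF sub] and so = subgroup.one_closed[OF sub]
  have c: "a \<in> carrier A \<and> u \<in> carrier K" if "(a, u) \<in> S" for a u using subgroup.subset[OF sub] that by auto
  obtain U \<phi> where p: "pr A S = (U, \<phi>)" by fastforce
  have U: "U = snd ` S" and ext: "\<phi> \<in> extensional U" using p by (auto simp: pr_def)
  have \<phi>: "\<phi> u = inv\<^bsub>A\<^esub> a" if "(a, u) \<in> S" for a u using pr_apply[OF S that] p by simp
  have mem: "\<exists>a. (a, u) \<in> S" if "u \<in> U" for u using that U by auto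
  have memI: "u \<in> U" if "(a, u) \<in> S" for a u using that U by force
  have "subgroup U K"
  proof (rule K.subgroupI)
    show "U \<subseteq> carrier K" using mem c by blast
    show "U \<noteq> {}" using so U by auto
    fix u assume "u \<in> U"
    then obtain a where a: "(a, u) \<in> S" using mem by blast
    show "inv\<^bsub>K\<^esub> u \<in> U" using si[OF a] inv_AK c[OF a] memI by simp
    fix v assume "v \<in> U"
    then obtain b where b: "(b, v) \<in> S" using mem by blast
    show "u \<otimes>\<^bsub>K\<^esub> v \<in> U" using sc[OF a b] memI by simp
  qed
  moreover have "\<phi> \<in> hom (K\<lparr>carrier := U\<rparr>) A"
  proof (rule homI)
    fix u assume "u \<in> carrier (K\<lparr>carrier := U\<rparr>)"
    then obtain a where a: "(a, u) \<in> S" using mem by auto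
    then show "\<phi> u \<in> carrier A" using \<phi> c by simp
    fix v assume "v \<in> carrier (K\<lparr>carrier := U\<rparr>)"
    then obtain b where b: "(b, v) \<in> S" using mem by auto
    have "(a \<otimes>\<^bsub>A\<^esub> b, u \<otimes>\<^bsub>K\<^esub> v) \<in> S" using sc[OF a b] by simp
    then show "\<phi> (u \<otimes>\<^bsub>K\<lparr>carrier := U\<rparr>\<^esub> v) = \<phi> u \<otimes>\<^bsub>A\<^esub> \<phi> v"
      using \<phi> a b c by (simp add: A.inv_mult)
  qed
  ultimately show ?thesis unfolding p using ext by (simp add: pairs_def)
qed

text \<open>The point of working with graphs: restriction of homomorphisms becomes inclusion, and
  joins become products of sets.\<close>

lemma gr_le_iff:
  assumes p: "p \<in> pairs A K" and q: "q \<in> pairs A K"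
  shows "pair_le p q \<longleftrightarrow> gr A p \<subseteq> gr A q"
proof -
  obtain U \<phi> V \<psi> where pq: "p = (U, \<phi>)" "q = (V, \<psi>)" by (metis surj_pair)
  note P = pairsD[OF p[unfolded pq]] and Q = pairsD[OF q[unfolded pq]]
  have "gr A p \<subseteq> gr A q \<longleftrightarrow> (\<forall>u\<in>U. u \<in> V \<and> inv\<^bsub>A\<^esub> (\<phi> u) = inv\<^bsub>A\<^esub> (\<psi> u))"
    unfolding pq gr_def by auto
  also have "\<dots> \<longleftrightarrow> (\<forall>u\<in>U. u \<in> V \<and> \<phi> u = \<psi> u)"
    using P(2) Q(2) by (metis A.inv_inv)
  also have "\<dots> \<longleftrightarrow> U \<subseteq> V \<and> \<phi> = restrict \<psi> U"
    using P(3) by (auto simp: fun_eq_iff extensional_def)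
  finally show ?thesis unfolding pq pair_le_def by simp
qed

lemma gr_inj: "p \<in> pairs A K \<Longrightarrow> q \<in> pairs A K \<Longrightarrow> gr A p = gr A q \<Longrightarrow> p = q"
proof -
  assume pq: "p \<in> pairs A K" "q \<in> pairs A K" "gr A p = gr A q"
  then have "pair_le p q" "pair_le q p" using gr_le_iff by simp_all
  moreover obtain U \<phi> V \<psi> where u: "p = (U, \<phi>)" "q = (V, \<psi>)" by (metis surj_pair)
  ultimately have "U = V" "\<phi> = restrict \<psi> V" by (auto simp: pair_le_def)
  moreover have "restrict \<psi> V = \<psi>" using pairsD(3)[OF pq(2)[unfolded u]] by (rule extensional_restrict)
  ultimately show "p = q" using u by simp
qed

text \<open>Normality of the subgroup and invariance of the homomorphism, merged into one condition
  on the graph.\<close>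

definition conj_stable where
  "conj_stable N \<longleftrightarrow> (\<forall>a n. (a, n) \<in> N \<longrightarrow> (\<forall>g\<in>carrier K. (a, g \<otimes>\<^bsub>K\<^esub> n \<otimes>\<^bsub>K\<^esub> inv\<^bsub>K\<^esub> g) \<in> N))"

lemma stable_pairs_iff: "p \<in> stable_pairs A K \<longleftrightarrow> p \<in> pairs A K \<and> conj_stable (gr A p)"
proof -
  obtain U \<phi> where p: "p = (U, \<phi>)" by fastforce
  have "(U, \<phi>) \<in> stable_pairs A K \<longleftrightarrow> conj_stable (gr A (U, \<phi>))" if P: "(U, \<phi>) \<in> pairs A K"
  proof
    assume "(U, \<phi>) \<in> stable_pairs A K"
    then have N: "U \<lhd> K" and st: "\<forall>g\<in>carrier K. \<forall>x\<in>U. \<phi> (g \<otimes>\<^bsub>K\<^esub> x \<otimes>\<^bsub>K\<^esub> inv\<^bsub>K\<^esub> g) = \<phi> x"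
      by (auto simp: stable_pairs_def)
    show "conj_stable (gr A (U, \<phi>))"
      using N st unfolding conj_stable_def K.normal_inv_iff by (auto simp: mem_gr)
  next
    assume c: "conj_stable (gr A (U, \<phi>))"
    have "g \<otimes>\<^bsub>K\<^esub> x \<otimes>\<^bsub>K\<^esub> inv\<^bsub>K\<^esub> g \<in> U \<and> \<phi> (g \<otimes>\<^bsub>K\<^esub> x \<otimes>\<^bsub>K\<^esub> inv\<^bsub>K\<^esub> g) = \<phi> x"
      if "g \<in> carrier K" "x \<in> U" for g x
    proof -
      have "(inv\<^bsub>A\<^esub> (\<phi> x), x) \<in> gr A (U, \<phi>)" using that by (simp add: mem_gr)
      then have "(inv\<^bsub>A\<^esub> (\<phi> x), g \<otimes>\<^bsub>K\<^esub> x \<otimes>\<^bsub>K\<^esub> inv\<^bsub>K\<^esub> g) \<in> gr A (U, \<phi>)"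
        using c that unfolding conj_stable_def by blast
      then have *: "g \<otimes>\<^bsub>K\<^esub> x \<otimes>\<^bsub>K\<^esub> inv\<^bsub>K\<^esub> g \<in> U" "inv\<^bsub>A\<^esub> (\<phi> x) = inv\<^bsub>A\<^esub> (\<phi> (g \<otimes>\<^bsub>K\<^esub> x \<otimes>\<^bsub>K\<^esub> inv\<^bsub>K\<^esub> g))"
        by (simp_all add: mem_gr)
      then have "\<phi> (g \<otimes>\<^bsub>K\<^esub> x \<otimes>\<^bsub>K\<^esub> inv\<^bsub>K\<^esub> g) = \<phi> x"
        using pairsD(2)[OF P] that(2) by (metis A.inv_inv)
      then show ?thesis using * by simp
    qed
    then show "(U, \<phi>) \<in> stable_pairs A K"
      using P pairsD(1)[OF P] by (simp add: stable_pairs_def K.normal_inv_iff)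
  qed
  moreover have "p \<in> stable_pairs A K \<Longrightarrow> p \<in> pairs A K" by (auto simp: stable_pairs_def)
  ultimately show ?thesis unfolding p by blast
qed

end

lemma (in fin_tri_group) std_class_single:
  assumes "cring R" "fib A G H (twisted_subgroup A p)"
  shows "std_class R A G H p = single R (cl A G H (twisted_subgroup A p))"
proof -
  have "std_biset A G H p = sb (twisted_subgroup A p)"
    by (simp add: std_biset_def sb_def Let_def)
  then show ?thesis
    unfolding std_class_def sb_def
    using biset_class_orbit[OF assms(1) fibered_bisetD(1)[OF sb_props(1)[OF assms(2)]] sb_props(2,3)[OF assms(2)]]
      sb_props(4)[OF assms(2)] by simp
qed

section \<open>Restriction, transport and reversal of stabilizers\<close>

lemma fib_restrict_right:
  assumes A: "comm_group A" and G: "group G" and H: "group H" and S: "fib A G H S" and Q: "subgroup Q H"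
  shows "fib A G (H\<lparr>carrier := Q\<rparr>) {(a, g, h) \<in> S. h \<in> Q}"
proof -
  interpret T: tri_group A G H using A G H by (rule tri_group.intro)
  interpret H: group H by fact
  have HQ: "group (H\<lparr>carrier := Q\<rparr>)" by (rule subgroup.subgroup_is_group[OF Q H])
  interpret TQ: tri_group A G "H\<lparr>carrier := Q\<rparr>" using A G HQ by (rule tri_group.intro)
  have sub: "subgroup S T.T" using S by (simp add: fib_def)
  have c: "a \<in> carrier A" "g \<in> carrier G" if "(a, g, h) \<in> S" for a g h using subgroup.subset[OF sub] that by auto
  have QH: "h \<in> Q \<Longrightarrow> h \<in> carrier H" for h using subgroup.subset[OF Q] by blast
  let ?S = "{(a, g, h) \<in> S. h \<in> Q}"
  have "subgroup ?S TQ.T"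
  proof (rule TQ.T.subgroupI)
    show "?S \<subseteq> carrier TQ.T" using c by auto
    show "?S \<noteq> {}" using subgroup.one_closed[OF sub] subgroup.one_closed[OF Q] by auto
    fix s assume "s \<in> ?S"
    then obtain a g h where s: "s = (a, g, h)" "(a, g, h) \<in> S" "h \<in> Q" by auto
    show "inv\<^bsub>TQ.T\<^esub> s \<in> ?S"
      using subgroup.m_inv_closed[OF sub s(2)] T.inv_T[of a g h] TQ.inv_T[of a g h] c[OF s(2)] s QH
        subgroup.m_inv_closed[OF Q s(3)] by (simp add: group.m_inv_consistent[OF H Q])
    fix t assume "t \<in> ?S"
    then obtain b k i where t: "t = (b, k, i)" "(b, k, i) \<in> S" "i \<in> Q" by auto
    show "s \<otimes>\<^bsub>TQ.T\<^esub> t \<in> ?S"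
      using subgroup.m_closed[OF sub s(2) t(2)] subgroup.m_closed[OF Q s(3) t(3)] s t by simp
  qed
  then show ?thesis using S by (auto simp: fib_def)
qed

lemma fib_restrict_left:
  assumes A: "comm_group A" and G: "group G" and H: "group H" and S: "fib A H G S" and Q: "subgroup Q H"
  shows "fib A (H\<lparr>carrier := Q\<rparr>) G {(a, h, g) \<in> S. h \<in> Q}"
proof -
  interpret T: tri_group A H G using A H G by (rule tri_group.intro)
  interpret H: group H by fact
  have HQ: "group (H\<lparr>carrier := Q\<rparr>)" by (rule subgroup.subgroup_is_group[OF Q H])
  interpret TQ: tri_group A "H\<lparr>carrier := Q\<rparr>" G using A HQ G by (rule tri_group.intro)
  have sub: "subgroup S T.T" using S by (simp add: fib_def)
  have c: "a \<in> carrier A" "g \<in> carrier G" if "(a, h, g) \<in> S" for a g h using subgroup.subset[OF sub] that by auto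
  have QH: "h \<in> Q \<Longrightarrow> h \<in> carrier H" for h using subgroup.subset[OF Q] by blast
  let ?S = "{(a, h, g) \<in> S. h \<in> Q}"
  have "subgroup ?S TQ.T"
  proof (rule TQ.T.subgroupI)
    show "?S \<subseteq> carrier TQ.T" using c by auto
    show "?S \<noteq> {}" using subgroup.one_closed[OF sub] subgroup.one_closed[OF Q] by auto
    fix s assume "s \<in> ?S"
    then obtain a g h where s: "s = (a, h, g)" "(a, h, g) \<in> S" "h \<in> Q" by auto
    show "inv\<^bsub>TQ.T\<^esub> s \<in> ?S"
      using subgroup.m_inv_closed[OF sub s(2)] T.inv_T[of a h g] TQ.inv_T[of a h g] c[OF s(2)] s QH
        subgroup.m_inv_closed[OF Q s(3)] by (simp add: group.m_inv_consistent[OF H Q])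
    fix t assume "t \<in> ?S"
    then obtain b k i where t: "t = (b, i, k)" "(b, i, k) \<in> S" "i \<in> Q" by auto
    show "s \<otimes>\<^bsub>TQ.T\<^esub> t \<in> ?S"
      using subgroup.m_closed[OF sub s(2) t(2)] subgroup.m_closed[OF Q s(3) t(3)] s t by simp
  qed
  then show ?thesis using S by (auto simp: fib_def)
qed

lemma iso_facts:
  assumes "\<theta> \<in> iso P H" "group P" "group H"
  shows "\<theta> \<one>\<^bsub>P\<^esub> = \<one>\<^bsub>H\<^esub>" "x \<in> carrier P \<Longrightarrow> \<theta> x \<in> carrier H" "inj_on \<theta> (carrier P)" "\<theta> ` carrier P = carrier H"
    "x \<in> carrier P \<Longrightarrow> y \<in> carrier P \<Longrightarrow> \<theta> (x \<otimes>\<^bsub>P\<^esub> y) = \<theta> x \<otimes>\<^bsub>H\<^esub> \<theta> y"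
    "x \<in> carrier P \<Longrightarrow> \<theta> (inv\<^bsub>P\<^esub> x) = inv\<^bsub>H\<^esub> (\<theta> x)"
proof -
  have h: "\<theta> \<in> hom P H" using assms(1) by (simp add: iso_def)
  interpret group_hom P H \<theta> using assms h by (simp add: group_hom_def group_hom_axioms_def)
  show "\<theta> \<one>\<^bsub>P\<^esub> = \<one>\<^bsub>H\<^esub>" "inj_on \<theta> (carrier P)" "\<theta> ` carrier P = carrier H"
    using assms(1) by (auto simp: iso_def bij_betw_def)
  show "x \<in> carrier P \<Longrightarrow> \<theta> x \<in> carrier H" "x \<in> carrier P \<Longrightarrow> y \<in> carrier P \<Longrightarrow> \<theta> (x \<otimes>\<^bsub>P\<^esub> y) = \<theta> x \<otimes>\<^bsub>H\<^esub> \<theta> y"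
    "x \<in> carrier P \<Longrightarrow> \<theta> (inv\<^bsub>P\<^esub> x) = inv\<^bsub>H\<^esub> (\<theta> x)" by simp_all
qed

text \<open>Renames the first coordinates along an isomorphism from a subgroup containing all of
  them. Since the ideal is defined by groups of natural numbers, a factorization through a subgroup
  of \<open>G\<close> has to be renamed in this way.\<close>

lemma fib_transport_left:
  assumes A: "comm_group A" and G: "group G" and L: "group L" and H: "group H" and S: "fib A G L S" and P: "subgroup P G"
    and \<theta>: "\<theta> \<in> iso (G\<lparr>carrier := P\<rparr>) H" and SP: "\<And>a g l. (a, g, l) \<in> S \<Longrightarrow> g \<in> P"
  shows "fib A H L ((\<lambda>(a, g, l). (a, \<theta> g, l)) ` S)"
proof -
  interpret T: tri_group A G L using A G L by (rule tri_group.intro)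
  interpret U: tri_group A H L using A H L by (rule tri_group.intro)
  have GP: "group (G\<lparr>carrier := P\<rparr>)" by (rule subgroup.subgroup_is_group[OF P G])
  note th = iso_facts[OF \<theta> GP H, simplified]
  have sub: "subgroup S T.T" using S by (simp add: fib_def)
  have c: "a \<in> carrier A" "g \<in> carrier G" "l \<in> carrier L" if "(a, g, l) \<in> S" for a g l using subgroup.subset[OF sub] that by auto
  let ?f = "\<lambda>(a, g, l). (a, \<theta> g, l)"
  have "subgroup (?f ` S) U.T"
  proof (rule U.T.subgroupI)
    show "?f ` S \<subseteq> carrier U.T" using c SP th(2) by auto
    show "?f ` S \<noteq> {}" using subgroup.one_closed[OF sub] by auto
    fix s assume "s \<in> ?f ` S"
    then obtain a g l where s: "s = (a, \<theta> g, l)" "(a, g, l) \<in> S" by auto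
    have "(inv\<^bsub>A\<^esub> a, inv\<^bsub>G\<^esub> g, inv\<^bsub>L\<^esub> l) \<in> S"
      using subgroup.m_inv_closed[OF sub s(2)] T.inv_T c[OF s(2)] by simp
    moreover have "inv\<^bsub>U.T\<^esub> s = (inv\<^bsub>A\<^esub> a, \<theta> (inv\<^bsub>G\<^esub> g), inv\<^bsub>L\<^esub> l)"
      unfolding s(1) using U.inv_T[of a "\<theta> g" l] c[OF s(2)] SP[OF s(2)] th(2,6) by (simp add: T.G.m_inv_consistent[OF P])
    ultimately show "inv\<^bsub>U.T\<^esub> s \<in> ?f ` S" by force
    fix t assume "t \<in> ?f ` S"
    then obtain b k m where t: "t = (b, \<theta> k, m)" "(b, k, m) \<in> S" by auto
    have "(a \<otimes>\<^bsub>A\<^esub> b, g \<otimes>\<^bsub>G\<^esub> k, l \<otimes>\<^bsub>L\<^esub> m) \<in> S" using subgroup.m_closed[OF sub s(2) t(2)] by simp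
    moreover have "s \<otimes>\<^bsub>U.T\<^esub> t = (a \<otimes>\<^bsub>A\<^esub> b, \<theta> (g \<otimes>\<^bsub>G\<^esub> k), l \<otimes>\<^bsub>L\<^esub> m)"
      unfolding s(1) t(1) using th(5) SP[OF s(2)] SP[OF t(2)] by simp
    ultimately show "s \<otimes>\<^bsub>U.T\<^esub> t \<in> ?f ` S" by force
  qed
  moreover have "a = \<one>\<^bsub>A\<^esub>" if a: "(a, \<one>\<^bsub>H\<^esub>, \<one>\<^bsub>L\<^esub>) \<in> ?f ` S" for a
  proof -
    obtain g where g: "(a, g, \<one>\<^bsub>L\<^esub>) \<in> S" "\<theta> g = \<one>\<^bsub>H\<^esub>" using a by auto
    then have "g = \<one>\<^bsub>G\<^esub>" using th(1,3) SP[OF g(1)] subgroup.one_closed[OF P] by (auto simp: inj_on_def)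
    then show ?thesis using g(1) S by (simp add: fib_def)
  qed
  ultimately show ?thesis by (simp add: fib_def)
qed

text \<open>The stabilizer for the opposite biset. Inverting the fibre entry makes the reversed
  subgroup an inverse for composition, and it matches the sign convention of
  \<open>right_triple\<close>.\<close>

lemma fib_swap:
  assumes A: "comm_group A" and G: "group G" and H: "group H" and S: "fib A G H S"
  shows "fib A H G ((\<lambda>(a, g, h). (inv\<^bsub>A\<^esub> a, h, g)) ` S)"
proof -
  interpret T: tri_group A G H using A G H by (rule tri_group.intro)
  interpret U: tri_group A H G using A H G by (rule tri_group.intro)
  have sub: "subgroup S T.T" using S by (simp add: fib_def)
  have c: "a \<in> carrier A" "g \<in> carrier G" "l \<in> carrier H" if "(a, g, l) \<in> S" for a g l using subgroup.subset[OF sub] that by auto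
  let ?f = "\<lambda>(a, g, h). (inv\<^bsub>A\<^esub> a, h, g)"
  have "subgroup (?f ` S) U.T"
  proof (rule U.T.subgroupI)
    show "?f ` S \<subseteq> carrier U.T" using c by auto
    show "?f ` S \<noteq> {}" using subgroup.one_closed[OF sub] by auto
    fix s assume "s \<in> ?f ` S"
    then obtain a g l where s: "s = (inv\<^bsub>A\<^esub> a, l, g)" "(a, g, l) \<in> S" by auto
    have "(inv\<^bsub>A\<^esub> a, inv\<^bsub>G\<^esub> g, inv\<^bsub>H\<^esub> l) \<in> S"
      using subgroup.m_inv_closed[OF sub s(2)] T.inv_T c[OF s(2)] by simp
    moreover have "inv\<^bsub>U.T\<^esub> s = (inv\<^bsub>A\<^esub> (inv\<^bsub>A\<^esub> a), inv\<^bsub>H\<^esub> l, inv\<^bsub>G\<^esub> g)"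
      unfolding s(1) using U.inv_T[of "inv\<^bsub>A\<^esub> a" l g] c[OF s(2)] by simp
    ultimately show "inv\<^bsub>U.T\<^esub> s \<in> ?f ` S" by force
    fix t assume "t \<in> ?f ` S"
    then obtain b k m where t: "t = (inv\<^bsub>A\<^esub> b, m, k)" "(b, k, m) \<in> S" by auto
    have "(a \<otimes>\<^bsub>A\<^esub> b, g \<otimes>\<^bsub>G\<^esub> k, l \<otimes>\<^bsub>H\<^esub> m) \<in> S" using subgroup.m_closed[OF sub s(2) t(2)] by simp
    moreover have "s \<otimes>\<^bsub>U.T\<^esub> t = (inv\<^bsub>A\<^esub> (a \<otimes>\<^bsub>A\<^esub> b), l \<otimes>\<^bsub>H\<^esub> m, g \<otimes>\<^bsub>G\<^esub> k)"
      unfolding s(1) t(1) using c[OF s(2)] c[OF t(2)] by (simp add: T.A.inv_mult)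
    ultimately show "s \<otimes>\<^bsub>U.T\<^esub> t \<in> ?f ` S" by force
  qed
  moreover have "a = \<one>\<^bsub>A\<^esub>" if a: "(a, \<one>\<^bsub>H\<^esub>, \<one>\<^bsub>G\<^esub>) \<in> ?f ` S" for a
  proof -
    obtain b where b: "(b, \<one>\<^bsub>G\<^esub>, \<one>\<^bsub>H\<^esub>) \<in> S" "a = inv\<^bsub>A\<^esub> b" using a by auto
    then have "b = \<one>\<^bsub>A\<^esub>" using S by (simp add: fib_def)
    then show ?thesis using b(2) by simp
  qed
  ultimately show ?thesis by (simp add: fib_def)
qed

lemma fib_graph:
  assumes A: "comm_group A" and G: "group G" and H: "group H" and P: "subgroup P G"
    and \<theta>: "\<theta> \<in> iso (G\<lparr>carrier := P\<rparr>) H"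
  shows "fib A G H ((\<lambda>g. (\<one>\<^bsub>A\<^esub>, g, \<theta> g)) ` P)"
proof -
  interpret T: tri_group A G H using A G H by (rule tri_group.intro)
  have GP: "group (G\<lparr>carrier := P\<rparr>)" by (rule subgroup.subgroup_is_group[OF P G])
  note th = iso_facts[OF \<theta> GP H, simplified]
  have PG: "g \<in> P \<Longrightarrow> g \<in> carrier G" for g using subgroup.subset[OF P] by blast
  let ?f = "\<lambda>g. (\<one>\<^bsub>A\<^esub>, g, \<theta> g)"
  have "subgroup (?f ` P) T.T"
  proof (rule T.T.subgroupI)
    show "?f ` P \<subseteq> carrier T.T" using PG th(2) by auto
    show "?f ` P \<noteq> {}" using subgroup.one_closed[OF P] by auto
    fix s assume "s \<in> ?f ` P"
    then obtain g where s: "s = ?f g" "g \<in> P" by auto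
    have "inv\<^bsub>T.T\<^esub> s = ?f (inv\<^bsub>G\<^esub> g)"
      unfolding s(1) using T.inv_T[of "\<one>\<^bsub>A\<^esub>" g "\<theta> g"] PG s(2) th(2,6) by (simp add: T.G.m_inv_consistent[OF P])
    then show "inv\<^bsub>T.T\<^esub> s \<in> ?f ` P" using subgroup.m_inv_closed[OF P s(2)] by simp
    fix t assume "t \<in> ?f ` P"
    then obtain k where t: "t = ?f k" "k \<in> P" by auto
    have "s \<otimes>\<^bsub>T.T\<^esub> t = ?f (g \<otimes>\<^bsub>G\<^esub> k)" using s t th(5) by simp
    then show "s \<otimes>\<^bsub>T.T\<^esub> t \<in> ?f ` P" using subgroup.m_closed[OF P s(2) t(2)] by simp
  qed
  then show ?thesis by (auto simp: fib_def)
qed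

section \<open>The ideal of classes factoring through smaller groups\<close>

lemma tcompI: "(c, g, h) \<in> S \<Longrightarrow> (d, h, i) \<in> S' \<Longrightarrow> (c \<otimes>\<^bsub>A\<^esub> d, g, i) \<in> tcomp A S S'"
  unfolding tcomp_def by blast

lemma tcompE:
  assumes "s \<in> tcomp A S S'"
  obtains c d g h i where "s = (c \<otimes>\<^bsub>A\<^esub> d, g, i)" "(c, g, h) \<in> S" "(d, h, i) \<in> S'"
  using assms unfolding tcomp_def by blast

text \<open>For the graph of a stable pair this is the stabilizer behind \<open>e_elt\<close>, by
  \<open>twisted_diag\<close>. It is written for any set \<open>N\<close> because the composite of
  two such subgroups is put in this form before it is known whether \<open>N\<close> is a
  graph.\<close>

definition Dm :: "'a monoid \<Rightarrow> 'g monoid \<Rightarrow> ('a \<times> 'g) set \<Rightarrow> ('a \<times> 'g \<times> 'g) set" where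
  "Dm A G N = {(a, n \<otimes>\<^bsub>G\<^esub> g, g) | a n g. (a, n) \<in> N \<and> g \<in> carrier G}"

context pair_group
begin

lemma fib_Dm:
  assumes N: "graph_sub A K N" and cs: "conj_stable N"
  shows "fib A K K (Dm A K N)"
proof -
  interpret T: tri_group A K K by (intro tri_group.intro A.comm_group_axioms K.group_axioms)
  have sub: "subgroup N (A \<times>\<times> K)" using N by (simp add: graph_sub_def)
  have c: "a \<in> carrier A" "n \<in> carrier K" if "(a, n) \<in> N" for a n using subgroup.subset[OF sub] that by auto
  have "subgroup (Dm A K N) T.T"
  proof (rule T.T.subgroupI)
    show "Dm A K N \<subseteq> carrier T.T" using c by (auto simp: Dm_def)
    show "Dm A K N \<noteq> {}" using subgroup.one_closed[OF sub] K.one_closed by (force simp: Dm_def)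
    fix s assume "s \<in> Dm A K N"
    then obtain a n g where s: "s = (a, n \<otimes>\<^bsub>K\<^esub> g, g)" "(a, n) \<in> N" "g \<in> carrier K" by (auto simp: Dm_def)
    note cn = c[OF s(2)]
    have "(inv\<^bsub>A\<^esub> a, inv\<^bsub>K\<^esub> n) \<in> N" using subgroup.m_inv_closed[OF sub s(2)] inv_AK cn by simp
    then have "(inv\<^bsub>A\<^esub> a, inv\<^bsub>K\<^esub> g \<otimes>\<^bsub>K\<^esub> inv\<^bsub>K\<^esub> n \<otimes>\<^bsub>K\<^esub> inv\<^bsub>K\<^esub> (inv\<^bsub>K\<^esub> g)) \<in> N"
      using cs s(3) unfolding conj_stable_def by blast
    moreover have "inv\<^bsub>T.T\<^esub> s = (inv\<^bsub>A\<^esub> a, (inv\<^bsub>K\<^esub> g \<otimes>\<^bsub>K\<^esub> inv\<^bsub>K\<^esub> n \<otimes>\<^bsub>K\<^esub> inv\<^bsub>K\<^esub> (inv\<^bsub>K\<^esub> g)) \<otimes>\<^bsub>K\<^esub> inv\<^bsub>K\<^esub> g, inv\<^bsub>K\<^esub> g)"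
      unfolding s(1) using T.inv_T[of a "n \<otimes>\<^bsub>K\<^esub> g" g] cn s(3) by (simp add: K.inv_mult_group K.m_assoc)
    ultimately show "inv\<^bsub>T.T\<^esub> s \<in> Dm A K N" using s(3) unfolding Dm_def by blast
    fix t assume "t \<in> Dm A K N"
    then obtain b m h where t: "t = (b, m \<otimes>\<^bsub>K\<^esub> h, h)" "(b, m) \<in> N" "h \<in> carrier K" by (auto simp: Dm_def)
    note cm = c[OF t(2)]
    have "(b, g \<otimes>\<^bsub>K\<^esub> m \<otimes>\<^bsub>K\<^esub> inv\<^bsub>K\<^esub> g) \<in> N" using cs t(2) s(3) unfolding conj_stable_def by blast
    then have "(a \<otimes>\<^bsub>A\<^esub> b, n \<otimes>\<^bsub>K\<^esub> (g \<otimes>\<^bsub>K\<^esub> m \<otimes>\<^bsub>K\<^esub> inv\<^bsub>K\<^esub> g)) \<in> N"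
      using subgroup.m_closed[OF sub s(2)] by fastforce
    moreover have "s \<otimes>\<^bsub>T.T\<^esub> t = (a \<otimes>\<^bsub>A\<^esub> b, (n \<otimes>\<^bsub>K\<^esub> (g \<otimes>\<^bsub>K\<^esub> m \<otimes>\<^bsub>K\<^esub> inv\<^bsub>K\<^esub> g)) \<otimes>\<^bsub>K\<^esub> (g \<otimes>\<^bsub>K\<^esub> h), g \<otimes>\<^bsub>K\<^esub> h)"
    proof -
      have "inv\<^bsub>K\<^esub> g \<otimes>\<^bsub>K\<^esub> (g \<otimes>\<^bsub>K\<^esub> h) = h" using s(3) t(3) by (simp flip: K.m_assoc)
      then show ?thesis unfolding s(1) t(1) using cn cm s(3) t(3) by (simp add: K.m_assoc)
    qed
    ultimately show "s \<otimes>\<^bsub>T.T\<^esub> t \<in> Dm A K N" using s(3) t(3) unfolding Dm_def by blast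
  qed
  moreover have "a = \<one>\<^bsub>A\<^esub>" if a: "(a, \<one>\<^bsub>K\<^esub>, \<one>\<^bsub>K\<^esub>) \<in> Dm A K N" for a
  proof -
    obtain n where n: "(a, n) \<in> N" "n \<otimes>\<^bsub>K\<^esub> \<one>\<^bsub>K\<^esub> = \<one>\<^bsub>K\<^esub>" using a unfolding Dm_def by auto
    then have "n = \<one>\<^bsub>K\<^esub>" using c by simp
    then show ?thesis using n N by (simp add: graph_sub_def)
  qed
  ultimately show ?thesis by (simp add: fib_def)
qed

lemma twisted_diag:
  assumes p: "p \<in> stable_pairs A K"
  shows "twisted_subgroup A (diag_pair K p) = Dm A K (gr A p)"
proof -
  obtain U \<phi> where p': "p = (U, \<phi>)" by fastforce
  have N: "U \<lhd> K" using p unfolding p' by (auto simp: stable_pairs_def)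
  have sub: "subgroup U K" using N by (simp add: normal_def)
  have UK: "u \<in> U \<Longrightarrow> u \<in> carrier K" for u using subgroup.subset[OF sub] by blast
  have coset: "g <#\<^bsub>K\<^esub> U = h <#\<^bsub>K\<^esub> U \<longleftrightarrow> g \<otimes>\<^bsub>K\<^esub> inv\<^bsub>K\<^esub> h \<in> U" if gh: "g \<in> carrier K" "h \<in> carrier K" for g h
  proof -
    have r: "x <#\<^bsub>K\<^esub> U = U #>\<^bsub>K\<^esub> x" if "x \<in> carrier K" for x
      using normal.coset_eq[OF N] that by simp
    have "U #>\<^bsub>K\<^esub> g = U #>\<^bsub>K\<^esub> h \<longleftrightarrow> g \<otimes>\<^bsub>K\<^esub> inv\<^bsub>K\<^esub> h \<in> U"
    proof
      assume "U #>\<^bsub>K\<^esub> g = U #>\<^bsub>K\<^esub> h"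
      then have "g \<in> U #>\<^bsub>K\<^esub> h" using K.rcos_self[OF gh(1) sub] by simp
      then show "g \<otimes>\<^bsub>K\<^esub> inv\<^bsub>K\<^esub> h \<in> U" using subgroup.rcos_module_imp[OF sub K.group_axioms gh(2)] by blast
    next
      assume "g \<otimes>\<^bsub>K\<^esub> inv\<^bsub>K\<^esub> h \<in> U"
      then have "g \<in> U #>\<^bsub>K\<^esub> h" using subgroup.rcos_module_rev[OF sub K.group_axioms gh(2,1)] by blast
      then show "U #>\<^bsub>K\<^esub> g = U #>\<^bsub>K\<^esub> h" using K.repr_independence[OF _ gh(2) sub] by simp
    qed
    then show ?thesis using r gh by simp
  qed
  have "(a, g, h) \<in> twisted_subgroup A (diag_pair K p) \<longleftrightarrow> (a, g, h) \<in> Dm A K (gr A p)" for a g h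
  proof
    assume "(a, g, h) \<in> twisted_subgroup A (diag_pair K p)"
    then have *: "g \<in> carrier K" "h \<in> carrier K" "g <#\<^bsub>K\<^esub> U = h <#\<^bsub>K\<^esub> U" "a = inv\<^bsub>A\<^esub> (\<phi> (g \<otimes>\<^bsub>K\<^esub> inv\<^bsub>K\<^esub> h))"
      unfolding p' twisted_subgroup_def diag_pair_def Let_def by auto
    then have "(a, g \<otimes>\<^bsub>K\<^esub> inv\<^bsub>K\<^esub> h) \<in> gr A p" using coset unfolding p' by (simp add: mem_gr)
    moreover have "g = (g \<otimes>\<^bsub>K\<^esub> inv\<^bsub>K\<^esub> h) \<otimes>\<^bsub>K\<^esub> h" using * by (simp add: K.m_assoc)
    ultimately show "(a, g, h) \<in> Dm A K (gr A p)" using *(2) unfolding Dm_def by blast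
  next
    assume "(a, g, h) \<in> Dm A K (gr A p)"
    then obtain n where n: "(a, n) \<in> gr A p" "g = n \<otimes>\<^bsub>K\<^esub> h" "h \<in> carrier K" unfolding Dm_def by blast
    then have nU: "n \<in> U" "a = inv\<^bsub>A\<^esub> (\<phi> n)" unfolding p' by (simp_all add: mem_gr)
    have "g \<otimes>\<^bsub>K\<^esub> inv\<^bsub>K\<^esub> h = n" using n nU UK by (simp add: K.m_assoc)
    then show "(a, g, h) \<in> twisted_subgroup A (diag_pair K p)"
      using coset[of g h] n nU UK unfolding p' twisted_subgroup_def diag_pair_def Let_def by auto
  qed
  then show ?thesis by auto
qed

lemma gr_graph_conj: "p \<in> stable_pairs A K \<Longrightarrow> graph_sub A K (gr A p)"
  "p \<in> stable_pairs A K \<Longrightarrow> conj_stable (gr A p)"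
  using stable_pairs_iff gr_graph_sub by auto

lemma trivial_pair:
  "({\<one>\<^bsub>K\<^esub>}, \<lambda>x\<in>{\<one>\<^bsub>K\<^esub>}. \<one>\<^bsub>A\<^esub>) \<in> stable_pairs A K"
  "gr A ({\<one>\<^bsub>K\<^esub>}, \<lambda>x\<in>{\<one>\<^bsub>K\<^esub>}. \<one>\<^bsub>A\<^esub>) = {(\<one>\<^bsub>A\<^esub>, \<one>\<^bsub>K\<^esub>)}"
proof -
  have s: "subgroup {\<one>\<^bsub>K\<^esub>} K" by (rule K.triv_subgroup)
  have p: "({\<one>\<^bsub>K\<^esub>}, \<lambda>x\<in>{\<one>\<^bsub>K\<^esub>}. \<one>\<^bsub>A\<^esub>) \<in> pairs A K"
    using s by (auto simp: pairs_def hom_def)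
  show g: "gr A ({\<one>\<^bsub>K\<^esub>}, \<lambda>x\<in>{\<one>\<^bsub>K\<^esub>}. \<one>\<^bsub>A\<^esub>) = {(\<one>\<^bsub>A\<^esub>, \<one>\<^bsub>K\<^esub>)}" by (auto simp: gr_def)
  show "({\<one>\<^bsub>K\<^esub>}, \<lambda>x\<in>{\<one>\<^bsub>K\<^esub>}. \<one>\<^bsub>A\<^esub>) \<in> stable_pairs A K"
    unfolding stable_pairs_iff conj_stable_def g using p by auto
qed

end

section \<open>The endomorphism algebra and its ideal\<close>

locale endo_ctx = coefficients R + GG: fin_tri_group A G G
  for R :: "'k ring" (structure) and A :: "'a monoid" and G :: "'g monoid"
begin

sublocale PG: pair_group A G
  by (intro pair_group.intro GG.A.comm_group_axioms GG.G.group_axioms)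

sublocale cc: compose_ctx R A G G G
  by (intro compose_ctx.intro coefficients_axioms GG.fin_tri_group_axioms)

abbreviation M where "M \<equiv> E_alg R A G"
abbreviation B where "B \<equiv> iso_classes A G G"
abbreviation \<II> where "\<II> \<equiv> I_ideal R A G"

sublocale fr: free_module R B M
  by (intro free_module.intro free_module_axioms.intro coefficients_axioms)
    (simp_all add: E_alg_def GG.burnside_eq)

lemma mult_M: "monoid.mult M = cc.cmp"
  by (simp add: E_alg_def)

lemma carrier_B: "carrier M = fin_supp R B"
  by (rule fr.carrier_M)

lemma e_elt_single: "p \<in> stable_pairs A G \<Longrightarrow> e_elt R A G p = single R (cl A G G (Dm A G (gr A p)))"
  unfolding e_elt_def
  using GG.std_class_single[OF cring_axioms, of "diag_pair G p"] PG.twisted_diag[of p]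
    PG.fib_Dm[OF PG.gr_graph_conj] by simp

lemma one_M: "\<one>\<^bsub>M\<^esub> = single R (cl A G G (Dm A G {(\<one>\<^bsub>A\<^esub>, \<one>\<^bsub>G\<^esub>)}))"
  using e_elt_single[OF PG.trivial_pair(1)] PG.trivial_pair(2) by (simp add: E_alg_def)

lemma mult_single:
  assumes S: "fib A G G S" and S': "fib A G G S'"
    and cover: "(\<forall>h\<in>carrier G. \<exists>a g. (a, g, h) \<in> S) \<or> (\<forall>h\<in>carrier G. \<exists>a i. (a, h, i) \<in> S')"
  shows "single R (cl A G G S) \<otimes>\<^bsub>M\<^esub> single R (cl A G G S') =
      (if afree A G G (tcomp A S S') then single R (cl A G G (tcomp A S S')) else \<zero>\<^bsub>M\<^esub>)"
    and "afree A G G (tcomp A S S') \<Longrightarrow> fib A G G (tcomp A S S')"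
  using cc.cmp_single_cover[OF assms] by (simp_all add: mult_M fr.zero_M)

lemma Dm_cover:
  assumes g: "g \<in> carrier G" and N: "graph_sub A G N"
  shows "\<exists>a h. (a, h, g) \<in> Dm A G N" "\<exists>a h. (a, g, h) \<in> Dm A G N"
proof -
  have "subgroup N (A \<times>\<times> G)" using N by (simp add: graph_sub_def)
  then have "(\<one>\<^bsub>A\<^esub>, \<one>\<^bsub>G\<^esub>) \<in> N" using subgroup.one_closed by fastforce
  then have "(\<one>\<^bsub>A\<^esub>, \<one>\<^bsub>G\<^esub> \<otimes>\<^bsub>G\<^esub> g, g) \<in> Dm A G N" using g unfolding Dm_def by blast
  then have "(\<one>\<^bsub>A\<^esub>, g, g) \<in> Dm A G N" using g by simp
  then show "\<exists>a h. (a, h, g) \<in> Dm A G N" "\<exists>a h. (a, g, h) \<in> Dm A G N" by blast+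
qed

lemma tcomp_Dm_left:
  assumes S: "fib A G G S"
  shows "tcomp A (Dm A G N) S = {(a \<otimes>\<^bsub>A\<^esub> b, n \<otimes>\<^bsub>G\<^esub> g, h) | a b n g h. (a, n) \<in> N \<and> (b, g, h) \<in> S}"
proof -
  have "g \<in> carrier G" if "(b, g, h) \<in> S" for b g h
    using S that subgroup.subset[of S GG.T] by (auto simp: fib_def)
  then show ?thesis unfolding tcomp_def Dm_def by blast
qed

lemma fib_carrier:
  assumes "fib A G G S" "(a, g, h) \<in> S" shows "a \<in> carrier A" "g \<in> carrier G" "h \<in> carrier G"
  using assms subgroup.subset[of S GG.T] by (auto simp: fib_def)

lemma fib_mult: "fib A G G S \<Longrightarrow> (a, g, h) \<in> S \<Longrightarrow> (b, k, i) \<in> S \<Longrightarrow> (a \<otimes>\<^bsub>A\<^esub> b, g \<otimes>\<^bsub>G\<^esub> k, h \<otimes>\<^bsub>G\<^esub> i) \<in> S"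
  using subgroup.m_closed[of S GG.T "(a, g, h)" "(b, k, i)"] by (simp add: fib_def)

lemma fib_inv: "fib A G G S \<Longrightarrow> (a, g, h) \<in> S \<Longrightarrow> (inv\<^bsub>A\<^esub> a, inv\<^bsub>G\<^esub> g, inv\<^bsub>G\<^esub> h) \<in> S"
  using subgroup.m_inv_closed[of S GG.T "(a, g, h)"] GG.inv_T[of a g h] fib_carrier[of S a g h] by (simp add: fib_def)

lemma fib_one: "fib A G G S \<Longrightarrow> (\<one>\<^bsub>A\<^esub>, \<one>\<^bsub>G\<^esub>, \<one>\<^bsub>G\<^esub>) \<in> S"
proof -
  assume "fib A G G S"
  then have "subgroup S GG.T" by (simp add: fib_def)
  from subgroup.one_closed[OF this] show ?thesis by simp
qed

lemma one_single:
  assumes b: "b \<in> B"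
  shows "\<one>\<^bsub>M\<^esub> \<otimes>\<^bsub>M\<^esub> single R b = single R b" "single R b \<otimes>\<^bsub>M\<^esub> \<one>\<^bsub>M\<^esub> = single R b"
proof -
  let ?D = "Dm A G {(\<one>\<^bsub>A\<^esub>, \<one>\<^bsub>G\<^esub>)}"
  obtain S where S: "fib A G G S" "b = cl A G G S" using b unfolding GG.iso_classes_eq by blast
  have gs: "graph_sub A G {(\<one>\<^bsub>A\<^esub>, \<one>\<^bsub>G\<^esub>)}" "PG.conj_stable {(\<one>\<^bsub>A\<^esub>, \<one>\<^bsub>G\<^esub>)}"
    using PG.gr_graph_conj[OF PG.trivial_pair(1)] PG.trivial_pair(2) by simp_all
  have D: "fib A G G ?D" by (rule PG.fib_Dm[OF gs])
  have Deq: "?D = {(\<one>\<^bsub>A\<^esub>, g, g) | g. g \<in> carrier G}" unfolding Dm_def by force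
  have "tcomp A ?D S = S"
  proof
    show "tcomp A ?D S \<subseteq> S" unfolding Deq tcomp_def using fib_carrier[OF S(1)] by auto
    show "S \<subseteq> tcomp A ?D S"
    proof
      fix s assume s: "s \<in> S"
      obtain a g h where agh: "s = (a, g, h)" by (metis surj_pair)
      note c = fib_carrier[OF S(1) s[unfolded agh]]
      have "(\<one>\<^bsub>A\<^esub> \<otimes>\<^bsub>A\<^esub> a, g, h) \<in> tcomp A ?D S"
        by (rule tcompI[of _ _ g]) (use s c agh in \<open>auto simp: Deq\<close>)
      then show "s \<in> tcomp A ?D S" unfolding agh using c(1) by simp
    qed
  qed
  moreover have "tcomp A S ?D = S"
  proof
    show "tcomp A S ?D \<subseteq> S" unfolding Deq tcomp_def using fib_carrier[OF S(1)] by auto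
    show "S \<subseteq> tcomp A S ?D"
    proof
      fix s assume s: "s \<in> S"
      obtain a g h where agh: "s = (a, g, h)" by (metis surj_pair)
      note c = fib_carrier[OF S(1) s[unfolded agh]]
      have "(a \<otimes>\<^bsub>A\<^esub> \<one>\<^bsub>A\<^esub>, g, h) \<in> tcomp A S ?D"
        by (rule tcompI[of _ _ h]) (use s c agh in \<open>auto simp: Deq\<close>)
      then show "s \<in> tcomp A S ?D" unfolding agh using c(1) by simp
    qed
  qed
  moreover have "afree A G G S" using S(1) by (simp add: fib_alt)
  ultimately show "\<one>\<^bsub>M\<^esub> \<otimes>\<^bsub>M\<^esub> single R b = single R b" "single R b \<otimes>\<^bsub>M\<^esub> \<one>\<^bsub>M\<^esub> = single R b"
    unfolding one_M S(2) using mult_single(1)[OF D S(1)] mult_single(1)[OF S(1) D] Dm_cover gs by auto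
qed

lemma E_k_algebra: "k_algebra R M"
proof -
  interpret ac: assoc_ctx R A G G G G
    by (intro assoc_ctx.intro cc.compose_ctx_axioms GG.fin_tri_group_axioms)
  note mod = fr.free_is_module
  have ab: "abelian_group M" by (rule fr.free_abelian_group)
  interpret ab: abelian_group M by (rule ab)
  have mult: "x \<otimes>\<^bsub>M\<^esub> y \<in> carrier M" if "x \<in> carrier M" "y \<in> carrier M" for x y
    using that cc.cmp_closed by (simp add: mult_M carrier_B)
  have ld: "(x \<oplus>\<^bsub>M\<^esub> y) \<otimes>\<^bsub>M\<^esub> z = x \<otimes>\<^bsub>M\<^esub> z \<oplus>\<^bsub>M\<^esub> y \<otimes>\<^bsub>M\<^esub> z"
    if "x \<in> carrier M" "y \<in> carrier M" "z \<in> carrier M" for x y z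
    using that cc.cmp_add_left by (simp add: mult_M carrier_B fr.add_M)
  have rd: "z \<otimes>\<^bsub>M\<^esub> (x \<oplus>\<^bsub>M\<^esub> y) = z \<otimes>\<^bsub>M\<^esub> x \<oplus>\<^bsub>M\<^esub> z \<otimes>\<^bsub>M\<^esub> y"
    if "x \<in> carrier M" "y \<in> carrier M" "z \<in> carrier M" for x y z
    using that cc.cmp_add_right by (simp add: mult_M carrier_B fr.add_M)
  have sm: "(c \<odot>\<^bsub>M\<^esub> x) \<otimes>\<^bsub>M\<^esub> y = c \<odot>\<^bsub>M\<^esub> (x \<otimes>\<^bsub>M\<^esub> y)" "x \<otimes>\<^bsub>M\<^esub> (c \<odot>\<^bsub>M\<^esub> y) = c \<odot>\<^bsub>M\<^esub> (x \<otimes>\<^bsub>M\<^esub> y)"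
    if "c \<in> carrier R" "x \<in> carrier M" "y \<in> carrier M" for c x y
    using that cc.cmp_smult by (simp_all add: mult_M carrier_B fr.smult_M)
  have one: "\<one>\<^bsub>M\<^esub> \<in> carrier M"
    unfolding one_M using PG.fib_Dm PG.gr_graph_conj[OF PG.trivial_pair(1)] PG.trivial_pair(2)
    by (intro fr.single_closed GG.cl_iso_classes) auto
  have ones: "\<one>\<^bsub>M\<^esub> \<otimes>\<^bsub>M\<^esub> x = x \<and> x \<otimes>\<^bsub>M\<^esub> \<one>\<^bsub>M\<^esub> = x" if x: "x \<in> carrier M" for x
    using x[unfolded carrier_B] subset_refl
  proof (induction rule: fr.free_induct)
    case zero
    show ?case by (simp add: mult_M fr.zero_M cc.cmp_zero)
  next
    case (add c b v)
    then show ?case using one by (simp add: ld rd sm one_single mult)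
  qed
  have mon: "Group.monoid M"
  proof (rule monoidI)
    fix x y z assume "x \<in> carrier M" "y \<in> carrier M" "z \<in> carrier M"
    then show "x \<otimes>\<^bsub>M\<^esub> y \<otimes>\<^bsub>M\<^esub> z = x \<otimes>\<^bsub>M\<^esub> (y \<otimes>\<^bsub>M\<^esub> z)"
      using ac.cmp_assoc by (simp add: mult_M carrier_B)
  qed (use mult one ones in auto)
  have "ring M" by (rule ringI[OF ab mon]) (use ld rd in auto)
  then show ?thesis unfolding k_algebra_def using mod sm by blast
qed

sublocale ka: k_alg R M
  by unfold_locales (rule E_k_algebra)

definition Gen where "Gen = {compose_burnside R A G H G v w | (H :: nat monoid) v w.
        group H \<and> finite (carrier H) \<and> order H < order G \<and>
        v \<in> burnside R A G H \<and> w \<in> burnside R A H G}"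

lemma GenI:
  fixes H :: "nat monoid"
  assumes "group H" "finite (carrier H)" "order H < order G" "v \<in> burnside R A G H" "w \<in> burnside R A H G"
  shows "compose_burnside R A G H G v w \<in> Gen"
  using assms unfolding Gen_def by blast

lemma I_eq: "\<II> = k_span R M Gen"
  by (simp add: I_ideal_def Gen_def)

lemma small_ctx:
  fixes H :: "'h monoid"
  assumes "group H" "finite (carrier H)"
  shows "compose_ctx R A G H G"
proof -
  have "fin_tri_group A G H" "fin_tri_group A H G"
    using assms GG.A.comm_group_axioms GG.G.group_axioms GG.finite_G
    by (auto intro!: fin_tri_group.intro tri_group.intro fin_tri_group_axioms.intro)
  then show ?thesis by (intro compose_ctx.intro coefficients_axioms)
qed

lemma Gen_carrier: "Gen \<subseteq> carrier M"
proof
  fix x assume "x \<in> Gen"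
  then obtain H :: "nat monoid" and v w where H: "group H" "finite (carrier H)"
    "v \<in> burnside R A G H" "w \<in> burnside R A H G" "x = compose_burnside R A G H G v w"
    unfolding Gen_def by blast
  interpret c: compose_ctx R A G H G by (rule small_ctx[OF H(1,2)])
  show "x \<in> carrier M"
    using c.cmp_closed H(3-5) by (simp add: carrier_B c.GH.burnside_eq c.HI.burnside_eq)
qed

lemma I_submodule: "submodule \<II> R M"
  unfolding I_eq by (rule ka.submodule_k_span[OF Gen_carrier])

text \<open>Associativity absorbs the outside factor into the neighbouring factor of the product
  through \<open>H\<close>, so the generating set is itself closed under multiplication from both
  sides.\<close>

lemma Gen_mult:
  assumes x: "x \<in> Gen" and u: "u \<in> carrier M"
  shows "u \<otimes>\<^bsub>M\<^esub> x \<in> Gen" "x \<otimes>\<^bsub>M\<^esub> u \<in> Gen"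
proof -
  obtain H :: "nat monoid" and v w where H: "group H" "finite (carrier H)" "order H < order G"
    "v \<in> burnside R A G H" "w \<in> burnside R A H G" "x = compose_burnside R A G H G v w"
    using x unfolding Gen_def by blast
  interpret c: compose_ctx R A G H G by (rule small_ctx[OF H(1,2)])
  interpret a1: assoc_ctx R A G G H G
    by (intro assoc_ctx.intro compose_ctx.intro coefficients_axioms GG.fin_tri_group_axioms
        c.GH.fin_tri_group_axioms c.HI.fin_tri_group_axioms)
  interpret a2: assoc_ctx R A G H G G
    by (intro assoc_ctx.intro c.compose_ctx_axioms GG.fin_tri_group_axioms)
  have vw: "v \<in> fin_supp R (iso_classes A G H)" "w \<in> fin_supp R (iso_classes A H G)" "u \<in> fin_supp R B"
    using H u by (simp_all add: c.GH.burnside_eq c.HI.burnside_eq carrier_B)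
  have "u \<otimes>\<^bsub>M\<^esub> x = compose_burnside R A G H G (compose_burnside R A G G H u v) w"
    unfolding mult_M H(6) using a1.cmp_assoc[OF vw(3,1,2)] by simp
  moreover have "compose_burnside R A G G H u v \<in> burnside R A G H"
    using a1.GHI.cmp_closed[OF vw(3,1)] by (simp add: c.GH.burnside_eq)
  ultimately show "u \<otimes>\<^bsub>M\<^esub> x \<in> Gen" unfolding Gen_def using H by blast
  have "x \<otimes>\<^bsub>M\<^esub> u = compose_burnside R A G H G v (compose_burnside R A H G G w u)"
    unfolding mult_M H(6) using a2.cmp_assoc[OF vw] by simp
  moreover have "compose_burnside R A H G G w u \<in> burnside R A H G"
    using a2.HIJ.cmp_closed[OF vw(2,3)] by (simp add: c.HI.burnside_eq)
  ultimately show "x \<otimes>\<^bsub>M\<^esub> u \<in> Gen" unfolding Gen_def using H by blast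
qed

lemma I_smult: "c \<in> carrier R \<Longrightarrow> x \<in> \<II> \<Longrightarrow> c \<odot>\<^bsub>M\<^esub> x \<in> \<II>"
  using fr.fm.submoduleE(4)[OF I_submodule] .

lemma I_is_ideal: "ideal \<II> M"
proof -
  note SE = fr.fm.submoduleE[OF I_submodule]
  have left: "u \<otimes>\<^bsub>M\<^esub> x \<in> \<II>" if u: "u \<in> carrier M" and x: "x \<in> \<II>" for u x
  proof -
    let ?N = "{x \<in> carrier M. u \<otimes>\<^bsub>M\<^esub> x \<in> \<II>}"
    have "submodule ?N R M"
    proof (rule fr.fm.submoduleI)
      have "\<zero>\<^bsub>M\<^esub> \<in> \<II>" using I_submodule by (auto simp: submodule_def dest: subgroup.one_closed)
      then show "\<zero>\<^bsub>M\<^esub> \<in> ?N" using u by simp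
      show "\<ominus>\<^bsub>M\<^esub> a \<in> ?N" if "a \<in> ?N" for a using that u SE(3) by (simp add: ka.r_minus)
      show "a \<oplus>\<^bsub>M\<^esub> b \<in> ?N" if "a \<in> ?N" "b \<in> ?N" for a b using that u SE(5) by (simp add: ka.r_distr)
      show "a \<odot>\<^bsub>M\<^esub> b \<in> ?N" if "a \<in> carrier R" "b \<in> ?N" for a b
        using that u SE(4) by (simp add: ka.smult_mult_right)
    qed auto
    moreover have "Gen \<subseteq> ?N"
      using Gen_carrier Gen_mult(1)[OF _ u] ka.k_span_superset[of Gen] unfolding I_eq by blast
    ultimately have "\<II> \<subseteq> ?N" unfolding I_eq by (rule ka.k_span_least)
    then show ?thesis using x by blast
  qed
  have right: "x \<otimes>\<^bsub>M\<^esub> u \<in> \<II>" if u: "u \<in> carrier M" and x: "x \<in> \<II>" for u x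
  proof -
    let ?N = "{x \<in> carrier M. x \<otimes>\<^bsub>M\<^esub> u \<in> \<II>}"
    have "submodule ?N R M"
    proof (rule fr.fm.submoduleI)
      have "\<zero>\<^bsub>M\<^esub> \<in> \<II>" using I_submodule by (auto simp: submodule_def dest: subgroup.one_closed)
      then show "\<zero>\<^bsub>M\<^esub> \<in> ?N" using u by simp
      show "\<ominus>\<^bsub>M\<^esub> a \<in> ?N" if "a \<in> ?N" for a using that u SE(3) by (simp add: ka.l_minus)
      show "a \<oplus>\<^bsub>M\<^esub> b \<in> ?N" if "a \<in> ?N" "b \<in> ?N" for a b using that u SE(5) by (simp add: ka.l_distr)
      show "a \<odot>\<^bsub>M\<^esub> b \<in> ?N" if "a \<in> carrier R" "b \<in> ?N" for a b
        using that u SE(4) by (simp add: ka.smult_mult_left)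
    qed auto
    moreover have "Gen \<subseteq> ?N"
      using Gen_carrier Gen_mult(2)[OF _ u] ka.k_span_superset[of Gen] unfolding I_eq by blast
    ultimately have "\<II> \<subseteq> ?N" unfolding I_eq by (rule ka.k_span_least)
    then show ?thesis using x by blast
  qed
  show ?thesis
    by (rule idealI[OF ka.ring_axioms]) (use I_submodule left right in \<open>auto simp: submodule_def\<close>)
qed

text \<open>Restricting the middle group to the overlap of the two projections turns an arbitrary
  orbit of a product through a small group into a product with a single orbit.\<close>

lemma small_tcomp_in_I:
  fixes H :: "nat monoid"
  assumes H: "group H" "finite (carrier H)" "order H < order G"
    and S: "fib A G H S" and S': "fib A H G S'" and free: "afree A G G (tcomp A S S')"
  shows "single R (cl A G G (tcomp A S S')) \<in> \<II>"
proof -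
  interpret H: group H by (rule H(1))
  interpret T: tri_group A G H by (intro tri_group.intro GG.A.comm_group_axioms GG.G.group_axioms H(1))
  interpret T': tri_group A H G by (intro tri_group.intro GG.A.comm_group_axioms GG.G.group_axioms H(1))
  have sub: "subgroup S T.T" "subgroup S' T'.T" using S S' by (simp_all add: fib_def)
  define Q where "Q = {h. (\<exists>a g. (a, g, h) \<in> S) \<and> (\<exists>a g. (a, h, g) \<in> S')}"
  have c: "a \<in> carrier A \<and> g \<in> carrier G \<and> h \<in> carrier H" if "(a, g, h) \<in> S" for a g h
    using subgroup.subset[OF sub(1)] that by auto
  have c': "a \<in> carrier A \<and> g \<in> carrier G \<and> h \<in> carrier H" if "(a, h, g) \<in> S'" for a g h
    using subgroup.subset[OF sub(2)] that by auto
  have QH: "Q \<subseteq> carrier H" using c unfolding Q_def by blast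
  have Q: "subgroup Q H"
  proof (rule H.subgroupI[OF QH])
    show "Q \<noteq> {}" using subgroup.one_closed[OF sub(1)] subgroup.one_closed[OF sub(2)] unfolding Q_def by auto
    fix h assume "h \<in> Q"
    then obtain a g b k where h: "(a, g, h) \<in> S" "(b, h, k) \<in> S'" unfolding Q_def by blast
    have "(inv\<^bsub>A\<^esub> a, inv\<^bsub>G\<^esub> g, inv\<^bsub>H\<^esub> h) \<in> S" "(inv\<^bsub>A\<^esub> b, inv\<^bsub>H\<^esub> h, inv\<^bsub>G\<^esub> k) \<in> S'"
      using subgroup.m_inv_closed[OF sub(1) h(1)] subgroup.m_inv_closed[OF sub(2) h(2)] c[OF h(1)] c'[OF h(2)]
      by (simp_all add: T.inv_T T'.inv_T)
    then show "inv\<^bsub>H\<^esub> h \<in> Q" unfolding Q_def by blast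
    fix h' assume "h' \<in> Q"
    then obtain a' g' b' k' where h': "(a', g', h') \<in> S" "(b', h', k') \<in> S'" unfolding Q_def by blast
    have "(a \<otimes>\<^bsub>A\<^esub> a', g \<otimes>\<^bsub>G\<^esub> g', h \<otimes>\<^bsub>H\<^esub> h') \<in> S" "(b \<otimes>\<^bsub>A\<^esub> b', h \<otimes>\<^bsub>H\<^esub> h', k \<otimes>\<^bsub>G\<^esub> k') \<in> S'"
      using subgroup.m_closed[OF sub(1) h(1) h'(1)] subgroup.m_closed[OF sub(2) h(2) h'(2)] by simp_all
    then show "h \<otimes>\<^bsub>H\<^esub> h' \<in> Q" unfolding Q_def by blast
  qed
  let ?H = "H\<lparr>carrier := Q\<rparr>"
  let ?S = "{(a, g, h) \<in> S. h \<in> Q}" and ?S' = "{(a, h, g) \<in> S'. h \<in> Q}"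
  have HQ: "group ?H" "finite (carrier ?H)" "order ?H < order G"
  proof -
    show "group ?H" by (rule subgroup.subgroup_is_group[OF Q H(1)])
    show "finite (carrier ?H)" using QH H(2) by (simp add: finite_subset)
    have "order ?H \<le> order H" using QH H(2) by (simp add: order_def card_mono)
    then show "order ?H < order G" using H(3) by simp
  qed
  interpret c: compose_ctx R A G ?H G by (rule small_ctx[OF HQ(1,2)])
  have fS: "fib A G ?H ?S" by (rule fib_restrict_right[OF GG.A.comm_group_axioms GG.G.group_axioms H(1) S Q])
  have fS': "fib A ?H G ?S'" by (rule fib_restrict_left[OF GG.A.comm_group_axioms GG.G.group_axioms H(1) S' Q])
  have eq: "tcomp A ?S ?S' = tcomp A S S'" unfolding tcomp_def Q_def by blast
  have cover: "\<forall>h\<in>carrier ?H. \<exists>a g. (a, g, h) \<in> ?S" unfolding Q_def by auto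
  have prod: "c.cmp (single R (cl A G ?H ?S)) (single R (cl A ?H G ?S')) = single R (cl A G G (tcomp A S S'))"
    using c.cmp_single_cover(1)[OF fS fS' disjI1[OF cover]] free unfolding eq by simp
  have mem: "single R (cl A G ?H ?S) \<in> burnside R A G ?H" "single R (cl A ?H G ?S') \<in> burnside R A ?H G"
    using c.GH.cl_iso_classes[OF fS] c.HI.cl_iso_classes[OF fS'] single_fin_supp
    by (auto simp: c.GH.burnside_eq c.HI.burnside_eq)
  have "single R (cl A G G (tcomp A S S')) \<in> Gen"
    using GenI[OF HQ mem] unfolding prod .
  then show ?thesis unfolding I_eq using ka.k_span_superset by blast
qed

text \<open>By \<open>mm_support\<close> and \<open>small_tcomp_in_I\<close>, every class that
  occurs in a generator lies in the ideal on its own. Its coefficient in the generator never has to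
  be inverted, so the ideal is contained in the span of the basis vectors that it contains, over
  every ring \<open>R\<close>.\<close>

lemma I_basis:
  assumes v: "v \<in> \<II>" and b: "v b \<noteq> \<zero>"
  shows "single R b \<in> \<II>"
proof -
  let ?U = "{b \<in> B. single R b \<in> \<II>}"
  have "Gen \<subseteq> fin_supp R ?U"
  proof
    fix x assume "x \<in> Gen"
    then obtain H :: "nat monoid" and v w where H: "group H" "finite (carrier H)" "order H < order G"
      "v \<in> burnside R A G H" "w \<in> burnside R A H G" "x = compose_burnside R A G H G v w"
      unfolding Gen_def by blast
    interpret c: compose_ctx R A G H G by (rule small_ctx[OF H(1,2)])
    show "x \<in> fin_supp R ?U" unfolding H(6)
    proof (rule c.cmp_fin_supp)
      fix b1 c1 assume bc: "b1 \<in> iso_classes A G H" "c1 \<in> iso_classes A H G"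
      have "d \<in> ?U" if d: "c.mm b1 c1 d \<noteq> \<zero>" for d
      proof -
        obtain S S' where S: "fib A G H S" "fib A H G S'" "afree A G G (tcomp A S S')" "d = cl A G G (tcomp A S S')"
          using c.mm_support[OF bc d] by blast
        have "d \<in> B" using fin_suppD(3)[OF c.mm_closed[OF bc]] d by blast
        then show ?thesis using small_tcomp_in_I[OF H(1-3) S(1-3)] S(4) by simp
      qed
      then show "c.mm b1 c1 \<in> fin_supp R ?U"
        using c.mm_closed[OF bc] unfolding fin_supp_def by blast
    qed (use H in \<open>simp_all add: c.GH.burnside_eq c.HI.burnside_eq\<close>)
  qed
  moreover have "submodule (fin_supp R ?U) R M" by (rule fr.submodule_fin_supp) blast
  ultimately have "\<II> \<subseteq> fin_supp R ?U" unfolding I_eq by (intro ka.k_span_least)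
  then have "v \<in> fin_supp R ?U" using v by blast
  then show ?thesis using fin_suppD(3)[of v R ?U b] b by blast
qed

text \<open>Supplies the copy on natural numbers that the definition of the ideal demands of the
  intermediate group.\<close>

lemma proper_subgroup_nat:
  assumes P: "subgroup P G" "P \<noteq> carrier G"
  obtains H :: "nat monoid" and \<theta> where "group H" "finite (carrier H)" "order H < order G"
    "\<theta> \<in> iso (G\<lparr>carrier := P\<rparr>) H"
proof -
  have PG: "P \<subseteq> carrier G" by (rule subgroup.subset[OF P(1)])
  have fP: "finite P" using PG GG.finite_G finite_subset by blast
  interpret P: group "G\<lparr>carrier := P\<rparr>" by (rule subgroup.subgroup_is_group[OF P(1) GG.G.group_axioms])
  obtain \<theta> :: "'g \<Rightarrow> nat" where \<theta>: "inj_on \<theta> P" using finite_imp_inj_to_nat_seg[OF fP] by blast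
  let ?H = "image_group \<theta> (G\<lparr>carrier := P\<rparr>)"
  have iso: "\<theta> \<in> iso (G\<lparr>carrier := P\<rparr>) ?H" by (rule inj_imp_image_group_iso) (use \<theta> in simp)
  have carr: "carrier ?H = \<theta> ` P" by (simp add: image_group_carrier)
  have oneH: "\<one>\<^bsub>?H\<^esub> = \<theta> \<one>\<^bsub>G\<^esub>" by (simp add: image_group_one)
  have bij: "inv_into P \<theta> (\<theta> x) = x" if "x \<in> P" for x using \<theta> that by simp
  have multH: "\<theta> x \<otimes>\<^bsub>?H\<^esub> \<theta> y = \<theta> (x \<otimes>\<^bsub>G\<^esub> y)" if "x \<in> P" "y \<in> P" for x y
    using that bij by (simp add: image_group_def)
  have Pc: "x \<in> P \<Longrightarrow> x \<in> carrier G" for x using PG by blast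
  have grp: "group ?H"
  proof (rule groupI; unfold carr oneH)
    show "\<theta> \<one>\<^bsub>G\<^esub> \<in> \<theta> ` P" using subgroup.one_closed[OF P(1)] by blast
  next
    fix u v assume "u \<in> \<theta> ` P" "v \<in> \<theta> ` P"
    then show "u \<otimes>\<^bsub>?H\<^esub> v \<in> \<theta> ` P" using multH subgroup.m_closed[OF P(1)] by auto
  next
    fix u v w assume "u \<in> \<theta> ` P" "v \<in> \<theta> ` P" "w \<in> \<theta> ` P"
    then show "u \<otimes>\<^bsub>?H\<^esub> v \<otimes>\<^bsub>?H\<^esub> w = u \<otimes>\<^bsub>?H\<^esub> (v \<otimes>\<^bsub>?H\<^esub> w)"
      using multH subgroup.m_closed[OF P(1)] Pc by (auto simp: GG.G.m_assoc)
  next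
    fix u assume "u \<in> \<theta> ` P"
    then show "\<theta> \<one>\<^bsub>G\<^esub> \<otimes>\<^bsub>?H\<^esub> u = u" using multH subgroup.one_closed[OF P(1)] Pc by auto
  next
    fix u assume "u \<in> \<theta> ` P"
    then obtain x where x: "x \<in> P" "u = \<theta> x" by blast
    then have "\<theta> (inv\<^bsub>G\<^esub> x) \<otimes>\<^bsub>?H\<^esub> u = \<theta> \<one>\<^bsub>G\<^esub>"
      using multH[OF subgroup.m_inv_closed[OF P(1) x(1)] x(1)] Pc by simp
    then show "\<exists>y\<in>\<theta> ` P. y \<otimes>\<^bsub>?H\<^esub> u = \<theta> \<one>\<^bsub>G\<^esub>" using subgroup.m_inv_closed[OF P(1) x(1)] by blast
  qed
  show thesis
  proof (rule that[OF grp _ _ iso])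
    show "finite (carrier ?H)" using fP by (simp add: carr)
    have "card (\<theta> ` P) = card P" by (rule card_image[OF \<theta>])
    also have "\<dots> < card (carrier G)" using P(2) PG GG.finite_G by (simp add: psubset_card_mono psubset_eq)
    finally show "order ?H < order G" by (simp add: order_def carr)
  qed
qed

definition covers where "covers S \<longleftrightarrow> (\<forall>g\<in>carrier G. \<exists>a h. (a, g, h) \<in> S) \<and> (\<forall>h\<in>carrier G. \<exists>a g. (a, g, h) \<in> S)"

text \<open>With \<open>P\<close> the first projection of \<open>S\<close>, the factors are the
  graph of the inclusion of \<open>P\<close> into \<open>G\<close>, labelled trivially, and
  \<open>S\<close> regarded as a subgroup over \<open>P\<close>. Both are rewritten with a copy
  \<open>H\<close> of \<open>P\<close>. As \<open>P\<close> is proper, \<open>H\<close> has smaller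
  order than \<open>G\<close>.\<close>

lemma not_left_cover_in_I:
  assumes S: "fib A G G S" and g: "\<not> (\<forall>g\<in>carrier G. \<exists>a h. (a, g, h) \<in> S)"
  obtains H :: "nat monoid" and S1 S2 where "group H" "finite (carrier H)" "order H < order G"
    "fib A G H S1" "fib A H G S2" "tcomp A S1 S2 = S"
proof -
  define P where "P = {g. \<exists>a h. (a, g, h) \<in> S}"
  have PG: "P \<subseteq> carrier G" using fib_carrier[OF S] unfolding P_def by blast
  have P: "subgroup P G"
  proof (rule GG.G.subgroupI[OF PG])
    show "P \<noteq> {}" using fib_one[OF S] unfolding P_def by blast
    fix g assume "g \<in> P"
    then obtain a h where g: "(a, g, h) \<in> S" unfolding P_def by blast
    show "inv\<^bsub>G\<^esub> g \<in> P" using fib_inv[OF S g] unfolding P_def by blast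
    fix k assume "k \<in> P"
    then obtain b i where k: "(b, k, i) \<in> S" unfolding P_def by blast
    show "g \<otimes>\<^bsub>G\<^esub> k \<in> P" using fib_mult[OF S g k] unfolding P_def by blast
  qed
  have "P \<noteq> carrier G" using g unfolding P_def by blast
  then obtain H :: "nat monoid" and \<theta> where H: "group H" "finite (carrier H)" "order H < order G"
    "\<theta> \<in> iso (G\<lparr>carrier := P\<rparr>) H" by (rule proper_subgroup_nat[OF P])
  let ?S1 = "(\<lambda>g. (\<one>\<^bsub>A\<^esub>, g, \<theta> g)) ` P" and ?S2 = "(\<lambda>(a, g, l). (a, \<theta> g, l)) ` S"
  have inj: "inj_on \<theta> P" using H(4) by (auto simp: iso_def bij_betw_def)
  have 1: "fib A G H ?S1" by (rule fib_graph[OF GG.A.comm_group_axioms GG.G.group_axioms H(1) P H(4)])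
  have SP: "g \<in> P" if "(a, g, l) \<in> S" for a g l using that unfolding P_def by blast
  have 2: "fib A H G ?S2"
    by (rule fib_transport_left[OF GG.A.comm_group_axioms GG.G.group_axioms GG.G.group_axioms H(1) S P H(4)]) (rule SP)
  have "tcomp A ?S1 ?S2 = S"
  proof
    show "tcomp A ?S1 ?S2 \<subseteq> S"
    proof
      fix s assume "s \<in> tcomp A ?S1 ?S2"
      then obtain g a g' l where s: "s = (\<one>\<^bsub>A\<^esub> \<otimes>\<^bsub>A\<^esub> a, g, l)" "g \<in> P" "(a, g', l) \<in> S" "\<theta> g = \<theta> g'"
        unfolding tcomp_def by auto
      have "g = g'" using inj s(2,4) SP[OF s(3)] by (auto simp: inj_on_def)
      then show "s \<in> S" using s fib_carrier[OF S s(3)] by simp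
    qed
    show "S \<subseteq> tcomp A ?S1 ?S2"
    proof
      fix s assume s: "s \<in> S"
      obtain a g l where agl: "s = (a, g, l)" by (metis surj_pair)
      have m: "(\<one>\<^bsub>A\<^esub>, g, \<theta> g) \<in> ?S1" "(a, \<theta> g, l) \<in> ?S2" using s SP unfolding agl by force+
      show "s \<in> tcomp A ?S1 ?S2" using tcompI[OF m, of A] fib_carrier(1)[OF S] s agl by simp
    qed
  qed
  then show thesis using that[OF H(1-3) 1 2] by simp
qed

abbreviation swp where "swp \<equiv> (\<lambda>(a, g, h). (inv\<^bsub>A\<^esub> a, h, g))"

lemma swap_tcomp:
  assumes "S1 \<subseteq> carrier A \<times> UNIV" "S2 \<subseteq> carrier A \<times> UNIV"
  shows "swp ` tcomp A S1 S2 = tcomp A (swp ` S2) (swp ` S1)"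
proof -
  have *: "inv\<^bsub>A\<^esub> (c \<otimes>\<^bsub>A\<^esub> d) = inv\<^bsub>A\<^esub> d \<otimes>\<^bsub>A\<^esub> inv\<^bsub>A\<^esub> c" if "(c, u) \<in> S1" "(d, v) \<in> S2" for c d u v
    using that assms by (intro GG.A.inv_mult_group) auto
  show ?thesis
  proof
    show "swp ` tcomp A S1 S2 \<subseteq> tcomp A (swp ` S2) (swp ` S1)"
    proof
      fix s assume "s \<in> swp ` tcomp A S1 S2"
      then obtain c d g h i where s: "s = (inv\<^bsub>A\<^esub> (c \<otimes>\<^bsub>A\<^esub> d), i, g)" "(c, g, h) \<in> S1" "(d, h, i) \<in> S2"
        unfolding tcomp_def by auto
      have "(inv\<^bsub>A\<^esub> d, i, h) \<in> swp ` S2" "(inv\<^bsub>A\<^esub> c, h, g) \<in> swp ` S1" using s by force+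
      then show "s \<in> tcomp A (swp ` S2) (swp ` S1)" unfolding s(1) *[OF s(2,3)] tcomp_def by blast
    qed
    show "tcomp A (swp ` S2) (swp ` S1) \<subseteq> swp ` tcomp A S1 S2"
    proof
      fix s assume "s \<in> tcomp A (swp ` S2) (swp ` S1)"
      then obtain c d g h i where s: "s = (inv\<^bsub>A\<^esub> d \<otimes>\<^bsub>A\<^esub> inv\<^bsub>A\<^esub> c, i, g)" "(c, g, h) \<in> S1" "(d, h, i) \<in> S2"
        unfolding tcomp_def by auto
      have "(c \<otimes>\<^bsub>A\<^esub> d, g, i) \<in> tcomp A S1 S2" using s unfolding tcomp_def by blast
      then show "s \<in> swp ` tcomp A S1 S2" unfolding s(1) *[OF s(2,3), symmetric] by force
    qed
  qed
qed

text \<open>If the second projection is the proper one, the reversed subgroup is factored and the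
  factors are reversed again, in the opposite order.\<close>

lemma I_not_cover:
  assumes S: "fib A G G S" and nc: "\<not> covers S"
  shows "single R (cl A G G S) \<in> \<II>"
proof (cases "\<forall>g\<in>carrier G. \<exists>a h. (a, g, h) \<in> S")
  case False
  obtain H :: "nat monoid" and S1 S2 where H: "group H" "finite (carrier H)" "order H < order G"
    "fib A G H S1" "fib A H G S2" "tcomp A S1 S2 = S" by (rule not_left_cover_in_I[OF S False])
  then show ?thesis using small_tcomp_in_I[OF H(1-5)] S by (simp add: fib_alt)
next
  case True
  then have F: "\<not> (\<forall>h\<in>carrier G. \<exists>a g. (a, g, h) \<in> S)" using nc by (simp add: covers_def)
  have S': "fib A G G (swp ` S)" by (rule fib_swap[OF GG.A.comm_group_axioms GG.G.group_axioms GG.G.group_axioms S])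
  obtain k where k: "k \<in> carrier G" "\<And>a g. (a, g, k) \<notin> S" using F by blast
  then have "(a, k, h) \<notin> swp ` S" for a h by auto
  then have F': "\<not> (\<forall>g\<in>carrier G. \<exists>a h. (a, g, h) \<in> swp ` S)" using k(1) by blast
  obtain H :: "nat monoid" and S1 S2 where H: "group H" "finite (carrier H)" "order H < order G"
    "fib A G H S1" "fib A H G S2" "tcomp A S1 S2 = swp ` S" by (rule not_left_cover_in_I[OF S' F'])
  have f: "fib A G H (swp ` S2)" "fib A H G (swp ` S1)"
    by (rule fib_swap[OF GG.A.comm_group_axioms H(1) GG.G.group_axioms H(5)],
        rule fib_swap[OF GG.A.comm_group_axioms GG.G.group_axioms H(1) H(4)])
  have sub: "S1 \<subseteq> carrier A \<times> UNIV" "S2 \<subseteq> carrier A \<times> UNIV"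
    using H(4,5) by (auto simp: fib_def dest!: subgroup.subset)
  have "swp (swp s) = s" if s: "s \<in> S" for s
  proof -
    obtain a g h where "s = (a, g, h)" by (metis surj_pair)
    then show ?thesis using fib_carrier(1)[OF S] s by simp
  qed
  then have "swp ` (swp ` S) = S" unfolding image_image by (simp cong: image_cong)
  then have eq: "tcomp A (swp ` S2) (swp ` S1) = S" using swap_tcomp[OF sub] H(6) by simp
  then show ?thesis using small_tcomp_in_I[OF H(1-3) f] S by (simp add: fib_alt)
qed

end

section \<open>Classes with surjective projections\<close>

context endo_ctx
begin

text \<open>For \<open>S\<close> the graph of \<open>(U, \<phi>)\<close>, this is the graph of \<open>(k\<^sub>1(U), \<phi>\<^sub>1)\<close>, and swapping the factors of \<open>S\<close>
  gives that of \<open>(k\<^sub>2(U), \<phi>\<^sub>2)\<close>.\<close>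

definition lS where "lS S = {(a, g). (a, g, \<one>\<^bsub>G\<^esub>) \<in> S}"

lemma fib_swp: "fib A G G S \<Longrightarrow> fib A G G (swp ` S)"
  by (rule fib_swap[OF GG.A.comm_group_axioms GG.G.group_axioms GG.G.group_axioms])

lemma mem_swp:
  assumes "fib A G G S"
  shows "(a, g, h) \<in> swp ` S \<longleftrightarrow> a \<in> carrier A \<and> (inv\<^bsub>A\<^esub> a, h, g) \<in> S"
proof
  assume "(a, g, h) \<in> swp ` S"
  then obtain b where "a = inv\<^bsub>A\<^esub> b" "(b, h, g) \<in> S" by auto
  then show "a \<in> carrier A \<and> (inv\<^bsub>A\<^esub> a, h, g) \<in> S" using fib_carrier[OF assms] by simp
next
  assume a: "a \<in> carrier A \<and> (inv\<^bsub>A\<^esub> a, h, g) \<in> S"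
  have "swp (inv\<^bsub>A\<^esub> a, h, g) = (a, g, h)" using conjunct1[OF a] by simp
  then show "(a, g, h) \<in> swp ` S" using imageI[OF conjunct2[OF a], of swp] by (simp only:)
qed

lemma swp_swp_image:
  assumes "S \<subseteq> carrier A \<times> UNIV" shows "swp ` (swp ` S) = S"
proof -
  have "swp (swp s) = s" if "s \<in> S" for s using assms that by (cases s) auto
  then show ?thesis unfolding image_image by simp
qed

lemma fib_sub: "fib A G G S \<Longrightarrow> S \<subseteq> carrier A \<times> UNIV"
  using fib_carrier(1) by auto

lemma swp_swp: "fib A G G S \<Longrightarrow> swp ` (swp ` S) = S"
  by (rule swp_swp_image[OF fib_sub])

lemma covers_swp: "fib A G G S \<Longrightarrow> covers S \<Longrightarrow> covers (swp ` S)"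
  unfolding covers_def by (force)

lemma swp_tcomp:
  assumes "fib A G G S" "fib A G G S'"
  shows "swp ` tcomp A S S' = tcomp A (swp ` S') (swp ` S)"
  by (rule swap_tcomp[OF fib_sub[OF assms(1)] fib_sub[OF assms(2)]])

text \<open>For \<open>g\<close> in \<open>G\<close>, surjectivity of the first projection gives an
  element of \<open>S\<close> with \<open>g\<close> in the first coordinate. Conjugation by it
  conjugates the first coordinate by \<open>g\<close>, keeps the second one trivial, and leaves the
  fibre entry alone because \<open>A\<close> is commutative.\<close>

lemma lS_stable:
  assumes S: "fib A G G S" and cov: "covers S"
  shows "graph_sub A G (lS S)" "PG.conj_stable (lS S)"
proof -
  have "subgroup (lS S) (A \<times>\<times> G)"
  proof (rule group.subgroupI[OF PG.AK_group])
    show "lS S \<subseteq> carrier (A \<times>\<times> G)" using fib_carrier[OF S] by (auto simp: lS_def)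
    show "lS S \<noteq> {}" using fib_one[OF S] by (auto simp: lS_def)
    fix s assume "s \<in> lS S"
    then obtain a g where s: "s = (a, g)" "(a, g, \<one>\<^bsub>G\<^esub>) \<in> S" by (auto simp: lS_def)
    show "inv\<^bsub>A \<times>\<times> G\<^esub> s \<in> lS S"
      using fib_inv[OF S s(2)] fib_carrier[OF S s(2)] s(1) PG.inv_AK by (simp add: lS_def)
    fix t assume "t \<in> lS S"
    then obtain b h where t: "t = (b, h)" "(b, h, \<one>\<^bsub>G\<^esub>) \<in> S" by (auto simp: lS_def)
    show "s \<otimes>\<^bsub>A \<times>\<times> G\<^esub> t \<in> lS S" using fib_mult[OF S s(2) t(2)] s(1) t(1) by (simp add: lS_def)
  qed
  moreover have "a = \<one>\<^bsub>A\<^esub>" if "(a, \<one>\<^bsub>G\<^esub>) \<in> lS S" for a using that S unfolding lS_def fib_def by blast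
  ultimately show "graph_sub A G (lS S)" unfolding graph_sub_def by blast
  show "PG.conj_stable (lS S)"
    unfolding PG.conj_stable_def
  proof (intro allI impI ballI)
    fix a n g assume an: "(a, n) \<in> lS S" and g: "g \<in> carrier G"
    then have s: "(a, n, \<one>\<^bsub>G\<^esub>) \<in> S" by (simp add: lS_def)
    obtain b h where b: "(b, g, h) \<in> S" using cov g unfolding covers_def by blast
    note cb = fib_carrier[OF S b] and cs = fib_carrier[OF S s]
    have "(b \<otimes>\<^bsub>A\<^esub> a \<otimes>\<^bsub>A\<^esub> inv\<^bsub>A\<^esub> b, g \<otimes>\<^bsub>G\<^esub> n \<otimes>\<^bsub>G\<^esub> inv\<^bsub>G\<^esub> g, h \<otimes>\<^bsub>G\<^esub> \<one>\<^bsub>G\<^esub> \<otimes>\<^bsub>G\<^esub> inv\<^bsub>G\<^esub> h) \<in> S"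
      by (rule fib_mult[OF S fib_mult[OF S b s] fib_inv[OF S b]])
    moreover have "b \<otimes>\<^bsub>A\<^esub> a \<otimes>\<^bsub>A\<^esub> inv\<^bsub>A\<^esub> b = a" using cb(1) cs(1) by (simp add: GG.A.m_ac)
    ultimately show "(a, g \<otimes>\<^bsub>G\<^esub> n \<otimes>\<^bsub>G\<^esub> inv\<^bsub>G\<^esub> g) \<in> lS S" using cb(3) by (simp add: lS_def)
  qed
qed

text \<open>Conjugation acts on \<open>lS S\<close> through conjugation in \<open>G\<close> only,
  and under this \<open>lS S\<close> is stable. So the left pair depends on the class alone and not
  on the stabilizer chosen for it.\<close>

lemma lS_conj_subset:
  assumes S: "fib A G G S" and cov: "covers S" and t: "t \<in> carrier GG.T"
  shows "lS {t \<otimes>\<^bsub>GG.T\<^esub> s \<otimes>\<^bsub>GG.T\<^esub> inv\<^bsub>GG.T\<^esub> t | s. s \<in> S} = lS S" (is "lS ?S' = _")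
proof
  obtain x k m where t': "t = (x, k, m)" "x \<in> carrier A" "k \<in> carrier G" "m \<in> carrier G" using t by auto
  have conj: "t \<otimes>\<^bsub>GG.T\<^esub> (a, g, h) \<otimes>\<^bsub>GG.T\<^esub> inv\<^bsub>GG.T\<^esub> t = (a, k \<otimes>\<^bsub>G\<^esub> g \<otimes>\<^bsub>G\<^esub> inv\<^bsub>G\<^esub> k, m \<otimes>\<^bsub>G\<^esub> h \<otimes>\<^bsub>G\<^esub> inv\<^bsub>G\<^esub> m)"
    if "a \<in> carrier A" for a g h
    using t' that by (simp add: GG.inv_T GG.A.m_ac)
  show "lS ?S' \<subseteq> lS S"
  proof
    fix p assume "p \<in> lS ?S'"
    then obtain b n s where p: "p = (b, n)" "s \<in> S" "(b, n, \<one>\<^bsub>G\<^esub>) = t \<otimes>\<^bsub>GG.T\<^esub> s \<otimes>\<^bsub>GG.T\<^esub> inv\<^bsub>GG.T\<^esub> t"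
      unfolding lS_def by blast
    obtain a g h where s: "s = (a, g, h)" by (metis surj_pair)
    note c = fib_carrier[OF S p(2)[unfolded s]]
    have e: "b = a" "n = k \<otimes>\<^bsub>G\<^esub> g \<otimes>\<^bsub>G\<^esub> inv\<^bsub>G\<^esub> k" "\<one>\<^bsub>G\<^esub> = m \<otimes>\<^bsub>G\<^esub> h \<otimes>\<^bsub>G\<^esub> inv\<^bsub>G\<^esub> m"
      using p(3) conj[OF c(1), of g h] unfolding s by simp_all
    have "m \<otimes>\<^bsub>G\<^esub> h = m" using e(3) c(3) t'(4) by (metis GG.G.inv_equality GG.G.inv_inv GG.G.m_closed GG.G.inv_closed)
    then have "h = \<one>\<^bsub>G\<^esub>" using c(3) t'(4) by (simp add: GG.G.r_cancel_one)
    then have "(a, g) \<in> lS S" using p(2) s by (simp add: lS_def)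
    then show "p \<in> lS S" using lS_stable(2)[OF S cov] t'(3) unfolding PG.conj_stable_def p(1) e(1,2) by blast
  qed
  show "lS S \<subseteq> lS ?S'"
  proof
    fix p assume p: "p \<in> lS S"
    obtain a n where an: "p = (a, n)" by fastforce
    have s: "(a, n, \<one>\<^bsub>G\<^esub>) \<in> S" using p an by (simp add: lS_def)
    note c = fib_carrier[OF S s]
    let ?n = "inv\<^bsub>G\<^esub> k \<otimes>\<^bsub>G\<^esub> n \<otimes>\<^bsub>G\<^esub> inv\<^bsub>G\<^esub> (inv\<^bsub>G\<^esub> k)"
    have "(a, ?n) \<in> lS S"
      using lS_stable(2)[OF S cov] p t'(3) unfolding PG.conj_stable_def an by blast
    then have m1: "(a, ?n, \<one>\<^bsub>G\<^esub>) \<in> S" by (simp add: lS_def)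
    have "k \<otimes>\<^bsub>G\<^esub> ?n \<otimes>\<^bsub>G\<^esub> inv\<^bsub>G\<^esub> k = n"
    proof -
      have "k \<otimes>\<^bsub>G\<^esub> ?n \<otimes>\<^bsub>G\<^esub> inv\<^bsub>G\<^esub> k = (k \<otimes>\<^bsub>G\<^esub> inv\<^bsub>G\<^esub> k) \<otimes>\<^bsub>G\<^esub> n \<otimes>\<^bsub>G\<^esub> (k \<otimes>\<^bsub>G\<^esub> inv\<^bsub>G\<^esub> k)"
        using t'(3) c(2) by (simp only: GG.G.m_assoc GG.G.inv_closed GG.G.m_closed GG.G.inv_inv)
      then show ?thesis using t'(3) c(2) by simp
    qed
    then have "(a, n, \<one>\<^bsub>G\<^esub>) = t \<otimes>\<^bsub>GG.T\<^esub> (a, ?n, \<one>\<^bsub>G\<^esub>) \<otimes>\<^bsub>GG.T\<^esub> inv\<^bsub>GG.T\<^esub> t"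
      using conj[OF c(1), of ?n "\<one>\<^bsub>G\<^esub>"] t'(4) by simp
    then show "p \<in> lS ?S'" unfolding lS_def an using m1 by blast
  qed
qed

lemma swp_conj:
  assumes S: "fib A G G S" and t: "(x, k, m) \<in> carrier GG.T"
  shows "swp ` {(x, k, m) \<otimes>\<^bsub>GG.T\<^esub> s \<otimes>\<^bsub>GG.T\<^esub> inv\<^bsub>GG.T\<^esub> (x, k, m) | s. s \<in> S} =
    {(x, m, k) \<otimes>\<^bsub>GG.T\<^esub> s \<otimes>\<^bsub>GG.T\<^esub> inv\<^bsub>GG.T\<^esub> (x, m, k) | s. s \<in> swp ` S}"
proof -
  have *: "swp ((x, k, m) \<otimes>\<^bsub>GG.T\<^esub> s \<otimes>\<^bsub>GG.T\<^esub> inv\<^bsub>GG.T\<^esub> (x, k, m)) =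
    (x, m, k) \<otimes>\<^bsub>GG.T\<^esub> swp s \<otimes>\<^bsub>GG.T\<^esub> inv\<^bsub>GG.T\<^esub> (x, m, k)" if s: "s \<in> S" for s
  proof -
    obtain a g h where agh: "s = (a, g, h)" by (metis surj_pair)
    note c = fib_carrier[OF S s[unfolded agh]]
    \<comment> \<open>The fibre part of the conjugating element cancels. Hence reversal may keep
      \<open>x\<close> as it is instead of inverting it.\<close>
    have "x \<otimes>\<^bsub>A\<^esub> y \<otimes>\<^bsub>A\<^esub> inv\<^bsub>A\<^esub> x = y" if "y \<in> carrier A" for y
      using t that by (simp add: GG.A.m_comm[of x y] GG.A.m_assoc)
    then show ?thesis unfolding agh using t c by (simp add: GG.inv_T)
  qed
  have "swp ` {(x, k, m) \<otimes>\<^bsub>GG.T\<^esub> s \<otimes>\<^bsub>GG.T\<^esub> inv\<^bsub>GG.T\<^esub> (x, k, m) | s. s \<in> S} =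
    (\<lambda>s. swp ((x, k, m) \<otimes>\<^bsub>GG.T\<^esub> s \<otimes>\<^bsub>GG.T\<^esub> inv\<^bsub>GG.T\<^esub> (x, k, m))) ` S"
    unfolding Setcompr_eq_image image_image ..
  also have "\<dots> = (\<lambda>s. (x, m, k) \<otimes>\<^bsub>GG.T\<^esub> swp s \<otimes>\<^bsub>GG.T\<^esub> inv\<^bsub>GG.T\<^esub> (x, m, k)) ` S"
    using * by (rule image_cong[OF refl])
  finally show ?thesis unfolding Setcompr_eq_image image_image .
qed

lemma cl_lS:
  assumes S: "fib A G G S" "covers S" and eq: "cl A G G S = cl A G G S'"
  shows "lS S' = lS S" "lS (swp ` S') = lS (swp ` S)"
proof -
  obtain t where t: "t \<in> carrier GG.T" "S' = {t \<otimes>\<^bsub>GG.T\<^esub> s \<otimes>\<^bsub>GG.T\<^esub> inv\<^bsub>GG.T\<^esub> t | s. s \<in> S}"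
    by (rule GG.cl_eqD[OF eq S(1)])
  show "lS S' = lS S" unfolding t(2) by (rule lS_conj_subset[OF S t(1)])
  obtain x k m where t': "t = (x, k, m)" by (metis surj_pair)
  have "(x, m, k) \<in> carrier GG.T" using t(1) t' by simp
  then show "lS (swp ` S') = lS (swp ` S)"
    unfolding t(2) t' swp_conj[OF S(1) t(1)[unfolded t']]
    by (rule lS_conj_subset[OF fib_swp[OF S(1)] covers_swp[OF S]])
qed

section \<open>The left and the right pair of a class\<close>

definition Cv where "Cv = {cl A G G S | S. fib A G G S \<and> covers S}"

text \<open>A class only fixes its stabilizers up to conjugation; by \<open>lt_cl\<close> the choice
  does not affect the pairs read off from it.\<close>

definition rep_S where "rep_S b = (SOME S. fib A G G S \<and> covers S \<and> b = cl A G G S)"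

definition lt where "lt b = pr A (lS (rep_S b))"

definition rt where "rt b = pr A (lS (swp ` rep_S b))"

definition ep where "ep p = cl A G G (Dm A G (gr A p))"

lemma lt_cl:
  assumes "fib A G G S" "covers S"
  shows "lt (cl A G G S) = pr A (lS S)" "rt (cl A G G S) = pr A (lS (swp ` S))"
proof -
  have r: "fib A G G (rep_S (cl A G G S)) \<and> covers (rep_S (cl A G G S)) \<and> cl A G G S = cl A G G (rep_S (cl A G G S))"
    unfolding rep_S_def by (rule someI[of _ S]) (use assms in simp)
  show "lt (cl A G G S) = pr A (lS S)" "rt (cl A G G S) = pr A (lS (swp ` S))"
    unfolding lt_def rt_def using cl_lS[OF assms, of "rep_S (cl A G G S)"] r by simp_all
qed

lemma pr_lS_stable:
  assumes "fib A G G S" "covers S"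
  shows "pr A (lS S) \<in> stable_pairs A G" "gr A (pr A (lS S)) = lS S"
  unfolding PG.stable_pairs_iff
  using PG.gr_pr[OF lS_stable(1)[OF assms]] PG.pr_pairs[OF lS_stable(1)[OF assms]] lS_stable(2)[OF assms] by simp_all

lemma stable_pairs_pairs: "p \<in> stable_pairs A G \<Longrightarrow> p \<in> pairs A G"
  by (simp add: PG.stable_pairs_iff)

lemma pr_gr: "p \<in> stable_pairs A G \<Longrightarrow> pr A (gr A p) = p"
proof -
  assume p: "p \<in> stable_pairs A G"
  have g: "graph_sub A G (gr A p)" by (rule PG.gr_graph_conj(1)[OF p])
  show "pr A (gr A p) = p"
    by (rule PG.gr_inj[OF PG.pr_pairs[OF g] stable_pairs_pairs[OF p] PG.gr_pr[OF g]])
qed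

lemma le_gr: "p \<in> stable_pairs A G \<Longrightarrow> q \<in> stable_pairs A G \<Longrightarrow> pair_le p q \<longleftrightarrow> gr A p \<subseteq> gr A q"
  by (rule PG.gr_le_iff) (simp_all add: stable_pairs_pairs)

lemma Dm_props:
  assumes p: "p \<in> stable_pairs A G"
  shows "fib A G G (Dm A G (gr A p))" "covers (Dm A G (gr A p))" "lS (Dm A G (gr A p)) = gr A p"
    "swp ` Dm A G (gr A p) = Dm A G (gr A p)"
proof -
  note g = PG.gr_graph_conj[OF p]
  show D: "fib A G G (Dm A G (gr A p))" by (rule PG.fib_Dm[OF g])
  show "covers (Dm A G (gr A p))" unfolding covers_def using Dm_cover g(1) by blast
  have sub: "subgroup (gr A p) (A \<times>\<times> G)" using g(1) by (simp add: graph_sub_def)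
  have c: "a \<in> carrier A \<and> n \<in> carrier G" if "(a, n) \<in> gr A p" for a n using subgroup.subset[OF sub] that by auto
  show "lS (Dm A G (gr A p)) = gr A p"
  proof -
    have "(a, n) \<in> lS (Dm A G (gr A p)) \<longleftrightarrow> (a, n) \<in> gr A p" for a n
    proof
      assume "(a, n) \<in> lS (Dm A G (gr A p))"
      then obtain m where "(a, m) \<in> gr A p" "n = m \<otimes>\<^bsub>G\<^esub> \<one>\<^bsub>G\<^esub>" unfolding lS_def Dm_def by blast
      then show "(a, n) \<in> gr A p" using c by simp
    next
      assume an: "(a, n) \<in> gr A p"
      then have "(a, n \<otimes>\<^bsub>G\<^esub> \<one>\<^bsub>G\<^esub>, \<one>\<^bsub>G\<^esub>) \<in> Dm A G (gr A p)" unfolding Dm_def by blast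
      then show "(a, n) \<in> lS (Dm A G (gr A p))" using c[OF an] by (simp add: lS_def)
    qed
    then show ?thesis by auto
  qed
  have half: "swp ` Dm A G (gr A p) \<subseteq> Dm A G (gr A p)"
  proof
    fix s assume "s \<in> swp ` Dm A G (gr A p)"
    then obtain a n g where s: "s = (inv\<^bsub>A\<^esub> a, g, n \<otimes>\<^bsub>G\<^esub> g)" "(a, n) \<in> gr A p" "g \<in> carrier G" unfolding Dm_def by auto
    have "(inv\<^bsub>A\<^esub> a, inv\<^bsub>G\<^esub> n) \<in> gr A p" using subgroup.m_inv_closed[OF sub s(2)] PG.inv_AK c[OF s(2)] by simp
    moreover have "g = inv\<^bsub>G\<^esub> n \<otimes>\<^bsub>G\<^esub> (n \<otimes>\<^bsub>G\<^esub> g)" using c[OF s(2)] s(3) by (simp flip: GG.G.m_assoc)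
    moreover have "n \<otimes>\<^bsub>G\<^esub> g \<in> carrier G" using c[OF s(2)] s(3) by simp
    ultimately show "s \<in> Dm A G (gr A p)" unfolding s(1) Dm_def by blast
  qed
  show "swp ` Dm A G (gr A p) = Dm A G (gr A p)"
  proof
    show "Dm A G (gr A p) \<subseteq> swp ` Dm A G (gr A p)"
      using image_mono[OF half, of swp] swp_swp[OF D] by simp
  qed (rule half)
qed

lemma tcomp_covers:
  assumes S: "fib A G G S" "covers S" and S': "fib A G G S'" "covers S'"
  shows "covers (tcomp A S S')"
  unfolding covers_def
proof (intro conjI ballI)
  fix g assume g: "g \<in> carrier G"
  obtain a h where a: "(a, g, h) \<in> S" using S(2) g unfolding covers_def by blast
  obtain b i where b: "(b, h, i) \<in> S'" using S'(2) fib_carrier(3)[OF S(1) a] unfolding covers_def by blast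
  show "\<exists>a h. (a, g, h) \<in> tcomp A S S'" using tcompI[OF a b, of A] by blast
  obtain c k where c: "(c, k, g) \<in> S'" using S'(2) g unfolding covers_def by blast
  obtain d j where d: "(d, j, k) \<in> S" using S(2) fib_carrier(2)[OF S'(1) c] unfolding covers_def by blast
  show "\<exists>a h. (a, h, g) \<in> tcomp A S S'" using tcompI[OF d c, of A] by blast
qed

lemma lS_tcomp_mono:
  assumes "fib A G G S" "fib A G G S'"
  shows "lS S \<subseteq> lS (tcomp A S S')"
proof
  fix p assume p: "p \<in> lS S"
  obtain a g where ag: "p = (a, g)" by fastforce
  have s: "(a, g, \<one>\<^bsub>G\<^esub>) \<in> S" using p ag by (simp add: lS_def)
  show "p \<in> lS (tcomp A S S')" using tcompI[OF s fib_one[OF assms(2)], of A] fib_carrier(1)[OF assms(1) s]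
    unfolding lS_def ag by simp
qed

lemma mult_single_covering:
  assumes S: "fib A G G S" "covers S" and S': "fib A G G S'" "covers S'" and free: "afree A G G (tcomp A S S')"
  shows "single R (cl A G G S) \<otimes>\<^bsub>M\<^esub> single R (cl A G G S') = single R (cl A G G (tcomp A S S'))"
    "fib A G G (tcomp A S S')" "covers (tcomp A S S')"
    "lS S \<subseteq> lS (tcomp A S S')" "lS (swp ` S') \<subseteq> lS (swp ` tcomp A S S')"
proof -
  have cover: "(\<forall>h\<in>carrier G. \<exists>a g. (a, g, h) \<in> S) \<or> (\<forall>h\<in>carrier G. \<exists>a i. (a, h, i) \<in> S')"
    using S(2) unfolding covers_def by blast
  show "single R (cl A G G S) \<otimes>\<^bsub>M\<^esub> single R (cl A G G S') = single R (cl A G G (tcomp A S S'))"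
    "fib A G G (tcomp A S S')"
    using mult_single[OF S(1) S'(1) cover] free by auto
  show "covers (tcomp A S S')" by (rule tcomp_covers[OF S S'])
  show "lS S \<subseteq> lS (tcomp A S S')" by (rule lS_tcomp_mono[OF S(1) S'(1)])
  show "lS (swp ` S') \<subseteq> lS (swp ` tcomp A S S')"
    unfolding swp_tcomp[OF S(1) S'(1)] by (rule lS_tcomp_mono[OF fib_swp[OF S'(1)] fib_swp[OF S(1)]])
qed

lemma mult_not_free:
  assumes "fib A G G S" "covers S" "fib A G G S'" "\<not> afree A G G (tcomp A S S')"
  shows "single R (cl A G G S) \<otimes>\<^bsub>M\<^esub> single R (cl A G G S') = \<zero>\<^bsub>M\<^esub>"
  using mult_single(1)[OF assms(1,3)] assms(2,4) unfolding covers_def by simp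

text \<open>If \<open>(d, h, 1)\<close> lies in \<open>S'\<close>, the hypothesis on the middle
  pairs puts \<open>(inv d, 1, h)\<close> into \<open>S\<close>. Dividing an element
  \<open>(c, g, h)\<close> of \<open>S\<close> by it gives \<open>(c \<otimes> d, g, 1)\<close> in
  \<open>S\<close>. So the composite has no more elements with trivial right coordinate than
  \<open>S\<close>, which yields freeness and the left pair at once.\<close>

lemma linked_tcomp:
  assumes S: "fib A G G S" "covers S" and S': "fib A G G S'" "covers S'" and l: "lS (swp ` S) = lS S'"
  shows "afree A G G (tcomp A S S')" "lS (tcomp A S S') = lS S"
proof -
  have key: "(c \<otimes>\<^bsub>A\<^esub> d, g, \<one>\<^bsub>G\<^esub>) \<in> S" if "(c, g, h) \<in> S" "(d, h, \<one>\<^bsub>G\<^esub>) \<in> S'" for c d g h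
  proof -
    have "(d, h) \<in> lS (swp ` S)" unfolding l using that(2) by (simp add: lS_def)
    then have "(d, h, \<one>\<^bsub>G\<^esub>) \<in> swp ` S" by (simp add: lS_def)
    then have d: "d \<in> carrier A" "(inv\<^bsub>A\<^esub> d, \<one>\<^bsub>G\<^esub>, h) \<in> S" using mem_swp[OF S(1)] by simp_all
    note c = fib_carrier[OF S(1) that(1)]
    have "(c \<otimes>\<^bsub>A\<^esub> inv\<^bsub>A\<^esub> (inv\<^bsub>A\<^esub> d), g \<otimes>\<^bsub>G\<^esub> inv\<^bsub>G\<^esub> \<one>\<^bsub>G\<^esub>, h \<otimes>\<^bsub>G\<^esub> inv\<^bsub>G\<^esub> h) \<in> S"
      by (rule fib_mult[OF S(1) that(1) fib_inv[OF S(1) d(2)]])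
    then show ?thesis using c d(1) by simp
  qed
  show "afree A G G (tcomp A S S')"
    unfolding afree_def
  proof (intro allI impI)
    fix a assume "(a, \<one>\<^bsub>G\<^esub>, \<one>\<^bsub>G\<^esub>) \<in> tcomp A S S'"
    then obtain c d h where "a = c \<otimes>\<^bsub>A\<^esub> d" "(c, \<one>\<^bsub>G\<^esub>, h) \<in> S" "(d, h, \<one>\<^bsub>G\<^esub>) \<in> S'" unfolding tcomp_def by blast
    then show "a = \<one>\<^bsub>A\<^esub>" using key S(1) unfolding fib_def by blast
  qed
  show "lS (tcomp A S S') = lS S"
  proof
    show "lS (tcomp A S S') \<subseteq> lS S" unfolding lS_def tcomp_def using key by blast
  qed (rule lS_tcomp_mono[OF S(1) S'(1)])
qed

text \<open>Composing with \<open>Dm A G N\<close> multiplies the elements of \<open>S\<close> by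
  elements \<open>(a, n, 1)\<close> with \<open>(a, n)\<close> in \<open>N\<close>, and these
  already belong to \<open>S\<close>.\<close>

lemma Dm_absorb:
  assumes N: "graph_sub A G N" and S: "fib A G G S" and sub: "N \<subseteq> lS S"
  shows "tcomp A (Dm A G N) S = S"
proof
  show "tcomp A (Dm A G N) S \<subseteq> S"
  proof
    fix s assume "s \<in> tcomp A (Dm A G N) S"
    then obtain a b n g h where s: "s = (a \<otimes>\<^bsub>A\<^esub> b, n \<otimes>\<^bsub>G\<^esub> g, h)" "(a, n) \<in> N" "(b, g, h) \<in> S"
      unfolding tcomp_Dm_left[OF S] by blast
    have "(a, n, \<one>\<^bsub>G\<^esub>) \<in> S" using s(2) sub by (auto simp: lS_def)
    from fib_mult[OF S this s(3)] show "s \<in> S" using s(1) fib_carrier[OF S s(3)] by simp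
  qed
  show "S \<subseteq> tcomp A (Dm A G N) S"
  proof
    fix s assume s: "s \<in> S"
    obtain a g h where agh: "s = (a, g, h)" by (metis surj_pair)
    note c = fib_carrier[OF S s[unfolded agh]]
    have "subgroup N (A \<times>\<times> G)" using N by (simp add: graph_sub_def)
    from subgroup.one_closed[OF this] have "(\<one>\<^bsub>A\<^esub>, \<one>\<^bsub>G\<^esub>) \<in> N" by simp
    then have "(\<one>\<^bsub>A\<^esub> \<otimes>\<^bsub>A\<^esub> a, \<one>\<^bsub>G\<^esub> \<otimes>\<^bsub>G\<^esub> g, h) \<in> tcomp A (Dm A G N) S"
      unfolding tcomp_Dm_left[OF S] using s agh by blast
    then show "s \<in> tcomp A (Dm A G N) S" using c agh by simp
  qed
qed

text \<open>The inverse semigroup law in terms of stabilizers: two elements of \<open>S\<close> with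
  the same right coordinate differ by an element with trivial right coordinate, that is, by a member
  of \<open>lS S\<close>.\<close>

lemma tcomp_swp_self:
  assumes S: "fib A G G S" "covers S"
  shows "tcomp A S (swp ` S) = Dm A G (lS S)"
proof
  show "tcomp A S (swp ` S) \<subseteq> Dm A G (lS S)"
  proof
    fix s assume "s \<in> tcomp A S (swp ` S)"
    then obtain c d g h i where s: "s = (c \<otimes>\<^bsub>A\<^esub> d, g, i)" "(c, g, h) \<in> S" "(d, h, i) \<in> swp ` S" by (rule tcompE)
    then have d: "d \<in> carrier A" "(inv\<^bsub>A\<^esub> d, i, h) \<in> S" using mem_swp[OF S(1)] by simp_all
    note c1 = fib_carrier[OF S(1) s(2)] and c2 = fib_carrier[OF S(1) d(2)]
    have "(c \<otimes>\<^bsub>A\<^esub> inv\<^bsub>A\<^esub> (inv\<^bsub>A\<^esub> d), g \<otimes>\<^bsub>G\<^esub> inv\<^bsub>G\<^esub> i, h \<otimes>\<^bsub>G\<^esub> inv\<^bsub>G\<^esub> h) \<in> S"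
      by (rule fib_mult[OF S(1) s(2) fib_inv[OF S(1) d(2)]])
    then have "(c \<otimes>\<^bsub>A\<^esub> d, g \<otimes>\<^bsub>G\<^esub> inv\<^bsub>G\<^esub> i) \<in> lS S" using c1 d(1) by (simp add: lS_def)
    moreover have "g = (g \<otimes>\<^bsub>G\<^esub> inv\<^bsub>G\<^esub> i) \<otimes>\<^bsub>G\<^esub> i" using c1 c2 by (simp add: GG.G.m_assoc)
    ultimately show "s \<in> Dm A G (lS S)" unfolding s(1) Dm_def using c2(2) by blast
  qed
  show "Dm A G (lS S) \<subseteq> tcomp A S (swp ` S)"
  proof
    fix s assume "s \<in> Dm A G (lS S)"
    then obtain a n g where s: "s = (a, n \<otimes>\<^bsub>G\<^esub> g, g)" "(a, n, \<one>\<^bsub>G\<^esub>) \<in> S" "g \<in> carrier G" unfolding Dm_def lS_def by blast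
    obtain d h where d: "(d, g, h) \<in> S" using S(2) s(3) unfolding covers_def by blast
    note c1 = fib_carrier[OF S(1) s(2)] and c2 = fib_carrier[OF S(1) d]
    have 1: "(a \<otimes>\<^bsub>A\<^esub> d, n \<otimes>\<^bsub>G\<^esub> g, h) \<in> S" using fib_mult[OF S(1) s(2) d] c2 by simp
    have 2: "(inv\<^bsub>A\<^esub> d, h, g) \<in> swp ` S" using mem_swp[OF S(1)] d c2 by simp
    have "a \<otimes>\<^bsub>A\<^esub> d \<otimes>\<^bsub>A\<^esub> inv\<^bsub>A\<^esub> d = a" using c1(1) c2(1) by (simp add: GG.A.m_assoc)
    then show "s \<in> tcomp A S (swp ` S)" using tcompI[OF 1 2, of A] s(1) by simp
  qed
qed

lemma Dm_free:
  assumes "p \<in> stable_pairs A G" shows "afree A G G (Dm A G (gr A p))"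
  using Dm_props(1)[OF assms] by (simp add: fib_alt)

lemma e_left_cl:
  assumes p: "p \<in> stable_pairs A G" and S: "fib A G G S" "covers S" and le: "gr A p \<subseteq> lS S"
  shows "single R (ep p) \<otimes>\<^bsub>M\<^esub> single R (cl A G G S) = single R (cl A G G S)"
proof -
  have eq: "tcomp A (Dm A G (gr A p)) S = S" by (rule Dm_absorb[OF PG.gr_graph_conj(1)[OF p] S(1) le])
  have "afree A G G (tcomp A (Dm A G (gr A p)) S)" unfolding eq using S(1) by (simp add: fib_alt)
  from mult_single_covering(1)[OF Dm_props(1,2)[OF p] S this] show ?thesis unfolding eq ep_def .
qed

text \<open>The subgroups \<open>Dm\<close> are their own reversals, so absorption on the right of
  \<open>S\<close> is absorption on the left of the reversed subgroup.\<close>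

lemma e_right_cl:
  assumes p: "p \<in> stable_pairs A G" and S: "fib A G G S" "covers S" and le: "gr A p \<subseteq> lS (swp ` S)"
  shows "single R (cl A G G S) \<otimes>\<^bsub>M\<^esub> single R (ep p) = single R (cl A G G S)"
proof -
  have "tcomp A (Dm A G (gr A p)) (swp ` S) = swp ` S"
    by (rule Dm_absorb[OF PG.gr_graph_conj(1)[OF p] fib_swp[OF S(1)] le])
  then have "swp ` (swp ` tcomp A S (Dm A G (gr A p))) = S"
    unfolding swp_tcomp[OF S(1) Dm_props(1)[OF p]] Dm_props(4)[OF p] using swp_swp[OF S(1)] by simp
  moreover have "tcomp A S (Dm A G (gr A p)) \<subseteq> carrier A \<times> UNIV"
    using fib_carrier(1)[OF S(1)] fib_carrier(1)[OF Dm_props(1)[OF p]] by (auto elim!: tcompE)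
  ultimately have eq: "tcomp A S (Dm A G (gr A p)) = S" using swp_swp_image by metis
  have "afree A G G (tcomp A S (Dm A G (gr A p)))" unfolding eq using S(1) by (simp add: fib_alt)
  from mult_single_covering(1)[OF S Dm_props(1,2)[OF p] this] show ?thesis unfolding eq ep_def .
qed

text \<open>The composite of the two diagonal subgroups is \<open>Dm\<close> of the product set of
  the graphs. If it is free over \<open>A\<close>, that product is the graph of the join of
  \<open>p\<close> and \<open>q\<close>. If there is any common upper bound \<open>s\<close>, the
  composite lies inside the free subgroup \<open>Dm\<close> of the graph of \<open>s\<close>. So the
  product vanishes exactly when no common upper bound exists.\<close>

lemma e_mult:
  assumes p: "p \<in> stable_pairs A G" and q: "q \<in> stable_pairs A G"
  shows "(\<exists>j\<in>stable_pairs A G. single R (ep p) \<otimes>\<^bsub>M\<^esub> single R (ep q) = single R (ep j) \<and>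
        (\<forall>s\<in>stable_pairs A G. pair_le j s \<longleftrightarrow> pair_le p s \<and> pair_le q s)) \<or>
      single R (ep p) \<otimes>\<^bsub>M\<^esub> single R (ep q) = \<zero>\<^bsub>M\<^esub> \<and> \<not> (\<exists>s\<in>stable_pairs A G. pair_le p s \<and> pair_le q s)"
proof -
  let ?D = "Dm A G (gr A p)" and ?E = "Dm A G (gr A q)"
  note D = Dm_props[OF p] and E = Dm_props[OF q]
  let ?N = "{(a \<otimes>\<^bsub>A\<^esub> b, n \<otimes>\<^bsub>G\<^esub> m) | a b n m. (a, n) \<in> gr A p \<and> (b, m) \<in> gr A q}"
  have cq: "b \<in> carrier A \<and> m \<in> carrier G" if "(b, m) \<in> gr A q" for b m
    using PG.gr_graph_conj(1)[OF q] that subgroup.subset[of "gr A q" "A \<times>\<times> G"] by (auto simp: graph_sub_def)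
  have cp: "b \<in> carrier A \<and> m \<in> carrier G" if "(b, m) \<in> gr A p" for b m
    using PG.gr_graph_conj(1)[OF p] that subgroup.subset[of "gr A p" "A \<times>\<times> G"] by (auto simp: graph_sub_def)
  \<comment> \<open>This needs only the carriers: at this point the product set is not known to be
    the graph of a pair.\<close>
  have teq: "tcomp A ?D ?E = Dm A G ?N"
  proof -
    have "tcomp A ?D ?E = {(a \<otimes>\<^bsub>A\<^esub> b, n \<otimes>\<^bsub>G\<^esub> (m \<otimes>\<^bsub>G\<^esub> g), g) | a b n m g. (a, n) \<in> gr A p \<and> (b, m) \<in> gr A q \<and> g \<in> carrier G}"
      unfolding tcomp_Dm_left[OF E(1)] unfolding Dm_def by blast
    also have "\<dots> = {(a \<otimes>\<^bsub>A\<^esub> b, n \<otimes>\<^bsub>G\<^esub> m \<otimes>\<^bsub>G\<^esub> g, g) | a b n m g. (a, n) \<in> gr A p \<and> (b, m) \<in> gr A q \<and> g \<in> carrier G}"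
      using cp cq by (metis (no_types, opaque_lifting) GG.G.m_assoc)
    also have "\<dots> = Dm A G ?N" unfolding Dm_def by blast
    finally show ?thesis .
  qed
  have lN: "lS (Dm A G ?N) = ?N"
  proof -
    have "(a, n) \<in> lS (Dm A G ?N) \<longleftrightarrow> (a, n) \<in> ?N" for a n
    proof
      assume "(a, n) \<in> lS (Dm A G ?N)"
      then obtain b c m k where *: "a = b \<otimes>\<^bsub>A\<^esub> c" "n = m \<otimes>\<^bsub>G\<^esub> k \<otimes>\<^bsub>G\<^esub> \<one>\<^bsub>G\<^esub>" "(b, m) \<in> gr A p" "(c, k) \<in> gr A q"
        unfolding lS_def Dm_def by blast
      then have "n = m \<otimes>\<^bsub>G\<^esub> k" using cp cq by simp
      then show "(a, n) \<in> ?N" using * by blast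
    next
      assume an: "(a, n) \<in> ?N"
      then have "n \<in> carrier G" using cp cq by auto
      moreover have "(a, n \<otimes>\<^bsub>G\<^esub> \<one>\<^bsub>G\<^esub>, \<one>\<^bsub>G\<^esub>) \<in> Dm A G ?N" unfolding Dm_def using an by blast
      ultimately show "(a, n) \<in> lS (Dm A G ?N)" by (simp add: lS_def)
    qed
    then show ?thesis by (intro Set.set_eqI) (metis (no_types, lifting) surj_pair)
  qed
  have sup: "?N \<subseteq> gr A s \<longleftrightarrow> gr A p \<subseteq> gr A s \<and> gr A q \<subseteq> gr A s" if s: "s \<in> stable_pairs A G" for s
  proof -
    have sub: "subgroup (gr A s) (A \<times>\<times> G)" "subgroup (gr A p) (A \<times>\<times> G)" "subgroup (gr A q) (A \<times>\<times> G)"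
      using PG.gr_graph_conj(1)[OF s] PG.gr_graph_conj(1)[OF p] PG.gr_graph_conj(1)[OF q] by (simp_all add: graph_sub_def)
    have one: "(\<one>\<^bsub>A\<^esub>, \<one>\<^bsub>G\<^esub>) \<in> gr A p" "(\<one>\<^bsub>A\<^esub>, \<one>\<^bsub>G\<^esub>) \<in> gr A q"
      using subgroup.one_closed[OF sub(2)] subgroup.one_closed[OF sub(3)] by simp_all
    show ?thesis
    proof
      assume N: "?N \<subseteq> gr A s"
      have "(a, n) \<in> gr A s" if an: "(a, n) \<in> gr A p" for a n
      proof -
        have "(a \<otimes>\<^bsub>A\<^esub> \<one>\<^bsub>A\<^esub>, n \<otimes>\<^bsub>G\<^esub> \<one>\<^bsub>G\<^esub>) \<in> ?N" using an one by blast
        from subsetD[OF N this] show ?thesis using cp[OF an] by simp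
      qed
      moreover have "(a, n) \<in> gr A s" if an: "(a, n) \<in> gr A q" for a n
      proof -
        have "(\<one>\<^bsub>A\<^esub> \<otimes>\<^bsub>A\<^esub> a, \<one>\<^bsub>G\<^esub> \<otimes>\<^bsub>G\<^esub> n) \<in> ?N" using an one by blast
        from subsetD[OF N this] show ?thesis using cq[OF an] by simp
      qed
      ultimately show "gr A p \<subseteq> gr A s \<and> gr A q \<subseteq> gr A s" by auto
    next
      assume "gr A p \<subseteq> gr A s \<and> gr A q \<subseteq> gr A s"
      then have "(a \<otimes>\<^bsub>A\<^esub> b, n \<otimes>\<^bsub>G\<^esub> m) \<in> gr A s" if "(a, n) \<in> gr A p" "(b, m) \<in> gr A q" for a b n m
        using subgroup.m_closed[OF sub(1), of "(a, n)" "(b, m)"] that by auto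
      then show "?N \<subseteq> gr A s" by auto
    qed
  qed
  show ?thesis
  proof (cases "afree A G G (tcomp A ?D ?E)")
    case True
    note C = mult_single_covering[OF D(1,2) E(1,2) True]
    define j where "j = pr A (lS (tcomp A ?D ?E))"
    have j: "j \<in> stable_pairs A G" "gr A j = ?N"
      unfolding j_def using pr_lS_stable[OF C(2,3)] lN teq by simp_all
    have "single R (ep p) \<otimes>\<^bsub>M\<^esub> single R (ep q) = single R (ep j)"
      using C(1) unfolding ep_def j(2) teq .
    moreover have "pair_le j s \<longleftrightarrow> pair_le p s \<and> pair_le q s" if "s \<in> stable_pairs A G" for s
      using sup[OF that] le_gr[OF j(1) that] le_gr[OF p that] le_gr[OF q that] j(2) by simp
    ultimately show ?thesis using j(1) by blast
  next
    case False
    have "\<not> (pair_le p s \<and> pair_le q s)" if s: "s \<in> stable_pairs A G" for s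
    proof
      assume "pair_le p s \<and> pair_le q s"
      then have "?N \<subseteq> gr A s" using sup[OF s] le_gr[OF p s] le_gr[OF q s] by simp
      then have "Dm A G ?N \<subseteq> Dm A G (gr A s)" unfolding Dm_def by blast
      then have "tcomp A ?D ?E \<subseteq> Dm A G (gr A s)" unfolding teq .
      then show False using False Dm_free[OF s] unfolding afree_def by blast
    qed
    moreover have "single R (ep p) \<otimes>\<^bsub>M\<^esub> single R (ep q) = \<zero>\<^bsub>M\<^esub>"
      unfolding ep_def by (rule mult_not_free[OF D(1,2) E(1) False])
    ultimately show ?thesis by blast
  qed
qed

end

section \<open>Moebius inversion\<close>

lemma moebius_right_sum:
  assumes "finite P" "\<And>N. N \<in> P \<Longrightarrow> finite N" "K \<in> P" "L \<in> P" "K \<subseteq> L"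
  shows "(\<Sum>N\<in>{N \<in> P. K \<subseteq> N \<and> N \<subseteq> L}. moebius P K N) = (if K = L then 1 else 0)"
proof (cases "K = L")
  case True
  then have "{N \<in> P. K \<subseteq> N \<and> N \<subseteq> L} = {L}" using assms(4) by auto
  then show ?thesis using True assms by (simp add: moebius.simps)
next
  case False
  have "{N \<in> P. K \<subseteq> N \<and> N \<subseteq> L} = insert L {N \<in> P. K \<subseteq> N \<and> N \<subset> L}" using assms(4,5) by auto
  moreover have "moebius P K L = - (\<Sum>N\<in>{N \<in> P. K \<subseteq> N \<and> N \<subset> L}. moebius P K N)"
    using assms False by (subst moebius.simps) simp
  ultimately show ?thesis using False assms(1) by simp
qed

text \<open>The defining recursion of \<open>moebius\<close> sums over the second argument, whereas
  inverting the definition of \<open>f_elt\<close> needs a sum over the first. It is the fact that a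
  one-sided inverse of a finite triangular matrix is two-sided, proved by induction on the upper end
  of the interval.\<close>

lemma moebius_left_sum:
  assumes P: "finite P" "\<And>N. N \<in> P \<Longrightarrow> finite N" "K \<in> P"
  shows "L \<in> P \<Longrightarrow> K \<subseteq> L \<Longrightarrow>
    (\<Sum>N\<in>{N \<in> P. K \<subseteq> N \<and> N \<subseteq> L}. moebius P N L) = (if K = L then 1 else 0)"
proof (induction "card L" arbitrary: L rule: less_induct)
  case less
  define h where "h L = (\<Sum>N\<in>{N \<in> P. K \<subseteq> N \<and> N \<subseteq> L}. moebius P N L)" for L
  define S where "S = {N \<in> P. K \<subseteq> N \<and> N \<subseteq> L}"
  have fin: "finite S" "\<And>Q. finite {N \<in> S. Q N}" using P(1) by (simp_all add: S_def)
  have LS: "L \<in> S" using less.prems by (simp add: S_def)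
  \<comment> \<open>All sums \<open>h Q\<close> over the interval are added up. After exchanging the
    order the inner sums are those of \<open>moebius_right_sum\<close>, and the total is one. By
    induction the \<open>h Q\<close> with \<open>Q\<close> below \<open>L\<close> are known, so
    \<open>h L\<close> is what is left.\<close>
  have "(\<Sum>Q\<in>S. h Q) = (\<Sum>Q\<in>S. \<Sum>N\<in>{N \<in> S. N \<subseteq> Q}. moebius P N Q)"
    unfolding h_def by (intro sum.cong refl) (auto simp: S_def)
  also have "\<dots> = (\<Sum>N\<in>S. \<Sum>Q\<in>{Q \<in> S. N \<subseteq> Q}. moebius P N Q)"
    by (rule sum.swap_restrict) (use fin in auto)
  also have "\<dots> = (\<Sum>N\<in>S. if N = L then 1 else 0)"
  proof (intro sum.cong refl)
    fix N assume N: "N \<in> S"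
    have "{Q \<in> S. N \<subseteq> Q} = {Q \<in> P. N \<subseteq> Q \<and> Q \<subseteq> L}" using N by (auto simp: S_def)
    then show "(\<Sum>Q\<in>{Q \<in> S. N \<subseteq> Q}. moebius P N Q) = (if N = L then 1 else 0)"
      using moebius_right_sum[OF P(1,2), of N L] N less.prems by (simp add: S_def)
  qed
  also have "\<dots> = 1" using fin LS by simp
  finally have 1: "(\<Sum>Q\<in>S. h Q) = 1" .
  have "(\<Sum>Q\<in>S - {L}. h Q) = (\<Sum>Q\<in>S - {L}. if K = Q then 1 else 0)"
  proof (intro sum.cong refl)
    fix Q assume Q: "Q \<in> S - {L}"
    then have "card Q < card L" using P(2)[OF less.prems(1)] by (auto simp: S_def intro!: psubset_card_mono)
    then show "h Q = (if K = Q then 1 else 0)" using less.hyps Q by (simp add: S_def h_def)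
  qed
  also have "\<dots> = (if K = L then 0 else 1)" using fin P(3) less.prems by (simp add: S_def)
  finally have "h L = (if K = L then 1 else 0)" using 1 sum.remove[OF fin(1) LS, of h] by (simp split: if_splits)
  then show ?case by (simp add: h_def)
qed

lemma (in abelian_group) finsum_int_multiples:
  assumes "finite S" "x \<in> carrier G"
  shows "(\<Oplus>q\<in>S. [(n q :: int)] \<cdot> x) = [(\<Sum>q\<in>S. n q)] \<cdot> x"
  using assms(1)
proof (induction S)
  case empty
  then show ?case by (simp add: add_pow_def)
next
  case (insert q S)
  then show ?case using assms(2) by (simp add: add.int_pow_mult)
qed

lemma (in abelian_monoid) finsum_swap:
  assumes "finite S" "finite T" "\<And>a b. a \<in> S \<Longrightarrow> b \<in> T \<Longrightarrow> g a b \<in> carrier G"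
  shows "(\<Oplus>a\<in>S. \<Oplus>b\<in>T. g a b) = (\<Oplus>b\<in>T. \<Oplus>a\<in>S. g a b)"
  using assms(1,3)
proof (induction S)
  case empty
  then show ?case by simp
next
  case (insert a S)
  have "(\<Oplus>b\<in>T. \<Oplus>a\<in>insert a S. g a b) = (\<Oplus>b\<in>T. g a b \<oplus> (\<Oplus>a\<in>S. g a b))"
    using insert by (intro finsum_cong') (auto intro!: finsum_insert)
  also have "\<dots> = (\<Oplus>b\<in>T. g a b) \<oplus> (\<Oplus>b\<in>T. \<Oplus>a\<in>S. g a b)"
    using insert.prems by (intro finsum_addf) auto
  finally show ?case using insert by simp
qed

lemma pair_le_trans: "pair_le p q \<Longrightarrow> pair_le q s \<Longrightarrow> pair_le p s"
  by (auto simp: pair_le_def restrict_restrict Int_absorb1)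

section \<open>Intervals in the poset of stable pairs\<close>

context pair_group
begin

lemma pair_le_refl: "p \<in> stable_pairs A K \<Longrightarrow> pair_le p p"
  using pairsD(3) by (auto simp: stable_pairs_def pair_le_def extensional_restrict)

lemma pair_le_antisym: "pair_le p q \<Longrightarrow> pair_le q p \<Longrightarrow> p = q"
  by (auto simp: pair_le_def)

lemma restrict_stable:
  assumes "(L, l) \<in> stable_pairs A K" "N \<lhd> K" "N \<subseteq> L"
  shows "(N, restrict l N) \<in> stable_pairs A K"
proof -
  have N: "subgroup N K" by (rule normal_imp_subgroup[OF assms(2)])
  have "l (x \<otimes>\<^bsub>K\<^esub> y) = l x \<otimes>\<^bsub>A\<^esub> l y" "l x \<in> carrier A" if "x \<in> N" "y \<in> N" for x y
    using assms(1) subsetD[OF assms(3)] that unfolding stable_pairs_def pairs_def hom_def by auto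
  then have "restrict l N \<in> hom (K\<lparr>carrier := N\<rparr>) A"
    using subgroup.m_closed[OF N] by (auto simp: hom_def)
  moreover have "g \<otimes>\<^bsub>K\<^esub> x \<otimes>\<^bsub>K\<^esub> inv\<^bsub>K\<^esub> g \<in> N" if "g \<in> carrier K" "x \<in> N" for g x
    by (rule normal.inv_op_closed2[OF assms(2) that])
  ultimately show ?thesis using assms N unfolding stable_pairs_def pairs_def by (auto simp: restrict_extensional)
qed

lemma stable_normal: "p \<in> stable_pairs A K \<Longrightarrow> fst p \<lhd> K"
  by (auto simp: stable_pairs_def)

text \<open>Below a fixed \<open>s\<close> a pair is determined by its subgroup, because its
  homomorphism is the restriction of that of \<open>s\<close>, and every normal subgroup in between
  occurs. Thus the interval from \<open>p\<close> to \<open>s\<close> is an interval of normal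
  subgroups, and the Moebius function of the latter inverts sums over pairs.\<close>

lemma moebius_pairs_sum:
  assumes fin: "finite (carrier K)" and p: "p \<in> stable_pairs A K" and s: "s \<in> stable_pairs A K" and le: "pair_le p s"
  shows "(\<Sum>q\<in>{q \<in> stable_pairs A K. pair_le p q \<and> pair_le q s}. moebius {N. N \<lhd> K} (fst q) (fst s)) =
    (if p = s then 1 else 0)"
proof -
  have sub: "N \<subseteq> carrier K" if "N \<lhd> K" for N using subgroup.subset[OF normal_imp_subgroup[OF that]] .
  have "bij_betw fst {q \<in> stable_pairs A K. pair_le p q \<and> pair_le q s} {N \<in> {N. N \<lhd> K}. fst p \<subseteq> N \<and> N \<subseteq> fst s}"
  proof (rule bij_betw_byWitness[where f' = "\<lambda>N. (N, restrict (snd s) N)"])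
    show "(\<lambda>N. (N, restrict (snd s) N)) ` {N \<in> {N. N \<lhd> K}. fst p \<subseteq> N \<and> N \<subseteq> fst s} \<subseteq>
      {q \<in> stable_pairs A K. pair_le p q \<and> pair_le q s}"
      using restrict_stable[of "fst s" "snd s"] s le
      by (auto simp: pair_le_def case_prod_unfold restrict_restrict Int_absorb1)
  qed (auto simp: pair_le_def case_prod_unfold intro!: prod_eqI dest: stable_normal)
  then have "(\<Sum>q\<in>{q \<in> stable_pairs A K. pair_le p q \<and> pair_le q s}. moebius {N. N \<lhd> K} (fst q) (fst s)) =
    (\<Sum>N\<in>{N \<in> {N. N \<lhd> K}. fst p \<subseteq> N \<and> N \<subseteq> fst s}. moebius {N. N \<lhd> K} N (fst s))"
    by (rule sum.reindex_bij_betw)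
  also have "\<dots> = (if fst p = fst s then 1 else 0)"
  proof (rule moebius_left_sum)
    show "finite {N. N \<lhd> K}" using fin sub by (auto intro: finite_subset[of _ "Pow (carrier K)"])
    show "finite N" if "N \<in> {N. N \<lhd> K}" for N using sub that fin by (auto intro: finite_subset)
  qed (use p s le stable_normal in \<open>auto simp: pair_le_def\<close>)
  also have "\<dots> = (if p = s then 1 else 0)"
  proof -
    have "fst p = fst s \<Longrightarrow> pair_le s p" using le pair_le_refl[OF s] by (auto simp: pair_le_def case_prod_unfold)
    then show ?thesis using pair_le_antisym[OF le] by auto
  qed
  finally show ?thesis .
qed

end

context endo_ctx
begin

lemma e_elt_ep: "p \<in> stable_pairs A G \<Longrightarrow> e_elt R A G p = single R (ep p)"
  by (simp add: e_elt_single ep_def)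

lemma Cv_B: "Cv \<subseteq> B"
  unfolding Cv_def GG.iso_classes_eq by blast

lemma ep_Cv: "p \<in> stable_pairs A G \<Longrightarrow> ep p \<in> Cv"
  unfolding Cv_def ep_def using Dm_props(1,2) by blast

lemma ep_closed: "p \<in> stable_pairs A G \<Longrightarrow> single R (ep p) \<in> carrier M"
  using fr.single_closed ep_Cv Cv_B by blast

lemma f_elt_upper:
  assumes fin: "finite (stable_pairs A G)" and p: "p \<in> stable_pairs A G"
  shows "\<exists>h\<in>fin_supp R (ep ` {q \<in> stable_pairs A G. pair_le p q \<and> q \<noteq> p}). f_elt R A G p = single R (ep p) \<oplus>\<^bsub>M\<^esub> h"
proof -
  define U where "U = {q \<in> stable_pairs A G. pair_le p q \<and> q \<noteq> p}"
  define g where "g q = [moebius {N. N \<lhd> G} (fst p) (fst q)] \<cdot>\<^bsub>M\<^esub> e_elt R A G q" for q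
  have gc: "g q \<in> carrier M" if "q \<in> stable_pairs A G" for q
    using ep_closed[OF that] e_elt_ep[OF that] by (simp add: g_def)
  have sub: "submodule (fin_supp R (ep ` U)) R M"
    by (rule fr.submodule_fin_supp) (use ep_Cv Cv_B in \<open>auto simp: U_def\<close>)
  have gU: "g q \<in> fin_supp R (ep ` U)" if "q \<in> U" for q
  proof -
    have "single R (ep q) \<in> fin_supp R (ep ` U)" using that by (intro single_fin_supp) auto
    moreover have "subgroup (fin_supp R (ep ` U)) (add_monoid M)" using sub by (simp add: submodule_def)
    ultimately show ?thesis using that e_elt_ep group.subgroup_int_pow_closed[OF fr.fm.M.a_group]
      by (fastforce simp: g_def U_def add_pow_def)
  qed
  have "{q \<in> stable_pairs A G. pair_le p q} = insert p U" using p PG.pair_le_refl by (auto simp: U_def)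
  then have "f_elt R A G p = (\<Oplus>\<^bsub>M\<^esub>q\<in>insert p U. g q)" by (simp add: f_elt_def g_def)
  also have "\<dots> = g p \<oplus>\<^bsub>M\<^esub> (\<Oplus>\<^bsub>M\<^esub>q\<in>U. g q)"
    using fin p gc by (intro fr.fm.M.finsum_insert) (auto simp: U_def)
  also have "g p = single R (ep p)"
  proof -
    have "fst p \<lhd> G" by (rule PG.stable_normal[OF p])
    then have 1: "moebius {N. N \<lhd> G} (fst p) (fst p) = 1"
      using GG.finite_G subgroup.subset[OF normal_imp_subgroup[of "fst p" G]]
      by (subst moebius.simps) (auto intro: finite_subset)
    show ?thesis unfolding g_def 1 e_elt_ep[OF p] by (rule fr.fm.M.add.int_pow_1[OF ep_closed[OF p]])
  qed
  finally show ?thesis using ka.finsum_in_submodule[OF sub gU] unfolding U_def by (rule bexI)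
qed

text \<open>After inserting the definition of \<open>f_elt\<close> and exchanging the sums, the
  coefficient of each \<open>e s\<close> is the Moebius sum over the interval from \<open>p\<close>
  to \<open>s\<close>, which vanishes unless \<open>s\<close> equals \<open>p\<close>.\<close>

lemma f_elt_sum:
  assumes fin: "finite (stable_pairs A G)" and p: "p \<in> stable_pairs A G"
  shows "(\<Oplus>\<^bsub>M\<^esub>q\<in>{q \<in> stable_pairs A G. pair_le p q}. f_elt R A G q) = single R (ep p)"
proof -
  define U where "U q = {s \<in> stable_pairs A G. pair_le q s}" for q
  \<comment> \<open>Extended by zero, so that all inner sums run over the same set
    \<open>U p\<close> and can be exchanged.\<close>
  define m where "m q s = (if pair_le q s then moebius {N. N \<lhd> G} (fst q) (fst s) else 0)" for q s :: "('g, 'a) cpair"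
  have fU: "finite (U q)" for q using fin by (simp add: U_def)
  have ec: "single R (ep s) \<in> carrier M" if "s \<in> U p" for s using that ep_closed by (simp add: U_def)
  have f: "f_elt R A G q = (\<Oplus>\<^bsub>M\<^esub>s\<in>U p. [m q s] \<cdot>\<^bsub>M\<^esub> single R (ep s))" if q: "q \<in> U p" for q
    unfolding f_elt_def
  proof (rule fr.fm.M.add.finprod_mono_neutral_cong_left)
    show "finite (U p)" by (rule fU)
    show "{s \<in> stable_pairs A G. pair_le q s} \<subseteq> U p" using q unfolding U_def by (blast intro: pair_le_trans)
    show "[m q s] \<cdot>\<^bsub>M\<^esub> single R (ep s) = \<zero>\<^bsub>M\<^esub>" if "s \<in> U p - {s \<in> stable_pairs A G. pair_le q s}" for s
      using that by (simp add: m_def U_def add_pow_def)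
  qed (use ec e_elt_ep in \<open>auto simp: m_def\<close>)
  have "(\<Oplus>\<^bsub>M\<^esub>q\<in>U p. f_elt R A G q) = (\<Oplus>\<^bsub>M\<^esub>q\<in>U p. \<Oplus>\<^bsub>M\<^esub>s\<in>U p. [m q s] \<cdot>\<^bsub>M\<^esub> single R (ep s))"
    by (intro fr.fm.M.finsum_cong' refl f fr.fm.M.finsum_closed) (use ec in auto)
  also have "\<dots> = (\<Oplus>\<^bsub>M\<^esub>s\<in>U p. \<Oplus>\<^bsub>M\<^esub>q\<in>U p. [m q s] \<cdot>\<^bsub>M\<^esub> single R (ep s))"
    by (rule fr.fm.M.finsum_swap) (use fU ec in auto)
  also have "\<dots> = (\<Oplus>\<^bsub>M\<^esub>s\<in>U p. if p = s then single R (ep s) else \<zero>\<^bsub>M\<^esub>)"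
  proof (intro fr.fm.M.finsum_cong' refl)
    fix s assume s: "s \<in> U p"
    have "(\<Sum>q\<in>U p. m q s) = (\<Sum>q\<in>{q \<in> U p. pair_le q s}. moebius {N. N \<lhd> G} (fst q) (fst s))"
      unfolding m_def by (rule sum.inter_filter[symmetric]) (rule fU)
    also have "{q \<in> U p. pair_le q s} = {q \<in> stable_pairs A G. pair_le p q \<and> pair_le q s}" by (auto simp: U_def)
    also have "(\<Sum>q\<in>\<dots>. moebius {N. N \<lhd> G} (fst q) (fst s)) = (if p = s then 1 else 0)"
      using PG.moebius_pairs_sum[OF GG.finite_G p, of s] s by (simp add: U_def)
    finally show "(\<Oplus>\<^bsub>M\<^esub>q\<in>U p. [m q s] \<cdot>\<^bsub>M\<^esub> single R (ep s)) = (if p = s then single R (ep s) else \<zero>\<^bsub>M\<^esub>)"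
      using fr.fm.M.finsum_int_multiples[OF fU[of p] ec[OF s], of "\<lambda>q. m q s"] ec[OF s] fr.fm.M.add.int_pow_1 by (simp add: add_pow_def)
  qed (use ec in auto)
  also have "\<dots> = single R (ep p)"
    using fr.fm.M.add.finprod_singleton[of p "U p" "\<lambda>s. single R (ep s)"] fU ec p PG.pair_le_refl by (simp add: U_def)
  finally show ?thesis by (simp add: U_def)
qed

end

section \<open>The blocks of the double Burnside algebra\<close>

context endo_ctx
begin

section \<open>Pairs on the product group against left and right pairs of stabilizers\<close>

abbreviation P where "P \<equiv> stable_pairs A G"

lemma GG_pair_group: "pair_group A (G \<times>\<times> G)"
  by (intro pair_group.intro GG.A.comm_group_axioms DirProd_group GG.G.group_axioms)

lemma fib_twisted: "u \<in> pairs A (G \<times>\<times> G) \<Longrightarrow> fib A G G (gr A u)"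
  unfolding fib_eq_graph_sub by (rule pair_group.gr_graph_sub[OF GG_pair_group])

lemma covers_gr:
  assumes u: "(U, \<phi>) \<in> pairs A (G \<times>\<times> G)"
  shows "covers (gr A (U, \<phi>)) \<longleftrightarrow> p1 U = carrier G \<and> p2 U = carrier G"
proof -
  have "U \<subseteq> carrier G \<times> carrier G"
    using subgroup.subset[OF pair_group.pairsD(1)[OF GG_pair_group u]] by simp
  moreover have "covers (gr A (U, \<phi>)) \<longleftrightarrow>
    (\<forall>g\<in>carrier G. \<exists>h. (g, h) \<in> U) \<and> (\<forall>h\<in>carrier G. \<exists>g. (g, h) \<in> U)"
    unfolding covers_def by (simp add: gr_def)
  moreover have "p1 U = {g. \<exists>h. (g, h) \<in> U}" "p2 U = {h. \<exists>g. (g, h) \<in> U}"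
    unfolding p1_def p2_def by (simp_all only: Domain_fst[symmetric] Range_snd[symmetric] Domain_unfold Range_iff set_eq_iff mem_Collect_eq simp_thms)
  ultimately show ?thesis by blast
qed

lemma Cv_pairs: "Cv = {cl A G G (gr A (U, \<phi>)) | U \<phi>.
   (U, \<phi>) \<in> pairs A (G \<times>\<times> G) \<and> p1 U = carrier G \<and> p2 U = carrier G}" (is "_ = ?C")
proof
  show "Cv \<subseteq> ?C"
  proof
    fix b assume "b \<in> Cv"
    then obtain S where S: "fib A G G S" "covers S" "b = cl A G G S" unfolding Cv_def by blast
    have g: "graph_sub A (G \<times>\<times> G) S" using S(1) by (simp add: fib_eq_graph_sub)
    obtain U \<phi> where u: "pr A S = (U, \<phi>)" by fastforce
    have gr: "gr A (U, \<phi>) = S" using pair_group.gr_pr[OF GG_pair_group g] u by simp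
    have up: "(U, \<phi>) \<in> pairs A (G \<times>\<times> G)" using pair_group.pr_pairs[OF GG_pair_group g] u by simp
    then have "p1 U = carrier G \<and> p2 U = carrier G" using covers_gr[OF up] S(2) gr by simp
    then show "b \<in> ?C" using up S(3) gr by blast
  qed
  show "?C \<subseteq> Cv"
    unfolding Cv_def using fib_twisted covers_gr by blast
qed

lemma std_class_gr: "u \<in> pairs A (G \<times>\<times> G) \<Longrightarrow> std_class R A G G u = single R (cl A G G (gr A u))"
  using GG.std_class_single[OF cring_axioms, of u] fib_twisted[of u] by (simp add: twisted_eq_gr)

lemma E_cov_eq: "E_cov R A G = fin_supp R Cv"
proof -
  have "{std_class R A G G (U, \<phi>) | U \<phi>. (U, \<phi>) \<in> pairs A (G \<times>\<times> G) \<and> p1 U = carrier G \<and> p2 U = carrier G} =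
    single R ` Cv" (is "?L = _")
  proof
    show "?L \<subseteq> single R ` Cv" unfolding Cv_pairs using std_class_gr by blast
    show "single R ` Cv \<subseteq> ?L" unfolding Cv_pairs using std_class_gr[symmetric] by blast
  qed
  then show ?thesis unfolding E_cov_def using fr.k_span_single[OF Cv_B] by simp
qed

lemma left_triple_iff:
  assumes u: "u \<in> pairs A (G \<times>\<times> G)" and p: "p \<in> P"
  shows "left_triple G G u = (carrier G, p) \<longleftrightarrow> p1 (fst u) = carrier G \<and> lS (gr A u) = gr A p"
proof -
  obtain U \<phi> where U: "u = (U, \<phi>)" by fastforce
  obtain N \<nu> where N: "p = (N, \<nu>)" by fastforce
  note uD = pair_group.pairsD[OF GG_pair_group u[unfolded U]]
  note pD = PG.pairsD[OF stable_pairs_pairs[OF p, unfolded N]]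
  have lS: "lS (gr A u) = {(inv\<^bsub>A\<^esub> (\<phi> (g, \<one>\<^bsub>G\<^esub>)), g) | g. g \<in> k1 G U}"
    unfolding lS_def U gr_def k1_def by auto
  have "lS (gr A u) = gr A p \<longleftrightarrow> k1 G U = N \<and> (\<forall>g\<in>N. \<phi> (g, \<one>\<^bsub>G\<^esub>) = \<nu> g)"
  proof
    assume eq: "lS (gr A u) = gr A p"
    have "snd ` lS (gr A u) = k1 G U" "snd ` gr A p = N" unfolding lS unfolding N gr_def prod.case Setcompr_eq_image image_image by simp_all
    then have k: "k1 G U = N" using eq by simp
    have "\<phi> (g, \<one>\<^bsub>G\<^esub>) = \<nu> g" if g: "g \<in> N" for g
    proof -
      have "(inv\<^bsub>A\<^esub> (\<phi> (g, \<one>\<^bsub>G\<^esub>)), g) \<in> gr A p" unfolding eq[symmetric] lS using g k by blast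
      then have "inv\<^bsub>A\<^esub> (\<phi> (g, \<one>\<^bsub>G\<^esub>)) = inv\<^bsub>A\<^esub> (\<nu> g)" unfolding N PG.mem_gr by simp
      moreover have "\<phi> (g, \<one>\<^bsub>G\<^esub>) \<in> carrier A" using g k by (intro uD(2)) (auto simp: k1_def)
      ultimately show ?thesis using pD(2)[OF g] by (metis GG.A.inv_inv)
    qed
    then show "k1 G U = N \<and> (\<forall>g\<in>N. \<phi> (g, \<one>\<^bsub>G\<^esub>) = \<nu> g)" using k by blast
  next
    assume "k1 G U = N \<and> (\<forall>g\<in>N. \<phi> (g, \<one>\<^bsub>G\<^esub>) = \<nu> g)"
    then show "lS (gr A u) = gr A p" unfolding lS unfolding N gr_def by auto
  qed
  also have "\<dots> \<longleftrightarrow> k1 G U = N \<and> (\<lambda>g\<in>k1 G U. \<phi> (g, \<one>\<^bsub>G\<^esub>)) = \<nu>"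
    using pD(3) by (auto simp: fun_eq_iff extensional_def restrict_def)
  finally show ?thesis unfolding U N left_triple_def by auto
qed

text \<open>Reversal replaces the fibre entry of an element \<open>(1, h)\<close>, the inverse of
  its value under \<open>\<phi>\<close>, by that value. By the convention for the second component
  this is the inverse of the homomorphism of \<open>right_triple\<close> at \<open>h\<close>, as
  required in the graph of \<open>p\<close>.\<close>

lemma right_triple_iff:
  assumes u: "u \<in> pairs A (G \<times>\<times> G)" and p: "p \<in> P"
  shows "right_triple A G G u = (carrier G, p) \<longleftrightarrow> p2 (fst u) = carrier G \<and> lS (swp ` gr A u) = gr A p"
proof -
  obtain U \<phi> where U: "u = (U, \<phi>)" by fastforce
  obtain N \<nu> where N: "p = (N, \<nu>)" by fastforce
  note uD = pair_group.pairsD[OF GG_pair_group u[unfolded U]]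
  note pD = PG.pairsD[OF stable_pairs_pairs[OF p, unfolded N]]
  have lS: "lS (swp ` gr A u) = {(\<phi> (\<one>\<^bsub>G\<^esub>, g), g) | g. g \<in> k2 G U}"
  proof -
    have 1: "inv\<^bsub>A\<^esub> (inv\<^bsub>A\<^esub> (\<phi> (\<one>\<^bsub>G\<^esub>, g))) = \<phi> (\<one>\<^bsub>G\<^esub>, g)" if "(\<one>\<^bsub>G\<^esub>, g) \<in> U" for g using uD(2)[OF that] by simp
    have "(a, g) \<in> lS (swp ` gr A u) \<longleftrightarrow> (\<one>\<^bsub>G\<^esub>, g) \<in> U \<and> a = \<phi> (\<one>\<^bsub>G\<^esub>, g)" for a g
    proof
      assume "(a, g) \<in> lS (swp ` gr A u)"
      then obtain s where s: "s \<in> gr A u" "(a, g, \<one>\<^bsub>G\<^esub>) = swp s" unfolding lS_def by blast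
      then obtain v where v: "v \<in> U" "s = (inv\<^bsub>A\<^esub> (\<phi> v), v)" unfolding U gr_def by blast
      have "v = (\<one>\<^bsub>G\<^esub>, g)" "a = inv\<^bsub>A\<^esub> (inv\<^bsub>A\<^esub> (\<phi> v))" using s(2) v(2) by (cases v; simp)+
      then show "(\<one>\<^bsub>G\<^esub>, g) \<in> U \<and> a = \<phi> (\<one>\<^bsub>G\<^esub>, g)" using v(1) 1 by simp
    next
      assume g: "(\<one>\<^bsub>G\<^esub>, g) \<in> U \<and> a = \<phi> (\<one>\<^bsub>G\<^esub>, g)"
      then have "(inv\<^bsub>A\<^esub> (\<phi> (\<one>\<^bsub>G\<^esub>, g)), \<one>\<^bsub>G\<^esub>, g) \<in> gr A u" unfolding U gr_def by blast
      from imageI[OF this, of swp] show "(a, g) \<in> lS (swp ` gr A u)" using g 1 by (simp add: lS_def)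
    qed
    then show ?thesis unfolding k2_def by auto
  qed
  have "lS (swp ` gr A u) = gr A p \<longleftrightarrow> k2 G U = N \<and> (\<forall>g\<in>N. inv\<^bsub>A\<^esub> (\<phi> (\<one>\<^bsub>G\<^esub>, g)) = \<nu> g)"
  proof
    assume eq: "lS (swp ` gr A u) = gr A p"
    have "snd ` lS (swp ` gr A u) = k2 G U" "snd ` gr A p = N" unfolding lS unfolding N gr_def prod.case Setcompr_eq_image image_image by simp_all
    then have k: "k2 G U = N" using eq by simp
    have "inv\<^bsub>A\<^esub> (\<phi> (\<one>\<^bsub>G\<^esub>, g)) = \<nu> g" if g: "g \<in> N" for g
    proof -
      have "(\<phi> (\<one>\<^bsub>G\<^esub>, g), g) \<in> gr A p" unfolding eq[symmetric] lS using g k by blast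
      then have "\<phi> (\<one>\<^bsub>G\<^esub>, g) = inv\<^bsub>A\<^esub> (\<nu> g)" unfolding N PG.mem_gr by simp
      then show ?thesis using pD(2)[OF g] by simp
    qed
    then show "k2 G U = N \<and> (\<forall>g\<in>N. inv\<^bsub>A\<^esub> (\<phi> (\<one>\<^bsub>G\<^esub>, g)) = \<nu> g)" using k by blast
  next
    assume N': "k2 G U = N \<and> (\<forall>g\<in>N. inv\<^bsub>A\<^esub> (\<phi> (\<one>\<^bsub>G\<^esub>, g)) = \<nu> g)"
    have "\<phi> (\<one>\<^bsub>G\<^esub>, g) = inv\<^bsub>A\<^esub> (\<nu> g)" if g: "g \<in> N" for g
    proof -
      have "\<phi> (\<one>\<^bsub>G\<^esub>, g) \<in> carrier A" using g N' by (intro uD(2)) (auto simp: k2_def)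
      then show ?thesis using N' g by (metis GG.A.inv_inv)
    qed
    then show "lS (swp ` gr A u) = gr A p" unfolding lS unfolding N gr_def using N' by auto
  qed
  also have "\<dots> \<longleftrightarrow> k2 G U = N \<and> (\<lambda>g\<in>k2 G U. inv\<^bsub>A\<^esub> (\<phi> (\<one>\<^bsub>G\<^esub>, g))) = \<nu>"
    using pD(3) by (auto simp: fun_eq_iff extensional_def restrict_def)
  finally show ?thesis unfolding U N right_triple_def by auto
qed

lemma lt_ep: "p \<in> P \<Longrightarrow> lt (ep p) = p"
  unfolding ep_def using lt_cl(1)[OF Dm_props(1,2)] Dm_props(3) pr_gr by simp

lemma rt_ep: "p \<in> P \<Longrightarrow> rt (ep p) = p"
  unfolding ep_def using lt_cl(2)[OF Dm_props(1,2)] Dm_props(3,4) pr_gr by simp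

lemma lt_P: "b \<in> Cv \<Longrightarrow> lt b \<in> P"
  using pr_lS_stable(1) by (auto simp: Cv_def lt_cl)

lemma rt_P: "b \<in> Cv \<Longrightarrow> rt b \<in> P"
  using pr_lS_stable(1)[OF fib_swp covers_swp] by (auto simp: Cv_def lt_cl)

lemma pair_le_pr_lS:
  assumes "fib A G G S" "covers S" "fib A G G S'" "covers S'" "lS S \<subseteq> lS S'"
  shows "pair_le (pr A (lS S)) (pr A (lS S'))"
  using le_gr[OF pr_lS_stable(1)[OF assms(1,2)] pr_lS_stable(1)[OF assms(3,4)]]
    pr_lS_stable(2)[OF assms(1,2)] pr_lS_stable(2)[OF assms(3,4)] assms(5) by simp

lemma Cv_mult:
  assumes b: "b \<in> Cv" and c: "c \<in> Cv"
  shows "single R b \<otimes>\<^bsub>M\<^esub> single R c = \<zero>\<^bsub>M\<^esub> \<or>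
    (\<exists>d\<in>Cv. single R b \<otimes>\<^bsub>M\<^esub> single R c = single R d \<and> pair_le (lt b) (lt d) \<and> pair_le (rt c) (rt d))"
proof -
  obtain S where S: "fib A G G S" "covers S" "b = cl A G G S" using b unfolding Cv_def by blast
  obtain S' where S': "fib A G G S'" "covers S'" "c = cl A G G S'" using c unfolding Cv_def by blast
  let ?T = "tcomp A S S'"
  note sw = fib_swp[OF S(1)] covers_swp[OF S(1,2)] fib_swp[OF S'(1)] covers_swp[OF S'(1,2)]
  show ?thesis
  proof (cases "afree A G G ?T")
    case False
    then show ?thesis using mult_not_free[OF S(1,2) S'(1)] S(3) S'(3) by simp
  next
    case True
    note T = mult_single_covering[OF S(1,2) S'(1,2) True]
    have "cl A G G ?T \<in> Cv" using T(2,3) unfolding Cv_def by blast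
    moreover have "pair_le (lt b) (lt (cl A G G ?T))"
      unfolding S(3) lt_cl(1)[OF S(1,2)] lt_cl(1)[OF T(2,3)] by (rule pair_le_pr_lS[OF S(1,2) T(2,3,4)])
    moreover have "pair_le (rt c) (rt (cl A G G ?T))"
      unfolding S'(3) lt_cl(2)[OF S'(1,2)] lt_cl(2)[OF T(2,3)]
      by (rule pair_le_pr_lS[OF sw(3,4) fib_swp[OF T(2)] covers_swp[OF T(2,3)] T(5)])
    ultimately show ?thesis using T(1) S(3) S'(3) by blast
  qed
qed

lemma Cv_mult_linked:
  assumes b: "b \<in> Cv" and c: "c \<in> Cv" and l: "rt b = lt c"
  shows "\<exists>d\<in>Cv. single R b \<otimes>\<^bsub>M\<^esub> single R c = single R d \<and> lt d = lt b \<and> rt d = rt c"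
proof -
  obtain S where S: "fib A G G S" "covers S" "b = cl A G G S" using b unfolding Cv_def by blast
  obtain S' where S': "fib A G G S'" "covers S'" "c = cl A G G S'" using c unfolding Cv_def by blast
  let ?T = "tcomp A S S'"
  note sw = fib_swp[OF S(1)] covers_swp[OF S(1,2)] fib_swp[OF S'(1)] covers_swp[OF S'(1,2)]
  have "gr A (pr A (lS (swp ` S))) = gr A (pr A (lS S'))"
    using l unfolding S(3) S'(3) lt_cl(2)[OF S(1,2)] lt_cl(1)[OF S'(1,2)] by (rule arg_cong)
  then have eq: "lS (swp ` S) = lS S'" unfolding pr_lS_stable(2)[OF sw(1,2)] pr_lS_stable(2)[OF S'(1,2)] .
  note k = linked_tcomp[OF S(1,2) S'(1,2) eq]
  note T = mult_single_covering[OF S(1,2) S'(1,2) k(1)]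
  have "lS (swp ` (swp ` S')) = lS (swp ` S)" unfolding swp_swp[OF S'(1)] by (rule eq[symmetric])
  from linked_tcomp(2)[OF sw(3,4,1,2) this] have r: "lS (swp ` ?T) = lS (swp ` S')"
    unfolding swp_tcomp[OF S(1) S'(1)] .
  have "cl A G G ?T \<in> Cv" using T(2,3) unfolding Cv_def by blast
  moreover have "lt (cl A G G ?T) = lt b" unfolding S(3) lt_cl(1)[OF S(1,2)] lt_cl(1)[OF T(2,3)] k(2) ..
  moreover have "rt (cl A G G ?T) = rt c" unfolding S'(3) lt_cl(2)[OF S'(1,2)] lt_cl(2)[OF T(2,3)] r ..
  ultimately show ?thesis using T(1) S(3) S'(3) by blast
qed

lemma e_left:
  assumes p: "p \<in> P" and b: "b \<in> Cv" and le: "pair_le p (lt b)"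
  shows "single R (ep p) \<otimes>\<^bsub>M\<^esub> single R b = single R b"
proof -
  obtain S where S: "fib A G G S" "covers S" "b = cl A G G S" using b unfolding Cv_def by blast
  show ?thesis
    unfolding S(3)
  proof (rule e_left_cl[OF p S(1,2)])
    show "gr A p \<subseteq> lS S" using le le_gr[OF p pr_lS_stable(1)[OF S(1,2)]] pr_lS_stable(2)[OF S(1,2)]
      unfolding S(3) lt_cl(1)[OF S(1,2)] by simp
  qed
qed

lemma e_right:
  assumes p: "p \<in> P" and b: "b \<in> Cv" and le: "pair_le p (rt b)"
  shows "single R b \<otimes>\<^bsub>M\<^esub> single R (ep p) = single R b"
proof -
  obtain S where S: "fib A G G S" "covers S" "b = cl A G G S" using b unfolding Cv_def by blast
  note sw = fib_swp[OF S(1)] covers_swp[OF S(1,2)]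
  show ?thesis
    unfolding S(3)
  proof (rule e_right_cl[OF p S(1,2)])
    show "gr A p \<subseteq> lS (swp ` S)" using le le_gr[OF p pr_lS_stable(1)[OF sw]] pr_lS_stable(2)[OF sw]
      unfolding S(3) lt_cl(2)[OF S(1,2)] by simp
  qed
qed

lemma Cv_inverse:
  assumes b: "b \<in> Cv"
  shows "\<exists>c\<in>Cv. lt c = rt b \<and> rt c = lt b \<and>
      single R b \<otimes>\<^bsub>M\<^esub> single R c = single R (ep (lt b)) \<and> single R c \<otimes>\<^bsub>M\<^esub> single R b = single R (ep (rt b))"
proof -
  obtain S where S: "fib A G G S" "covers S" "b = cl A G G S" using b unfolding Cv_def by blast
  note sw = fib_swp[OF S(1)] covers_swp[OF S(1,2)]
  let ?c = "cl A G G (swp ` S)"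
  have ss: "swp ` (swp ` S) = S" by (rule swp_swp[OF S(1)])
  have 1: "tcomp A S (swp ` S) = Dm A G (gr A (lt b))"
    unfolding tcomp_swp_self[OF S(1,2)] S(3) lt_cl(1)[OF S(1,2)] pr_lS_stable(2)[OF S(1,2)] ..
  have 2: "tcomp A (swp ` S) S = Dm A G (gr A (rt b))"
    using tcomp_swp_self[OF sw] unfolding ss S(3) lt_cl(2)[OF S(1,2)] pr_lS_stable(2)[OF sw] .
  have P: "lt b \<in> P" "rt b \<in> P"
    unfolding S(3) lt_cl[OF S(1,2)] using pr_lS_stable(1)[OF S(1,2)] pr_lS_stable(1)[OF sw] by simp_all
  have "single R b \<otimes>\<^bsub>M\<^esub> single R ?c = single R (ep (lt b))"
    using mult_single_covering(1)[OF S(1,2) sw] Dm_free[OF P(1)] unfolding 1 ep_def S(3) by simp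
  moreover have "single R ?c \<otimes>\<^bsub>M\<^esub> single R b = single R (ep (rt b))"
    using mult_single_covering(1)[OF sw S(1,2)] Dm_free[OF P(2)] unfolding 2 ep_def S(3) by simp
  moreover have "lt ?c = rt b" "rt ?c = lt b" unfolding S(3) lt_cl[OF S(1,2)] lt_cl[OF sw] ss by simp_all
  moreover have "?c \<in> Cv" using sw unfolding Cv_def by blast
  ultimately show ?thesis by blast
qed

lemma fibered_blocks_E_alg:
  assumes fin: "finite P"
  shows "fibered_blocks R B M Cv P pair_le ep lt rt ({\<one>\<^bsub>G\<^esub>}, \<lambda>x\<in>{\<one>\<^bsub>G\<^esub>}. \<one>\<^bsub>A\<^esub>) (f_elt R A G) \<II>"
proof (intro fibered_blocks.intro fibered_blocks_axioms.intro)
  let ?bt = "({\<one>\<^bsub>G\<^esub>}, \<lambda>x\<in>{\<one>\<^bsub>G\<^esub>}. \<one>\<^bsub>A\<^esub>)"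
  show "k_alg R M" by (rule ka.k_alg_axioms)
  show "free_module R B M" by (rule fr.free_module_axioms)
  show "\<And>a x. a \<in> carrier R \<Longrightarrow> x \<in> \<II> \<Longrightarrow> a \<odot>\<^bsub>M\<^esub> x \<in> \<II>" by (rule I_smult)
  show "Cv \<subseteq> B" by (rule Cv_B)
  show "finite P" by (rule fin)
  show "\<And>p. p \<in> P \<Longrightarrow> pair_le p p" by (rule PG.pair_le_refl)
  show "\<And>p q s. pair_le p q \<Longrightarrow> pair_le q s \<Longrightarrow> pair_le p s" by (rule pair_le_trans)
  show "\<And>p q. p \<in> P \<Longrightarrow> q \<in> P \<Longrightarrow> pair_le p q \<Longrightarrow> pair_le q p \<Longrightarrow> p = q" by (rule PG.pair_le_antisym)
  show "?bt \<in> P" by (rule PG.trivial_pair)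
  show "pair_le ?bt p" if p: "p \<in> P" for p
  proof -
    have "subgroup (gr A p) (A \<times>\<times> G)" using PG.gr_graph_conj(1)[OF p] by (simp add: graph_sub_def)
    from subgroup.one_closed[OF this] have "(\<one>\<^bsub>A\<^esub>, \<one>\<^bsub>G\<^esub>) \<in> gr A p" by simp
    then show ?thesis unfolding le_gr[OF PG.trivial_pair(1) p] PG.trivial_pair(2) by simp
  qed
  show "\<And>p. p \<in> P \<Longrightarrow> ep p \<in> Cv" by (rule ep_Cv)
  show "\<And>p. p \<in> P \<Longrightarrow> lt (ep p) = p" by (rule lt_ep)
  show "\<And>p. p \<in> P \<Longrightarrow> rt (ep p) = p" by (rule rt_ep)
  show "\<And>b. b \<in> Cv \<Longrightarrow> lt b \<in> P" by (rule lt_P)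
  show "\<And>b. b \<in> Cv \<Longrightarrow> rt b \<in> P" by (rule rt_P)
  show "\<one>\<^bsub>M\<^esub> = single R (ep ?bt)" unfolding ep_def PG.trivial_pair(2) by (rule one_M)
next
  fix p assume p: "p \<in> P"
  show "\<exists>h\<in>fin_supp R (ep ` {q \<in> P. pair_le p q \<and> q \<noteq> p}). f_elt R A G p = single R (ep p) \<oplus>\<^bsub>M\<^esub> h"
    by (rule f_elt_upper[OF fin p])
  show "(\<Oplus>\<^bsub>M\<^esub>q\<in>{q \<in> P. pair_le p q}. f_elt R A G q) = single R (ep p)"
    by (rule f_elt_sum[OF fin p])
next
  show "ideal \<II> M" by (rule I_is_ideal)
  show "\<And>v b. v \<in> \<II> \<Longrightarrow> v b \<noteq> \<zero> \<Longrightarrow> single R b \<in> \<II>" by (rule I_basis)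
  show "single R b \<in> \<II>" if "b \<in> B" "b \<notin> Cv" for b
    using that I_not_cover unfolding GG.iso_classes_eq Cv_def by blast
qed (fact Cv_mult Cv_mult_linked e_left e_right e_mult Cv_inverse)+

end

section \<open>Translation of the abstract block theory\<close>

context endo_ctx
begin

text \<open>Links the abstract sets \<open>Lk\<close> to pairs on the product group. With
  \<open>q\<close> arbitrary it identifies linkage, and with \<open>q\<close> equal to
  \<open>p\<close> the carrier of \<open>Gamma\<close>.\<close>

lemma Lk_pairs:
  assumes p: "p \<in> P" and q: "q \<in> P"
  shows "{b \<in> Cv. lt b = p \<and> rt b = q} = {cl A G G (gr A u) | u. u \<in> pairs A (G \<times>\<times> G) \<and>
    left_triple G G u = (carrier G, p) \<and> right_triple A G G u = (carrier G, q)}" (is "?L = ?R")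
proof -
  have key: "lt (cl A G G (gr A u)) = p \<and> rt (cl A G G (gr A u)) = q \<longleftrightarrow>
      lS (gr A u) = gr A p \<and> lS (swp ` gr A u) = gr A q"
    if u: "u \<in> pairs A (G \<times>\<times> G)" "covers (gr A u)" for u
  proof -
    note f = fib_twisted[OF u(1)]
    have "pr A (lS (gr A u)) = p \<longleftrightarrow> lS (gr A u) = gr A p"
      using pr_lS_stable(2)[OF f u(2)] pr_gr[OF p] by metis
    moreover have "pr A (lS (swp ` gr A u)) = q \<longleftrightarrow> lS (swp ` gr A u) = gr A q"
      using pr_lS_stable(2)[OF fib_swp[OF f] covers_swp[OF f u(2)]] pr_gr[OF q] by metis
    ultimately show ?thesis unfolding lt_cl[OF f u(2)] by simp
  qed
  show ?thesis
  proof
    show "?L \<subseteq> ?R"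
    proof
      fix b assume b: "b \<in> ?L"
      then obtain U \<phi> where u: "b = cl A G G (gr A (U, \<phi>))" "(U, \<phi>) \<in> pairs A (G \<times>\<times> G)"
        "p1 U = carrier G" "p2 U = carrier G"
        unfolding Cv_pairs by blast
      have "covers (gr A (U, \<phi>))" using covers_gr[OF u(2)] u(3,4) by simp
      then have "lS (gr A (U, \<phi>)) = gr A p" "lS (swp ` gr A (U, \<phi>)) = gr A q"
        using key[OF u(2)] b unfolding u(1) by blast+
      then have "left_triple G G (U, \<phi>) = (carrier G, p)" "right_triple A G G (U, \<phi>) = (carrier G, q)"
        using left_triple_iff[OF u(2) p] right_triple_iff[OF u(2) q] u(3,4) by simp_all
      then show "b \<in> ?R" using u(1,2) by blast
    qed
    show "?R \<subseteq> ?L"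
    proof
      fix b assume "b \<in> ?R"
      then obtain u where u: "b = cl A G G (gr A u)" "u \<in> pairs A (G \<times>\<times> G)"
        "left_triple G G u = (carrier G, p)" "right_triple A G G u = (carrier G, q)" by blast
      have t: "p1 (fst u) = carrier G" "lS (gr A u) = gr A p" "p2 (fst u) = carrier G" "lS (swp ` gr A u) = gr A q"
        using left_triple_iff[OF u(2) p] right_triple_iff[OF u(2) q] u(3,4) by simp_all
      have cov: "covers (gr A u)" using covers_gr[of "fst u" "snd u"] u(2) t(1,3) by simp
      then have "b \<in> Cv" unfolding Cv_def u(1) using fib_twisted[OF u(2)] by blast
      then show "b \<in> ?L" using key[OF u(2) cov] t(2,4) unfolding u(1) by blast
    qed
  qed
qed

text \<open>Once \<open>R_set\<close>, \<open>linkage\<close>, \<open>block\<close> and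
  \<open>Gamma\<close> are matched with their abstract counterparts, every conjunct is a statement
  of the locale. The sums that define \<open>essential_blocks\<close> collapse to the block and the
  idempotent of the single saturated set \<open>F.Rs\<close>.\<close>

lemma block_decomposition:
  assumes fin: "finite P"
  shows
    "E_cov R A G <+>\<^bsub>M\<^esub> \<II> = carrier M \<and>
     sum_is_direct R M ((P - R_set R A G) // linkage A G) (block R A G) \<and>
     E_cov R A G \<inter> \<II> = sum_of_submodules M ((P - R_set R A G) // linkage A G) (block R A G) \<and>
     sum_is_direct R M (R_set R A G // linkage A G) (block R A G) \<and>
     carrier (essential_blocks R A G) \<subseteq> E_cov R A G \<and>
     k_algebra_iso R (essential_blocks R A G) (E_bar R A G) (bar R A G) \<and>
     (\<forall>p\<in>R_set R A G.
       k_algebra_iso R (group_algebra R (Gamma R A G p))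
         (corner_algebra (E_bar R A G) (bar R A G (f_elt R A G p)))
         (\<lambda>a. bar R A G (f_elt R A G p) \<otimes>\<^bsub>E_bar R A G\<^esub> bar R A G (Gamma_incl R A G a)
                \<otimes>\<^bsub>E_bar R A G\<^esub> bar R A G (f_elt R A G p)))"
proof -
  let ?bt = "({\<one>\<^bsub>G\<^esub>}, \<lambda>x\<in>{\<one>\<^bsub>G\<^esub>}. \<one>\<^bsub>A\<^esub>)"
  interpret F: fibered_blocks R B M Cv P pair_le ep lt rt ?bt "f_elt R A G" \<II>
    by (rule fibered_blocks_E_alg[OF fin])
  have cov: "E_cov R A G = fin_supp R Cv" by (rule E_cov_eq)
  have Rs: "R_set R A G = F.Rs" unfolding R_set_def F.Rs_def using e_elt_ep by auto
  have Lk: "F.Lk p q = {cl A G G (gr A u) | u. u \<in> pairs A (G \<times>\<times> G) \<and>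
      left_triple G G u = (carrier G, p) \<and> right_triple A G G u = (carrier G, q)}"
    if "p \<in> P" "q \<in> P" for p q
    unfolding F.Lk_def by (rule Lk_pairs[OF that])
  have linked: "linkage A G = F.linked"
    unfolding linkage_def F.linked_def using Lk by blast
  have eps: "f_class R A G = F.eps" unfolding f_class_def F.eps_def ..
  have blk: "block R A G = F.blk" unfolding block_def F.blk_def eps cov ..
  have Es: "essential_blocks R A G = M\<lparr>carrier := F.blk F.Rs, one := F.eps F.Rs\<rparr>"
    unfolding essential_blocks_def Rs linked eps blk F.sum_blk[OF F.saturated_Rs] F.eps_quotient_sum[OF F.saturated_Rs] ..
  have bar: "bar R A G = (\<lambda>v. \<II> +>\<^bsub>M\<^esub> v)" unfolding bar_def ..
  have "k_algebra_iso R (group_algebra R (Gamma R A G p))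
         (corner_algebra (E_bar R A G) (bar R A G (f_elt R A G p)))
         (\<lambda>a. bar R A G (f_elt R A G p) \<otimes>\<^bsub>E_bar R A G\<^esub> bar R A G (Gamma_incl R A G a)
                \<otimes>\<^bsub>E_bar R A G\<^esub> bar R A G (f_elt R A G p))" if p: "p \<in> F.Rs" for p
  proof -
    have pP: "p \<in> P" using p by (simp add: F.Rs_def)
    have "carrier (Gamma R A G p) = single R ` F.Lk p p"
    proof -
      have "carrier (Gamma R A G p) = {single R (cl A G G (gr A u)) | u. u \<in> pairs A (G \<times>\<times> G) \<and>
        left_triple G G u = (carrier G, p) \<and> right_triple A G G u = (carrier G, p)}"
        unfolding Gamma_def partial_object.select_convs
        by (intro Collect_cong ex_cong1) (auto simp only: std_class_gr)
      also have "\<dots> = single R ` F.Lk p p" unfolding Lk[OF pP pP] by blast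
      finally show ?thesis .
    qed
    then interpret GB: group_block R B M Cv P pair_le ep lt rt ?bt "f_elt R A G" \<II> "Gamma R A G p" p
      by unfold_locales (use p e_elt_ep[OF pP] in \<open>simp_all add: Gamma_def\<close>)
    have "Gamma_incl R A G = GB.incl" unfolding Gamma_incl_def GB.incl_def ..
    then show ?thesis using GB.group_block_iso by (simp add: bar E_bar_def)
  qed
  moreover have "F.blk F.Rs \<subseteq> E_cov R A G"
    unfolding cov using F.eps_cov_iff[OF F.saturated_subset[OF F.saturated_Rs]] by blast
  moreover have "k_algebra_iso R (essential_blocks R A G) (E_bar R A G) (bar R A G)"
    unfolding Es E_bar_def bar by (rule F.essential_iso)
  ultimately show ?thesis
    unfolding Rs linked blk cov
    using F.cov_plus_I F.cov_Int_I F.blk_direct[OF F.saturated_Rs] F.blk_direct[OF F.saturated_Diff[OF F.saturated_Rs]]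
      F.sum_blk[OF F.saturated_Diff[OF F.saturated_Rs]] Es cov by simp
qed

end

theorem proposition8p4:
  fixes k :: "'k ring" and A :: "'a monoid" and G :: "'g monoid"
  assumes "cring k" and "comm_group A" and "group G" and "finite (carrier G)"
    and "finite (stable_pairs A G)"
  shows
    "E_cov k A G <+>\<^bsub>E_alg k A G\<^esub> I_ideal k A G = carrier (E_alg k A G) \<and>
     sum_is_direct k (E_alg k A G)
       ((stable_pairs A G - R_set k A G) // linkage A G) (block k A G) \<and>
     E_cov k A G \<inter> I_ideal k A G =
       sum_of_submodules (E_alg k A G)
         ((stable_pairs A G - R_set k A G) // linkage A G) (block k A G) \<and>
     sum_is_direct k (E_alg k A G) (R_set k A G // linkage A G) (block k A G) \<and>
     carrier (essential_blocks k A G) \<subseteq> E_cov k A G \<and>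
     k_algebra_iso k (essential_blocks k A G) (E_bar k A G) (bar k A G) \<and>
     (\<forall>p\<in>R_set k A G.
       k_algebra_iso k
         (group_algebra k (Gamma k A G p))
         (corner_algebra (E_bar k A G) (bar k A G (f_elt k A G p)))
         (\<lambda>a. bar k A G (f_elt k A G p) \<otimes>\<^bsub>E_bar k A G\<^esub> bar k A G (Gamma_incl k A G a)
                \<otimes>\<^bsub>E_bar k A G\<^esub> bar k A G (f_elt k A G p)))"
proof -
  interpret endo_ctx k A G
    by (intro endo_ctx.intro coefficients.intro fin_tri_group.intro fin_tri_group_axioms.intro tri_group.intro assms)
  show ?thesis by (rule block_decomposition[OF assms(5)])
qed

end
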